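(* Let $f=(f_1,\ldots,f_n)\in\mathcal M_{rad}\cap\mathcal M^{||}$ and let $(A_1,\ldots,A_n)\in B(\mathcal H)^n$. Then there are an $n$-tuple of operators $(T_1,\ldots,T_n)\in\mathbb B_f(\mathcal H)$ and an invertible operator $X\in B(\mathcal H)$ such that $$A_i=X^{-1}T_iX\quad\text{for any } i=1,\ldots,n,$$ if and only if the $n$-tuple $(A_1,\ldots,A_n)$ is completely polynomially bounded with respect to the noncommutative domain algebra $\mathcal A(\mathbb B_f)$.
   Context: Notation. $\mathbb F_n^+$ is the free semigroup on $g_1,\ldots,g_n$ with identity $g_0$ and length $|\cdot|$. For an $n$-tuple $X$ of elements of a unital algebra, $X_\alpha=X_{i_1}\cdots X_{i_k}$ if $\alpha=g_{i_1}\cdots g_{i_k}$, $X_{g_0}=I$; $[f(X)]_\alpha$ is the corresponding product of $f_1(X),\ldots,f_n(X)$. A tuple $X\in B(\mathcal H)^n$ is viewed as a row operator, so $\|X\|=\|\sum X_iX_i^*\|^{1/2}$; $[B(\mathcal H)^n]_\gamma=\{X:\|X\|<\gamma\}$. A free holomorphic function on $[B(\mathcal H)^n]_\gamma$ is a formal power series $\sum a_\alpha Z_\alpha$ in noncommuting indeterminates (complex coefficients) with radius of convergence $r$, $r^{-1}=\limsup_k(\sum_{|\alpha|=k}|a_\alpha|^2)^{1/2k}$, at least $\gamma$, identified with the map $X\mapsto\sum_k\sum_{|\alpha|=k}a_\alpha X_\alpha$ (norm convergence; $\mathcal H$ separable infinite-dimensional). $H^2_{\bf ball}$ is the Hilbert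 space of series with $\sum|a_\alpha|^2<\infty$ (the $Z_\alpha$ being orthonormal). Convergence sets. For an $n$-tuple $f$ of formal power series $f_j=\sum c^{(j)}_\alpha Z_\alpha$ and a Hilbert space $\mathcal H$: $\mathcal C_f^{SOT}(\mathcal H)$ is the set of $X\in B(\mathcal H)^n$ such that each series $f_j(X):=\sum_k\sum_{|\alpha|=k}c^{(j)}_\alpha X_\alpha$ is SOT-convergent; $\mathcal C_f^{rad}(\mathcal H)$ is the set of $X$ such that for some $\delta\in(0,1)$ these series converge in norm at $rX$ for all $r\in(\delta,1)$ and $f_j(X):=\text{SOT-}\lim_{r\to1}f_j(rX)$ exists for each $j$. Model property. $f=(f_1,\ldots,f_n)$ has the model property if one of the following holds. (A) $f$ is an $n$-tuple of noncommutative polynomials for which there is an $n$-tuple $g$ of noncommutative polynomials with $f\circ g=g\circ f=\mathrm{id}$. Then $\{f_\alpha\}$ is a linear basis of $\mathbb C[Z_1,\ldots,Z_n]$ and $\mathbb H^2(f)$ is the completion of $\mathbb C[Z_1,\ldots,Z_n]$ for the inner product $\langle f_\alpha,f_\beta\rangle=\delta_{\alpha\beta}$. (S) $f$ is an $n$-tuple of formal power series with $f(0)=0$, nonzero radius of convergence and $\det J_f(0)\neq0$ ($J_f(0)_{ij}$ is the coefficient of $Z_j$ in $f_i$); $\mathbb H^2(f)$ is the Hilbert space of formal power series $\sum a_\alpha f_\alpha$, $\sum|a_\alpha|^2<\infty$, with $\{f_\alpha\}$ orthonormal; $Z_1,\ldots,Z_n\in\mathbb H^2(f)$; left multiplication $M_{Z_i}$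 by $Z_i$ is bounded on $\mathbb H^2(f)$; and $M_Z=(M_{Z_1},\ldots,M_{Z_n})$ belongs to $\mathcal C_f^{SOT}(\mathbb H^2(f))$ or $\mathcal C_f^{rad}(\mathbb H^2(f))$ with $f_j(M_Z)=M_{f_j}$ (left multiplication by $f_j$), $j=1,\ldots,n$. (F) $f$ is an $n$-tuple of free holomorphic functions on some $[B(\mathcal H)^n]_\gamma$, $\gamma>0$, with range in $[B(\mathcal H)^n]_1$, such that $G\circ f\not\equiv0$ for every nonzero free holomorphic $G$ on $[B(\mathcal H)^n]_1$; $\mathbb H^2(f)=\{G\circ f:G\in H^2_{\bf ball}\}$ with $\langle F\circ f,G\circ f\rangle=\langle F,G\rangle$; the coordinate functions $Z_1,\ldots,Z_n$ lie in $\mathbb H^2(f)$, left multiplications $M_{Z_i}$ by them are bounded on $\mathbb H^2(f)$, and $M_Z$ is in $\mathcal C_f^{SOT}(\mathbb H^2(f))$ or $\mathcal C_f^{rad}(\mathbb H^2(f))$ with $f_j(M_Z)=M_{f_j}$ for all $j$. In all cases $\{f_\alpha\}_{\alpha\in\mathbb F_n^+}$ is an orthonormal basis of $\mathbb H^2(f)$, and $M_Z$ is called the universal model. Writing $Z_i=\sum_\alpha a^{(i)}_\alpha f_\alpha$ in $\mathbb H^2(f)$, one has $M_{Z_i}f_\beta=\sum_\alpha a^{(i)}_\alpha f_{\alpha\beta}$, and $g_i:=\sum_\alpha a^{(i)}_\alpha Z_\alpha$ defines the inverse $g=(g_1,\ldots,g_n)$ of $f$ with respect to composition. Domain. $X\in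 B(\mathcal H)^n$ satisfies $g(f(X))=X$ if $X\in\mathcal C_f^{SOT}(\mathcal H)\cup\mathcal C_f^{rad}(\mathcal H)$ and either (for all $i$) $X_i=\sum_k\sum_{|\alpha|=k}a^{(i)}_\alpha[f(X)]_\alpha$ in the SOT, or (for all $i$) $X_i=\text{SOT-}\lim_{r\to1}\sum_k\sum_{|\alpha|=k}a^{(i)}_\alpha r^{|\alpha|}[f(X)]_\alpha$ (automatic in case (A)). Then $\mathbb B_f(\mathcal H):=\{X\in B(\mathcal H)^n:\ g(f(X))=X,\ \|f(X)\|\le1\}$. Classes. $\mathcal M_{rad}$ is the set of $f$ with the model property for which there is $\delta\in(0,1)$ such that $(rf_1,\ldots,rf_n)$ has the model property for every $r\in(\delta,1]$. $\mathcal M^{||}$ is the set of $f$ with the model property such that $M_Z$ is in the set of norm-convergence of $f$ (the series $f_j(M_Z)$ converge in operator norm) or of radial norm-convergence of $f$ (the series converge in norm at $rM_Z$ for $r<1$ close to $1$, and $f_j(M_Z)=\lim_{r\to1}f_j(rM_Z)$ in norm). $\mathcal A(\mathbb B_f)$ is the norm closure in $B(\mathbb H^2(f))$ of all noncommutative polynomials in $M_{Z_1},\ldots,M_{Z_n}$ and the identity. $(A_1,\ldots,A_n)$ is completely polynomially bounded with respect to $\mathcal A(\mathbb B_f)$ if the map $p(M_{Z_1},\ldots,M_{Z_n})\mapsto p(A_1,\ldots,A_n)$, $p\in\mathbb C[Z_1,\ldots,Z_n]$, is well defined and completely bounded. *)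

theory Defs
  imports "HOL-Analysis.Analysis"
begin

section \<open>Complex Hilbert spaces and their operators\<close>

class complex_hilbert_space = real_inner + complete_space +
  fixes scaleC :: "complex \<Rightarrow> 'a \<Rightarrow> 'a"  (infixr "*\<^sub>C" 75)
    and cinner :: "'a \<Rightarrow> 'a \<Rightarrow> complex"
  assumes scaleC_add_right: "c *\<^sub>C (x + y) = c *\<^sub>C x + c *\<^sub>C y"
    and scaleC_add_left: "(c + d) *\<^sub>C x = c *\<^sub>C x + d *\<^sub>C x"
    and scaleC_scaleC: "c *\<^sub>C d *\<^sub>C x = (c * d) *\<^sub>C x"
    and scaleR_scaleC: "scaleR r x = complex_of_real r *\<^sub>C x"
    and cinner_commute: "cinner x y = cnj (cinner y x)"
    and cinner_add_left: "cinner (x + y) z = cinner x z + cinner y z"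
    and cinner_scaleC_left: "cinner (c *\<^sub>C x) y = c * cinner x y"
    and inner_cinner: "inner x y = Re (cinner x y)"
begin

subclass banach ..

end

lemma cinner_self: "cinner x x = complex_of_real ((norm x)\<^sup>2)"
  for x :: "'a::complex_hilbert_space"
proof -
  have "Im (cinner x x) = 0"
    using arg_cong[OF cinner_commute[of x x], of Im] by simp
  then show ?thesis
    by (simp add: complex_eq_iff power2_norm_eq_inner inner_cinner)
qed

lemma norm_scaleC: "norm (c *\<^sub>C x) = cmod c * norm x"
  for x :: "'a::complex_hilbert_space"
proof -
  have "cinner (c *\<^sub>C x) (c *\<^sub>C x) = c * cnj c * cinner x x"
    by (metis cinner_commute cinner_scaleC_left complex_cnj_mult mult.assoc)
  then have "complex_of_real ((norm (c *\<^sub>C x))\<^sup>2) = complex_of_real ((cmod c * norm x)\<^sup>2)"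
    by (simp add: cinner_self complex_norm_square[symmetric] power_mult_distrib)
  then have "(norm (c *\<^sub>C x))\<^sup>2 = (cmod c * norm x)\<^sup>2"
    by (simp only: of_real_eq_iff)
  then show ?thesis
    by (simp add: power2_eq_iff_nonneg)
qed

lemma bounded_linear_scaleC: "bounded_linear (scaleC c :: 'a \<Rightarrow> 'a::complex_hilbert_space)"
proof (rule bounded_linear_intro[where K = "cmod c"])
  fix x y :: 'a and r :: real
  show "c *\<^sub>C (x + y) = c *\<^sub>C x + c *\<^sub>C y" by (rule scaleC_add_right)
  show "c *\<^sub>C (r *\<^sub>R x) = r *\<^sub>R (c *\<^sub>C x)"
    by (simp add: scaleR_scaleC scaleC_scaleC mult.commute)
  show "norm (c *\<^sub>C x) \<le> norm x * cmod c" by (simp add: norm_scaleC mult.commute)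
qed

text \<open>The library type \<open>'a \<Rightarrow>\<^sub>L 'b\<close> consists of the bounded \<^emph>\<open>real\<close>-linear maps; \<open>B(H)\<close> is the
  following subset. It inherits the operator norm, the norm topology and the library's
  \<^const>\<open>strong_operator_topology\<close>.\<close>

definition bounded_clinear_ops ::
  "('a::complex_hilbert_space \<Rightarrow>\<^sub>L 'b::complex_hilbert_space) set" where
  "bounded_clinear_ops = {T. \<forall>c x. blinfun_apply T (c *\<^sub>C x) = c *\<^sub>C blinfun_apply T x}"

lift_definition scaleC_op ::
  "complex \<Rightarrow> ('a::complex_hilbert_space \<Rightarrow>\<^sub>L 'b::complex_hilbert_space) \<Rightarrow> 'a \<Rightarrow>\<^sub>L 'b"
  is "\<lambda>c T x. c *\<^sub>C T x"
  by (rule bounded_linear_compose[OF bounded_linear_scaleC])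

text \<open>Norm of the operator matrix \<open>[T\<^sub>i\<^sub>j]\<close>, \<open>i \<in> I\<close>, \<open>j \<in> J\<close> (\<open>I\<close>, \<open>J\<close> finite), as an operator from the
  Hilbert direct sum over \<open>J\<close> to the Hilbert direct sum over \<open>I\<close>.\<close>

definition opmat_norm :: "'i set \<Rightarrow> 'j set \<Rightarrow>
  ('i \<Rightarrow> 'j \<Rightarrow> ('a::complex_hilbert_space \<Rightarrow>\<^sub>L 'b::complex_hilbert_space)) \<Rightarrow> real" where
  "opmat_norm I J T =
     (SUP h\<in>{h. L2_set (\<lambda>j. norm (h j)) J \<le> 1}.
        L2_set (\<lambda>i. norm (\<Sum>j\<in>J. blinfun_apply (T i j) (h j))) I)"

definition row_norm :: "('n::finite \<Rightarrow> ('a::complex_hilbert_space \<Rightarrow>\<^sub>L 'a)) \<Rightarrow> real" where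
  "row_norm X = opmat_norm {()} UNIV (\<lambda>_ i. X i)"

lemma limitin_strong_operator_topology:
  "limitin strong_operator_topology S T F \<longleftrightarrow>
     (\<forall>x. ((\<lambda>i. blinfun_apply (S i) x) \<longlongrightarrow> blinfun_apply T x) F)" (is "?L \<longleftrightarrow> ?R")
proof
  assume ?L
  show ?R
  proof
    fix x
    from continuous_map_limit[OF strong_operator_topology_continuous_evaluation[of x] \<open>?L\<close>]
    show "((\<lambda>i. blinfun_apply (S i) x) \<longlongrightarrow> blinfun_apply T x) F"
      by (simp add: o_def limitin_canonical_iff)
  qed
next
  assume R: ?R
  show ?L
    unfolding limitin_def
  proof (intro conjI allI impI)
    show "T \<in> topspace strong_operator_topology"
      by (simp add: strong_operator_topology_topspace)
    fix U assume U: "openin strong_operator_topology U \<and> T \<in> U"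
    then obtain V where V: "open V" "U = blinfun_apply -` V"
      by (auto simp: strong_operator_topology_def openin_pullback_topology)
    have "((\<lambda>i. blinfun_apply (S i)) \<longlongrightarrow> blinfun_apply T) F"
      using R limitin_componentwise[of "\<lambda>_. euclidean" UNIV "\<lambda>i. blinfun_apply (S i)" "blinfun_apply T" F]
      by (simp add: euclidean_product_topology limitin_canonical_iff)
    then have "\<forall>\<^sub>F i in F. blinfun_apply (S i) \<in> V"
      using U V by (auto simp: tendsto_def)
    then show "\<forall>\<^sub>F i in F. S i \<in> U" by (simp add: V)
  qed
qed


section \<open>The Hilbert space of square-summable families\<close>

typedef 'a ell2 = "{u :: 'a \<Rightarrow> complex. (\<lambda>i. (cmod (u i))\<^sup>2) summable_on UNIV}"
  morphisms ell2_coeff Abs_ell2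
  by (rule exI[of _ "\<lambda>_. 0"]) simp

setup_lifting type_definition_ell2

lemma ell2_prod_summable:
  fixes u v :: "'a \<Rightarrow> complex"
  assumes "(\<lambda>i. (cmod (u i))\<^sup>2) summable_on UNIV" "(\<lambda>i. (cmod (v i))\<^sup>2) summable_on UNIV"
  shows "(\<lambda>i. u i * cnj (v i)) summable_on UNIV"
proof (rule abs_summable_summable, rule summable_on_comparison_test)
  show "(\<lambda>i. (cmod (u i))\<^sup>2 + (cmod (v i))\<^sup>2) summable_on UNIV"
    by (rule summable_on_add[OF assms])
  fix i
  have "2 * (cmod (u i) * cmod (v i)) \<le> (cmod (u i))\<^sup>2 + (cmod (v i))\<^sup>2"
    using sum_squares_bound[of "cmod (u i)" "cmod (v i)"] by (simp add: mult.assoc)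
  moreover have "0 \<le> cmod (u i) * cmod (v i)" by simp
  ultimately have "cmod (u i) * cmod (v i) \<le> (cmod (u i))\<^sup>2 + (cmod (v i))\<^sup>2"
    by linarith
  then show "norm (u i * cnj (v i)) \<le> (cmod (u i))\<^sup>2 + (cmod (v i))\<^sup>2"
    by (simp add: norm_mult)
qed simp

lemma ell2_add_summable:
  fixes u v :: "'a \<Rightarrow> complex"
  assumes "(\<lambda>i. (cmod (u i))\<^sup>2) summable_on UNIV" "(\<lambda>i. (cmod (v i))\<^sup>2) summable_on UNIV"
  shows "(\<lambda>i. (cmod (u i + v i))\<^sup>2) summable_on UNIV"
proof (rule summable_on_comparison_test)
  show "(\<lambda>i. 2 * (cmod (u i))\<^sup>2 + 2 * (cmod (v i))\<^sup>2) summable_on UNIV"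
    by (intro summable_on_add summable_on_cmult_right assms)
  fix i
  have "(cmod (u i + v i))\<^sup>2 \<le> (cmod (u i) + cmod (v i))\<^sup>2"
    by (simp add: norm_triangle_ineq power_mono)
  also have "\<dots> \<le> 2 * (cmod (u i))\<^sup>2 + 2 * (cmod (v i))\<^sup>2"
    using sum_squares_bound[of "cmod (u i)" "cmod (v i)"] by (simp add: power2_sum)
  finally show "(cmod (u i + v i))\<^sup>2 \<le> 2 * (cmod (u i))\<^sup>2 + 2 * (cmod (v i))\<^sup>2" .
qed simp

lemma ell2_scale_summable:
  fixes u :: "'a \<Rightarrow> complex"
  assumes "(\<lambda>i. (cmod (u i))\<^sup>2) summable_on UNIV"
  shows "(\<lambda>i. (cmod (c * u i))\<^sup>2) summable_on UNIV"
  using summable_on_cmult_right[OF assms, of "(cmod c)\<^sup>2"]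
  by (simp add: norm_mult power_mult_distrib)

instantiation ell2 :: (type) real_vector
begin

lift_definition zero_ell2 :: "'a ell2" is "\<lambda>_. 0" by simp
lift_definition plus_ell2 :: "'a ell2 \<Rightarrow> 'a ell2 \<Rightarrow> 'a ell2" is "\<lambda>u v i. u i + v i"
  by (rule ell2_add_summable)
lift_definition uminus_ell2 :: "'a ell2 \<Rightarrow> 'a ell2" is "\<lambda>u i. - u i" by simp
lift_definition minus_ell2 :: "'a ell2 \<Rightarrow> 'a ell2 \<Rightarrow> 'a ell2" is "\<lambda>u v i. u i - v i"
  subgoal for u v using ell2_add_summable[of u "\<lambda>i. - v i"] by simp
  done
lift_definition scaleR_ell2 :: "real \<Rightarrow> 'a ell2 \<Rightarrow> 'a ell2" is "\<lambda>r u i. of_real r * u i"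
  by (rule ell2_scale_summable)

instance
  by standard (transfer; simp add: algebra_simps fun_eq_iff)+

end

instantiation ell2 :: (type) real_inner
begin

definition inner_ell2 :: "'a ell2 \<Rightarrow> 'a ell2 \<Rightarrow> real" where
  "inner_ell2 u v = Re (\<Sum>\<^sub>\<infinity>i. ell2_coeff u i * cnj (ell2_coeff v i))"
definition norm_ell2 :: "'a ell2 \<Rightarrow> real" where
  "norm_ell2 u = sqrt (\<Sum>\<^sub>\<infinity>i. (cmod (ell2_coeff u i))\<^sup>2)"
definition sgn_ell2 :: "'a ell2 \<Rightarrow> 'a ell2" where
  "sgn_ell2 u = inverse (norm u) *\<^sub>R u"
definition dist_ell2 :: "'a ell2 \<Rightarrow> 'a ell2 \<Rightarrow> real" where
  "dist_ell2 u v = norm (u - v)"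
definition uniformity_ell2 :: "('a ell2 \<times> 'a ell2) filter" where
  "uniformity_ell2 = (INF e\<in>{0<..}. principal {(u, v). dist u v < e})"
definition open_ell2 :: "'a ell2 set \<Rightarrow> bool" where
  "open_ell2 U \<longleftrightarrow> (\<forall>u\<in>U. \<forall>\<^sub>F (u', v) in uniformity. u' = u \<longrightarrow> v \<in> U)"

instance
proof
  note summable = ell2_prod_summable[OF ell2_coeff[simplified] ell2_coeff[simplified]]
  note summable2 = ell2_coeff[simplified]
  fix u v w :: "'a ell2" and r :: real
  have self: "inner u u = (\<Sum>\<^sub>\<infinity>i. (cmod (ell2_coeff u i))\<^sup>2)" for u :: "'a ell2"
    using infsum_Re[OF summable[of u u]]
    by (simp add: inner_ell2_def complex_norm_square[symmetric] del: of_real_power)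
  show "inner u v = inner v u"
  proof -
    have "(\<Sum>\<^sub>\<infinity>i. ell2_coeff u i * cnj (ell2_coeff v i)) =
        cnj (\<Sum>\<^sub>\<infinity>i. ell2_coeff v i * cnj (ell2_coeff u i))"
      unfolding infsum_cnj[symmetric] by (simp add: mult.commute)
    then show ?thesis by (simp add: inner_ell2_def)
  qed
  show "inner (u + v) w = inner u w + inner v w"
    by (simp add: inner_ell2_def plus_ell2.rep_eq distrib_right infsum_add summable)
  show "inner (r *\<^sub>R u) v = r * inner u v"
    by (simp add: inner_ell2_def scaleR_ell2.rep_eq mult.assoc infsum_cmult_right')
  show "0 \<le> inner u u"
    unfolding self by (rule infsum_nonneg) simp
  show "inner u u = 0 \<longleftrightarrow> u = 0"
  proof
    assume "inner u u = 0"
    then have "(cmod (ell2_coeff u i))\<^sup>2 = 0" for i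
      using nonneg_infsum_le_0D[OF _ summable2[of u], of i] by (simp add: self)
    then show "u = 0" by (simp add: ell2_coeff_inject[symmetric] zero_ell2.rep_eq fun_eq_iff)
  next
    assume "u = 0" then show "inner u u = 0" by (simp add: self zero_ell2.rep_eq)
  qed
  show "norm u = sqrt (inner u u)" by (simp add: norm_ell2_def self)
qed (simp_all only: sgn_ell2_def dist_ell2_def uniformity_ell2_def open_ell2_def)

end

lemma ell2_coeff_norm_le: "cmod (ell2_coeff u i) \<le> norm u"
proof -
  have "(\<Sum>j\<in>{i}. (cmod (ell2_coeff u j))\<^sup>2) \<le> (\<Sum>\<^sub>\<infinity>j. (cmod (ell2_coeff u j))\<^sup>2)"
    using ell2_coeff[of u] by (intro finite_sum_le_infsum) auto
  then show ?thesis by (simp add: norm_ell2_def real_le_rsqrt)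
qed

instance ell2 :: (type) complete_space
proof
  fix X :: "nat \<Rightarrow> 'a ell2"
  assume "Cauchy X"
  have "Cauchy (\<lambda>n. ell2_coeff (X n) i)" for i
  proof (rule CauchyI)
    fix e :: real assume "0 < e"
    with \<open>Cauchy X\<close> obtain M where M: "\<And>m n. m \<ge> M \<Longrightarrow> n \<ge> M \<Longrightarrow> norm (X m - X n) < e"
      using CauchyD by blast
    then show "\<exists>M. \<forall>m\<ge>M. \<forall>n\<ge>M. norm (ell2_coeff (X m) i - ell2_coeff (X n) i) < e"
      using ell2_coeff_norm_le[of "X _ - X _" i]
      by (metis (no_types, lifting) le_less_trans minus_ell2.rep_eq)
  qed
  then have "\<exists>l. (\<lambda>n. ell2_coeff (X n) i) \<longlonglongrightarrow> l" for i
    by (simp add: Cauchy_convergent_iff convergent_def)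
  then obtain l where l: "\<And>i. (\<lambda>n. ell2_coeff (X n) i) \<longlonglongrightarrow> l i"
    by metis
  have bound: "(\<Sum>i\<in>F. (cmod (ell2_coeff (X m) i - l i))\<^sup>2) \<le> e\<^sup>2"
    if F: "finite F" and m: "m \<ge> M" and e: "0 < e"
      and M: "\<And>m n. m \<ge> M \<Longrightarrow> n \<ge> M \<Longrightarrow> norm (X m - X n) < e" for F e M m
  proof (rule tendsto_upperbound)
    show "(\<lambda>n. \<Sum>i\<in>F. (cmod (ell2_coeff (X m) i - ell2_coeff (X n) i))\<^sup>2)
            \<longlonglongrightarrow> (\<Sum>i\<in>F. (cmod (ell2_coeff (X m) i - l i))\<^sup>2)"
      by (intro tendsto_intros l)
    show "\<forall>\<^sub>F n in sequentially.
            (\<Sum>i\<in>F. (cmod (ell2_coeff (X m) i - ell2_coeff (X n) i))\<^sup>2) \<le> e\<^sup>2"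
      using eventually_ge_at_top[of M]
    proof eventually_elim
      case (elim n)
      have "(\<Sum>i\<in>F. (cmod (ell2_coeff (X m - X n) i))\<^sup>2)
              \<le> (\<Sum>\<^sub>\<infinity>i. (cmod (ell2_coeff (X m - X n) i))\<^sup>2)"
        using ell2_coeff[of "X m - X n"] F by (intro finite_sum_le_infsum) auto
      also have "\<dots> = (norm (X m - X n))\<^sup>2"
        by (simp add: norm_ell2_def infsum_nonneg)
      also have "\<dots> \<le> e\<^sup>2"
        using M[OF m elim] by (intro power_mono) auto
      finally show ?case by (simp add: minus_ell2.rep_eq)
    qed
  qed simp
  have diff: "(\<lambda>i. (cmod (ell2_coeff (X m) i - l i))\<^sup>2) summable_on UNIV \<and>
      (\<Sum>\<^sub>\<infinity>i. (cmod (ell2_coeff (X m) i - l i))\<^sup>2) \<le> e\<^sup>2"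
    if m: "m \<ge> M" and e: "0 < e"
      and M: "\<And>m n. m \<ge> M \<Longrightarrow> n \<ge> M \<Longrightarrow> norm (X m - X n) < e" for e M m
  proof
    show "(\<lambda>i. (cmod (ell2_coeff (X m) i - l i))\<^sup>2) summable_on UNIV"
      using bound[OF _ m e M] by (intro nonneg_bdd_above_summable_on) (auto simp: bdd_above_def)
    then show "(\<Sum>\<^sub>\<infinity>i. (cmod (ell2_coeff (X m) i - l i))\<^sup>2) \<le> e\<^sup>2"
      using bound[OF _ m e M] by (rule infsum_le_finite_sums)
  qed
  obtain M1 where M1: "\<And>m n. m \<ge> M1 \<Longrightarrow> n \<ge> M1 \<Longrightarrow> norm (X m - X n) < 1"
    using CauchyD[OF \<open>Cauchy X\<close>, of 1] by auto
  have "(\<lambda>i. (cmod (ell2_coeff (X M1) i + - 1 * (ell2_coeff (X M1) i - l i)))\<^sup>2) summable_on UNIV"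
    using diff[OF order_refl _ M1] ell2_coeff[of "X M1"]
    by (intro ell2_add_summable ell2_scale_summable) auto
  then have L: "ell2_coeff (Abs_ell2 l) = l"
    by (intro Abs_ell2_inverse) simp
  have "X \<longlonglongrightarrow> Abs_ell2 l"
  proof (rule LIMSEQ_I)
    fix e :: real assume "0 < e"
    then obtain M where M: "\<And>m n. m \<ge> M \<Longrightarrow> n \<ge> M \<Longrightarrow> norm (X m - X n) < e / 2"
      using CauchyD[OF \<open>Cauchy X\<close>, of "e / 2"] by auto
    have "norm (X m - Abs_ell2 l) < e" if "m \<ge> M" for m
    proof -
      have "norm (X m - Abs_ell2 l) \<le> e / 2"
        using diff[OF that _ M] \<open>0 < e\<close>
        unfolding norm_ell2_def minus_ell2.rep_eq L by (intro real_le_lsqrt) auto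
      with \<open>0 < e\<close> show ?thesis by simp
    qed
    then show "\<exists>M. \<forall>m\<ge>M. norm (X m - Abs_ell2 l) < e" by blast
  qed
  then show "convergent X" by (rule convergentI)
qed

instantiation ell2 :: (type) complex_hilbert_space
begin

lift_definition scaleC_ell2 :: "complex \<Rightarrow> 'a ell2 \<Rightarrow> 'a ell2" is "\<lambda>c u i. c * u i"
  by (rule ell2_scale_summable)
definition cinner_ell2 :: "'a ell2 \<Rightarrow> 'a ell2 \<Rightarrow> complex" where
  "cinner_ell2 u v = (\<Sum>\<^sub>\<infinity>i. ell2_coeff u i * cnj (ell2_coeff v i))"

instance
proof
  note summable = ell2_prod_summable[OF ell2_coeff[simplified] ell2_coeff[simplified]]
  fix u v w :: "'a ell2" and c d :: complex and r :: real
  show "c *\<^sub>C (u + v) = c *\<^sub>C u + c *\<^sub>C v" by transfer (simp add: algebra_simps)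
  show "(c + d) *\<^sub>C u = c *\<^sub>C u + d *\<^sub>C u" by transfer (simp add: algebra_simps)
  show "c *\<^sub>C d *\<^sub>C u = (c * d) *\<^sub>C u" by transfer (simp add: algebra_simps)
  show "r *\<^sub>R u = complex_of_real r *\<^sub>C u" by transfer simp
  show "cinner u v = cnj (cinner v u)"
    unfolding cinner_ell2_def infsum_cnj[symmetric] by (simp add: mult.commute)
  show "cinner (u + v) w = cinner u w + cinner v w"
    by (simp add: cinner_ell2_def plus_ell2.rep_eq distrib_right infsum_add summable)
  show "cinner (c *\<^sub>C u) v = c * cinner u v"
    by (simp add: cinner_ell2_def scaleC_ell2.rep_eq mult.assoc infsum_cmult_right')
  show "inner u v = Re (cinner u v)" by (simp add: inner_ell2_def cinner_ell2_def)
qed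

end


section \<open>Noncommutative power series\<close>

text \<open>The free semigroup on generators indexed by \<open>'n\<close> is \<open>'n list\<close> (the identity \<open>g\<^sub>0\<close> is \<open>[]\<close>), and
  \<open>n = CARD('n)\<close>. A formal power series \<open>\<Sum> c\<^sub>\<alpha> Z\<^sub>\<alpha>\<close> is its coefficient function.\<close>

type_synonym 'n nc_series = "'n list \<Rightarrow> complex"

definition nc_polynomial :: "'n nc_series \<Rightarrow> bool" where
  "nc_polynomial c \<longleftrightarrow> finite {\<alpha>. c \<alpha> \<noteq> 0}"

definition nc_one :: "'n nc_series" where
  "nc_one = (\<lambda>\<alpha>. if \<alpha> = [] then 1 else 0)"

definition nc_var :: "'n \<Rightarrow> 'n nc_series" where
  "nc_var i = (\<lambda>\<alpha>. if \<alpha> = [i] then 1 else 0)"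

definition nc_mult :: "'n nc_series \<Rightarrow> 'n nc_series \<Rightarrow> 'n nc_series" where
  "nc_mult c d = (\<lambda>\<alpha>. \<Sum>k\<le>length \<alpha>. c (take k \<alpha>) * d (drop k \<alpha>))"

definition nc_word :: "('n \<Rightarrow> 'n nc_series) \<Rightarrow> 'n list \<Rightarrow> 'n nc_series" where
  "nc_word f \<alpha> = foldr (\<lambda>i. nc_mult (f i)) \<alpha> nc_one"

text \<open>The series \<open>\<Sum>\<^sub>\<alpha> c\<^sub>\<alpha> f\<^sub>\<alpha>\<close>, formed coefficientwise. It is used only where each coefficient is a
  finite sum: for \<open>c\<close> a polynomial, or for \<open>f(0) = 0\<close> (then the coefficient of \<open>Z\<^sub>\<beta>\<close> in \<open>f\<^sub>\<alpha>\<close> vanishes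
  if \<open>length \<beta> < length \<alpha>\<close>).\<close>

definition nc_subst :: "'n nc_series \<Rightarrow> ('n \<Rightarrow> 'n nc_series) \<Rightarrow> 'n nc_series" where
  "nc_subst c f = (\<lambda>\<beta>. \<Sum>\<alpha> | c \<alpha> \<noteq> 0 \<and> nc_word f \<alpha> \<beta> \<noteq> 0. c \<alpha> * nc_word f \<alpha> \<beta>)"

definition nc_radius :: "('n::finite) nc_series \<Rightarrow> ereal" where
  "nc_radius c = conv_radius (\<lambda>k. sqrt (\<Sum>\<alpha> | length \<alpha> = k. (cmod (c \<alpha>))\<^sup>2))"

definition op_word :: "('n \<Rightarrow> ('a::complex_hilbert_space \<Rightarrow>\<^sub>L 'a)) \<Rightarrow> 'n list \<Rightarrow> ('a \<Rightarrow>\<^sub>L 'a)" where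
  "op_word X \<alpha> = foldr (\<lambda>i T. X i o\<^sub>L T) \<alpha> id_blinfun"

definition nc_poly_eval ::
  "'n nc_series \<Rightarrow> ('n \<Rightarrow> ('a::complex_hilbert_space \<Rightarrow>\<^sub>L 'a)) \<Rightarrow> ('a \<Rightarrow>\<^sub>L 'a)" where
  "nc_poly_eval p X = (\<Sum>\<alpha> | p \<alpha> \<noteq> 0. scaleC_op (p \<alpha>) (op_word X \<alpha>))"

definition nc_term ::
  "('n::finite) nc_series \<Rightarrow> ('n \<Rightarrow> ('a::complex_hilbert_space \<Rightarrow>\<^sub>L 'a)) \<Rightarrow> nat \<Rightarrow> ('a \<Rightarrow>\<^sub>L 'a)" where
  "nc_term c X k = (\<Sum>\<alpha> | length \<alpha> = k. scaleC_op (c \<alpha>) (op_word X \<alpha>))"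

text \<open>Sum in operator norm; meaningful only when \<^term>\<open>summable (nc_term c X)\<close>.\<close>

definition nc_eval ::
  "('n::finite) nc_series \<Rightarrow> ('n \<Rightarrow> ('a::complex_hilbert_space \<Rightarrow>\<^sub>L 'a)) \<Rightarrow> ('a \<Rightarrow>\<^sub>L 'a)" where
  "nc_eval c X = (\<Sum>k. nc_term c X k)"

text \<open>\<open>sot_eval f X Y\<close>: \<open>X\<close> lies in \<open>C\<^sub>f\<^sup>S\<^sup>O\<^sup>T\<close> and \<open>f(X) = Y\<close>. \<open>rad_eval f X Y\<close>: \<open>X\<close> lies in \<open>C\<^sub>f\<^sup>r\<^sup>a\<^sup>d\<close> and
  \<open>f(X) = Y\<close>. By Abel's theorem the two values agree if both exist.\<close>

definition sot_eval :: "('n \<Rightarrow> ('n::finite) nc_series) \<Rightarrow>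
  ('n \<Rightarrow> ('a::complex_hilbert_space \<Rightarrow>\<^sub>L 'a)) \<Rightarrow> ('n \<Rightarrow> ('a \<Rightarrow>\<^sub>L 'a)) \<Rightarrow> bool" where
  "sot_eval f X Y \<longleftrightarrow>
     (\<forall>j. limitin strong_operator_topology (\<lambda>N. \<Sum>k<N. nc_term (f j) X k) (Y j) sequentially)"

definition rad_eval :: "('n \<Rightarrow> ('n::finite) nc_series) \<Rightarrow>
  ('n \<Rightarrow> ('a::complex_hilbert_space \<Rightarrow>\<^sub>L 'a)) \<Rightarrow> ('n \<Rightarrow> ('a \<Rightarrow>\<^sub>L 'a)) \<Rightarrow> bool" where
  "rad_eval f X Y \<longleftrightarrow>
     (\<exists>\<delta>\<in>{0<..<1}. \<forall>r\<in>{\<delta><..<1}. \<forall>j. summable (nc_term (f j) (\<lambda>i. r *\<^sub>R X i))) \<and>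
     (\<forall>j. limitin strong_operator_topology
            (\<lambda>r. nc_eval (f j) (\<lambda>i. r *\<^sub>R X i)) (Y j) (at_left (1::real)))"

definition has_value :: "('n \<Rightarrow> ('n::finite) nc_series) \<Rightarrow>
  ('n \<Rightarrow> ('a::complex_hilbert_space \<Rightarrow>\<^sub>L 'a)) \<Rightarrow> ('n \<Rightarrow> ('a \<Rightarrow>\<^sub>L 'a)) \<Rightarrow> bool" where
  "has_value f X Y \<longleftrightarrow> sot_eval f X Y \<or> rad_eval f X Y"


section \<open>The model property and the universal model\<close>

text \<open>In each of the three cases \<open>H\<^sup>2(f)\<close> has the orthonormal basis \<open>{f\<^sub>\<alpha>}\<close>. It is represented here on
  \<^typ>\<open>'n list ell2\<close>, the family \<open>u\<close> standing for the element \<open>\<Sum> u\<^sub>\<alpha> f\<^sub>\<alpha>\<close>: a formal power series in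
  case (S), the function \<open>G \<circ> f\<close> with \<open>G = \<Sum> u\<^sub>\<alpha> Z\<^sub>\<alpha>\<close> in case (F), and in case (A) an element of the
  completion of the polynomials, where the polynomials are the finitely supported \<open>u\<close>.

  The predicates \<open>model_A\<close>, \<open>model_S\<close>, \<open>model_F\<close> hold of \<open>f\<close>, \<open>a\<close>, \<open>W\<close> if \<open>f\<close> satisfies the
  respective alternative of the model property, \<open>Z\<^sub>i = \<Sum> a\<^sub>i\<^sub>,\<^sub>\<alpha> f\<^sub>\<alpha>\<close> in \<open>H\<^sup>2(f)\<close>, and \<open>W\<^sub>i\<close> is the operator
  \<open>M\<^sub>Z\<^sub>i\<close> of left multiplication by \<open>Z\<^sub>i\<close> on \<open>H\<^sup>2(f)\<close>.\<close>

definition model_A :: "('n::finite \<Rightarrow> 'n nc_series) \<Rightarrow> ('n \<Rightarrow> 'n list ell2) \<Rightarrow>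
  ('n \<Rightarrow> ('n list ell2 \<Rightarrow>\<^sub>L 'n list ell2)) \<Rightarrow> bool" where
  "model_A f a W \<longleftrightarrow>
     (\<forall>i. nc_polynomial (f i)) \<and>
     (\<exists>g. (\<forall>i. nc_polynomial (g i)) \<and>
          (\<forall>i. nc_subst (f i) g = nc_var i) \<and> (\<forall>i. nc_subst (g i) f = nc_var i)) \<and>
     (\<forall>i. nc_polynomial (ell2_coeff (a i)) \<and> nc_subst (ell2_coeff (a i)) f = nc_var i) \<and>
     (\<forall>i. W i \<in> bounded_clinear_ops \<and>
        (\<forall>u. nc_polynomial (ell2_coeff u) \<longrightarrow>
           nc_polynomial (ell2_coeff (blinfun_apply (W i) u)) \<and>
           nc_subst (ell2_coeff (blinfun_apply (W i) u)) f =
             nc_mult (nc_var i) (nc_subst (ell2_coeff u) f)))"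

text \<open>\<open>T\<close> is left multiplication by the series \<open>\<phi>\<close> on \<open>H\<^sup>2(f)\<close>, case (S).\<close>

definition formal_multiplication :: "('n::finite \<Rightarrow> 'n nc_series) \<Rightarrow> 'n nc_series \<Rightarrow>
  ('n list ell2 \<Rightarrow>\<^sub>L 'n list ell2) \<Rightarrow> bool" where
  "formal_multiplication f \<phi> T \<longleftrightarrow>
     T \<in> bounded_clinear_ops \<and>
     (\<forall>u. nc_subst (ell2_coeff (blinfun_apply T u)) f = nc_mult \<phi> (nc_subst (ell2_coeff u) f))"

definition model_S :: "('n::finite \<Rightarrow> 'n nc_series) \<Rightarrow> ('n \<Rightarrow> 'n list ell2) \<Rightarrow>
  ('n \<Rightarrow> ('n list ell2 \<Rightarrow>\<^sub>L 'n list ell2)) \<Rightarrow> bool" where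
  "model_S f a W \<longleftrightarrow>
     (\<forall>i. f i [] = 0) \<and> (\<forall>i. nc_radius (f i) > 0) \<and>
     det ((\<chi> i j. f i [j]) :: complex^'n^'n) \<noteq> 0 \<and>
     (\<forall>i. nc_subst (ell2_coeff (a i)) f = nc_var i) \<and>
     (\<forall>i. formal_multiplication f (nc_var i) (W i)) \<and>
     (\<exists>Y. has_value f W Y \<and> (\<forall>j. formal_multiplication f (f j) (Y j)))"

text \<open>\<open>[B(K)\<^sup>n]\<^sub>\<gamma>\<close> for \<open>K = \<ell>\<^sup>2(\<nat>)\<close>, a separable infinite-dimensional Hilbert space.\<close>

definition op_ball :: "real \<Rightarrow> ('n::finite \<Rightarrow> (nat ell2 \<Rightarrow>\<^sub>L nat ell2)) set" where
  "op_ball \<gamma> = {X. (\<forall>i. X i \<in> bounded_clinear_ops) \<and> row_norm X < \<gamma>}"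

text \<open>\<open>T\<close> is left multiplication by the free holomorphic function \<open>\<phi>\<close> on \<open>H\<^sup>2(f)\<close>, case (F).\<close>

definition holomorphic_multiplication :: "real \<Rightarrow> ('n::finite \<Rightarrow> 'n nc_series) \<Rightarrow> 'n nc_series \<Rightarrow>
  ('n list ell2 \<Rightarrow>\<^sub>L 'n list ell2) \<Rightarrow> bool" where
  "holomorphic_multiplication \<gamma> f \<phi> T \<longleftrightarrow>
     T \<in> bounded_clinear_ops \<and>
     (\<forall>u. \<forall>X\<in>op_ball \<gamma>.
        nc_eval (ell2_coeff (blinfun_apply T u)) (\<lambda>j. nc_eval (f j) X) =
        nc_eval \<phi> X o\<^sub>L nc_eval (ell2_coeff u) (\<lambda>j. nc_eval (f j) X))"

definition model_F :: "('n::finite \<Rightarrow> 'n nc_series) \<Rightarrow> ('n \<Rightarrow> 'n list ell2) \<Rightarrow>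
  ('n \<Rightarrow> ('n list ell2 \<Rightarrow>\<^sub>L 'n list ell2)) \<Rightarrow> bool" where
  "model_F f a W \<longleftrightarrow>
     (\<exists>\<gamma>>0. (\<forall>j. nc_radius (f j) \<ge> ereal \<gamma>) \<and>
        (\<forall>X\<in>op_ball \<gamma>. (\<lambda>j. nc_eval (f j) X) \<in> op_ball 1) \<and>
        (\<forall>G. nc_radius G \<ge> 1 \<and> G \<noteq> (\<lambda>_. 0) \<longrightarrow>
           (\<exists>X\<in>op_ball \<gamma>. nc_eval G (\<lambda>j. nc_eval (f j) X) \<noteq> 0)) \<and>
        (\<forall>i. \<forall>X\<in>op_ball \<gamma>. nc_eval (ell2_coeff (a i)) (\<lambda>j. nc_eval (f j) X) = X i) \<and>
        (\<forall>i. holomorphic_multiplication \<gamma> f (nc_var i) (W i)) \<and>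
        (\<exists>Y. has_value f W Y \<and> (\<forall>j. holomorphic_multiplication \<gamma> f (f j) (Y j))))"

definition is_model :: "('n::finite \<Rightarrow> 'n nc_series) \<Rightarrow> ('n \<Rightarrow> 'n list ell2) \<Rightarrow>
  ('n \<Rightarrow> ('n list ell2 \<Rightarrow>\<^sub>L 'n list ell2)) \<Rightarrow> bool" where
  "is_model f a W \<longleftrightarrow> model_A f a W \<or> model_S f a W \<or> model_F f a W"

definition model_property :: "('n::finite \<Rightarrow> 'n nc_series) \<Rightarrow> bool" where
  "model_property f \<longleftrightarrow> (\<exists>a W. is_model f a W)"

text \<open>\<open>a\<close> and \<open>W\<close> are determined by \<open>f\<close> (\<open>a\<^sub>i\<close> is the inverse of \<open>f\<close> under composition, and
  \<open>W\<^sub>i f\<^sub>\<beta> = \<Sum> a\<^sub>i\<^sub>,\<^sub>\<alpha> f\<^sub>\<alpha>\<^sub>\<beta>\<close>), also when \<open>f\<close> satisfies more than one of the alternatives, so that the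
  choice below is immaterial.\<close>

definition model_data :: "('n::finite \<Rightarrow> 'n nc_series) \<Rightarrow>
  ('n \<Rightarrow> 'n list ell2) \<times> ('n \<Rightarrow> ('n list ell2 \<Rightarrow>\<^sub>L 'n list ell2))" where
  "model_data f = (SOME (a, W). is_model f a W)"

definition inverse_series :: "('n::finite \<Rightarrow> 'n nc_series) \<Rightarrow> 'n \<Rightarrow> 'n nc_series" where
  "inverse_series f i = ell2_coeff (fst (model_data f) i)"

definition universal_model ::
  "('n::finite \<Rightarrow> 'n nc_series) \<Rightarrow> 'n \<Rightarrow> ('n list ell2 \<Rightarrow>\<^sub>L 'n list ell2)" where
  "universal_model f = snd (model_data f)"

definition M_rad :: "('n::finite \<Rightarrow> 'n nc_series) set" where
  "M_rad = {f. model_property f \<and>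
     (\<exists>\<delta>\<in>{0<..<1}. \<forall>r\<in>{\<delta><..1}. model_property (\<lambda>i \<alpha>. complex_of_real r * f i \<alpha>))}"

definition norm_convergent_at :: "('n \<Rightarrow> ('n::finite) nc_series) \<Rightarrow>
  ('n \<Rightarrow> ('a::complex_hilbert_space \<Rightarrow>\<^sub>L 'a)) \<Rightarrow> bool" where
  "norm_convergent_at f X \<longleftrightarrow> (\<forall>j. summable (nc_term (f j) X))"

definition radially_norm_convergent_at :: "('n \<Rightarrow> ('n::finite) nc_series) \<Rightarrow>
  ('n \<Rightarrow> ('a::complex_hilbert_space \<Rightarrow>\<^sub>L 'a)) \<Rightarrow> bool" where
  "radially_norm_convergent_at f X \<longleftrightarrow>
     (\<exists>\<delta>\<in>{0<..<1}. \<forall>r\<in>{\<delta><..<1}. \<forall>j. summable (nc_term (f j) (\<lambda>i. r *\<^sub>R X i))) \<and>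
     (\<exists>Y. has_value f X Y \<and>
        (\<forall>j. ((\<lambda>r. nc_eval (f j) (\<lambda>i. r *\<^sub>R X i)) \<longlongrightarrow> Y j) (at_left (1::real))))"

definition M_norm :: "('n::finite \<Rightarrow> 'n nc_series) set" where
  "M_norm = {f. model_property f \<and>
     (norm_convergent_at f (universal_model f) \<or>
      radially_norm_convergent_at f (universal_model f))}"


section \<open>The noncommutative domain and complete polynomial boundedness\<close>

definition nc_domain :: "('n::finite \<Rightarrow> 'n nc_series) \<Rightarrow>
  ('n \<Rightarrow> ('a::complex_hilbert_space \<Rightarrow>\<^sub>L 'a)) set" where
  "nc_domain f = {X. (\<forall>i. X i \<in> bounded_clinear_ops) \<and>
     (\<exists>Y. has_value f X Y \<and> has_value (inverse_series f) Y X \<and> row_norm Y \<le> 1)}"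

definition completely_bounded_on ::
  "('a::complex_hilbert_space \<Rightarrow>\<^sub>L 'a) set \<Rightarrow>
   (('a \<Rightarrow>\<^sub>L 'a) \<Rightarrow> ('b::complex_hilbert_space \<Rightarrow>\<^sub>L 'b)) \<Rightarrow> bool" where
  "completely_bounded_on S \<Phi> \<longleftrightarrow>
     (\<exists>C. \<forall>k::nat. \<forall>T. (\<forall>i<k. \<forall>j<k. T i j \<in> S) \<longrightarrow>
        opmat_norm {..<k} {..<k} (\<lambda>i j. \<Phi> (T i j)) \<le> C * opmat_norm {..<k} {..<k} T)"

text \<open>The domain of the map below is the dense subalgebra of polynomials in \<open>A(B\<^sub>f)\<close>; the matrix
  norms of \<open>A(B\<^sub>f)\<close> are those of \<open>B(H\<^sup>2(f))\<close>. Existence of \<open>\<Phi>\<close> says that the map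
  \<open>p(M\<^sub>Z) \<mapsto> p(A)\<close> is well defined.\<close>

definition poly_algebra :: "('n \<Rightarrow> ('a::complex_hilbert_space \<Rightarrow>\<^sub>L 'a)) \<Rightarrow> ('a \<Rightarrow>\<^sub>L 'a) set" where
  "poly_algebra X = {nc_poly_eval p X |p. nc_polynomial p}"

definition completely_polynomially_bounded ::
  "('n::finite \<Rightarrow> 'n nc_series) \<Rightarrow> ('n \<Rightarrow> ('a::complex_hilbert_space \<Rightarrow>\<^sub>L 'a)) \<Rightarrow> bool" where
  "completely_polynomially_bounded f A \<longleftrightarrow>
     (\<exists>\<Phi>. (\<forall>p. nc_polynomial p \<longrightarrow>
             \<Phi> (nc_poly_eval p (universal_model f)) = nc_poly_eval p A) \<and>
          completely_bounded_on (poly_algebra (universal_model f)) \<Phi>)"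

end

(* In the basis f_alpha the universal model W acts on l^2 of words, W_i being left multiplication by the
   coefficient vector of g_i, and f(W) is the tuple S of left shifts.

   Let T lie in the domain and Y = f(T). Then T_i is the SOT limit of g_i(rY) as r -> 1, and the Poisson
   kernel of the strict row contraction rY gives the von Neumann inequality ||[p_ij(T)]|| <= ||[p_ij(W)]||.
   Hence every tuple similar to T is completely polynomially bounded.

   Conversely, let p(W) -> p(A) be completely bounded. As in Paulsen's similarity theorem, the Hahn-Banach
   theorem provides an equivalent Hilbert norm for which this homomorphism is contractive on operator
   matrices, so A is similar to a tuple T with ||[p_ij(T)]|| <= ||[p_ij(W)]||. Norm convergence of f(W)
   passes to f(T) = Y, and Y is a row contraction because S is. If r f has the model property for some
   r < 1, then the coefficients of g_i are r^|alpha| times a square summable family, so g(S) converges in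
   norm to W, and this convergence passes to g(Y) = T. *)
theory Submission
  imports Defs "HOL-Library.Function_Algebras" "HOL-Complex_Analysis.Complex_Analysis"
begin

section \<open>Operators on complex Hilbert spaces\<close>

text \<open>The renorming uses no dilation. A finite formal sum of b_h tensor h defines the function
  \<xi> -> |sum of b_h \<xi>(h)|^2 of a test map \<xi>. A monotone linear functional on such
  functions turns formal sums into a semi-inner-product space on which each row of operators acts
  with its own norm, and the new norm is the quotient norm under the map to the sum of \<Phi>(b_h)
  h. The functional must be at least the squared norm of that sum and at most C^2 |h|^2 at 1 tensor
  h; complete boundedness makes these demands compatible. The homomorphism is not extended to the
  closed algebra: limits are taken in the closure of the pairs (p(W), p(T)), single-valued by
  contractivity. The obstacle in g(f(T)) = T is that the model property is a disjunction. f and r f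
  may satisfy different alternatives, and two instances of (F) may live on different balls, so their
  inverse series are compared case by case: by formal injectivity where f(0) = 0, after reading
  formal identities off scaled shifts, by faithfulness in (F), and by analytic continuation along t
  X from a small ball to a large one.\<close>

lemma cinner_add_right: "cinner x (y + z) = cinner x y + cinner x z"
  for x :: "'a::complex_hilbert_space"
  by (metis cinner_commute cinner_add_left complex_cnj_add)

lemma cinner_scaleC_right: "cinner x (c *\<^sub>C y) = cnj c * cinner x y"
  for x :: "'a::complex_hilbert_space"
  by (metis cinner_commute cinner_scaleC_left complex_cnj_mult)

lemma scaleC_zero_left [simp]: "0 *\<^sub>C x = (0::'a::complex_hilbert_space)"
  using norm_scaleC[of 0 x] by simp

lemma scaleC_zero_right [simp]: "c *\<^sub>C 0 = (0::'a::complex_hilbert_space)"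
  using norm_scaleC[of c "0::'a"] by simp

lemma scaleC_one [simp]: "1 *\<^sub>C x = (x::'a::complex_hilbert_space)"
  using scaleR_scaleC[of 1 x] by simp

lemma scaleC_minus_left: "(- c) *\<^sub>C x = - (c *\<^sub>C (x::'a::complex_hilbert_space))"
  using scaleC_add_left[of "-c" c x] by (simp add: eq_neg_iff_add_eq_0)

lemma scaleC_sum_right: "c *\<^sub>C sum f A = (\<Sum>i\<in>A. c *\<^sub>C (f i::'a::complex_hilbert_space))"
  by (induction A rule: infinite_finite_induct) (auto simp: scaleC_add_right)

lemma scaleC_sum_left: "sum f A *\<^sub>C x = (\<Sum>i\<in>A. f i *\<^sub>C (x::'a::complex_hilbert_space))"
  by (induction A rule: infinite_finite_induct) (auto simp: scaleC_add_left)

lemma cinner_zero_left [simp]: "cinner 0 x = 0" for x :: "'a::complex_hilbert_space"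
  using cinner_scaleC_left[of 0 x x] by simp

lemma cinner_zero_right [simp]: "cinner x 0 = 0" for x :: "'a::complex_hilbert_space"
  using cinner_scaleC_right[of x 0 x] by simp

lemma cinner_sum_left: "cinner (sum f A) x = (\<Sum>i\<in>A. cinner (f i) x)"
  for x :: "'a::complex_hilbert_space"
  by (induction A rule: infinite_finite_induct) (auto simp: cinner_add_left)

lemma cinner_sum_right: "cinner x (sum f A) = (\<Sum>i\<in>A. cinner x (f i))"
  for x :: "'a::complex_hilbert_space"
  by (induction A rule: infinite_finite_induct) (auto simp: cinner_add_right)

lemma cinner_diff_left: "cinner (x - y) z = cinner x z - cinner y z"
  for x :: "'a::complex_hilbert_space"
  using cinner_add_left[of "x - y" y z] by simp

lemma inner_scaleC_left: "inner (c *\<^sub>C x) y = inner x (cnj c *\<^sub>C (y::'a::complex_hilbert_space))"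
  by (simp add: inner_cinner cinner_scaleC_left cinner_scaleC_right)

lemma cinner_eq_inner: "cinner x y = Complex (inner x y) (inner x (\<i> *\<^sub>C (y::'a::complex_hilbert_space)))"
  by (simp add: inner_cinner cinner_scaleC_right complex_eq_iff)

text \<open>A unimodular factor makes the product equal to its modulus, so the real Cauchy--Schwarz
  inequality applies.\<close>

lemma cmod_cinner_le: "cmod (cinner x y) \<le> norm x * norm (y::'a::complex_hilbert_space)"
proof (cases "cinner x y = 0")
  case False
  define c where "c = cnj (cinner x y) / cmod (cinner x y)"
  have c: "cmod c = 1" using False by (simp add: c_def norm_divide)
  have "inner (c *\<^sub>C x) y = Re (cinner x y * cnj (cinner x y) / cmod (cinner x y))"
    by (simp add: inner_cinner cinner_scaleC_left c_def mult.commute)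
  also have "\<dots> = cmod (cinner x y)"
    using False by (simp add: complex_norm_square[symmetric] power2_eq_square)
  finally have "cmod (cinner x y) \<le> norm (c *\<^sub>C x) * norm y"
    using norm_cauchy_schwarz[of "c *\<^sub>C x" y] by simp
  then show ?thesis by (simp add: norm_scaleC c)
qed simp

lemma scaleC_decompose: "c *\<^sub>C x = Re c *\<^sub>R x + Im c *\<^sub>R (\<i> *\<^sub>C (x::'a::complex_hilbert_space))"
proof -
  have "c = complex_of_real (Re c) + complex_of_real (Im c) * \<i>" by (simp add: complex_eq_iff)
  then have "c *\<^sub>C x = (complex_of_real (Re c) + complex_of_real (Im c) * \<i>) *\<^sub>C x" by simp
  then show ?thesis by (simp only: scaleC_add_left scaleR_scaleC scaleC_scaleC)
qed

lemma clinear_opI: "(\<And>c x. blinfun_apply T (c *\<^sub>C x) = c *\<^sub>C blinfun_apply T x) \<Longrightarrow> T \<in> bounded_clinear_ops"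
  by (simp add: bounded_clinear_ops_def)

lemma clinear_opD: "T \<in> bounded_clinear_ops \<Longrightarrow> blinfun_apply T (c *\<^sub>C x) = c *\<^sub>C blinfun_apply T x"
  by (simp add: bounded_clinear_ops_def)

text \<open>The operator type is real linear by construction, so commutation with multiplication by
  \<i> is all that complex linearity adds.\<close>

lemma clinear_op_iffI:
  assumes "\<And>x. blinfun_apply T (\<i> *\<^sub>C x) = \<i> *\<^sub>C blinfun_apply T x"
  shows "T \<in> bounded_clinear_ops"
proof (rule clinear_opI)
  fix c x
  show "blinfun_apply T (c *\<^sub>C x) = c *\<^sub>C blinfun_apply T x"
    unfolding scaleC_decompose[of c] by (simp add: blinfun.add_right blinfun.scaleR_right assms)
qed

lemma scaleC_op_apply [simp]: "blinfun_apply (scaleC_op c T) x = c *\<^sub>C blinfun_apply T x"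
  by (simp add: scaleC_op.rep_eq)

lemma blinfun_id_apply [simp]: "blinfun_apply id_blinfun x = x"
  by (simp add: id_blinfun.rep_eq)

lemma clinear_zero [intro, simp]: "0 \<in> bounded_clinear_ops"
  by (simp add: bounded_clinear_ops_def)

lemma clinear_id [intro, simp]: "id_blinfun \<in> bounded_clinear_ops"
  by (simp add: bounded_clinear_ops_def)

lemma clinear_add [intro]:
  "S \<in> bounded_clinear_ops \<Longrightarrow> T \<in> bounded_clinear_ops \<Longrightarrow> S + T \<in> bounded_clinear_ops"
  by (simp add: bounded_clinear_ops_def blinfun.add_left scaleC_add_right)

lemma clinear_scaleR [intro]: "T \<in> bounded_clinear_ops \<Longrightarrow> r *\<^sub>R T \<in> bounded_clinear_ops"
  by (simp add: bounded_clinear_ops_def blinfun.scaleR_left scaleR_scaleC scaleC_scaleC mult.commute)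

lemma clinear_diff [intro]:
  "S \<in> bounded_clinear_ops \<Longrightarrow> T \<in> bounded_clinear_ops \<Longrightarrow> S - T \<in> bounded_clinear_ops"
  using clinear_add[OF _ clinear_scaleR[of T "-1"], of S] by simp

lemma clinear_scaleC_op [intro]: "T \<in> bounded_clinear_ops \<Longrightarrow> scaleC_op c T \<in> bounded_clinear_ops"
  by (simp add: bounded_clinear_ops_def scaleC_scaleC mult.commute)

lemma clinear_compose [intro]:
  "S \<in> bounded_clinear_ops \<Longrightarrow> T \<in> bounded_clinear_ops \<Longrightarrow> S o\<^sub>L T \<in> bounded_clinear_ops"
  by (simp add: bounded_clinear_ops_def)

lemma clinear_sum [intro]: "(\<And>i. i \<in> I \<Longrightarrow> T i \<in> bounded_clinear_ops) \<Longrightarrow> sum T I \<in> bounded_clinear_ops"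
  by (induction I rule: infinite_finite_induct) auto

text \<open>An intersection of closed equations; it keeps norm limits and the fixed point of
  \<open>selfadjoint_sqrt\<close> complex linear.\<close>

lemma closed_clinear_ops:
  "closed (bounded_clinear_ops :: ('a::complex_hilbert_space \<Rightarrow>\<^sub>L 'b::complex_hilbert_space) set)"
proof -
  have eq: "bounded_clinear_ops = (\<Inter>c. \<Inter>x. {T :: 'a \<Rightarrow>\<^sub>L 'b. blinfun_apply T (c *\<^sub>C x) = c *\<^sub>C blinfun_apply T x})"
    by (auto simp: bounded_clinear_ops_def)
  have "closed {T :: 'a \<Rightarrow>\<^sub>L 'b. blinfun_apply T (c *\<^sub>C x) = c *\<^sub>C blinfun_apply T x}" for c x
    by (intro closed_Collect_eq linear_continuous_on bounded_linear_compose[OF bounded_linear_scaleC]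
        bounded_linear_intros)
  then show ?thesis unfolding eq by (intro closed_INT ballI)
qed

lemma clinear_limit:
  "(T \<longlongrightarrow> S) F \<Longrightarrow> F \<noteq> bot \<Longrightarrow> (\<And>x. T x \<in> bounded_clinear_ops) \<Longrightarrow> S \<in> bounded_clinear_ops"
  by (rule Lim_in_closed_set[OF closed_clinear_ops]) auto

lemma norm_scaleC_op: "norm (scaleC_op c T) = cmod c * norm T"
proof -
  have le: "norm (scaleC_op c T) \<le> cmod c * norm T" for c and T :: "'a::complex_hilbert_space \<Rightarrow>\<^sub>L 'b::complex_hilbert_space"
    by (rule norm_blinfun_bound)
      (auto simp: norm_scaleC mult.assoc intro!: mult_left_mono norm_blinfun)
  show ?thesis
  proof (cases "c = 0")
    case False
    have "scaleC_op (inverse c) (scaleC_op c T) = T"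
      using False by (intro blinfun_eqI) (simp add: scaleC_scaleC)
    then have "norm T \<le> inverse (cmod c) * norm (scaleC_op c T)"
      using le[of "inverse c" "scaleC_op c T"] by (simp add: norm_inverse)
    then have "cmod c * norm T \<le> cmod c * (inverse (cmod c) * norm (scaleC_op c T))"
      by (intro mult_left_mono) auto
    then show ?thesis using le[of c T] False by (simp add: field_simps)
  qed (use le[of 0 T] in simp)
qed

lemma scaleC_op_one [simp]: "scaleC_op 1 T = T"
  by (rule blinfun_eqI) simp

lemma scaleC_op_zero [simp]: "scaleC_op 0 T = 0" "scaleC_op c 0 = 0"
  by (rule blinfun_eqI, simp)+

lemma scaleC_op_scaleC_op [simp]: "scaleC_op c (scaleC_op d T) = scaleC_op (c * d) T"
  by (rule blinfun_eqI) (simp add: scaleC_scaleC)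

lemma scaleC_op_add_left: "scaleC_op (c + d) T = scaleC_op c T + scaleC_op d T"
  by (rule blinfun_eqI) (simp add: scaleC_add_left blinfun.add_left)

lemma scaleC_op_diff_left: "scaleC_op (c - d) T = scaleC_op c T - scaleC_op d T"
  using scaleC_op_add_left[of "c - d" d T] by simp

lemma scaleC_op_sum_right: "scaleC_op c (sum T I) = (\<Sum>i\<in>I. scaleC_op c (T i))"
  by (rule blinfun_eqI) (simp add: blinfun.sum_left scaleC_sum_right)

lemma scaleC_op_sum_left: "scaleC_op (sum f I) T = (\<Sum>i\<in>I. scaleC_op (f i) T)"
  by (rule blinfun_eqI) (simp add: blinfun.sum_left scaleC_sum_left)

lemma scaleC_op_of_real: "scaleC_op (complex_of_real r) T = r *\<^sub>R T"
  by (rule blinfun_eqI) (simp add: blinfun.scaleR_left scaleR_scaleC)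

lemma scaleC_op_compose_left: "scaleC_op c S o\<^sub>L T = scaleC_op c (S o\<^sub>L T)"
  by (rule blinfun_eqI) simp

lemma scaleC_op_compose_right: "S \<in> bounded_clinear_ops \<Longrightarrow> S o\<^sub>L scaleC_op c T = scaleC_op c (S o\<^sub>L T)"
  by (rule blinfun_eqI) (simp add: clinear_opD)

lemma blinfun_compose_sum_left: "sum f I o\<^sub>L T = (\<Sum>i\<in>I. f i o\<^sub>L T)"
  by (rule blinfun_eqI) (simp add: blinfun.sum_left)

lemma blinfun_compose_sum_right: "T o\<^sub>L sum f I = (\<Sum>i\<in>I. T o\<^sub>L f i)"
  by (rule blinfun_eqI) (simp add: blinfun.sum_left blinfun.sum_right)

lemma blinfun_compose_id [simp]: "id_blinfun o\<^sub>L T = T" "T o\<^sub>L id_blinfun = T"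
  by (rule blinfun_eqI, simp)+

lemma blinfun_compose_assoc: "(S o\<^sub>L T) o\<^sub>L U = S o\<^sub>L (T o\<^sub>L U)"
  by (rule blinfun_eqI) simp

lemma tendsto_scaleC: "(f \<longlongrightarrow> l) F \<Longrightarrow> ((\<lambda>x. c *\<^sub>C f x) \<longlongrightarrow> c *\<^sub>C l) F"
  for f :: "'c \<Rightarrow> 'a::complex_hilbert_space"
  by (rule bounded_linear.tendsto[OF bounded_linear_scaleC])

lemmas blinfun_compose_diff_left = bounded_bilinear.diff_left[OF bounded_bilinear_blinfun_compose]
lemmas blinfun_compose_diff_right = bounded_bilinear.diff_right[OF bounded_bilinear_blinfun_compose]
lemmas tendsto_blinfun_compose = bounded_bilinear.tendsto[OF bounded_bilinear_blinfun_compose]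

text \<open>Squares of norms are easier to sum than \<^const>\<open>L2_set\<close>; for finite \<open>I\<close>, \<open>J\<close> and \<open>D \<ge> 0\<close> this says
  \<^term>\<open>opmat_norm I J T \<le> D\<close>.\<close>

definition op_bound :: "'i set \<Rightarrow> 'j set \<Rightarrow>
  ('i \<Rightarrow> 'j \<Rightarrow> ('a::complex_hilbert_space \<Rightarrow>\<^sub>L 'b::complex_hilbert_space)) \<Rightarrow> real \<Rightarrow> bool" where
  "op_bound I J T D \<longleftrightarrow>
     (\<forall>h. (\<Sum>i\<in>I. (norm (\<Sum>j\<in>J. blinfun_apply (T i j) (h j)))\<^sup>2) \<le> D\<^sup>2 * (\<Sum>j\<in>J. (norm (h j))\<^sup>2))"

lemma op_boundD: "op_bound I J T D \<Longrightarrow>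
  (\<Sum>i\<in>I. (norm (\<Sum>j\<in>J. blinfun_apply (T i j) (h j)))\<^sup>2) \<le> D\<^sup>2 * (\<Sum>j\<in>J. (norm (h j))\<^sup>2)"
  by (simp add: op_bound_def)

lemma opmat_norm_bdd:
  fixes T :: "'i \<Rightarrow> 'j \<Rightarrow> ('a::complex_hilbert_space \<Rightarrow>\<^sub>L 'b::complex_hilbert_space)"
  assumes "finite I" "finite J"
  shows "bdd_above ((\<lambda>h. L2_set (\<lambda>i. norm (\<Sum>j\<in>J. blinfun_apply (T i j) (h j))) I) ` {h. L2_set (\<lambda>j. norm (h j)) J \<le> 1})"
proof (rule bdd_aboveI2)
  fix h :: "'j \<Rightarrow> 'a" assume "h \<in> {h. L2_set (\<lambda>j. norm (h j)) J \<le> 1}"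
  then have h: "norm (h j) \<le> 1" if "j \<in> J" for j
    using member_le_L2_set[OF assms(2) that, of "\<lambda>j. norm (h j)"] by simp
  have "L2_set (\<lambda>i. norm (\<Sum>j\<in>J. blinfun_apply (T i j) (h j))) I \<le> (\<Sum>i\<in>I. norm (\<Sum>j\<in>J. blinfun_apply (T i j) (h j)))"
    by (rule L2_set_le_sum) simp
  also have "\<dots> \<le> (\<Sum>i\<in>I. \<Sum>j\<in>J. norm (T i j))"
  proof (intro sum_mono order_trans[OF norm_sum])
    fix i j assume "i \<in> I" "j \<in> J"
    show "norm (blinfun_apply (T i j) (h j)) \<le> norm (T i j)"
      using norm_blinfun[of "T i j" "h j"] mult_left_mono[OF h[OF \<open>j \<in> J\<close>], of "norm (T i j)"] by simp
  qed
  finally show "L2_set (\<lambda>i. norm (\<Sum>j\<in>J. blinfun_apply (T i j) (h j))) I \<le> (\<Sum>i\<in>I. \<Sum>j\<in>J. norm (T i j))" .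
qed

lemma opmat_norm_nonneg: "finite I \<Longrightarrow> finite J \<Longrightarrow> 0 \<le> opmat_norm I J T"
  unfolding opmat_norm_def
  by (rule cSUP_upper2[OF opmat_norm_bdd, where x = "\<lambda>_. 0"]) (auto simp: L2_set_def)

text \<open>By homogeneity: \<open>h\<close> is divided by its length \<open>s\<close>, and for
  \<open>s = 0\<close> all \<open>h j\<close> with \<open>j \<in> J\<close> vanish.\<close>

lemma opmat_norm_op_bound:
  fixes T :: "'i \<Rightarrow> 'j \<Rightarrow> ('a::complex_hilbert_space \<Rightarrow>\<^sub>L 'b::complex_hilbert_space)"
  assumes "finite I" "finite J"
  shows "op_bound I J T (opmat_norm I J T)"
  unfolding op_bound_def
proof
  fix h :: "'j \<Rightarrow> 'a"
  define s where "s = L2_set (\<lambda>j. norm (h j)) J"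
  have s2: "s\<^sup>2 = (\<Sum>j\<in>J. (norm (h j))\<^sup>2)" by (simp add: s_def L2_set_def sum_nonneg)
  have s0: "0 \<le> s" by (simp add: s_def)
  show "(\<Sum>i\<in>I. (norm (\<Sum>j\<in>J. blinfun_apply (T i j) (h j)))\<^sup>2) \<le> (opmat_norm I J T)\<^sup>2 * (\<Sum>j\<in>J. (norm (h j))\<^sup>2)"
  proof (cases "s = 0")
    case True
    then have "\<forall>j\<in>J. (norm (h j))\<^sup>2 = 0"
      using s2 assms by (simp add: sum_nonneg_eq_0_iff)
    then show ?thesis by simp
  next
    case False
    then have s: "s > 0" using s0 by simp
    define k where "k j = (1/s) *\<^sub>R h j" for j
    have "L2_set (\<lambda>j. norm (k j)) J = (1/s) * s"
      unfolding s_def using s by (subst L2_set_right_distrib) (auto simp: k_def s_def)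
    then have "L2_set (\<lambda>i. norm (\<Sum>j\<in>J. blinfun_apply (T i j) (k j))) I \<le> opmat_norm I J T"
      unfolding opmat_norm_def using s
      by (intro cSUP_upper opmat_norm_bdd assms) auto
    then have "(L2_set (\<lambda>i. norm (\<Sum>j\<in>J. blinfun_apply (T i j) (k j))) I)\<^sup>2 \<le> (opmat_norm I J T)\<^sup>2"
      by (intro power_mono) auto
    moreover have "(L2_set (\<lambda>i. norm (\<Sum>j\<in>J. blinfun_apply (T i j) (k j))) I)\<^sup>2 =
       (\<Sum>i\<in>I. (norm (\<Sum>j\<in>J. blinfun_apply (T i j) (k j)))\<^sup>2)"
      by (simp add: L2_set_def sum_nonneg)
    moreover have "(norm (\<Sum>j\<in>J. blinfun_apply (T i j) (k j)))\<^sup>2 =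
       (norm (\<Sum>j\<in>J. blinfun_apply (T i j) (h j)))\<^sup>2 / s\<^sup>2" for i
      using s by (simp add: k_def blinfun.scaleR_right scaleR_sum_right[symmetric] power_divide)
    ultimately have "(\<Sum>i\<in>I. (norm (\<Sum>j\<in>J. blinfun_apply (T i j) (h j)))\<^sup>2) / s\<^sup>2 \<le> (opmat_norm I J T)\<^sup>2"
      by (simp add: sum_divide_distrib)
    then show ?thesis using s by (simp add: s2[symmetric] field_simps)
  qed
qed

lemma opmat_norm_le:
  fixes T :: "'i \<Rightarrow> 'j \<Rightarrow> ('a::complex_hilbert_space \<Rightarrow>\<^sub>L 'b::complex_hilbert_space)"
  assumes "0 \<le> D" "op_bound I J T D"
  shows "opmat_norm I J T \<le> D"
  unfolding opmat_norm_def
proof (rule cSUP_least)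
  have "L2_set (\<lambda>j. norm (0::'a)) J \<le> 1" by (simp add: L2_set_def)
  then have "(\<lambda>_. 0::'a) \<in> {h. L2_set (\<lambda>j. norm (h j)) J \<le> 1}" by simp
  then show "{h. L2_set (\<lambda>j. norm (h j::'a)) J \<le> 1} \<noteq> {}" by (metis empty_iff)
next
  fix h :: "'j \<Rightarrow> 'a" assume "h \<in> {h. L2_set (\<lambda>j. norm (h j)) J \<le> 1}"
  then have "(\<Sum>j\<in>J. (norm (h j))\<^sup>2) \<le> 1" by (simp add: L2_set_def)
  then have "D\<^sup>2 * (\<Sum>j\<in>J. (norm (h j))\<^sup>2) \<le> D\<^sup>2"
    by (intro mult_left_le) (auto simp: sum_nonneg)
  then have "(\<Sum>i\<in>I. (norm (\<Sum>j\<in>J. blinfun_apply (T i j) (h j)))\<^sup>2) \<le> D\<^sup>2"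
    using op_boundD[OF assms(2), of h] by simp
  then show "L2_set (\<lambda>i. norm (\<Sum>j\<in>J. blinfun_apply (T i j) (h j))) I \<le> D"
    unfolding L2_set_def using assms(1) by (intro real_le_lsqrt) (auto simp: sum_nonneg)
qed

lemma op_bound_mono: "op_bound I J T D \<Longrightarrow> 0 \<le> D \<Longrightarrow> D \<le> D' \<Longrightarrow> op_bound I J T D'"
  unfolding op_bound_def
  by (meson order_trans mult_right_mono power_mono sum_nonneg zero_le_power2)

lemma row_norm_le_iff:
  assumes "0 \<le> D"
  shows "row_norm X \<le> D \<longleftrightarrow> (\<forall>h. (norm (\<Sum>i\<in>UNIV. blinfun_apply (X i) (h i)))\<^sup>2 \<le> D\<^sup>2 * (\<Sum>i\<in>UNIV. (norm (h i))\<^sup>2))"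
proof -
  have "op_bound {()} UNIV (\<lambda>_ i. X i) D \<longleftrightarrow> (\<forall>h. (norm (\<Sum>i\<in>UNIV. blinfun_apply (X i) (h i)))\<^sup>2 \<le> D\<^sup>2 * (\<Sum>i\<in>UNIV. (norm (h i))\<^sup>2))"
    by (simp add: op_bound_def)
  moreover have "row_norm X \<le> D \<longleftrightarrow> op_bound {()} UNIV (\<lambda>_ i. X i) D"
  proof
    assume "row_norm X \<le> D"
    then show "op_bound {()} UNIV (\<lambda>_ i. X i) D"
      by (intro op_bound_mono[OF opmat_norm_op_bound opmat_norm_nonneg]) (auto simp: row_norm_def)
  next
    assume "op_bound {()} UNIV (\<lambda>_ i. X i) D"
    then show "row_norm X \<le> D" unfolding row_norm_def by (rule opmat_norm_le[OF assms])
  qed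
  ultimately show ?thesis by simp
qed

lemma row_norm_nonneg: "0 \<le> row_norm X"
  unfolding row_norm_def by (rule opmat_norm_nonneg) auto

lemma row_normD:
  "row_norm X \<le> D \<Longrightarrow> (norm (\<Sum>i\<in>UNIV. blinfun_apply (X i) (h i)))\<^sup>2 \<le> D\<^sup>2 * (\<Sum>i\<in>UNIV. (norm (h i))\<^sup>2)"
  using row_norm_le_iff[of D X] row_norm_nonneg[of X] by simp

text \<open>The functional \<open>J\<close> is bounded below and attains its infimum: the
  parallelogram law makes a minimizing sequence Cauchy. At the minimizer \<open>g\<close> the first
  variation vanishes in every direction \<open>y\<close>, which is the representation.\<close>

lemma riesz_representation:
  fixes \<phi> :: "'a::{real_inner,complete_space} \<Rightarrow> real"
  assumes "bounded_linear \<phi>"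
  shows "\<exists>g. \<forall>x. \<phi> x = inner g x"
proof -
  interpret bounded_linear \<phi> by fact
  obtain B where B: "\<And>x. \<bar>\<phi> x\<bar> \<le> norm x * B" using bounded by auto
  define J where "J x = (norm x)\<^sup>2 - 2 * \<phi> x" for x
  define m where "m = Inf (range J)"
  have lower: "- B\<^sup>2 \<le> J x" for x
  proof -
    have "2 * \<phi> x \<le> 2 * (norm x * B)" using B[of x] by linarith
    moreover have "0 \<le> (norm x - B)\<^sup>2" by simp
    ultimately show ?thesis unfolding J_def by (simp add: power2_diff)
  qed
  have bdd: "bdd_below (range J)" using lower by (intro bdd_belowI2)
  have m: "m \<le> J x" for x unfolding m_def by (rule cINF_lower[OF bdd]) simp
  \<comment> \<open>Compares \<open>J x\<close> and \<open>J y\<close> with the value of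
    \<open>J\<close> at the midpoint, which is at least \<open>m\<close>.\<close>
  have par: "(norm (x - y))\<^sup>2 \<le> 2 * (J x - m) + 2 * (J y - m)" for x y
  proof -
    have "J ((1/2) *\<^sub>R (x + y)) = (norm (x + y))\<^sup>2 / 4 - \<phi> x - \<phi> y"
      by (simp add: J_def scaleR add power_divide add_divide_distrib)
    moreover have "(norm (x + y))\<^sup>2 + (norm (x - y))\<^sup>2 = 2 * (norm x)\<^sup>2 + 2 * (norm y)\<^sup>2"
      by (simp add: power2_norm_eq_inner inner_add inner_diff inner_commute)
    ultimately show ?thesis using m[of "(1/2) *\<^sub>R (x + y)"] by (simp add: J_def)
  qed
  have "\<exists>x. J x < m + 1 / (real n + 1)" for n
  proof (rule ccontr)
    assume "\<not> ?thesis"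
    then have "m + 1 / (real n + 1) \<le> m"
      unfolding m_def by (intro cINF_greatest) (auto simp: not_less m_def)
    then have "1 / (real n + 1) \<le> 0" by simp
    then show False by (simp add: divide_le_0_iff)
  qed
  then obtain x where x: "\<And>n. J (x n) < m + 1 / (real n + 1)" by metis
  have "Cauchy x"
  proof (rule CauchyI)
    fix e :: real assume e: "0 < e"
    obtain N where N: "4 / (real N + 1) < e\<^sup>2"
    proof -
      obtain N where "real N > 4 / e\<^sup>2" using reals_Archimedean2 by blast
      then have "4 < real N * e\<^sup>2" using e by (simp add: field_simps)
      then have "4 < (real N + 1) * e\<^sup>2" by (smt (verit) e mult_right_mono zero_less_power)
      then show ?thesis by (intro that[of N]) (simp add: field_simps)
    qed
    have le: "J (x n) - m \<le> 1 / (real N + 1)" if "n \<ge> N" for n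
    proof -
      have "1 / (real n + 1) \<le> 1 / (real N + 1)" using that by (intro divide_left_mono) auto
      then show ?thesis using x[of n] by simp
    qed
    show "\<exists>M. \<forall>m\<ge>M. \<forall>n\<ge>M. norm (x m - x n) < e"
    proof (intro exI allI impI)
      fix k n assume "k \<ge> N" "n \<ge> N"
      then have "(norm (x k - x n))\<^sup>2 \<le> 4 / (real N + 1)"
        using par[of "x k" "x n"] le[of k] le[of n] by simp
      then show "norm (x k - x n) < e" using N e by (meson le_less_trans less_imp_le power2_less_imp_less)
    qed
  qed
  then obtain g where g: "x \<longlonglongrightarrow> g" using Cauchy_convergent convergent_def by blast
  have "(\<lambda>n. J (x n)) \<longlonglongrightarrow> J g"
    unfolding J_def by (intro tendsto_intros g tendsto)
  moreover have "(\<lambda>n. m + 1 / (real n + 1)) \<longlonglongrightarrow> m + 0"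
    by (intro tendsto_intros) (use LIMSEQ_inverse_real_of_nat in \<open>simp add: divide_inverse add.commute\<close>)
  ultimately have Jg: "J g \<le> m"
    using LIMSEQ_le[of "\<lambda>n. J (x n)" "J g" "\<lambda>n. m + 1 / (real n + 1)" "m + 0"] x less_imp_le by auto
  show ?thesis
  proof (intro exI allI)
    fix y
    define d where "d = inner g y - \<phi> y"
    define N where "N = (norm y)\<^sup>2"
    have "0 \<le> 2 * t * d + t\<^sup>2 * N" for t
    proof -
      have "J (g + t *\<^sub>R y) = J g + 2 * t * d + t\<^sup>2 * N"
        unfolding J_def d_def N_def add scaleR power2_norm_eq_inner
        by (simp add: inner_add_left inner_add_right inner_commute[of y g] power2_eq_square algebra_simps)
      then show ?thesis using m[of "g + t *\<^sub>R y"] Jg by simp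
    qed
    \<comment> \<open>At this \<open>t\<close> the quadratic equals
      \<open>- d\<^sup>2 * (N + 2) / (N + 1)\<^sup>2\<close>; the denominator \<open>N + 1\<close>
      instead of the optimal \<open>N\<close> covers \<open>y = 0\<close>.\<close>
    from this[of "- d / (N + 1)"] have "0 \<le> (2 * (- d / (N + 1)) * d + (- d / (N + 1))\<^sup>2 * N) * (N + 1)\<^sup>2"
      by (intro mult_nonneg_nonneg) auto
    moreover have N0: "0 \<le> N" by (simp add: N_def)
    moreover have "(2 * (- d / (N + 1)) * d + (- d / (N + 1))\<^sup>2 * N) * (N + 1)\<^sup>2 = - (d\<^sup>2 * (N + 2))"
    proof -
      define M where "M = N + 1"
      have M: "M \<noteq> 0" "N = M - 1" using N0 by (auto simp: M_def)
      have "(2 * (- d / M) * d + (- d / M)\<^sup>2 * (M - 1)) * M\<^sup>2 = - (d\<^sup>2 * (M + 1))"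
        using M(1) by (simp add: power2_eq_square field_simps)
      then show ?thesis unfolding M_def by (simp only: add_diff_cancel_right' add.assoc one_add_one)
    qed
    ultimately have "d\<^sup>2 * (N + 2) \<le> 0" by simp
    then have "d = 0" using N0 by (simp add: mult_le_0_iff)
    then show "\<phi> y = inner g y" by (simp add: d_def)
  qed
qed

text \<open>The adjoint for the real inner product, whose existence comes from
  \<open>form_representation\<close>; for complex-linear \<open>T\<close> it is also the adjoint for
  \<open>cinner\<close>, see \<open>cinner_adj\<close>.\<close>

definition adj :: "('a::complex_hilbert_space \<Rightarrow>\<^sub>L 'b::complex_hilbert_space) \<Rightarrow> ('b \<Rightarrow>\<^sub>L 'a)" where
  "adj T = (SOME A. \<forall>x y. inner (blinfun_apply A y) x = inner y (blinfun_apply T x))"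

text \<open>Riesz representation in the first variable yields vectors \<open>g y\<close>. Their
  uniqueness transfers linearity in \<open>y\<close>, and testing with \<open>x = g y\<close> gives
  boundedness. Used for adjoints and for the form behind an equivalent norm.\<close>

lemma form_representation:
  fixes b :: "'a::complex_hilbert_space \<Rightarrow> 'b::complex_hilbert_space \<Rightarrow> real"
  assumes "\<And>y. linear (\<lambda>x. b x y)" "\<And>x. linear (b x)"
    and le: "\<And>x y. \<bar>b x y\<bar> \<le> K * norm x * norm y"
  shows "\<exists>A :: 'b \<Rightarrow>\<^sub>L 'a. \<forall>x y. inner (blinfun_apply A y) x = b x y"
proof -
  have "bounded_linear (\<lambda>x. b x y)" for y
  proof -
    interpret linear "\<lambda>x. b x y" by fact
    show ?thesis
      by (rule bounded_linear_intro[where K = "K * norm y"])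
        (use le[of _ y] in \<open>auto simp: add scaleR mult.assoc mult.left_commute mult.commute\<close>)
  qed
  then have "\<exists>g. \<forall>x. b x y = inner g x" for y by (rule riesz_representation)
  then obtain g where g: "\<And>x y. b x y = inner (g y) x" by metis
  have eqI: "u = v" if "\<And>x. inner u x = inner v x" for u v :: 'a
    using that[of "u - v"] by (metis inner_diff_left inner_eq_zero_iff right_minus_eq)
  have add: "g (y + z) = g y + g z" for y z
    by (rule eqI) (simp add: inner_add_left g[symmetric] linear_add[OF assms(2)])
  have scale: "g (r *\<^sub>R y) = r *\<^sub>R g y" for y r
    by (rule eqI) (simp add: g[symmetric] linear_cmul[OF assms(2)])
  have bound: "norm (g y) \<le> norm y * \<bar>K\<bar>" for y
  proof (cases "g y = 0")
    case False
    have "norm (g y) * norm (g y) \<le> norm (g y) * (norm y * K)"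
      using le[of "g y" y] by (simp add: g power2_norm_eq_inner[symmetric] power2_eq_square mult.commute mult.left_commute)
    then have "norm (g y) \<le> norm y * K" using False by simp
    also have "\<dots> \<le> norm y * \<bar>K\<bar>" by (intro mult_left_mono) auto
    finally show ?thesis .
  qed simp
  have "bounded_linear g" by (rule bounded_linear_intro[OF add scale bound])
  then show ?thesis
    by (intro exI[of _ "Blinfun g"]) (simp add: bounded_linear_Blinfun_apply g)
qed

lemma adj_inner: "inner (blinfun_apply (adj T) y) x = inner y (blinfun_apply T x)"
proof -
  have "\<exists>A. \<forall>x y. inner (blinfun_apply A y) x = inner y (blinfun_apply T x)"
  proof (rule form_representation)
    show "linear (\<lambda>x. inner y (blinfun_apply T x))" for y
      by (intro linearI) (auto simp: blinfun.add_right blinfun.scaleR_right inner_add_right)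
    show "linear (\<lambda>y. inner y (blinfun_apply T x))" for x
      by (intro linearI) (auto simp: inner_add_left)
    show "\<bar>inner y (blinfun_apply T x)\<bar> \<le> norm T * norm x * norm y" for x y
      using Cauchy_Schwarz_ineq2[of y "blinfun_apply T x"] mult_left_mono[OF norm_blinfun[of T x], of "norm y"]
      by (simp add: mult.commute mult.left_commute)
  qed
  from someI_ex[OF this] show ?thesis unfolding adj_def by blast
qed

lemma inner_adj: "inner x (blinfun_apply (adj T) y) = inner (blinfun_apply T x) y"
  by (metis adj_inner inner_commute)

lemma inner_eqI: "(\<And>z. inner x z = inner y z) \<Longrightarrow> x = (y::'a::real_inner)"
  by (metis inner_eq_zero_iff inner_diff_left right_minus_eq)

lemma adj_clinear:
  assumes "T \<in> bounded_clinear_ops"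
  shows "adj T \<in> bounded_clinear_ops"
  by (rule clinear_opI, rule inner_eqI) (simp add: adj_inner inner_scaleC_left clinear_opD[OF assms, symmetric])

text \<open>One-sided inverses of I - Y are the fixed points of V -> I + Y V and of U -> I + U Y,
  contractions with constant \<open>norm Y\<close>; a left and a right inverse coincide.\<close>

lemma invertible_perturbation:
  assumes "Y \<in> bounded_clinear_ops" "norm (Y :: 'a::complex_hilbert_space \<Rightarrow>\<^sub>L 'a) < 1"
  shows "\<exists>V \<in> bounded_clinear_ops. V o\<^sub>L (id_blinfun - Y) = id_blinfun \<and> (id_blinfun - Y) o\<^sub>L V = id_blinfun"
proof -
  have "\<exists>!V. V \<in> UNIV \<and> id_blinfun + (Y o\<^sub>L V) = V"
  proof (rule Banach_fix[where c = "norm Y"])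
    show "dist (id_blinfun + (Y o\<^sub>L U)) (id_blinfun + (Y o\<^sub>L V)) \<le> norm Y * dist U V" for U V
      using norm_blinfun_compose[of Y "U - V"] by (simp add: dist_norm blinfun_compose_diff_right)
  qed (use assms in auto)
  then obtain V where V: "id_blinfun + (Y o\<^sub>L V) = V" by auto
  have "\<exists>!U. U \<in> UNIV \<and> id_blinfun + (U o\<^sub>L Y) = U"
  proof (rule Banach_fix[where c = "norm Y"])
    show "dist (id_blinfun + (U o\<^sub>L Y)) (id_blinfun + (V o\<^sub>L Y)) \<le> norm Y * dist U V" for U V
      using norm_blinfun_compose[of "U - V" Y] by (simp add: dist_norm blinfun_compose_diff_left mult.commute)
  qed (use assms in auto)
  then obtain U where U: "id_blinfun + (U o\<^sub>L Y) = U" by auto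
  have 1: "(id_blinfun - Y) o\<^sub>L V = id_blinfun" using V by (simp add: blinfun_compose_diff_left algebra_simps)
  have 2: "U o\<^sub>L (id_blinfun - Y) = id_blinfun" using U by (simp add: blinfun_compose_diff_right algebra_simps)
  have "U = U o\<^sub>L ((id_blinfun - Y) o\<^sub>L V)" by (simp add: 1)
  also have "\<dots> = V" by (simp only: blinfun_compose_assoc[symmetric] 2 blinfun_compose_id)
  finally have UV: "U = V" .
  have "V \<in> bounded_clinear_ops"
  proof (rule clinear_opI)
    fix c x
    have inv: "blinfun_apply V (blinfun_apply (id_blinfun - Y) z) = z" "blinfun_apply (id_blinfun - Y) (blinfun_apply V z) = z" for z
      using 1 2 UV by (metis blinfun_apply_blinfun_compose blinfun_id_apply)+
    have lin: "id_blinfun - Y \<in> bounded_clinear_ops" using assms by blast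
    show "blinfun_apply V (c *\<^sub>C x) = c *\<^sub>C blinfun_apply V x"
      using clinear_opD[OF lin, of c "blinfun_apply V x"] inv by metis
  qed
  with 1 2 UV show ?thesis by blast
qed

text \<open>The square root of \<open>I - P\<close> is \<open>I - Y\<close> for the fixed point \<open>Y\<close> of \<open>Y \<mapsto> (P + Y\<^sup>2) / 2\<close>.\<close>

lemma selfadjoint_sqrt:
  fixes P :: "'a::complex_hilbert_space \<Rightarrow>\<^sub>L 'a"
  assumes clin: "P \<in> bounded_clinear_ops" and P: "norm P < 1"
    and self: "\<And>x y. inner (blinfun_apply P x) y = inner x (blinfun_apply P y)"
  shows "\<exists>Y \<in> bounded_clinear_ops. norm Y < 1 \<and>
    (\<forall>x y. inner (blinfun_apply Y x) y = inner x (blinfun_apply Y y)) \<and>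
    (id_blinfun - Y) o\<^sub>L (id_blinfun - Y) = id_blinfun - P"
proof -
  define z where "z = norm P"
  \<comment> \<open>Complex linearity and self-adjointness are closed conditions, so they are put
    into the complete set in which the fixed point is sought. The ball of radius
    \<open>z = norm P\<close> is invariant because (z + z^2)/2 <= z.\<close>
  define S where "S = {Y :: 'a \<Rightarrow>\<^sub>L 'a. norm Y \<le> z} \<inter> bounded_clinear_ops \<inter>
    (\<Inter>x. \<Inter>y. {Y. inner (blinfun_apply Y x) y = inner x (blinfun_apply Y y)})"
  define F where "F Y = (1/2) *\<^sub>R (P + (Y o\<^sub>L Y))" for Y
  have z: "0 \<le> z" "z < 1" using P by (auto simp: z_def)
  have "closed {Y :: 'a \<Rightarrow>\<^sub>L 'a. inner (blinfun_apply Y x) y = inner x (blinfun_apply Y y)}" for x y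
    by (intro closed_Collect_eq continuous_intros)
  then have "closed S" unfolding S_def
    by (intro closed_Int closed_INT closed_clinear_ops ballI closed_Collect_le continuous_intros) auto
  then have compl: "complete S" by (simp add: complete_eq_closed)
  have SD: "Y \<in> bounded_clinear_ops" "norm Y \<le> z" "inner (blinfun_apply Y x) y = inner x (blinfun_apply Y y)" if "Y \<in> S" for Y x y
    using that by (auto simp: S_def)
  have "\<exists>!Y. Y \<in> S \<and> F Y = Y"
  proof (rule Banach_fix[OF compl _ z])
    have "0 \<in> S" using z by (auto simp: S_def)
    then show "S \<noteq> {}" by blast
    show "F ` S \<subseteq> S"
    proof safe
      fix Y assume Y: "Y \<in> S"
      have "norm (P + (Y o\<^sub>L Y)) \<le> z + z * z"
        using norm_triangle_ineq[of P "Y o\<^sub>L Y"] norm_blinfun_compose[of Y Y] SD(2)[OF Y]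
          mult_mono[OF SD(2)[OF Y] SD(2)[OF Y]] z by (simp add: z_def)
      also have "\<dots> \<le> 2 * z" using z mult_left_le[of z z] by simp
      finally have "norm (F Y) \<le> z" by (simp add: F_def)
      then show "F Y \<in> S"
        using SD[OF Y] clin by (auto simp: S_def F_def blinfun.scaleR_left blinfun.add_left inner_add self)
    qed
    show "dist (F U) (F V) \<le> z * dist U V" if U: "U \<in> S" and V: "V \<in> S" for U V
    proof -
      \<comment> \<open>Operators need not commute, so the difference of squares is split in this
        order. Each half is at most \<open>z\<close> times the distance, and the factor 1/2 in
        \<open>F\<close> leaves the contraction constant \<open>z\<close>.\<close>
      have "(U o\<^sub>L U) - (V o\<^sub>L V) = (U o\<^sub>L (U - V)) + ((U - V) o\<^sub>L V)"
        by (simp add: blinfun_compose_diff_left blinfun_compose_diff_right)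
      then have "norm ((U o\<^sub>L U) - (V o\<^sub>L V)) \<le> norm U * norm (U - V) + norm (U - V) * norm V"
        by (metis norm_triangle_mono norm_blinfun_compose)
      also have "\<dots> \<le> z * norm (U - V) + norm (U - V) * z"
        using SD(2)[OF U] SD(2)[OF V] by (intro add_mono mult_right_mono mult_left_mono) auto
      finally have "norm ((U o\<^sub>L U) - (V o\<^sub>L V)) \<le> 2 * (z * norm (U - V))" by simp
      moreover have "F U - F V = (1/2) *\<^sub>R ((U o\<^sub>L U) - (V o\<^sub>L V))"
        by (simp add: F_def algebra_simps)
      ultimately show "dist (F U) (F V) \<le> z * dist U V" by (simp add: dist_norm)
    qed
  qed
  then obtain Y where Y: "Y \<in> S" "F Y = Y" by blast
  have "P + (Y o\<^sub>L Y) = 2 *\<^sub>R Y"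
    using arg_cong[OF Y(2), of "\<lambda>T. 2 *\<^sub>R T"] by (simp add: F_def)
  then have "(id_blinfun - Y) o\<^sub>L (id_blinfun - Y) = id_blinfun - P"
    by (simp add: blinfun_compose_diff_left blinfun_compose_diff_right algebra_simps scaleR_2)
  with SD[OF Y(1)] z show ?thesis by (intro bexI[of _ Y]) auto
qed

text \<open>The defect \<open>d\<close> of homogeneity is additive in \<open>t\<close>, vanishes at
  integers and is bounded on the unit interval, hence bounded everywhere; since \<open>d\<close> of
  n t is n times \<open>d t\<close>, boundedness forces it to be zero.\<close>

lemma additive_bounded_homogeneous:
  fixes b :: "'a::real_normed_vector \<Rightarrow> real"
  assumes add: "\<And>x y. b (x + y) = b x + b y" and bd: "\<And>x. norm x \<le> R \<Longrightarrow> \<bar>b x\<bar> \<le> M" and R: "norm x \<le> R"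
  shows "b (t *\<^sub>R x) = t * b x"
proof -
  define d where "d t = b (t *\<^sub>R x) - t * b x" for t
  have b0: "b 0 = 0" using add[of 0 0] by simp
  have bn: "b (- y) = - b y" for y using add[of y "- y"] b0 by simp
  have d_add: "d (s + t) = d s + d t" for s t
    by (simp add: d_def scaleR_left_distrib add algebra_simps)
  have d_nat: "d (real n * t) = real n * d t" for n t
    by (induction n) (auto simp: d_add algebra_simps, simp add: d_def b0)
  have d1: "d 1 = 0" by (simp add: d_def)
  have d_int: "d (of_int k) = 0" for k
  proof (cases "k \<ge> 0")
    case True
    then show ?thesis using d_nat[of "nat k" 1] d1 by simp
  next
    case False
    have "d (of_int k) = - d (real (nat (- k)))" using d_add[of "of_int k" "real (nat (- k))"] False
      by (simp add: d_def b0)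
    then show ?thesis using d_nat[of "nat (- k)" 1] d1 by simp
  qed
  have small: "\<bar>d t\<bar> \<le> M + \<bar>b x\<bar>" if "0 \<le> t" "t \<le> 1" for t
  proof -
    have "norm (t *\<^sub>R x) \<le> R" using that R mult_right_mono[of t 1 "norm x"] by simp
    then have "\<bar>b (t *\<^sub>R x)\<bar> \<le> M" by (rule bd)
    moreover have "\<bar>t * b x\<bar> \<le> \<bar>b x\<bar>" using that by (simp add: abs_mult mult_left_le_one_le)
    ultimately show ?thesis unfolding d_def by linarith
  qed
  have all: "\<bar>d t\<bar> \<le> M + \<bar>b x\<bar>" for t
  proof -
    have "d t = d (frac t)" using d_add[of "frac t" "of_int \<lfloor>t\<rfloor>"] d_int[of "\<lfloor>t\<rfloor>"] by (simp add: frac_def)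
    then show ?thesis using small[of "frac t"] by (simp add: frac_ge_0 frac_lt_1 less_imp_le)
  qed
  have "d t = 0"
  proof (rule ccontr)
    assume "d t \<noteq> 0"
    then obtain n where "M + \<bar>b x\<bar> < real n * \<bar>d t\<bar>"
      using reals_Archimedean3[of "\<bar>d t\<bar>"] by auto
    then show False using all[of "real n * t"] by (simp add: d_nat abs_mult)
  qed
  then show ?thesis by (simp add: d_def)
qed

text \<open>The Jordan--von Neumann argument, followed by a square root of the operator that represents the form.\<close>

lemma equivalent_hilbert_norm:
  fixes Q :: "'a::complex_hilbert_space \<Rightarrow> real"
  assumes par: "\<And>x y. Q (x + y) + Q (x - y) = 2 * Q x + 2 * Q y"
    and hom: "\<And>c x. Q (c *\<^sub>C x) = (cmod c)\<^sup>2 * Q x"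
    and lower: "\<And>x. (norm x)\<^sup>2 \<le> Q x" and upper: "\<And>x. Q x \<le> C\<^sup>2 * (norm x)\<^sup>2"
  shows "\<exists>X \<in> bounded_clinear_ops. \<exists>X' \<in> bounded_clinear_ops.
    X' o\<^sub>L X = (id_blinfun :: 'a \<Rightarrow>\<^sub>L 'a) \<and> X o\<^sub>L X' = (id_blinfun :: 'a \<Rightarrow>\<^sub>L 'a) \<and>
    (\<forall>x. (norm (blinfun_apply X x))\<^sup>2 = Q x)"
proof -
  define b where "b x y = (Q (x + y) - Q x - Q y) / 2" for x y
  have Q0: "Q 0 = 0" using upper[of 0] lower[of 0] by simp
  have homR: "Q (r *\<^sub>R x) = r\<^sup>2 * Q x" for r x using hom[of "complex_of_real r" x] by (simp add: scaleR_scaleC)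
  have Qm: "Q (- x) = Q x" for x using homR[of "-1" x] by simp
  have Qnn: "0 \<le> Q x" for x using lower[of x] by (rule order_trans[rotated]) simp
  \<comment> \<open>Four instances of the parallelogram law eliminate the mixed differences; what
    remains is additivity of the polar form \<open>b\<close>.\<close>
  have three: "Q (x + y + z) = Q (x + y) + Q (y + z) + Q (x + z) - Q x - Q y - Q z" for x y z
    using par[of "x + y" z] par[of x "y - z"] par[of "x + z" y] par[of y z] by (simp add: algebra_simps)
  have sym: "b x y = b y x" for x y by (simp add: b_def add.commute)
  have add1: "b (x + z) y = b x y + b z y" for x y z
    unfolding b_def using three[of x z y] by (simp add: field_simps)
  have self: "b x x = Q x" for x
    using homR[of 2 x] by (simp add: b_def scaleR_2)
  have bbd: "\<bar>b x y\<bar> \<le> (Q x + Q y) / 2" for x y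
  proof -
    have "b 0 y = 0" by (simp add: b_def Q0)
    then have "b (- x) y = - b x y" using add1[of x "- x" y] by simp
    moreover have "b (- x) y = (Q (y - x) - Q x - Q y) / 2" by (simp add: b_def Qm add.commute)
    ultimately have "b x y = - (Q (y - x) - Q x - Q y) / 2" by simp
    moreover have "b x y = (Q (x + y) - Q x - Q y) / 2" by (simp add: b_def)
    ultimately show ?thesis using Qnn[of "x + y"] Qnn[of "y - x"] by (simp add: field_simps abs_le_iff)
  qed
  have scale1: "b (t *\<^sub>R x) y = t * b x y" for t x y
  proof (rule additive_bounded_homogeneous[where b = "\<lambda>x. b x y" and R = "norm x" and M = "(C\<^sup>2 * (norm x)\<^sup>2 + Q y) / 2"])
    fix z :: 'a assume "norm z \<le> norm x"
    then have "C\<^sup>2 * (norm z)\<^sup>2 \<le> C\<^sup>2 * (norm x)\<^sup>2" by (intro mult_left_mono power_mono) auto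
    then show "\<bar>b z y\<bar> \<le> (C\<^sup>2 * (norm x)\<^sup>2 + Q y) / 2" using bbd[of z y] upper[of z] by simp
  qed (auto simp: add1)
  have lin1: "linear (\<lambda>x. b x y)" for y by (rule linearI) (auto simp: add1 scale1)
  have lin2: "linear (b x)" for x
  proof (rule linearI)
    show "b x (y + z) = b x y + b x z" for y z by (simp only: sym[of x] add1)
    show "b x (r *\<^sub>R y) = r *\<^sub>R b x y" for r y by (simp only: sym[of x] scale1 real_scaleR_def)
  qed
  have le: "\<bar>b x y\<bar> \<le> C\<^sup>2 * norm x * norm y" for x y
  proof (cases "x = 0 \<or> y = 0")
    case True
    then show ?thesis by (auto simp: b_def Q0)
  next
    case False
    define u where "u = (1 / norm x) *\<^sub>R x"
    define v where "v = (1 / norm y) *\<^sub>R y"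
    have xu: "x = norm x *\<^sub>R u" "y = norm y *\<^sub>R v" "norm u = 1" "norm v = 1"
      using False by (auto simp: u_def v_def)
    have "\<bar>b u v\<bar> \<le> C\<^sup>2"
      using bbd[of u v] upper[of u] upper[of v] xu by simp
    have "b x y = norm x * (norm y * b u v)"
      using scale1[of "norm x" u "norm y *\<^sub>R v"] scale1[of "norm y" v u] xu(1,2) sym[of u] by simp
    then have "\<bar>b x y\<bar> = (norm x * norm y) * \<bar>b u v\<bar>" by (simp add: abs_mult)
    also have "\<dots> \<le> (norm x * norm y) * C\<^sup>2" using \<open>\<bar>b u v\<bar> \<le> C\<^sup>2\<close> by (intro mult_left_mono) auto
    finally show ?thesis by (simp add: mult.commute mult.left_commute)
  qed
  obtain G where G: "\<And>x y. inner (blinfun_apply G y) x = b x y"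
    using form_representation[OF lin1 lin2 le] by blast
  \<comment> \<open>\<open>Q\<close> is invariant under multiplication by \<i>, hence so is
    \<open>b\<close>; this makes the representing operator commute with \<i>.\<close>
  have Gi: "blinfun_apply G (\<i> *\<^sub>C y) = \<i> *\<^sub>C blinfun_apply G y" for y
  proof (rule inner_eqI)
    fix x
    have bi: "b (\<i> *\<^sub>C x) (\<i> *\<^sub>C y) = b x y" for x y
      by (simp add: b_def scaleC_add_right[symmetric] hom)
    have "b (\<i> *\<^sub>C x) (\<i> *\<^sub>C (\<i> *\<^sub>C y)) = b x (\<i> *\<^sub>C y)" by (rule bi)
    moreover have "\<i> *\<^sub>C (\<i> *\<^sub>C y) = (-1) *\<^sub>R y" by (simp add: scaleC_scaleC scaleR_scaleC)
    ultimately have "b x (\<i> *\<^sub>C y) = - b (\<i> *\<^sub>C x) y" using scale1[of "-1" y "\<i> *\<^sub>C x"] by (simp add: sym)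
    moreover have "inner (\<i> *\<^sub>C blinfun_apply G y) x = inner (blinfun_apply G y) (- (\<i> *\<^sub>C x))"
      by (simp add: inner_scaleC_left scaleC_minus_left[symmetric])
    ultimately show "inner (blinfun_apply G (\<i> *\<^sub>C y)) x = inner (\<i> *\<^sub>C blinfun_apply G y) x"
      by (simp add: G)
  qed
  have Gclin: "G \<in> bounded_clinear_ops" by (rule clinear_op_iffI) (rule Gi)
  show ?thesis
  \<comment> \<open>On the zero space nothing forces \<open>C\<^sup>2\<close> to be at least 1, on
    which the choice of \<open>s\<close> below depends.\<close>
  proof (cases "\<forall>x::'a. x = 0")
    case True
    then have "(norm (blinfun_apply id_blinfun x))\<^sup>2 = Q x" for x using Q0 by (metis blinfun_id_apply norm_zero zero_power2)
    then show ?thesis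
      by (auto intro!: bexI[of _ "id_blinfun :: 'a \<Rightarrow>\<^sub>L 'a"])
  next
    case False
    then obtain x0 :: 'a where "x0 \<noteq> 0" by blast
    then have C1: "1 \<le> C\<^sup>2" using order_trans[OF lower[of x0] upper[of x0]] by simp
    \<comment> \<open>From |x|^2 <= Q x and |G x| <= C^2 |x| one gets |x - s G x|^2 <= (1 - 2 s +
      s^2 C^4) |x|^2, and s = 1/C^4 minimizes the factor, to 1 - s. So s G = (I - Y)^2 for a strict
      contraction Y, and X will be (I - Y)/sqrt s.\<close>
    define s where "s = 1 / (C\<^sup>2)\<^sup>2"
    have s: "0 < s" "s \<le> 1" "s * (C\<^sup>2)\<^sup>2 = 1"
    proof -
      define K where "K = (C\<^sup>2)\<^sup>2"
      have "1 \<le> K" using one_le_power[OF C1, of 2] by (simp add: K_def)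
      then show "0 < s" "s \<le> 1" "s * (C\<^sup>2)\<^sup>2 = 1" unfolding s_def K_def[symmetric] by auto
    qed
    define P where "P = id_blinfun - s *\<^sub>R G"
    have normG: "norm (blinfun_apply G x) \<le> C\<^sup>2 * norm x" for x
    proof (cases "blinfun_apply G x = 0")
      case False
      have "norm (blinfun_apply G x) * norm (blinfun_apply G x) \<le> norm (blinfun_apply G x) * (C\<^sup>2 * norm x)"
        using le[of "blinfun_apply G x" x]
        by (simp add: G[symmetric] power2_norm_eq_inner[symmetric] power2_eq_square[of "norm (blinfun_apply G x)"] mult.commute mult.left_commute)
      then show ?thesis using False by simp
    qed simp
    have normP: "norm P \<le> sqrt (1 - s)"
    proof (rule norm_blinfun_bound)
      fix x
      have "(norm (x - s *\<^sub>R blinfun_apply G x))\<^sup>2 = (norm x)\<^sup>2 - 2 * s * inner (blinfun_apply G x) x + s\<^sup>2 * (norm (blinfun_apply G x))\<^sup>2"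
        using dot_norm_neg[of "s *\<^sub>R blinfun_apply G x" x]
        by (simp add: norm_minus_commute[of x] power_mult_distrib)
      also have "\<dots> \<le> (norm x)\<^sup>2 - 2 * s * (norm x)\<^sup>2 + s\<^sup>2 * (C\<^sup>2 * norm x)\<^sup>2"
      proof -
        have "2 * s * (norm x)\<^sup>2 \<le> 2 * s * Q x" using s lower[of x] by (intro mult_left_mono) auto
        moreover have "s\<^sup>2 * (norm (blinfun_apply G x))\<^sup>2 \<le> s\<^sup>2 * (C\<^sup>2 * norm x)\<^sup>2"
          using normG[of x] by (intro mult_left_mono power_mono) auto
        moreover have "inner (blinfun_apply G x) x = Q x" by (simp add: G self)
        ultimately show ?thesis by (simp add: mult.assoc)
      qed
      also have "s\<^sup>2 * (C\<^sup>2 * norm x)\<^sup>2 = s * (s * (C\<^sup>2)\<^sup>2) * (norm x)\<^sup>2"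
        by (simp only: power_mult_distrib power2_eq_square mult_ac)
      also have "\<dots> = s * (norm x)\<^sup>2" unfolding s(3) by simp
      also have "(norm x)\<^sup>2 - 2 * s * (norm x)\<^sup>2 + s * (norm x)\<^sup>2 = (1 - s) * (norm x)\<^sup>2"
        by (simp add: left_diff_distrib)
      also have "\<dots> = (sqrt (1 - s) * norm x)\<^sup>2" using s by (simp add: power_mult_distrib)
      finally have "norm (x - s *\<^sub>R blinfun_apply G x) \<le> sqrt (1 - s) * norm x"
        by (rule power2_le_imp_le) (use s in simp)
      then show "norm (blinfun_apply P x) \<le> sqrt (1 - s) * norm x"
        by (simp add: P_def blinfun.diff_left blinfun.scaleR_left)
    qed (use s in auto)
    have "sqrt (1 - s) < 1" using s by simp
    with normP have P1: "norm P < 1" by linarith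
    have Pclin: "P \<in> bounded_clinear_ops" unfolding P_def by (intro clinear_diff clinear_scaleR Gclin clinear_id)
    have Gself: "inner (blinfun_apply G x) y = inner x (blinfun_apply G y)" for x y
      by (simp add: G sym inner_commute[of x])
    obtain Y where Y: "Y \<in> bounded_clinear_ops" "norm Y < 1"
      "\<And>x y. inner (blinfun_apply Y x) y = inner x (blinfun_apply Y y)"
      "(id_blinfun - Y) o\<^sub>L (id_blinfun - Y) = id_blinfun - P"
      using selfadjoint_sqrt[OF Pclin P1] Gself
      by (auto simp: P_def blinfun.diff_left blinfun.scaleR_left inner_diff_left inner_diff_right)
    obtain V where V: "V \<in> bounded_clinear_ops" "V o\<^sub>L (id_blinfun - Y) = id_blinfun" "(id_blinfun - Y) o\<^sub>L V = id_blinfun"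
      using invertible_perturbation[OF Y(1,2)] by blast
    define w where "w = sqrt s"
    have w: "w > 0" "w\<^sup>2 = s" using s by (auto simp: w_def)
    define X where "X = (1 / w) *\<^sub>R (id_blinfun - Y)"
    define X' where "X' = w *\<^sub>R V"
    have XX: "X' o\<^sub>L X = id_blinfun" "X o\<^sub>L X' = id_blinfun"
      using V(2,3) w by (auto simp: X_def X'_def bounded_bilinear.scaleR_left[OF bounded_bilinear_blinfun_compose]
          bounded_bilinear.scaleR_right[OF bounded_bilinear_blinfun_compose])
    have "(norm (blinfun_apply X x))\<^sup>2 = Q x" for x
    proof -
      define R where "R = id_blinfun - Y"
      have R: "inner (blinfun_apply R x) y = inner x (blinfun_apply R y)" for x y
        by (simp add: R_def blinfun.diff_left inner_diff_left inner_diff_right Y(3))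
      have "blinfun_apply R (blinfun_apply R x) = s *\<^sub>R blinfun_apply G x"
        using arg_cong[OF Y(4), of "\<lambda>T. blinfun_apply T x"]
        by (simp add: R_def P_def blinfun.scaleR_left)
      then have "(norm (blinfun_apply R x))\<^sup>2 = s * Q x"
        unfolding power2_norm_eq_inner R by (simp add: inner_commute[of x] G self)
      moreover have "(norm (blinfun_apply X x))\<^sup>2 = (norm (blinfun_apply R x))\<^sup>2 / w\<^sup>2"
        using w by (simp add: X_def R_def blinfun.scaleR_left power_divide)
      ultimately show ?thesis using w s by simp
    qed
    moreover have "X \<in> bounded_clinear_ops" "X' \<in> bounded_clinear_ops"
      unfolding X_def X'_def using V(1) Y(1) by auto
    ultimately show ?thesis using XX by blast
  qed
qed

section \<open>The Hahn--Banach theorem for sublinear functionals\<close>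

text \<open>Completes the pointwise structure of \<open>Function_Algebras\<close> to a real vector
  space: the Hahn--Banach theorem is applied to functions of test maps, and weights are scaled as
  vectors.\<close>

instantiation "fun" :: (type, real_vector) real_vector
begin

definition scaleR_fun :: "real \<Rightarrow> ('a \<Rightarrow> 'b) \<Rightarrow> 'a \<Rightarrow> 'b" where
  "scaleR_fun r f = (\<lambda>x. r *\<^sub>R f x)"

instance
  by standard (auto simp: scaleR_fun_def fun_eq_iff scaleR_add_right scaleR_add_left)

end

text \<open>Shared by three infima: along a chain, in the variation of a minimal functional, and
  over \<open>majorants\<close>. \<open>cInf_scale_le\<close> is its companion in the same three
  places.\<close>

lemma cInf_add_le:
  fixes S S' T :: "real set"
  assumes "S \<noteq> {}" "S' \<noteq> {}" "bdd_below T" "\<And>v v'. v \<in> S \<Longrightarrow> v' \<in> S' \<Longrightarrow> \<exists>s\<in>T. s \<le> v + v'"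
  shows "Inf T \<le> Inf S + Inf S'"
proof -
  have "Inf T - v' \<le> Inf S" if v': "v' \<in> S'" for v'
  proof (rule cInf_greatest[OF assms(1)])
    fix v assume "v \<in> S"
    then obtain s where "s \<in> T" "s \<le> v + v'" using assms(4) v' by blast
    then show "Inf T - v' \<le> v" using cInf_lower[OF _ assms(3), of s] by simp
  qed
  then have "Inf T - Inf S \<le> Inf S'" by (intro cInf_greatest[OF assms(2)]) (simp add: algebra_simps)
  then show ?thesis by simp
qed

lemma cInf_scale_le:
  fixes S T :: "real set"
  assumes "S \<noteq> {}" "bdd_below T" "t > 0" "\<And>v. v \<in> S \<Longrightarrow> \<exists>s\<in>T. s \<le> t * v"
  shows "Inf T \<le> t * Inf S"
proof -
  have "Inf T / t \<le> Inf S"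
  proof (rule cInf_greatest[OF assms(1)])
    fix v assume "v \<in> S"
    then obtain s where "s \<in> T" "s \<le> t * v" using assms(4) by blast
    then show "Inf T / t \<le> v" using cInf_lower[OF _ assms(2), of s] assms(3) by (simp add: field_simps)
  qed
  then show ?thesis using assms(3) by (simp add: field_simps)
qed

text \<open>An inequality for \<open>t > 0\<close> is all that is demanded of scaling;
  \<open>sublinear_on_scale\<close> recovers equality by applying it to
  \<open>1 / t\<close>.\<close>

definition sublinear_on :: "'v::real_vector set \<Rightarrow> ('v \<Rightarrow> real) \<Rightarrow> bool" where
  "sublinear_on V p \<longleftrightarrow> (\<forall>x\<in>V. \<forall>y\<in>V. p (x + y) \<le> p x + p y) \<and> (\<forall>x\<in>V. \<forall>t>0. p (t *\<^sub>R x) \<le> t * p x)"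

lemma sublinear_on_scale:
  assumes "subspace V" "sublinear_on V p" "x \<in> V" "t > 0"
  shows "p (t *\<^sub>R x) = t * p x"
proof -
  have "p ((1/t) *\<^sub>R t *\<^sub>R x) \<le> (1/t) * p (t *\<^sub>R x)"
    using assms subspace_scale[OF assms(1,3), of t] unfolding sublinear_on_def by (meson divide_pos_pos zero_less_one)
  then have "t * p x \<le> p (t *\<^sub>R x)" using assms(4) by (simp add: field_simps)
  moreover have "p (t *\<^sub>R x) \<le> t * p x" using assms by (auto simp: sublinear_on_def)
  ultimately show ?thesis by simp
qed

lemma sublinear_on_zero:
  assumes "subspace V" "sublinear_on V p"
  shows "p 0 = 0"
  using sublinear_on_scale[OF assms subspace_0[OF assms(1)], of 2] by simp

lemma sublinear_on_minus:
  assumes "subspace V" "sublinear_on V p" "x \<in> V"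
  shows "- p (- x) \<le> p x"
proof -
  have "p (x + (- x)) \<le> p x + p (- x)"
    using assms(2,3) subspace_neg[OF assms(1,3)] unfolding sublinear_on_def by blast
  then show ?thesis using sublinear_on_zero[OF assms(1,2)] by simp
qed

text \<open>A minimal sublinear functional is linear: minimality forces \<open>q x = inf\<^sub>t (q (x + t y) - t q y)\<close>.\<close>

lemma hahn_banach_subspace:
  fixes V :: "'v::real_vector set"
  assumes V: "subspace V" and p: "sublinear_on V p"
  shows "\<exists>L. (\<forall>x\<in>V. L x \<le> p x) \<and> (\<forall>x\<in>V. \<forall>y\<in>V. L (x + y) = L x + L y) \<and> (\<forall>x\<in>V. \<forall>t. L (t *\<^sub>R x) = t * L x)"
proof -
  define A where "A = {q. sublinear_on V q \<and> (\<forall>x\<in>V. q x \<le> p x) \<and> (\<forall>x. x \<notin> V \<longrightarrow> q x = 0)}"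
  \<comment> \<open>The order is reversed: Zorn's lemma yields maximal elements, and a minimal
    functional is wanted. Elements of \<open>A\<close> vanish off \<open>V\<close>, so comparison at
    all vectors amounts to comparison on \<open>V\<close>.\<close>
  define R :: "('v \<Rightarrow> real) \<Rightarrow> ('v \<Rightarrow> real) \<Rightarrow> bool" where "R q q' \<longleftrightarrow> (\<forall>x. q' x \<le> q x)" for q q'
  note add = subspace_add[OF V] and scale = subspace_scale[OF V]
  have AD: "sublinear_on V q" "x \<in> V \<Longrightarrow> q x \<le> p x" "x \<notin> V \<Longrightarrow> q x = 0" if "q \<in> A" for q x
    using that by (auto simp: A_def)
  have lower: "- p (- x) \<le> q x" if "q \<in> A" "x \<in> V" for q x
    using sublinear_on_minus[OF V AD(1)[OF that(1)] that(2)] AD(2)[OF that(1) subspace_neg[OF V that(2)]] by simp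
  have "\<exists>m\<in>A. \<forall>a\<in>A. R m a \<longrightarrow> a = m"
  proof (rule predicate_Zorn)
    show "partial_order_on A (relation_of R A)"
      by (rule partial_order_on_relation_ofI) (auto simp: R_def fun_eq_iff intro: order_trans order_antisym)
  next
    fix Ch assume "Ch \<in> Chains (relation_of R A)"
    then have ChA: "Ch \<subseteq> A" and total: "\<And>q q'. q \<in> Ch \<Longrightarrow> q' \<in> Ch \<Longrightarrow> R q q' \<or> R q' q"
      by (auto simp: Chains_def relation_of_def)
    show "\<exists>u\<in>A. \<forall>a\<in>Ch. R a u"
    proof (cases "Ch = {}")
      case True
      have "(\<lambda>x. if x \<in> V then p x else 0) \<in> A"
        using p by (auto simp: A_def sublinear_on_def add scale)
      then show ?thesis using True by blast
    next
      case False
      define u where "u x = (if x \<in> V then Inf ((\<lambda>q. q x) ` Ch) else 0)" for x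
      have bdd: "bdd_below ((\<lambda>q. q x) ` Ch)" if "x \<in> V" for x
        using lower[OF _ that] ChA by (intro bdd_belowI2[of _ "- p (- x)"]) auto
      have le: "u x \<le> q x" if "q \<in> Ch" for q x
        using cINF_lower[OF bdd that] AD(3)[of q x] ChA that by (auto simp: u_def)
      have "u \<in> A"
        unfolding A_def sublinear_on_def
      proof (intro CollectI conjI ballI allI impI)
        fix x y assume x: "x \<in> V" and y: "y \<in> V"
        have "Inf ((\<lambda>q. q (x + y)) ` Ch) \<le> Inf ((\<lambda>q. q x) ` Ch) + Inf ((\<lambda>q. q y) ` Ch)"
        proof (rule cInf_add_le)
          fix v v' assume "v \<in> (\<lambda>q. q x) ` Ch" "v' \<in> (\<lambda>q. q y) ` Ch"
          then obtain q q' where q: "q \<in> Ch" "q' \<in> Ch" "v = q x" "v' = q' y" by blast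
          \<comment> \<open>Of two members of the chain the smaller one serves both points.\<close>
          from total[OF q(1,2)] obtain r where r: "r \<in> Ch" "r x \<le> q x" "r y \<le> q' y"
            using q(1,2) unfolding R_def by blast
          have "r (x + y) \<le> r x + r y" using AD(1)[of r] r ChA x y by (auto simp: sublinear_on_def)
          then show "\<exists>s\<in>(\<lambda>q. q (x + y)) ` Ch. s \<le> v + v'"
            using r q by (intro bexI[of _ "r (x + y)"]) auto
        qed (use False bdd add x y in auto)
        then show "u (x + y) \<le> u x + u y" using x y add by (simp add: u_def)
      next
        fix x and t :: real assume x: "x \<in> V" and t: "t > 0"
        have "Inf ((\<lambda>q. q (t *\<^sub>R x)) ` Ch) \<le> t * Inf ((\<lambda>q. q x) ` Ch)"
        proof (rule cInf_scale_le[OF _ _ t])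
          fix v assume "v \<in> (\<lambda>q. q x) ` Ch"
          then obtain q where q: "q \<in> Ch" "v = q x" by blast
          then have "q (t *\<^sub>R x) \<le> t * q x" using AD(1)[of q] ChA x t by (auto simp: sublinear_on_def)
          then show "\<exists>s\<in>(\<lambda>q. q (t *\<^sub>R x)) ` Ch. s \<le> t * v" using q by blast
        qed (use False bdd scale x in auto)
        then show "u (t *\<^sub>R x) \<le> t * u x" using x scale by (simp add: u_def)
      next
        fix x assume "x \<in> V"
        obtain q where "q \<in> Ch" using False by blast
        then show "u x \<le> p x" using le[of q x] AD(2)[of q x] ChA \<open>x \<in> V\<close> by force
      qed (simp add: u_def)
      then show ?thesis using le by (auto simp: R_def)
    qed
  qed
  then obtain m where m: "m \<in> A" and min: "\<And>a. a \<in> A \<Longrightarrow> (\<And>x. a x \<le> m x) \<Longrightarrow> a = m"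
    unfolding R_def by blast
  note sm = AD(1)[OF m]
  have sub: "m (x + y) \<le> m x + m y" if "x \<in> V" "y \<in> V" for x y
    using sm that by (auto simp: sublinear_on_def)
  have hom: "m (t *\<^sub>R x) = t * m x" if "x \<in> V" "t \<ge> 0" for t x
    using sublinear_on_scale[OF V sm that(1), of t] sublinear_on_zero[OF V sm] that(2) by (cases "t = 0") auto
  have "m (x + y) = m x + m y" if x: "x \<in> V" and y: "y \<in> V" for x y
  proof -
    define S where "S x = (\<lambda>t. m (x + t *\<^sub>R y) - t * m y) ` {0..}" for x
    define a where "a x = (if x \<in> V then Inf (S x) else 0)" for x
    have bdd: "bdd_below (S x)" if "x \<in> V" for x
      unfolding S_def
    proof (rule bdd_belowI2)
      fix t :: real assume "t \<in> {0..}"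
      then have "t * m y = m ((x + t *\<^sub>R y) + (- x))" using hom[OF y, of t] by simp
      also have "\<dots> \<le> m (x + t *\<^sub>R y) + m (- x)"
        using that y by (intro sub add scale subspace_neg[OF V])
      finally show "- m (- x) \<le> m (x + t *\<^sub>R y) - t * m y" by simp
    qed
    have mem: "m (x + t *\<^sub>R y) - t * m y \<in> S x" if "t \<ge> 0" for x t
      using that by (auto simp: S_def)
    have ne: "S x \<noteq> {}" for x using mem[of 0] by auto
    have le: "a x \<le> m x" for x
      using cInf_lower[OF mem[of 0 x] bdd] AD(3)[OF m, of x] by (auto simp: a_def)
    have "a \<in> A"
      unfolding A_def sublinear_on_def
    proof (intro CollectI conjI ballI allI impI)
      fix x z assume x: "x \<in> V" and z: "z \<in> V"
      have "Inf (S (x + z)) \<le> Inf (S x) + Inf (S z)"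
      proof (rule cInf_add_le[OF ne ne bdd[OF add[OF x z]]])
        fix v v' assume "v \<in> S x" "v' \<in> S z"
        then obtain s t where st: "0 \<le> s" "0 \<le> t" "v = m (x + s *\<^sub>R y) - s * m y" "v' = m (z + t *\<^sub>R y) - t * m y"
          by (auto simp: S_def)
        have "m ((x + z) + (s + t) *\<^sub>R y) = m ((x + s *\<^sub>R y) + (z + t *\<^sub>R y))"
          by (simp add: scaleR_left_distrib algebra_simps)
        also have "\<dots> \<le> m (x + s *\<^sub>R y) + m (z + t *\<^sub>R y)" using x z y by (intro sub add scale)
        finally have "m ((x + z) + (s + t) *\<^sub>R y) - (s + t) * m y \<le> v + v'"
          using st by (simp add: algebra_simps)
        then show "\<exists>s\<in>S (x + z). s \<le> v + v'" using mem[of "s + t"] st by (meson add_nonneg_nonneg)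
      qed
      then show "a (x + z) \<le> a x + a z" using x z add by (simp add: a_def)
    next
      fix x and r :: real assume x: "x \<in> V" and r: "r > 0"
      have "Inf (S (r *\<^sub>R x)) \<le> r * Inf (S x)"
      proof (rule cInf_scale_le[OF ne bdd[OF scale[OF x]] r])
        fix v assume "v \<in> S x"
        then obtain t where t: "0 \<le> t" "v = m (x + t *\<^sub>R y) - t * m y" by (auto simp: S_def)
        have "m (r *\<^sub>R x + (r * t) *\<^sub>R y) = r * m (x + t *\<^sub>R y)"
          using hom[of "x + t *\<^sub>R y" r] r x y add scale by (simp add: scaleR_right_distrib)
        then have "m (r *\<^sub>R x + (r * t) *\<^sub>R y) - (r * t) * m y \<le> r * v"
          unfolding t(2) by (simp add: algebra_simps)
        then show "\<exists>s\<in>S (r *\<^sub>R x). s \<le> r * v" using mem[of "r * t"] t r by (meson mult_nonneg_nonneg less_imp_le)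
      qed
      then show "a (r *\<^sub>R x) \<le> r * a x" using x scale by (simp add: a_def)
    next
      fix x assume "x \<in> V"
      then show "a x \<le> p x" using le[of x] AD(2)[OF m, of x] by simp
    qed (simp add: a_def)
    then have "a = m" using le by (rule min)
    \<comment> \<open>The parameter 1 in the infimum that defines \<open>a = m\<close> gives
      superadditivity of \<open>m\<close>.\<close>
    then have "m x \<le> m (x + 1 *\<^sub>R y) - 1 * m y"
      using cInf_lower[OF mem[of 1 x] bdd[OF x]] x by (metis a_def zero_le_one)
    then show ?thesis using sub[OF x y] by simp
  qed
  note madd = this
  have "m (t *\<^sub>R x) = t * m x" if x: "x \<in> V" for x t
  proof (cases "t \<ge> 0")
    case False
    have "m (t *\<^sub>R x) + m ((- t) *\<^sub>R x) = m (t *\<^sub>R x + (- t) *\<^sub>R x)"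
      by (rule madd[symmetric]) (intro scale x)+
    also have "\<dots> = 0" using sublinear_on_zero[OF V sm] by (simp add: scaleR_left_distrib[symmetric])
    finally show ?thesis using hom[OF x, of "- t"] False by simp
  qed (rule hom[OF x])
  with madd AD(2)[OF m] show ?thesis by blast
qed

section \<open>Similarity of completely bounded homomorphisms\<close>

text \<open>\<open>P\<close> is a unital algebra that need not be closed. Complete boundedness is
  phrased with arbitrary bounds \<open>D\<close> of \<open>op_bound\<close>, so that no operator
  norm has to be computed when it is applied.\<close>

locale cb_homomorphism =
  fixes P :: "('k::complex_hilbert_space \<Rightarrow>\<^sub>L 'k) set"
    and \<Phi> :: "('k \<Rightarrow>\<^sub>L 'k) \<Rightarrow> ('h::complex_hilbert_space \<Rightarrow>\<^sub>L 'h)"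
    and C :: real
  assumes P_clinear: "b \<in> P \<Longrightarrow> b \<in> bounded_clinear_ops"
    and P_id: "id_blinfun \<in> P"
    and P_add: "b \<in> P \<Longrightarrow> b' \<in> P \<Longrightarrow> b + b' \<in> P"
    and P_scale: "b \<in> P \<Longrightarrow> scaleC_op c b \<in> P"
    and P_mult: "b \<in> P \<Longrightarrow> b' \<in> P \<Longrightarrow> b o\<^sub>L b' \<in> P"
    and \<Phi>_clinear: "b \<in> P \<Longrightarrow> \<Phi> b \<in> bounded_clinear_ops"
    and \<Phi>_id: "\<Phi> id_blinfun = id_blinfun"
    and \<Phi>_add: "b \<in> P \<Longrightarrow> b' \<in> P \<Longrightarrow> \<Phi> (b + b') = \<Phi> b + \<Phi> b'"
    and \<Phi>_scale: "b \<in> P \<Longrightarrow> \<Phi> (scaleC_op c b) = scaleC_op c (\<Phi> b)"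
    and \<Phi>_mult: "b \<in> P \<Longrightarrow> b' \<in> P \<Longrightarrow> \<Phi> (b o\<^sub>L b') = \<Phi> b o\<^sub>L \<Phi> b'"
    and C_nonneg: "0 \<le> C"
    and \<Phi>_cb: "\<And>(k::nat) T D. (\<And>i j. i < k \<Longrightarrow> j < k \<Longrightarrow> T i j \<in> P) \<Longrightarrow> 0 \<le> D \<Longrightarrow>
      op_bound {..<k} {..<k} T D \<Longrightarrow> op_bound {..<k} {..<k} (\<lambda>i j. \<Phi> (T i j)) (C * D)"
begin

lemma P_zero: "0 \<in> P"
  using P_scale[OF P_id, of 0] by simp

lemma \<Phi>_zero: "\<Phi> 0 = 0"
  using \<Phi>_scale[OF P_id, of 0] by simp

lemma P_sum: "(\<And>i. i \<in> I \<Longrightarrow> b i \<in> P) \<Longrightarrow> sum b I \<in> P"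
  by (induction I rule: infinite_finite_induct) (auto simp: P_zero P_add)

lemma \<Phi>_sum: "(\<And>i. i \<in> I \<Longrightarrow> b i \<in> P) \<Longrightarrow> \<Phi> (sum b I) = (\<Sum>i\<in>I. \<Phi> (b i))"
  by (induction I rule: infinite_finite_induct) (auto simp: \<Phi>_zero \<Phi>_add P_sum)

text \<open>Zero rows or columns pad the matrix to a square one without affecting the bounds.
  \<open>consistency\<close> needs this because the number of tensors and the number of vectors are
  unrelated.\<close>

lemma cb_rectangular:
  fixes T :: "nat \<Rightarrow> nat \<Rightarrow> 'k \<Rightarrow>\<^sub>L 'k"
  assumes T: "\<And>i j. i < s \<Longrightarrow> j < m \<Longrightarrow> T i j \<in> P" and b: "op_bound {..<s} {..<m} T D" and "0 \<le> D"
  shows "op_bound {..<s} {..<m} (\<lambda>i j. \<Phi> (T i j)) (C * D)"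
proof -
  define k where "k = max s m"
  define U where "U i j = (if i < s \<and> j < m then T i j else 0)" for i j
  have red: "(\<Sum>i<k. (norm (\<Sum>j<k. blinfun_apply (\<Psi> (U i j)) (h j)))\<^sup>2) =
      (\<Sum>i<s. (norm (\<Sum>j<m. blinfun_apply (\<Psi> (T i j)) (h j)))\<^sup>2)"
    if "\<Psi> 0 = 0" for \<Psi> :: "('k \<Rightarrow>\<^sub>L 'k) \<Rightarrow> ('z::complex_hilbert_space \<Rightarrow>\<^sub>L 'z)" and h
  proof -
    have inner: "(\<Sum>j<k. blinfun_apply (\<Psi> (U i j)) (h j)) = (if i < s then \<Sum>j<m. blinfun_apply (\<Psi> (T i j)) (h j) else 0)" for i
    proof -
      have "(\<Sum>j<k. blinfun_apply (\<Psi> (U i j)) (h j)) = (\<Sum>j<m. blinfun_apply (\<Psi> (U i j)) (h j))"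
        by (rule sum.mono_neutral_right) (auto simp: U_def k_def that)
      then show ?thesis by (auto simp: U_def that)
    qed
    show ?thesis unfolding inner by (rule sum.mono_neutral_cong_right) (auto simp: k_def)
  qed
  have U: "op_bound {..<k} {..<k} U D"
    unfolding op_bound_def
  proof
    fix h
    have "(\<Sum>i<k. (norm (\<Sum>j<k. blinfun_apply (U i j) (h j)))\<^sup>2) \<le> D\<^sup>2 * (\<Sum>j<m. (norm (h j))\<^sup>2)"
      using red[of "\<lambda>T. T" h] op_boundD[OF b, of h] by simp
    also have "\<dots> \<le> D\<^sup>2 * (\<Sum>j<k. (norm (h j))\<^sup>2)"
      by (intro mult_left_mono sum_mono2) (auto simp: k_def)
    finally show "(\<Sum>i<k. (norm (\<Sum>j<k. blinfun_apply (U i j) (h j)))\<^sup>2) \<le> D\<^sup>2 * (\<Sum>j<k. (norm (h j))\<^sup>2)" .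
  qed
  have cb: "op_bound {..<k} {..<k} (\<lambda>i j. \<Phi> (U i j)) (C * D)"
    by (rule \<Phi>_cb[OF _ \<open>0 \<le> D\<close> U]) (auto simp: U_def T P_zero)
  show ?thesis
    unfolding op_bound_def
  proof
    fix h :: "nat \<Rightarrow> 'h"
    define h' where "h' j = (if j < m then h j else 0)" for j
    have "(\<Sum>i<s. (norm (\<Sum>j<m. blinfun_apply (\<Phi> (T i j)) (h j)))\<^sup>2) =
        (\<Sum>i<k. (norm (\<Sum>j<k. blinfun_apply (\<Phi> (U i j)) (h' j)))\<^sup>2)"
      using red[of \<Phi> h'] by (simp add: \<Phi>_zero h'_def)
    also have "\<dots> \<le> (C * D)\<^sup>2 * (\<Sum>j<k. (norm (h' j))\<^sup>2)" by (rule op_boundD[OF cb])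
    also have "(\<Sum>j<k. (norm (h' j))\<^sup>2) = (\<Sum>j<m. (norm (h j))\<^sup>2)"
      by (rule sum.mono_neutral_cong_right) (auto simp: h'_def k_def)
    finally show "(\<Sum>i<s. (norm (\<Sum>j<m. blinfun_apply (\<Phi> (T i j)) (h j)))\<^sup>2) \<le> (C * D)\<^sup>2 * (\<Sum>j<m. (norm (h j))\<^sup>2)" .
  qed
qed

text \<open>A finitely supported \<open>u :: 'h \<Rightarrow> P\<close> stands for the tensor \<open>\<Sum> u\<^sub>h \<otimes> h\<close> over the free vector space on
  the set \<open>'h\<close>, so that test maps \<open>\<xi> :: 'h \<Rightarrow> 'k\<close> need not be linear.\<close>

definition tensor :: "('h \<Rightarrow> ('k \<Rightarrow>\<^sub>L 'k)) \<Rightarrow> bool" where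
  "tensor u \<longleftrightarrow> finite {h. u h \<noteq> 0} \<and> (\<forall>h. u h \<in> P)"

definition tensor_apply :: "('h \<Rightarrow> ('k \<Rightarrow>\<^sub>L 'k)) \<Rightarrow> ('h \<Rightarrow> 'k) \<Rightarrow> 'k" where
  "tensor_apply u \<xi> = (\<Sum>h | u h \<noteq> 0. blinfun_apply (u h) (\<xi> h))"

definition tensor_value :: "('h \<Rightarrow> ('k \<Rightarrow>\<^sub>L 'k)) \<Rightarrow> 'h" where
  "tensor_value u = (\<Sum>h | u h \<noteq> 0. blinfun_apply (\<Phi> (u h)) h)"

definition tensor_form :: "('h \<Rightarrow> ('k \<Rightarrow>\<^sub>L 'k)) \<Rightarrow> ('h \<Rightarrow> 'k) \<Rightarrow> real" where
  "tensor_form u \<xi> = (norm (tensor_apply u \<xi>))\<^sup>2"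

definition pure :: "'h \<Rightarrow> 'h \<Rightarrow> ('k \<Rightarrow>\<^sub>L 'k)" where
  "pure k = (\<lambda>h. if h = k then id_blinfun else 0)"

lemma tensor_apply_superset:
  "finite K \<Longrightarrow> {h. u h \<noteq> 0} \<subseteq> K \<Longrightarrow> tensor_apply u \<xi> = (\<Sum>h\<in>K. blinfun_apply (u h) (\<xi> h))"
  unfolding tensor_apply_def by (rule sum.mono_neutral_left) auto

lemma tensor_value_superset:
  "finite K \<Longrightarrow> {h. u h \<noteq> 0} \<subseteq> K \<Longrightarrow> tensor_value u = (\<Sum>h\<in>K. blinfun_apply (\<Phi> (u h)) h)"
  unfolding tensor_value_def by (rule sum.mono_neutral_left) (auto simp: \<Phi>_zero)

lemma tensor_pure: "tensor (pure k)" "tensor_apply (pure k) \<xi> = \<xi> k" "tensor_value (pure k) = k"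
proof -
  have sub: "{h. pure k h \<noteq> 0} \<subseteq> {k}" by (auto simp: pure_def)
  then show "tensor (pure k)" by (auto simp: tensor_def pure_def P_id P_zero intro: finite_subset)
  show "tensor_apply (pure k) \<xi> = \<xi> k" by (subst tensor_apply_superset[OF _ sub]) (auto simp: pure_def)
  show "tensor_value (pure k) = k" by (subst tensor_value_superset[OF _ sub]) (auto simp: pure_def \<Phi>_id)
qed

text \<open>The row (b_j) acting from the left on a column of tensors. Evaluation at a test map
  intertwines it with the row (b_j), and \<open>tensor_value\<close> with the row of the
  \<Phi>(b_j), by multiplicativity of \<Phi>.\<close>

definition tensor_comb :: "'j set \<Rightarrow> ('j \<Rightarrow> ('k \<Rightarrow>\<^sub>L 'k)) \<Rightarrow> ('j \<Rightarrow> 'h \<Rightarrow> ('k \<Rightarrow>\<^sub>L 'k)) \<Rightarrow> 'h \<Rightarrow> ('k \<Rightarrow>\<^sub>L 'k)" where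
  "tensor_comb J b u = (\<lambda>h. \<Sum>j\<in>J. b j o\<^sub>L u j h)"

lemma tensor_comb:
  assumes J: "finite J" and b: "\<And>j. j \<in> J \<Longrightarrow> b j \<in> P" and u: "\<And>j. j \<in> J \<Longrightarrow> tensor (u j)"
  shows "tensor (tensor_comb J b u)"
    and "tensor_apply (tensor_comb J b u) \<xi> = (\<Sum>j\<in>J. blinfun_apply (b j) (tensor_apply (u j) \<xi>))"
    and "tensor_value (tensor_comb J b u) = (\<Sum>j\<in>J. blinfun_apply (\<Phi> (b j)) (tensor_value (u j)))"
proof -
  define K where "K = (\<Union>j\<in>J. {h. u j h \<noteq> 0})"
  have K: "finite K" using u J by (auto simp: K_def tensor_def)
  have sub: "{h. tensor_comb J b u h \<noteq> 0} \<subseteq> K"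
    by (auto simp: K_def tensor_comb_def elim!: sum.not_neutral_contains_not_neutral)
  have subj: "{h. u j h \<noteq> 0} \<subseteq> K" if "j \<in> J" for j using that by (auto simp: K_def)
  have uP: "u j h \<in> P" if "j \<in> J" for j h using u[OF that] by (auto simp: tensor_def)
  show "tensor (tensor_comb J b u)"
    using finite_subset[OF sub K] b uP by (auto simp: tensor_def tensor_comb_def intro!: P_sum P_mult)
  show "tensor_apply (tensor_comb J b u) \<xi> = (\<Sum>j\<in>J. blinfun_apply (b j) (tensor_apply (u j) \<xi>))"
    unfolding tensor_apply_superset[OF K sub] using tensor_apply_superset[OF K subj]
    by (simp add: tensor_comb_def blinfun.sum_left blinfun.sum_right sum.swap[of _ K J])
  show "tensor_value (tensor_comb J b u) = (\<Sum>j\<in>J. blinfun_apply (\<Phi> (b j)) (tensor_value (u j)))"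
    unfolding tensor_value_superset[OF K sub] using tensor_value_superset[OF K subj] b uP
    by (simp add: tensor_comb_def \<Phi>_sum P_mult \<Phi>_mult blinfun.sum_left blinfun.sum_right sum.swap[of _ K J])
qed

section \<open>Weights and the compatibility of the two constraints\<close>

definition weight :: "('h \<Rightarrow> real) \<Rightarrow> bool" where
  "weight w \<longleftrightarrow> finite {h. w h \<noteq> 0} \<and> (\<forall>h. 0 \<le> w h)"

text \<open>The codomain is generic because the form is taken both of test maps into
  \<open>'k\<close> and of the identity map of \<open>'h\<close>.\<close>

definition weight_form :: "('h \<Rightarrow> real) \<Rightarrow> ('h \<Rightarrow> 'z::real_normed_vector) \<Rightarrow> real" where
  "weight_form w \<xi> = (\<Sum>h | w h \<noteq> 0. w h * (norm (\<xi> h))\<^sup>2)"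

lemma weight_form_superset:
  "finite K \<Longrightarrow> {h. w h \<noteq> 0} \<subseteq> K \<Longrightarrow> weight_form w \<xi> = (\<Sum>h\<in>K. w h * (norm (\<xi> h))\<^sup>2)"
  unfolding weight_form_def by (rule sum.mono_neutral_left) auto

lemma weight_add: "weight w \<Longrightarrow> weight w' \<Longrightarrow> weight (w + w')"
  by (auto simp: weight_def intro: finite_subset[of _ "{h. w h \<noteq> 0} \<union> {h. w' h \<noteq> 0}"])

lemma weight_form_add:
  assumes "weight w" "weight w'"
  shows "weight_form (w + w') \<xi> = weight_form w \<xi> + weight_form w' \<xi>"
proof -
  define K where "K = {h. w h \<noteq> 0} \<union> {h. w' h \<noteq> 0}"
  have K: "finite K" "{h. w h \<noteq> 0} \<subseteq> K" "{h. w' h \<noteq> 0} \<subseteq> K" "{h. (w + w') h \<noteq> 0} \<subseteq> K"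
    using assms by (auto simp: K_def weight_def)
  show ?thesis
    unfolding weight_form_superset[OF K(1,2)] weight_form_superset[OF K(1,3)] weight_form_superset[of K "w + w'", OF K(1,4)]
    by (simp add: distrib_right sum.distrib)
qed

lemma weight_scale: "weight w \<Longrightarrow> 0 \<le> t \<Longrightarrow> weight (t *\<^sub>R w)"
  by (auto simp: weight_def scaleR_fun_def intro: rev_finite_subset)

lemma weight_form_scale: "weight w \<Longrightarrow> weight_form (t *\<^sub>R w) \<xi> = t * weight_form w \<xi>"
  using weight_form_superset[of "{h. w h \<noteq> 0}" "t *\<^sub>R w" \<xi>]
  by (auto simp: weight_def weight_form_def scaleR_fun_def sum_distrib_left mult.assoc)

lemma weight_form_nonneg: "weight w \<Longrightarrow> 0 \<le> weight_form w \<xi>"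
  by (auto simp: weight_def weight_form_def intro!: sum_nonneg)

text \<open>Complete boundedness enters here. Up to a regularization, the hypothesis says that the
  operator matrix with entries u_i(h)/sqrt(w h), with a row for each tensor and a column for each
  vector, is a contraction. Its image under \<Phi> then has bound \<open>C\<close>, and applied to
  the column of the vectors sqrt(w h) h it produces the values of the tensors.\<close>

lemma consistency:
  assumes w: "weight w" and us: "\<forall>u\<in>set us. tensor u"
    and le: "\<And>\<xi>. (\<Sum>u\<leftarrow>us. tensor_form u \<xi>) \<le> weight_form w \<xi>"
  shows "(\<Sum>u\<leftarrow>us. (norm (tensor_value u))\<^sup>2) \<le> C\<^sup>2 * weight_form w (\<lambda>h. h)"
proof -
  define K where "K = {h. w h \<noteq> 0} \<union> (\<Union>u\<in>set us. {h. u h \<noteq> 0})"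
  have K: "finite K" using w us by (auto simp: K_def weight_def tensor_def)
  have subw: "{h. w h \<noteq> 0} \<subseteq> K" and subu: "i < length us \<Longrightarrow> {h. (us ! i) h \<noteq> 0} \<subseteq> K" for i
    by (auto simp: K_def)
  obtain v where v: "bij_betw v {..<card K} K" using ex_bij_betw_nat_finite[OF K] by (auto simp: atLeast0LessThan)
  have sumK: "(\<Sum>h\<in>K. g h) = (\<Sum>j<card K. g (v j))" for g :: "'h \<Rightarrow> 'z::comm_monoid_add"
    by (rule sum.reindex_bij_betw[OF v, symmetric])
  have inj: "inj_on v {..<card K}" using v by (auto simp: bij_betw_def)
  \<comment> \<open>Weights may vanish, so \<open>e\<close> is added before dividing by their square
    roots and removed by a limit.\<close>
  have eps: "(\<Sum>u\<leftarrow>us. (norm (tensor_value u))\<^sup>2) \<le> C\<^sup>2 * (\<Sum>h\<in>K. (w h + e) * (norm h)\<^sup>2)" if e: "e > 0" for e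
  proof -
    define r where "r h = sqrt (w h + e)" for h
    have r: "r h > 0" "(r h)\<^sup>2 = w h + e" for h using w e by (auto simp: r_def weight_def add_nonneg_pos)
    define T where "T i j = scaleC_op (of_real (1 / r (v j))) ((us ! i) (v j))" for i j
    have bound: "op_bound {..<length us} {..<card K} T 1"
      unfolding op_bound_def
    proof
      fix x :: "nat \<Rightarrow> 'k"
      define \<xi> where "\<xi> h = (1 / r h) *\<^sub>R x (the_inv_into {..<card K} v h)" for h
      have \<xi>: "\<xi> (v j) = (1 / r (v j)) *\<^sub>R x j" if "j < card K" for j
        using the_inv_into_f_f[OF inj, of j] that by (simp add: \<xi>_def)
      have "(\<Sum>i<length us. (norm (\<Sum>j<card K. blinfun_apply (T i j) (x j)))\<^sup>2) = (\<Sum>i<length us. tensor_form (us ! i) \<xi>)"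
      proof (intro sum.cong refl)
        fix i assume "i \<in> {..<length us}"
        then have "tensor_apply (us ! i) \<xi> = (\<Sum>j<card K. blinfun_apply ((us ! i) (v j)) (\<xi> (v j)))"
          using tensor_apply_superset[OF K subu, of i \<xi>] by (simp add: sumK)
        then show "(norm (\<Sum>j<card K. blinfun_apply (T i j) (x j)))\<^sup>2 = tensor_form (us ! i) \<xi>"
          by (simp add: tensor_form_def T_def scaleC_op_of_real \<xi> blinfun.scaleR_left blinfun.scaleR_right del: of_real_divide)
      qed
      also have "\<dots> = (\<Sum>u\<leftarrow>us. tensor_form u \<xi>)" by (simp add: sum_list_sum_nth atLeast0LessThan)
      also have "\<dots> \<le> weight_form w \<xi>" by (rule le)
      also have "\<dots> = (\<Sum>j<card K. w (v j) * (norm (\<xi> (v j)))\<^sup>2)" by (simp add: weight_form_superset[OF K subw] sumK)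
      also have "\<dots> \<le> (\<Sum>j<card K. (norm (x j))\<^sup>2)"
      proof (rule sum_mono)
        fix j assume "j \<in> {..<card K}"
        then have "w (v j) * (norm (\<xi> (v j)))\<^sup>2 = (w (v j) / (w (v j) + e)) * (norm (x j))\<^sup>2"
          by (simp add: \<xi> power_divide power_mult_distrib r)
        also have "\<dots> \<le> 1 * (norm (x j))\<^sup>2"
          using e w by (intro mult_right_mono) (auto simp: weight_def divide_le_eq_1 add_nonneg_pos)
        finally show "w (v j) * (norm (\<xi> (v j)))\<^sup>2 \<le> (norm (x j))\<^sup>2" by simp
      qed
      finally show "(\<Sum>i<length us. (norm (\<Sum>j<card K. blinfun_apply (T i j) (x j)))\<^sup>2) \<le> 1\<^sup>2 * (\<Sum>j<card K. (norm (x j))\<^sup>2)"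
        by simp
    qed
    have uP: "(us ! i) h \<in> P" if "i < length us" for i h using us that by (auto simp: tensor_def)
    have "op_bound {..<length us} {..<card K} (\<lambda>i j. \<Phi> (T i j)) (C * 1)"
      by (rule cb_rectangular[OF _ bound]) (auto simp: T_def P_scale uP)
    from op_boundD[OF this, of "\<lambda>j. r (v j) *\<^sub>R v j"]
    have "(\<Sum>i<length us. (norm (\<Sum>j<card K. blinfun_apply (\<Phi> (T i j)) (r (v j) *\<^sub>R v j)))\<^sup>2) \<le>
        C\<^sup>2 * (\<Sum>j<card K. (norm (r (v j) *\<^sub>R v j))\<^sup>2)" by simp
    moreover have "(\<Sum>i<length us. (norm (\<Sum>j<card K. blinfun_apply (\<Phi> (T i j)) (r (v j) *\<^sub>R v j)))\<^sup>2) =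
        (\<Sum>i<length us. (norm (tensor_value (us ! i)))\<^sup>2)"
    proof (intro sum.cong refl)
      fix i assume i: "i \<in> {..<length us}"
      have "tensor_value (us ! i) = (\<Sum>j<card K. blinfun_apply (\<Phi> ((us ! i) (v j))) (v j))"
        using tensor_value_superset[OF K subu, of i] i by (simp add: sumK)
      moreover have "blinfun_apply (\<Phi> (T i j)) (r (v j) *\<^sub>R v j) = blinfun_apply (\<Phi> ((us ! i) (v j))) (v j)" for j
      proof -
        have "\<Phi> (T i j) = scaleC_op (of_real (1 / r (v j))) (\<Phi> ((us ! i) (v j)))"
          unfolding T_def using uP[of i] i by (intro \<Phi>_scale) auto
        then show ?thesis
          using r(1)[of "v j"] by (simp add: scaleC_op_of_real blinfun.scaleR_left blinfun.scaleR_right del: of_real_divide)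
      qed
      ultimately show "(norm (\<Sum>j<card K. blinfun_apply (\<Phi> (T i j)) (r (v j) *\<^sub>R v j)))\<^sup>2 = (norm (tensor_value (us ! i)))\<^sup>2"
        by simp
    qed
    moreover have "(\<Sum>j<card K. (norm (r (v j) *\<^sub>R v j))\<^sup>2) = (\<Sum>h\<in>K. (w h + e) * (norm h)\<^sup>2)"
      by (simp add: sumK power_mult_distrib r)
    ultimately show ?thesis by (simp add: sum_list_sum_nth atLeast0LessThan)
  qed
  have "((\<lambda>e. C\<^sup>2 * (\<Sum>h\<in>K. (w h + e) * (norm h)\<^sup>2)) \<longlongrightarrow> C\<^sup>2 * (\<Sum>h\<in>K. (w h + 0) * (norm h)\<^sup>2)) (at_right 0)"
    by (intro tendsto_intros)
  then have "(\<Sum>u\<leftarrow>us. (norm (tensor_value u))\<^sup>2) \<le> C\<^sup>2 * (\<Sum>h\<in>K. (w h + 0) * (norm h)\<^sup>2)"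
    by (rule tendsto_lowerbound) (auto simp: eventually_at_right_field intro!: exI[of _ 1] eps)
  then show ?thesis by (simp add: weight_form_superset[OF K subw])
qed

section \<open>The sublinear functional that encodes the constraints\<close>

definition dominated :: "(('h \<Rightarrow> 'k) \<Rightarrow> real) set" where
  "dominated = {g. \<exists>w. weight w \<and> (\<forall>\<xi>. \<bar>g \<xi>\<bar> \<le> weight_form w \<xi>)}"

text \<open>A linear functional below the infima of these sets is monotone, at most C^2 times the
  sum of w h |h|^2 at the form of a weight w, and at least the squared norm of
  \<open>tensor_value u\<close> at \<open>tensor_form u\<close>. Conversely the infimum is the upper
  bound at \<open>g\<close> that these three demands imply.\<close>

definition majorants :: "(('h \<Rightarrow> 'k) \<Rightarrow> real) \<Rightarrow> real set" where
  "majorants g = {C\<^sup>2 * weight_form w (\<lambda>h. h) - (\<Sum>u\<leftarrow>us. (norm (tensor_value u))\<^sup>2) | w us.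
     weight w \<and> (\<forall>u\<in>set us. tensor u) \<and> (\<forall>\<xi>. g \<xi> \<le> weight_form w \<xi> - (\<Sum>u\<leftarrow>us. tensor_form u \<xi>))}"

lemma majorantsI:
  "weight w \<Longrightarrow> \<forall>u\<in>set us. tensor u \<Longrightarrow> (\<And>\<xi>. g \<xi> \<le> weight_form w \<xi> - (\<Sum>u\<leftarrow>us. tensor_form u \<xi>)) \<Longrightarrow>
    C\<^sup>2 * weight_form w (\<lambda>h. h) - (\<Sum>u\<leftarrow>us. (norm (tensor_value u))\<^sup>2) \<in> majorants g"
  unfolding majorants_def by blast

lemma dominated_subspace: "subspace dominated"
  unfolding subspace_def
proof (intro conjI ballI allI)
  have "weight (\<lambda>_. 0)" by (simp add: weight_def)
  then show "0 \<in> dominated" by (auto simp: dominated_def intro!: exI[of _ "\<lambda>_. 0"] weight_form_nonneg)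
next
  fix g g' assume "g \<in> dominated" "g' \<in> dominated"
  then obtain w w' where w: "weight w" "weight w'" "\<And>\<xi>. \<bar>g \<xi>\<bar> \<le> weight_form w \<xi>" "\<And>\<xi>. \<bar>g' \<xi>\<bar> \<le> weight_form w' \<xi>"
    by (auto simp: dominated_def)
  have "\<bar>(g + g') \<xi>\<bar> \<le> weight_form (w + w') \<xi>" for \<xi>
    using w(3,4)[of \<xi>] weight_form_add[OF w(1,2), of \<xi>] abs_triangle_ineq[of "g \<xi>" "g' \<xi>"] by simp
  then show "g + g' \<in> dominated" using weight_add[OF w(1,2)] by (auto simp: dominated_def)
next
  fix r :: real and g assume "g \<in> dominated"
  then obtain w where w: "weight w" "\<And>\<xi>. \<bar>g \<xi>\<bar> \<le> weight_form w \<xi>" by (auto simp: dominated_def)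
  have "\<bar>(r *\<^sub>R g) \<xi>\<bar> \<le> weight_form (\<bar>r\<bar> *\<^sub>R w) \<xi>" for \<xi>
    unfolding weight_form_scale[OF w(1)] using w(2)[of \<xi>] by (simp add: scaleR_fun_def abs_mult mult_left_mono)
  then show "r *\<^sub>R g \<in> dominated" using weight_scale[OF w(1), of "\<bar>r\<bar>"] by (auto simp: dominated_def)
qed

lemma majorants_nonempty: "g \<in> dominated \<Longrightarrow> majorants g \<noteq> {}"
proof -
  assume "g \<in> dominated"
  then obtain w where w: "weight w" "\<And>\<xi>. \<bar>g \<xi>\<bar> \<le> weight_form w \<xi>" by (auto simp: dominated_def)
  have "g \<xi> \<le> weight_form w \<xi> - (\<Sum>u\<leftarrow>[]. tensor_form u \<xi>)" for \<xi> using w(2)[of \<xi>] by simp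
  from majorantsI[OF w(1) _ this] show ?thesis by auto
qed

text \<open>If \<open>g\<close> is at least minus the form of \<open>w\<close>, every competitor
  \<open>w'\<close>, \<open>us\<close> satisfies the hypothesis of \<open>consistency\<close> with
  the weight \<open>w + w'\<close>; its conclusion is the lower bound.\<close>

lemma majorants_bdd_below: "g \<in> dominated \<Longrightarrow> bdd_below (majorants g)"
proof -
  assume "g \<in> dominated"
  then obtain w where w: "weight w" "\<And>\<xi>. \<bar>g \<xi>\<bar> \<le> weight_form w \<xi>" by (auto simp: dominated_def)
  show ?thesis
  proof (rule bdd_belowI)
    fix x assume "x \<in> majorants g"
    then obtain w' us where x: "x = C\<^sup>2 * weight_form w' (\<lambda>h. h) - (\<Sum>u\<leftarrow>us. (norm (tensor_value u))\<^sup>2)"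
      and w': "weight w'" "\<forall>u\<in>set us. tensor u" "\<And>\<xi>. g \<xi> \<le> weight_form w' \<xi> - (\<Sum>u\<leftarrow>us. tensor_form u \<xi>)"
      unfolding majorants_def by blast
    have "(\<Sum>u\<leftarrow>us. tensor_form u \<xi>) \<le> weight_form (w + w') \<xi>" for \<xi>
      using w(2)[of \<xi>] w'(3)[of \<xi>] weight_form_add[OF w(1) w'(1), of \<xi>] by simp
    from consistency[OF weight_add[OF w(1) w'(1)] w'(2) this]
    show "- C\<^sup>2 * weight_form w (\<lambda>h. h) \<le> x"
      unfolding weight_form_add[OF w(1) w'(1)] x by (simp add: algebra_simps)
  qed
qed

definition tensor_scale :: "real \<Rightarrow> ('h \<Rightarrow> ('k \<Rightarrow>\<^sub>L 'k)) \<Rightarrow> 'h \<Rightarrow> ('k \<Rightarrow>\<^sub>L 'k)" where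
  "tensor_scale t u = tensor_comb {()} (\<lambda>_. scaleC_op (of_real t) id_blinfun) (\<lambda>_. u)"

lemma tensor_scale:
  assumes "tensor u"
  shows "tensor (tensor_scale t u)" "tensor_form (tensor_scale t u) \<xi> = t\<^sup>2 * tensor_form u \<xi>"
    "tensor_value (tensor_scale t u) = t *\<^sub>R tensor_value u"
  using tensor_comb[of "{()}" "\<lambda>_. scaleC_op (of_real t) id_blinfun" "\<lambda>_. u"] assms
  by (auto simp: tensor_scale_def P_scale P_id \<Phi>_scale \<Phi>_id scaleR_scaleC[symmetric] tensor_form_def power_mult_distrib)

lemma majorants_sublinear: "sublinear_on dominated (\<lambda>g. Inf (majorants g))"
  unfolding sublinear_on_def
proof (intro conjI ballI allI impI)
  fix g g' assume g: "g \<in> dominated" and g': "g' \<in> dominated"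
  show "Inf (majorants (g + g')) \<le> Inf (majorants g) + Inf (majorants g')"
  proof (rule cInf_add_le)
    fix v v' assume "v \<in> majorants g" "v' \<in> majorants g'"
    then obtain w us w' us' where
      w: "v = C\<^sup>2 * weight_form w (\<lambda>h. h) - (\<Sum>u\<leftarrow>us. (norm (tensor_value u))\<^sup>2)"
        "weight w" "\<forall>u\<in>set us. tensor u" "\<And>\<xi>. g \<xi> \<le> weight_form w \<xi> - (\<Sum>u\<leftarrow>us. tensor_form u \<xi>)"
      and w': "v' = C\<^sup>2 * weight_form w' (\<lambda>h. h) - (\<Sum>u\<leftarrow>us'. (norm (tensor_value u))\<^sup>2)"
        "weight w'" "\<forall>u\<in>set us'. tensor u" "\<And>\<xi>. g' \<xi> \<le> weight_form w' \<xi> - (\<Sum>u\<leftarrow>us'. tensor_form u \<xi>)"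
      unfolding majorants_def by blast
    have "C\<^sup>2 * weight_form (w + w') (\<lambda>h. h) - (\<Sum>u\<leftarrow>us @ us'. (norm (tensor_value u))\<^sup>2) \<in> majorants (g + g')"
    proof (rule majorantsI[OF weight_add[OF w(2) w'(2)]])
      show "(g + g') \<xi> \<le> weight_form (w + w') \<xi> - (\<Sum>u\<leftarrow>us @ us'. tensor_form u \<xi>)" for \<xi>
        using w(4)[of \<xi>] w'(4)[of \<xi>] by (simp add: weight_form_add[OF w(2) w'(2)])
    qed (use w(3) w'(3) in auto)
    then show "\<exists>s\<in>majorants (g + g'). s \<le> v + v'"
      unfolding weight_form_add[OF w(2) w'(2)] by (rule rev_bexI) (simp add: w(1) w'(1) algebra_simps)
  qed (use g g' in \<open>auto simp: majorants_nonempty majorants_bdd_below subspace_add[OF dominated_subspace]\<close>)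
next
  fix g and t :: real assume g: "g \<in> dominated" and t: "0 < t"
  show "Inf (majorants (t *\<^sub>R g)) \<le> t * Inf (majorants g)"
  proof (rule cInf_scale_le)
    fix v assume "v \<in> majorants g"
    then obtain w us where
      w: "v = C\<^sup>2 * weight_form w (\<lambda>h. h) - (\<Sum>u\<leftarrow>us. (norm (tensor_value u))\<^sup>2)"
        "weight w" "\<forall>u\<in>set us. tensor u" "\<And>\<xi>. g \<xi> \<le> weight_form w \<xi> - (\<Sum>u\<leftarrow>us. tensor_form u \<xi>)"
      unfolding majorants_def by blast
    \<comment> \<open>Tensor forms are quadratic, so a factor \<open>t\<close> is produced by
      scaling the tensors with its square root.\<close>
    define us' where "us' = map (tensor_scale (sqrt t)) us"
    have F: "(\<Sum>u\<leftarrow>us'. tensor_form u \<xi>) = t * (\<Sum>u\<leftarrow>us. tensor_form u \<xi>)" for \<xi>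
      unfolding us'_def using w(3) t
      by (induction us) (auto simp: tensor_scale algebra_simps)
    have E: "(\<Sum>u\<leftarrow>us'. (norm (tensor_value u))\<^sup>2) = t * (\<Sum>u\<leftarrow>us. (norm (tensor_value u))\<^sup>2)"
      unfolding us'_def using w(3) t
      by (induction us) (auto simp: tensor_scale algebra_simps power_mult_distrib)
    have "C\<^sup>2 * weight_form (t *\<^sub>R w) (\<lambda>h. h) - (\<Sum>u\<leftarrow>us'. (norm (tensor_value u))\<^sup>2) \<in> majorants (t *\<^sub>R g)"
    proof (rule majorantsI)
      show "weight (t *\<^sub>R w)" using weight_scale[OF w(2)] t by simp
      show "\<forall>u\<in>set us'. tensor u" using w(3) by (auto simp: us'_def tensor_scale)
      show "(t *\<^sub>R g) \<xi> \<le> weight_form (t *\<^sub>R w) \<xi> - (\<Sum>u\<leftarrow>us'. tensor_form u \<xi>)" for \<xi>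
        unfolding F weight_form_scale[OF w(2)]
        using mult_left_mono[OF w(4)[of \<xi>], of t] t by (simp add: scaleR_fun_def algebra_simps)
    qed
    then show "\<exists>s\<in>majorants (t *\<^sub>R g). s \<le> t * v"
      unfolding E weight_form_scale[OF w(2)] by (rule rev_bexI) (simp add: w(1) algebra_simps)
  qed (use g t in \<open>auto simp: majorants_nonempty majorants_bdd_below subspace_scale[OF dominated_subspace]\<close>)
qed

end

section \<open>The functional and the Hilbert norm it defines\<close>

context cb_homomorphism
begin

definition "functional = (SOME L. (\<forall>g\<in>dominated. L g \<le> Inf (majorants g)) \<and>
  (\<forall>g\<in>dominated. \<forall>g'\<in>dominated. L (g + g') = L g + L g') \<and> (\<forall>g\<in>dominated. \<forall>t. L (t *\<^sub>R g) = t * L g))"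

lemma functional:
  "g \<in> dominated \<Longrightarrow> functional g \<le> Inf (majorants g)"
  "g \<in> dominated \<Longrightarrow> g' \<in> dominated \<Longrightarrow> functional (g + g') = functional g + functional g'"
  "g \<in> dominated \<Longrightarrow> functional (t *\<^sub>R g) = t * functional g"
  using someI_ex[OF hahn_banach_subspace[OF dominated_subspace majorants_sublinear]]
  unfolding functional_def by blast+

lemma functional_zero: "functional 0 = 0"
  using functional(3)[OF subspace_0[OF dominated_subspace], of 0] by (simp only: scaleR_zero_left mult_zero_left)

lemma functional_sum:
  "(\<And>j. j \<in> J \<Longrightarrow> g j \<in> dominated) \<Longrightarrow> functional (sum g J) = (\<Sum>j\<in>J. functional (g j))"
proof (induction J rule: infinite_finite_induct)
  case empty
  show ?case by (simp only: sum.empty functional_zero)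
next
  case (insert j J)
  have "sum g J \<in> dominated" using insert.prems by (intro subspace_sum dominated_subspace) auto
  moreover have "g j \<in> dominated" using insert.prems by simp
  ultimately show ?case
    using insert.IH[OF insert.prems[OF insertI2]] unfolding sum.insert[OF insert.hyps]
    by (simp only: functional(2))
next
  case (infinite J)
  then show ?case by (simp only: sum.infinite functional_zero not_False_eq_True)
qed

lemma functional_le: "g \<in> dominated \<Longrightarrow> x \<in> majorants g \<Longrightarrow> functional g \<le> x"
  using functional(1) cInf_lower[OF _ majorants_bdd_below] by (meson order_trans)

lemma weight_zero: "weight 0" "weight_form 0 \<xi> = 0"
  by (simp_all add: weight_def weight_form_def)

text \<open>The difference g - g' is nonpositive, so the weight 0 and the empty list of tensors show
  that 0 is one of its majorants.\<close>

lemma functional_mono: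
  assumes "g \<in> dominated" "g' \<in> dominated" "\<And>\<xi>. g \<xi> \<le> g' \<xi>"
  shows "functional g \<le> functional g'"
proof -
  have m: "(-1) *\<^sub>R g' \<in> dominated" using assms by (intro subspace_scale dominated_subspace)
  have "C\<^sup>2 * weight_form 0 (\<lambda>h. h) - (\<Sum>u\<leftarrow>[]. (norm (tensor_value u))\<^sup>2) \<in> majorants (g + (-1) *\<^sub>R g')"
    by (rule majorantsI) (use assms(3) in \<open>auto simp: weight_zero scaleR_fun_def\<close>)
  then have "functional (g + (-1) *\<^sub>R g') \<le> 0"
    using functional_le[of "g + (-1) *\<^sub>R g'" 0] subspace_add[OF dominated_subspace assms(1) m] by (simp add: weight_zero)
  then show ?thesis by (simp only: functional(2)[OF assms(1) m] functional(3)[OF assms(2)])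
qed

text \<open>Cauchy--Schwarz, with the constant weight \<open>M\<close> on the support of
  \<open>u\<close>.\<close>

lemma tensor_form_dominated:
  assumes "tensor u"
  shows "tensor_form u \<in> dominated"
proof -
  define K where "K = {h. u h \<noteq> 0}"
  have K: "finite K" using assms by (simp add: K_def tensor_def)
  define M where "M = (\<Sum>h\<in>K. (norm (u h))\<^sup>2)"
  define w where "w h = (if h \<in> K then M else 0)" for h
  have w: "weight w" unfolding weight_def w_def M_def
    using K by (auto simp: sum_nonneg intro: rev_finite_subset[of K])
  have "\<bar>tensor_form u \<xi>\<bar> \<le> weight_form w \<xi>" for \<xi>
  proof -
    have "norm (tensor_apply u \<xi>) \<le> (\<Sum>h\<in>K. norm (u h) * norm (\<xi> h))"
      unfolding tensor_apply_def K_def[symmetric] by (rule order_trans[OF norm_sum sum_mono[OF norm_blinfun]])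
    then have "\<bar>tensor_form u \<xi>\<bar> \<le> (\<Sum>h\<in>K. norm (u h) * norm (\<xi> h))\<^sup>2"
      unfolding tensor_form_def by (simp add: power_mono)
    also have "\<dots> \<le> M * (\<Sum>h\<in>K. (norm (\<xi> h))\<^sup>2)"
      unfolding M_def by (rule Cauchy_Schwarz_ineq_sum)
    also have "\<dots> = weight_form w \<xi>"
    proof -
      have "{h. w h \<noteq> 0} \<subseteq> K" by (auto simp: w_def)
      then have "weight_form w \<xi> = (\<Sum>h\<in>K. w h * (norm (\<xi> h))\<^sup>2)" by (rule weight_form_superset[OF K])
      then show ?thesis by (simp add: w_def sum_distrib_left)
    qed
    finally show ?thesis .
  qed
  with w show ?thesis by (auto simp: dominated_def)
qed

definition tensor_size :: "('h \<Rightarrow> ('k \<Rightarrow>\<^sub>L 'k)) \<Rightarrow> real" where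
  "tensor_size u = functional (tensor_form u)"

text \<open>The weight 0 and the single tensor \<open>u\<close> form a competitor for the negative
  of \<open>tensor_form u\<close>.\<close>

lemma tensor_size_lower:
  assumes u: "tensor u"
  shows "(norm (tensor_value u))\<^sup>2 \<le> tensor_size u"
proof -
  have "(-1) *\<^sub>R tensor_form u \<in> dominated"
    by (intro subspace_scale dominated_subspace tensor_form_dominated u)
  moreover have "C\<^sup>2 * weight_form 0 (\<lambda>h. h) - (\<Sum>u\<leftarrow>[u]. (norm (tensor_value u))\<^sup>2) \<in> majorants ((-1) *\<^sub>R tensor_form u)"
    by (rule majorantsI) (use u in \<open>auto simp: weight_zero scaleR_fun_def\<close>)
  ultimately have "functional ((-1) *\<^sub>R tensor_form u) \<le> - (norm (tensor_value u))\<^sup>2"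
    using functional_le by (fastforce simp: weight_zero)
  then show ?thesis by (simp only: functional(3)[OF tensor_form_dominated[OF u]] tensor_size_def)
qed

text \<open>The form of a pure tensor is exactly the form of the weight 1 at \<open>k\<close>, whose
  majorant is the right side.\<close>

lemma tensor_size_pure: "tensor_size (pure k) \<le> C\<^sup>2 * (norm k)\<^sup>2"
proof -
  define w where "w h = (if h = k then 1 else 0 :: real)" for h
  have w: "weight w" by (auto simp: weight_def w_def)
  have wf: "weight_form w \<xi> = (norm (\<xi> k))\<^sup>2" for \<xi> :: "'h \<Rightarrow> 'z::real_normed_vector"
    using weight_form_superset[of "{k}" w \<xi>] by (auto simp: w_def)
  have "C\<^sup>2 * weight_form w (\<lambda>h. h) - (\<Sum>u\<leftarrow>[]. (norm (tensor_value u))\<^sup>2) \<in> majorants (tensor_form (pure k))"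
    by (rule majorantsI) (auto simp: w wf tensor_form_def tensor_pure)
  then show ?thesis
    unfolding tensor_size_def
    using functional_le[OF tensor_form_dominated[OF tensor_pure(1)]] by (fastforce simp: wf)
qed

lemma sum_fun_apply: "(sum g J :: 'x \<Rightarrow> 'y::comm_monoid_add) x = (\<Sum>j\<in>J. g j x)"
  by (induction J rule: infinite_finite_induct) auto

text \<open>A bound for the row (b_j) is a pointwise inequality between forms of test maps, and
  \<open>functional\<close> is linear and monotone. The bound \<open>D\<close> survives unchanged,
  with no factor \<open>C\<close>.\<close>

lemma tensor_size_row:
  fixes J :: "'j set"
  assumes J: "finite J" and b: "\<And>j. j \<in> J \<Longrightarrow> b j \<in> P" and u: "\<And>j. j \<in> J \<Longrightarrow> tensor (u j)"
    and D: "\<And>\<xi> :: 'j \<Rightarrow> 'k. (norm (\<Sum>j\<in>J. blinfun_apply (b j) (\<xi> j)))\<^sup>2 \<le> D\<^sup>2 * (\<Sum>j\<in>J. (norm (\<xi> j))\<^sup>2)"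
  shows "tensor_size (tensor_comb J b u) \<le> D\<^sup>2 * (\<Sum>j\<in>J. tensor_size (u j))"
proof -
  have uD: "tensor_form (u j) \<in> dominated" if "j \<in> J" for j using tensor_form_dominated[OF u[OF that]] .
  have sD: "(\<Sum>j\<in>J. tensor_form (u j)) \<in> dominated" by (intro subspace_sum dominated_subspace uD)
  have "functional (tensor_form (tensor_comb J b u)) \<le> functional (D\<^sup>2 *\<^sub>R (\<Sum>j\<in>J. tensor_form (u j)))"
  proof (rule functional_mono)
    show "tensor_form (tensor_comb J b u) \<in> dominated" using tensor_comb(1)[OF J b u] by (intro tensor_form_dominated)
    show "D\<^sup>2 *\<^sub>R (\<Sum>j\<in>J. tensor_form (u j)) \<in> dominated" by (intro subspace_scale dominated_subspace sD)
    show "tensor_form (tensor_comb J b u) \<xi> \<le> (D\<^sup>2 *\<^sub>R (\<Sum>j\<in>J. tensor_form (u j))) \<xi>" for \<xi>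
      using D[of "\<lambda>j. tensor_apply (u j) \<xi>"] tensor_comb(2)[OF J b u]
      by (simp add: tensor_form_def scaleR_fun_def sum_fun_apply)
  qed
  then show ?thesis by (simp only: tensor_size_def functional(3)[OF sD] functional_sum[OF uD])
qed

text \<open>The squared quotient norm under \<open>tensor_value\<close> for the seminorm whose
  square is \<open>tensor_size\<close>. It is comparable to the given norm, and rows from
  \<open>P\<close> act on it through \<Phi> with their own bounds.\<close>

definition quotient_form :: "'h \<Rightarrow> real" where
  "quotient_form h = Inf (tensor_size ` {u. tensor u \<and> tensor_value u = h})"

lemma quotient_form_lower: "(norm h)\<^sup>2 \<le> quotient_form h"
  unfolding quotient_form_def
  by (rule cINF_greatest) (use tensor_size_lower tensor_pure in blast)+

lemma quotient_form_le: "tensor u \<Longrightarrow> quotient_form (tensor_value u) \<le> tensor_size u"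
  unfolding quotient_form_def
  by (rule cINF_lower) (auto intro!: bdd_belowI2[of _ 0] order_trans[OF zero_le_power2 tensor_size_lower])

lemma quotient_form_upper: "quotient_form h \<le> C\<^sup>2 * (norm h)\<^sup>2"
  using quotient_form_le[OF tensor_pure(1), of h] tensor_size_pure[of h] tensor_pure(3)[of h] by simp

lemma quotient_form_approx:
  assumes "e > 0"
  obtains u where "tensor u" "tensor_value u = h" "tensor_size u < quotient_form h + e"
proof -
  have "\<exists>u\<in>{u. tensor u \<and> tensor_value u = h}. tensor_size u < quotient_form h + e"
  proof (rule ccontr)
    assume "\<not> ?thesis"
    moreover have "{u. tensor u \<and> tensor_value u = h} \<noteq> {}" using tensor_pure(1,3)[of h] by blast
    ultimately have "quotient_form h + e \<le> quotient_form h"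
      by (subst (2) quotient_form_def, intro cINF_greatest) (auto simp: not_less)
    then show False using assms by simp
  qed
  then show ?thesis using that by blast
qed

text \<open>Each \<open>h j\<close> is lifted to a tensor of nearly minimal size; the row applied to
  the lifts is a lift of the vector on the left, and \<open>tensor_size_row\<close> bounds
  it.\<close>

lemma quotient_form_row:
  fixes J :: "'j set"
  assumes J: "finite J" and b: "\<And>j. j \<in> J \<Longrightarrow> b j \<in> P"
    and D: "\<And>\<xi> :: 'j \<Rightarrow> 'k. (norm (\<Sum>j\<in>J. blinfun_apply (b j) (\<xi> j)))\<^sup>2 \<le> D\<^sup>2 * (\<Sum>j\<in>J. (norm (\<xi> j))\<^sup>2)"
  shows "quotient_form (\<Sum>j\<in>J. blinfun_apply (\<Phi> (b j)) (h j)) \<le> D\<^sup>2 * (\<Sum>j\<in>J. quotient_form (h j))"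
proof -
  have eps: "quotient_form (\<Sum>j\<in>J. blinfun_apply (\<Phi> (b j)) (h j)) \<le> D\<^sup>2 * (\<Sum>j\<in>J. quotient_form (h j) + e)"
    if e: "e > 0" for e
  proof -
    have "\<forall>j. \<exists>u. tensor u \<and> tensor_value u = h j \<and> tensor_size u < quotient_form (h j) + e"
      using quotient_form_approx[OF e] by metis
    then obtain u where u: "\<And>j. tensor (u j)" "\<And>j. tensor_value (u j) = h j" "\<And>j. tensor_size (u j) < quotient_form (h j) + e"
      by metis
    have "quotient_form (tensor_value (tensor_comb J b u)) \<le> tensor_size (tensor_comb J b u)"
      by (intro quotient_form_le tensor_comb J b u(1))
    also have "\<dots> \<le> D\<^sup>2 * (\<Sum>j\<in>J. tensor_size (u j))" by (intro tensor_size_row J b u(1) D)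
    also have "\<dots> \<le> D\<^sup>2 * (\<Sum>j\<in>J. quotient_form (h j) + e)"
      by (intro mult_left_mono sum_mono less_imp_le[OF u(3)]) auto
    finally show ?thesis using tensor_comb(3)[OF J b u(1)] u(2) by simp
  qed
  have "((\<lambda>e. D\<^sup>2 * (\<Sum>j\<in>J. quotient_form (h j) + e)) \<longlongrightarrow> D\<^sup>2 * (\<Sum>j\<in>J. quotient_form (h j) + 0)) (at_right 0)"
    by (intro tendsto_intros)
  then have "quotient_form (\<Sum>j\<in>J. blinfun_apply (\<Phi> (b j)) (h j)) \<le> D\<^sup>2 * (\<Sum>j\<in>J. quotient_form (h j) + 0)"
    by (rule tendsto_lowerbound) (auto simp: eventually_at_right_field intro!: exI[of _ 1] eps)
  then show ?thesis by simp
qed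

lemma quotient_form_scale: "quotient_form (c *\<^sub>C h) = (cmod c)\<^sup>2 * quotient_form h"
proof -
  have le: "quotient_form (c *\<^sub>C h) \<le> (cmod c)\<^sup>2 * quotient_form h" for c h
    using quotient_form_row[of "{()}" "\<lambda>_. scaleC_op c id_blinfun" "cmod c" "\<lambda>_. h"]
    by (simp add: P_scale P_id \<Phi>_scale \<Phi>_id norm_scaleC power_mult_distrib)
  show ?thesis
  proof (cases "c = 0")
    case True
    then show ?thesis using quotient_form_lower[of 0] quotient_form_upper[of 0] by simp
  next
    case False
    have "quotient_form h \<le> (cmod (1/c))\<^sup>2 * quotient_form (c *\<^sub>C h)"
      using le[of "1/c" "c *\<^sub>C h"] False by (simp add: scaleC_scaleC)
    then have "(cmod c)\<^sup>2 * quotient_form h \<le> quotient_form (c *\<^sub>C h)"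
      using False by (simp add: norm_divide power_divide field_simps)
    with le[of c h] show ?thesis by simp
  qed
qed

text \<open>If \<open>u\<close> and \<open>v\<close> lift \<open>x\<close> and \<open>y\<close>,
  then u + v and u - v lift the sum and the difference, and the parallelogram law holds exactly for
  tensor forms. Nearly minimal lifts give one inequality.\<close>

lemma quotient_form_parallelogram_le:
  "quotient_form (x + y) + quotient_form (x - y) \<le> 2 * quotient_form x + 2 * quotient_form y"
proof (rule field_le_epsilon)
  fix e :: real assume e: "e > 0"
  obtain u where u: "tensor u" "tensor_value u = x" "tensor_size u < quotient_form x + e / 4"
    by (rule quotient_form_approx[of "e / 4" x]) (use e in auto)
  obtain v where v: "tensor v" "tensor_value v = y" "tensor_size v < quotient_form y + e / 4"
    by (rule quotient_form_approx[of "e / 4" y]) (use e in auto)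
  \<comment> \<open>The two-element index type makes the sum and the difference of two tensors
    instances of \<open>tensor_comb\<close>.\<close>
  define t where "t j = (if j then u else v)" for j
  define p where "p = tensor_comb UNIV (\<lambda>_. id_blinfun) t"
  define m where "m = tensor_comb UNIV (\<lambda>j. scaleC_op (if j then 1 else -1) id_blinfun) t"
  have t: "tensor (t j)" for j using u v by (simp add: t_def)
  note cp = tensor_comb[of UNIV "\<lambda>_. id_blinfun" t, folded p_def, OF _ P_id t]
  note cm = tensor_comb[of UNIV "\<lambda>j. scaleC_op (if j then 1 else -1) id_blinfun" t, folded m_def, OF _ P_scale[OF P_id] t]
  have p: "tensor p" "tensor_apply p \<xi> = tensor_apply u \<xi> + tensor_apply v \<xi>" "tensor_value p = x + y" for \<xi>
    using cp by (auto simp: UNIV_bool t_def u v \<Phi>_id)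
  have m: "tensor m" "tensor_apply m \<xi> = tensor_apply u \<xi> - tensor_apply v \<xi>" "tensor_value m = x - y" for \<xi>
    using cm by (auto simp: UNIV_bool t_def u v \<Phi>_id \<Phi>_scale P_id scaleC_minus_left)
  have "tensor_form p + tensor_form m = 2 *\<^sub>R tensor_form u + 2 *\<^sub>R tensor_form v"
    by (simp add: fun_eq_iff scaleR_fun_def tensor_form_def p m)
      (simp add: power2_norm_eq_inner inner_add inner_diff inner_commute)
  from arg_cong[OF this, of functional]
  have "tensor_size p + tensor_size m = 2 * tensor_size u + 2 * tensor_size v"
    using p(1) m(1) u(1) v(1) subspace_scale[OF dominated_subspace]
    by (simp add: functional tensor_form_dominated tensor_size_def)
  then show "quotient_form (x + y) + quotient_form (x - y) \<le> 2 * quotient_form x + 2 * quotient_form y + e"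
    using quotient_form_le[OF p(1)] quotient_form_le[OF m(1)] u(3) v(3) by (simp add: p m)
qed

text \<open>The reverse inequality is \<open>quotient_form_parallelogram_le\<close> at x + y and x -
  y, since the form of 2 z is four times that of z.\<close>

lemma quotient_form_parallelogram:
  "quotient_form (x + y) + quotient_form (x - y) = 2 * quotient_form x + 2 * quotient_form y"
proof (rule antisym)
  have two: "quotient_form (2 *\<^sub>R z) = 4 * quotient_form z" for z
    using quotient_form_scale[of 2 z] scaleR_scaleC[of 2 z] by simp
  have "x + y + (x - y) = 2 *\<^sub>R x" "x + y - (x - y) = 2 *\<^sub>R y" by (simp_all add: scaleR_2)
  then show "2 * quotient_form x + 2 * quotient_form y \<le> quotient_form (x + y) + quotient_form (x - y)"
    using quotient_form_parallelogram_le[of "x + y" "x - y"] by (simp add: two)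
qed (rule quotient_form_parallelogram_le)

text \<open>\<open>X\<close> carries the new norm isometrically to the old one and is fixed before
  \<open>b\<close>, \<open>D\<close> and \<open>h\<close>. The index set will be that of the
  generators, because row norms of n-tuples have to be transferred.\<close>

lemma similar_to_row_contractive:
  fixes J :: "'j set"
  assumes J: "finite J"
  shows "\<exists>X\<in>bounded_clinear_ops. \<exists>X'\<in>bounded_clinear_ops.
    X' o\<^sub>L X = (id_blinfun :: 'h \<Rightarrow>\<^sub>L 'h) \<and> X o\<^sub>L X' = (id_blinfun :: 'h \<Rightarrow>\<^sub>L 'h) \<and>
    (\<forall>b D h. (\<forall>j\<in>J. b j \<in> P) \<longrightarrow>
      (\<forall>\<xi> :: 'j \<Rightarrow> 'k. (norm (\<Sum>j\<in>J. blinfun_apply (b j) (\<xi> j)))\<^sup>2 \<le> D\<^sup>2 * (\<Sum>j\<in>J. (norm (\<xi> j))\<^sup>2)) \<longrightarrow>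
      (norm (\<Sum>j\<in>J. blinfun_apply (X o\<^sub>L \<Phi> (b j) o\<^sub>L X') (h j)))\<^sup>2 \<le> D\<^sup>2 * (\<Sum>j\<in>J. (norm (h j))\<^sup>2))"
proof -
  obtain X X' :: "'h \<Rightarrow>\<^sub>L 'h" where X: "X \<in> bounded_clinear_ops" "X' \<in> bounded_clinear_ops"
    "X' o\<^sub>L X = id_blinfun" "X o\<^sub>L X' = id_blinfun" "\<And>x. (norm (blinfun_apply X x))\<^sup>2 = quotient_form x"
    using equivalent_hilbert_norm[OF quotient_form_parallelogram quotient_form_scale quotient_form_lower quotient_form_upper]
    by blast
  have inv: "blinfun_apply X (blinfun_apply X' z) = z" for z
    using arg_cong[OF X(4), of "\<lambda>T. blinfun_apply T z"] by simp
  have "(norm (\<Sum>j\<in>J. blinfun_apply (X o\<^sub>L \<Phi> (b j) o\<^sub>L X') (h j)))\<^sup>2 \<le> D\<^sup>2 * (\<Sum>j\<in>J. (norm (h j))\<^sup>2)"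
    if b: "\<forall>j\<in>J. b j \<in> P"
      and D: "\<forall>\<xi> :: 'j \<Rightarrow> 'k. (norm (\<Sum>j\<in>J. blinfun_apply (b j) (\<xi> j)))\<^sup>2 \<le> D\<^sup>2 * (\<Sum>j\<in>J. (norm (\<xi> j))\<^sup>2)" for b D h
  proof -
    have "(\<Sum>j\<in>J. blinfun_apply (X o\<^sub>L \<Phi> (b j) o\<^sub>L X') (h j)) =
        blinfun_apply X (\<Sum>j\<in>J. blinfun_apply (\<Phi> (b j)) (blinfun_apply X' (h j)))"
      by (simp add: blinfun.sum_right)
    then have "(norm (\<Sum>j\<in>J. blinfun_apply (X o\<^sub>L \<Phi> (b j) o\<^sub>L X') (h j)))\<^sup>2 =
        quotient_form (\<Sum>j\<in>J. blinfun_apply (\<Phi> (b j)) (blinfun_apply X' (h j)))" by (simp add: X(5))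
    also have "\<dots> \<le> D\<^sup>2 * (\<Sum>j\<in>J. quotient_form (blinfun_apply X' (h j)))"
      by (rule quotient_form_row[OF J]) (use b D in auto)
    also have "(\<Sum>j\<in>J. quotient_form (blinfun_apply X' (h j))) = (\<Sum>j\<in>J. (norm (h j))\<^sup>2)"
      by (simp add: X(5)[symmetric] inv)
    finally show ?thesis .
  qed
  with X(1-4) show ?thesis by (intro bexI[of _ X] bexI[of _ X'] conjI allI impI) auto
qed

end

section \<open>The basis of \<open>\<ell>\<^sup>2\<close> and its shifts\<close>

lift_definition ell2_basis :: "'a \<Rightarrow> 'a ell2" is "\<lambda>a i. if i = a then 1 else 0"
proof -
  fix a :: 'a
  have "{i \<in> UNIV. (cmod (if i = a then 1 else 0))\<^sup>2 \<noteq> 0} \<subseteq> {a}" by auto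
  then show "(\<lambda>i. (cmod (if i = a then 1 else 0))\<^sup>2) summable_on UNIV"
    by (intro finite_nonzero_values_imp_summable_on) (rule finite_subset, auto)
qed

lemma ell2_coeff_simps [simp]:
  "ell2_coeff (u + v) i = ell2_coeff u i + ell2_coeff v i"
  "ell2_coeff (u - v) i = ell2_coeff u i - ell2_coeff v i"
  "ell2_coeff (- u) i = - ell2_coeff u i"
  "ell2_coeff 0 i = 0"
  "ell2_coeff (c *\<^sub>C u) i = c * ell2_coeff u i"
  "ell2_coeff (r *\<^sub>R u) i = of_real r * ell2_coeff u i"
  "ell2_coeff (ell2_basis a) i = (if i = a then 1 else 0)"
  by (simp_all add: plus_ell2.rep_eq minus_ell2.rep_eq uminus_ell2.rep_eq zero_ell2.rep_eq
      scaleC_ell2.rep_eq scaleR_ell2.rep_eq ell2_basis.rep_eq)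

lemma ell2_coeff_sum [simp]: "ell2_coeff (sum f A) i = (\<Sum>a\<in>A. ell2_coeff (f a) i)"
  by (induction A rule: infinite_finite_induct) auto

lemma ell2_eqI: "(\<And>i. ell2_coeff u i = ell2_coeff v i) \<Longrightarrow> u = v"
  by (simp add: ell2_coeff_inject[symmetric] fun_eq_iff)

lemma ell2_summable: "(\<lambda>i. (cmod (ell2_coeff u i))\<^sup>2) summable_on A"
  using summable_on_subset_banach[of "\<lambda>i. (cmod (ell2_coeff u i))\<^sup>2" UNIV A] ell2_coeff[of u] by simp

lemma ell2_norm_sq: "(norm u)\<^sup>2 = (\<Sum>\<^sub>\<infinity>i. (cmod (ell2_coeff u i))\<^sup>2)"
  by (simp add: norm_ell2_def infsum_nonneg)

lemma ell2_finite_sum_le: "finite F \<Longrightarrow> (\<Sum>i\<in>F. (cmod (ell2_coeff u i))\<^sup>2) \<le> (norm u)\<^sup>2"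
  unfolding ell2_norm_sq by (rule finite_sum_le_infsum[OF ell2_summable]) auto

lemma ell2_norm_sq_finite:
  assumes "finite F" "\<And>i. i \<notin> F \<Longrightarrow> ell2_coeff u i = 0"
  shows "(norm u)\<^sup>2 = (\<Sum>i\<in>F. (cmod (ell2_coeff u i))\<^sup>2)"
proof -
  have "(\<Sum>\<^sub>\<infinity>i. (cmod (ell2_coeff u i))\<^sup>2) = (\<Sum>\<^sub>\<infinity>i\<in>F. (cmod (ell2_coeff u i))\<^sup>2)"
    by (rule infsum_cong_neutral) (use assms in auto)
  then show ?thesis using assms(1) by (simp add: ell2_norm_sq)
qed

lemma ell2_tail_small:
  assumes "0 < e"
  shows "\<exists>F. finite F \<and> norm (u - (\<Sum>a\<in>F. ell2_coeff u a *\<^sub>C ell2_basis a)) < e"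
proof -
  have "(\<Sum>\<^sub>\<infinity>i. (cmod (ell2_coeff u i))\<^sup>2) - e\<^sup>2 < (\<Sum>\<^sub>\<infinity>i. (cmod (ell2_coeff u i))\<^sup>2)" using assms by simp
  then have "\<exists>F. finite F \<and> (norm u)\<^sup>2 - e\<^sup>2 < (\<Sum>i\<in>F. (cmod (ell2_coeff u i))\<^sup>2)"
  proof -
    have "(sum (\<lambda>i. (cmod (ell2_coeff u i))\<^sup>2) \<longlongrightarrow> (\<Sum>\<^sub>\<infinity>i. (cmod (ell2_coeff u i))\<^sup>2)) (finite_subsets_at_top UNIV)"
      using has_sum_infsum[OF ell2_summable[of u UNIV]] by (simp add: has_sum_def)
    then have "\<forall>\<^sub>F F in finite_subsets_at_top UNIV. (norm u)\<^sup>2 - e\<^sup>2 < (\<Sum>i\<in>F. (cmod (ell2_coeff u i))\<^sup>2)"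
      by (rule order_tendstoD(1)) (use assms in \<open>simp add: ell2_norm_sq\<close>)
    then show ?thesis unfolding eventually_finite_subsets_at_top by blast
  qed
  then obtain F where F: "finite F" "(norm u)\<^sup>2 - e\<^sup>2 < (\<Sum>i\<in>F. (cmod (ell2_coeff u i))\<^sup>2)" by blast
  define v where "v = u - (\<Sum>a\<in>F. ell2_coeff u a *\<^sub>C ell2_basis a)"
  have v: "ell2_coeff v i = (if i \<in> F then 0 else ell2_coeff u i)" for i
    using F(1) by (simp add: v_def if_distrib[of "(*) _"] cong: if_cong)
  have "(norm u)\<^sup>2 = (\<Sum>\<^sub>\<infinity>i\<in>F \<union> - F. (cmod (ell2_coeff u i))\<^sup>2)" by (simp add: ell2_norm_sq)
  also have "\<dots> = (\<Sum>\<^sub>\<infinity>i\<in>F. (cmod (ell2_coeff u i))\<^sup>2) + (\<Sum>\<^sub>\<infinity>i\<in>- F. (cmod (ell2_coeff u i))\<^sup>2)"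
    by (rule infsum_Un_disjoint) (auto intro: ell2_summable)
  also have "(\<Sum>\<^sub>\<infinity>i\<in>- F. (cmod (ell2_coeff u i))\<^sup>2) = (norm v)\<^sup>2"
    unfolding ell2_norm_sq by (rule infsum_cong_neutral) (auto simp: v)
  finally have "(norm v)\<^sup>2 < e\<^sup>2" using F by simp
  then have "norm v < e" using assms by (simp add: power2_less_imp_less)
  then show ?thesis using F(1) v_def by blast
qed

text \<open>Finitely supported vectors are dense by \<open>ell2_tail_small\<close>, and there
  linearity decides.\<close>

lemma clinear_ell2_eqI:
  assumes S: "S \<in> bounded_clinear_ops" and T: "T \<in> bounded_clinear_ops"
    and eq: "\<And>a. blinfun_apply S (ell2_basis a) = blinfun_apply T (ell2_basis a)"
  shows "S = T"
proof (rule blinfun_eqI)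
  fix u
  define R where "R = S - T"
  have R: "R \<in> bounded_clinear_ops" "blinfun_apply R (ell2_basis a) = 0" for a
    using S T eq by (auto simp: R_def blinfun.diff_left)
  have "norm (blinfun_apply R u) \<le> norm R * e" if e: "0 < e" for e
  proof -
    obtain F where F: "norm (u - (\<Sum>a\<in>F. ell2_coeff u a *\<^sub>C ell2_basis a)) < e"
      using ell2_tail_small[OF e] by blast
    have "blinfun_apply R u = blinfun_apply R (u - (\<Sum>a\<in>F. ell2_coeff u a *\<^sub>C ell2_basis a))"
      by (simp add: blinfun.diff_right blinfun.sum_right clinear_opD[OF R(1)] R(2))
    then have "norm (blinfun_apply R u) \<le> norm R * norm (u - (\<Sum>a\<in>F. ell2_coeff u a *\<^sub>C ell2_basis a))"
      by (simp add: norm_blinfun)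
    also have "\<dots> \<le> norm R * e" using F by (intro mult_left_mono) auto
    finally show ?thesis .
  qed
  note le = this
  have "((\<lambda>e. norm R * e) \<longlongrightarrow> norm R * 0) (at_right 0)" by (intro tendsto_intros)
  then have "norm (blinfun_apply R u) \<le> norm R * 0"
    by (rule tendsto_lowerbound) (auto simp: eventually_at_right_field intro!: exI[of _ 1] le)
  then show "blinfun_apply S u = blinfun_apply T u" by (simp add: R_def blinfun.diff_left)
qed

text \<open>Left shifts, right shifts and the shifts on numbered words all move coefficients along a
  partial injection of index sets. Injectivity makes such a pullback contractive, so boundedness is
  proved once.\<close>

definition injective_partial :: "('b \<Rightarrow> 'a option) \<Rightarrow> bool" where
  "injective_partial \<sigma> \<longleftrightarrow> (\<forall>i j a. \<sigma> i = Some a \<longrightarrow> \<sigma> j = Some a \<longrightarrow> i = j)"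

definition pull_coeff :: "('b \<Rightarrow> 'a option) \<Rightarrow> ('a \<Rightarrow> complex) \<Rightarrow> 'b \<Rightarrow> complex" where
  "pull_coeff \<sigma> u i = (case \<sigma> i of None \<Rightarrow> 0 | Some a \<Rightarrow> u a)"

lemma pull_coeff_sum_le:
  assumes "injective_partial \<sigma>" "finite F"
  shows "(\<Sum>i\<in>F. (cmod (pull_coeff \<sigma> (ell2_coeff u) i))\<^sup>2) \<le> (norm u)\<^sup>2"
proof -
  define G where "G = {i\<in>F. \<sigma> i \<noteq> None}"
  have G: "finite G" "G \<subseteq> F" using assms by (auto simp: G_def)
  have inj: "inj_on (\<lambda>i. the (\<sigma> i)) G"
    using assms(1) by (auto simp: inj_on_def G_def injective_partial_def)
  have "(\<Sum>i\<in>F. (cmod (pull_coeff \<sigma> (ell2_coeff u) i))\<^sup>2) = (\<Sum>i\<in>G. (cmod (pull_coeff \<sigma> (ell2_coeff u) i))\<^sup>2)"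
    by (rule sum.mono_neutral_right) (auto simp: G_def pull_coeff_def assms)
  also have "\<dots> = (\<Sum>i\<in>G. (cmod (ell2_coeff u (the (\<sigma> i))))\<^sup>2)"
    by (rule sum.cong) (auto simp: G_def pull_coeff_def)
  also have "\<dots> = (\<Sum>a\<in>(\<lambda>i. the (\<sigma> i)) ` G. (cmod (ell2_coeff u a))\<^sup>2)"
    by (simp add: sum.reindex[OF inj])
  also have "\<dots> \<le> (norm u)\<^sup>2" by (rule ell2_finite_sum_le) (use G in auto)
  finally show ?thesis .
qed

definition ell2_pull :: "('b \<Rightarrow> 'a option) \<Rightarrow> 'a ell2 \<Rightarrow> 'b ell2" where
  "ell2_pull \<sigma> u = Abs_ell2 (pull_coeff \<sigma> (ell2_coeff u))"

definition pull_op :: "('b \<Rightarrow> 'a option) \<Rightarrow> ('a ell2 \<Rightarrow>\<^sub>L 'b ell2)" where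
  "pull_op \<sigma> = Blinfun (ell2_pull \<sigma>)"

lemma pull_op:
  assumes \<sigma>: "injective_partial \<sigma>"
  shows "ell2_coeff (blinfun_apply (pull_op \<sigma>) u) i = (case \<sigma> i of None \<Rightarrow> 0 | Some a \<Rightarrow> ell2_coeff u a)"
    and "norm (blinfun_apply (pull_op \<sigma>) u) \<le> norm u"
    and "pull_op \<sigma> \<in> bounded_clinear_ops"
proof -
  have "(\<lambda>i. (cmod (pull_coeff \<sigma> (ell2_coeff u) i))\<^sup>2) summable_on UNIV" for u
    using pull_coeff_sum_le[OF \<sigma>, of _ u] by (intro nonneg_bdd_above_summable_on) (auto simp: bdd_above_def)
  then have c: "ell2_coeff (ell2_pull \<sigma> u) = pull_coeff \<sigma> (ell2_coeff u)" for u
    unfolding ell2_pull_def by (intro Abs_ell2_inverse) simp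
  have n: "norm (ell2_pull \<sigma> u) \<le> norm u" for u
  proof -
    have "(norm (ell2_pull \<sigma> u))\<^sup>2 \<le> (norm u)\<^sup>2"
      unfolding ell2_norm_sq[of "ell2_pull \<sigma> u"]
      by (rule infsum_le_finite_sums[OF ell2_summable]) (use pull_coeff_sum_le[OF \<sigma>, of _ u] in \<open>simp add: c\<close>)
    then show ?thesis by (rule power2_le_imp_le) simp
  qed
  have "bounded_linear (ell2_pull \<sigma>)"
    by (rule bounded_linear_intro[where K = 1])
      (auto intro!: ell2_eqI simp: c n pull_coeff_def split: option.split)
  then have a: "blinfun_apply (pull_op \<sigma>) u = ell2_pull \<sigma> u" for u
    by (simp add: pull_op_def bounded_linear_Blinfun_apply)
  show "ell2_coeff (blinfun_apply (pull_op \<sigma>) u) i = (case \<sigma> i of None \<Rightarrow> 0 | Some a \<Rightarrow> ell2_coeff u a)"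
    by (simp add: a c pull_coeff_def)
  show "norm (blinfun_apply (pull_op \<sigma>) u) \<le> norm u" by (simp add: a n)
  show "pull_op \<sigma> \<in> bounded_clinear_ops"
    by (rule clinear_opI, rule ell2_eqI) (auto simp: a c pull_coeff_def split: option.split)
qed

definition lshift :: "'n \<Rightarrow> ('n list ell2 \<Rightarrow>\<^sub>L 'n list ell2)" where
  "lshift j = pull_op (\<lambda>\<gamma>. case \<gamma> of [] \<Rightarrow> None | i # \<alpha> \<Rightarrow> if i = j then Some \<alpha> else None)"

definition rshift :: "'n list \<Rightarrow> ('n list ell2 \<Rightarrow>\<^sub>L 'n list ell2)" where
  "rshift \<beta> = pull_op (\<lambda>\<gamma>. if \<exists>\<alpha>. \<gamma> = \<alpha> @ \<beta> then Some (take (length \<gamma> - length \<beta>) \<gamma>) else None)"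

lemma lshift_coeff:
  "ell2_coeff (blinfun_apply (lshift j) u) \<gamma> = (case \<gamma> of [] \<Rightarrow> 0 | i # \<alpha> \<Rightarrow> if i = j then ell2_coeff u \<alpha> else 0)"
  and lshift_clinear: "lshift j \<in> bounded_clinear_ops"
proof -
  have "injective_partial (\<lambda>\<gamma>. case \<gamma> of [] \<Rightarrow> None | i # \<alpha> \<Rightarrow> if i = j then Some \<alpha> else None)"
    by (auto simp: injective_partial_def split: list.splits if_splits)
  from pull_op[OF this]
  show "ell2_coeff (blinfun_apply (lshift j) u) \<gamma> = (case \<gamma> of [] \<Rightarrow> 0 | i # \<alpha> \<Rightarrow> if i = j then ell2_coeff u \<alpha> else 0)"
    "lshift j \<in> bounded_clinear_ops"
    by (auto simp: lshift_def split: list.split)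
qed

lemma rshift_coeff_append: "ell2_coeff (blinfun_apply (rshift \<beta>) u) (\<alpha> @ \<beta>) = ell2_coeff u \<alpha>"
  and rshift_coeff_other: "(\<And>\<alpha>. \<gamma> \<noteq> \<alpha> @ \<beta>) \<Longrightarrow> ell2_coeff (blinfun_apply (rshift \<beta>) u) \<gamma> = 0"
  and rshift_clinear: "rshift \<beta> \<in> bounded_clinear_ops"
proof -
  have inj: "injective_partial (\<lambda>\<gamma>. if \<exists>\<alpha>. \<gamma> = \<alpha> @ \<beta> then Some (take (length \<gamma> - length \<beta>) \<gamma>) else None)"
    by (auto simp: injective_partial_def split: if_splits)
  note p = pull_op[OF inj, folded rshift_def]
  show "ell2_coeff (blinfun_apply (rshift \<beta>) u) (\<alpha> @ \<beta>) = ell2_coeff u \<alpha>" by (simp add: p(1))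
  show "(\<And>\<alpha>. \<gamma> \<noteq> \<alpha> @ \<beta>) \<Longrightarrow> ell2_coeff (blinfun_apply (rshift \<beta>) u) \<gamma> = 0" by (simp add: p(1))
  show "rshift \<beta> \<in> bounded_clinear_ops" by (rule p(3))
qed

lemma lshift_basis: "blinfun_apply (lshift j) (ell2_basis \<beta>) = ell2_basis (j # \<beta>)"
  by (rule ell2_eqI) (auto simp: lshift_coeff split: list.split)

lemma rshift_basis: "blinfun_apply (rshift \<beta>) (ell2_basis \<alpha>) = ell2_basis (\<alpha> @ \<beta>)"
proof (rule ell2_eqI)
  fix \<gamma>
  show "ell2_coeff (blinfun_apply (rshift \<beta>) (ell2_basis \<alpha>)) \<gamma> = ell2_coeff (ell2_basis (\<alpha> @ \<beta>)) \<gamma>"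
  proof (cases "\<exists>\<delta>. \<gamma> = \<delta> @ \<beta>")
    case True
    then show ?thesis by (auto simp: rshift_coeff_append split: if_splits)
  next
    case False
    then show ?thesis using rshift_coeff_other[of \<gamma> \<beta>] by auto
  qed
qed

text \<open>Left multiplications are exactly the operators that commute with all right multiplications \<open>rshift \<beta>\<close>.\<close>

definition left_multiplication :: "('n list ell2 \<Rightarrow>\<^sub>L 'n list ell2) \<Rightarrow> bool" where
  "left_multiplication T \<longleftrightarrow> T \<in> bounded_clinear_ops \<and> (\<forall>\<beta>. T o\<^sub>L rshift \<beta> = rshift \<beta> o\<^sub>L T)"

lemma left_multiplication_clinear: "left_multiplication T \<Longrightarrow> T \<in> bounded_clinear_ops"
  by (simp add: left_multiplication_def)

text \<open>Every basis vector is a right shift of \<open>ell2_basis []\<close>, so commutation with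
  right shifts can be read off the basis, and the symbol, the image of \<open>ell2_basis []\<close>,
  determines the operator (\<open>left_multiplication_eqI\<close>).\<close>

lemma left_multiplicationI:
  assumes T: "T \<in> bounded_clinear_ops"
    and eq: "\<And>\<beta>. blinfun_apply T (ell2_basis \<beta>) = blinfun_apply (rshift \<beta>) (blinfun_apply T (ell2_basis []))"
  shows "left_multiplication T"
  unfolding left_multiplication_def
proof (intro conjI allI T)
  fix \<beta>
  show "T o\<^sub>L rshift \<beta> = rshift \<beta> o\<^sub>L T"
  proof (rule clinear_ell2_eqI)
    fix \<alpha>
    have "blinfun_apply (rshift \<beta>) (blinfun_apply (rshift \<alpha>) u) = blinfun_apply (rshift (\<alpha> @ \<beta>)) u" for u
    proof -
      have "rshift \<beta> o\<^sub>L rshift \<alpha> = rshift (\<alpha> @ \<beta>)"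
        by (rule clinear_ell2_eqI) (auto simp: rshift_basis intro: rshift_clinear)
      then show ?thesis by (metis blinfun_apply_blinfun_compose)
    qed
    then show "blinfun_apply (T o\<^sub>L rshift \<beta>) (ell2_basis \<alpha>) = blinfun_apply (rshift \<beta> o\<^sub>L T) (ell2_basis \<alpha>)"
      using eq[of "\<alpha> @ \<beta>"] eq[of \<alpha>] by (simp add: rshift_basis)
  qed (auto intro: T rshift_clinear)
qed

lemma left_multiplication_basis:
  assumes "left_multiplication T"
  shows "blinfun_apply T (ell2_basis \<beta>) = blinfun_apply (rshift \<beta>) (blinfun_apply T (ell2_basis []))"
proof -
  have "blinfun_apply (T o\<^sub>L rshift \<beta>) (ell2_basis []) = blinfun_apply (rshift \<beta> o\<^sub>L T) (ell2_basis [])"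
    using assms by (simp add: left_multiplication_def)
  then show ?thesis by (simp add: rshift_basis)
qed

lemma left_multiplication_eqI:
  assumes "left_multiplication S" "left_multiplication T"
    and "blinfun_apply S (ell2_basis []) = blinfun_apply T (ell2_basis [])"
  shows "S = T"
proof (rule clinear_ell2_eqI)
  fix \<beta>
  show "blinfun_apply S (ell2_basis \<beta>) = blinfun_apply T (ell2_basis \<beta>)"
    using left_multiplication_basis[OF assms(1)] left_multiplication_basis[OF assms(2)] assms(3) by metis
qed (use assms left_multiplication_clinear in auto)

lemma left_multiplication_id: "left_multiplication id_blinfun"
  by (simp add: left_multiplication_def)

lemma left_multiplication_compose:
  assumes "left_multiplication S" "left_multiplication T"
  shows "left_multiplication (S o\<^sub>L T)"
proof -
  have "(S o\<^sub>L T) o\<^sub>L rshift \<beta> = rshift \<beta> o\<^sub>L (S o\<^sub>L T)" for \<beta>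
    using assms unfolding left_multiplication_def by (metis blinfun_compose_assoc)
  then show ?thesis using assms by (auto simp: left_multiplication_def)
qed

lemma left_multiplication_scale: "left_multiplication T \<Longrightarrow> left_multiplication (scaleC_op c T)"
  unfolding left_multiplication_def
  by (auto simp: scaleC_op_compose_left scaleC_op_compose_right rshift_clinear)

lemma left_multiplication_sum:
  "(\<And>i. i \<in> I \<Longrightarrow> left_multiplication (T i)) \<Longrightarrow> left_multiplication (sum T I)"
  unfolding left_multiplication_def
  by (auto simp: blinfun_compose_sum_left blinfun_compose_sum_right intro!: sum.cong)

lemma left_multiplication_lshift: "left_multiplication (lshift j)"
  by (rule left_multiplicationI[OF lshift_clinear]) (simp add: lshift_basis rshift_basis)

section \<open>Evaluation of noncommutative polynomials and series\<close>

lemma finite_words [simp]: "finite {\<alpha> :: 'n::finite list. length \<alpha> = k}"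
  using finite_lists_length_eq[of "UNIV :: 'n set" k] by simp

lemma sum_words_Suc:
  "(\<Sum>\<alpha> | length \<alpha> = Suc k. g \<alpha>) = (\<Sum>i\<in>UNIV. \<Sum>\<alpha> | length \<alpha> = k. g (i # \<alpha>))"
  for g :: "'n::finite list \<Rightarrow> 'b::comm_monoid_add"
proof -
  have "{\<alpha> :: 'n list. length \<alpha> = Suc k} = (\<lambda>(i, \<alpha>). i # \<alpha>) ` (UNIV \<times> {\<alpha>. length \<alpha> = k})"
    by (auto simp: image_iff length_Suc_conv)
  moreover have "inj_on (\<lambda>(i, \<alpha>). i # \<alpha>) (UNIV \<times> {\<alpha> :: 'n list. length \<alpha> = k})"
    by (auto simp: inj_on_def)
  ultimately show ?thesis by (simp add: sum.reindex sum.cartesian_product case_prod_unfold)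
qed

lemma op_word_simps [simp]: "op_word X [] = id_blinfun" "op_word X (i # \<alpha>) = X i o\<^sub>L op_word X \<alpha>"
  by (simp_all add: op_word_def)

lemma op_word_append: "op_word X (\<alpha> @ \<beta>) = op_word X \<alpha> o\<^sub>L op_word X \<beta>"
  by (induction \<alpha>) (auto simp: blinfun_compose_assoc)

lemma op_word_clinear: "(\<And>i. X i \<in> bounded_clinear_ops) \<Longrightarrow> op_word X \<alpha> \<in> bounded_clinear_ops"
  by (induction \<alpha>) auto

lemma op_word_scaleR: "op_word (\<lambda>i. r *\<^sub>R X i) \<alpha> = r ^ length \<alpha> *\<^sub>R op_word X \<alpha>"
  by (induction \<alpha>) (auto intro!: blinfun_eqI simp: blinfun.scaleR_left blinfun.scaleR_right)

lemma nc_term_clinear: "(\<And>i. X i \<in> bounded_clinear_ops) \<Longrightarrow> nc_term c X k \<in> bounded_clinear_ops"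
  unfolding nc_term_def by (intro clinear_sum clinear_scaleC_op op_word_clinear)

lemma nc_poly_eval_clinear: "(\<And>i. X i \<in> bounded_clinear_ops) \<Longrightarrow> nc_poly_eval p X \<in> bounded_clinear_ops"
  unfolding nc_poly_eval_def by (intro clinear_sum clinear_scaleC_op op_word_clinear)

lemma nc_eval_clinear:
  assumes "\<And>i. X i \<in> bounded_clinear_ops" "summable (nc_term c X)"
  shows "nc_eval c X \<in> bounded_clinear_ops"
  using summable_LIMSEQ[OF assms(2)] unfolding nc_eval_def
  by (rule clinear_limit) (auto intro: nc_term_clinear assms(1))

lemma nc_term_scaleR: "nc_term c (\<lambda>i. r *\<^sub>R X i) k = r ^ k *\<^sub>R nc_term c X k"
proof -
  have "scaleC_op (c \<alpha>) (r ^ k *\<^sub>R op_word X \<alpha>) = r ^ k *\<^sub>R scaleC_op (c \<alpha>) (op_word X \<alpha>)" for \<alpha>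
    by (rule blinfun_eqI) (simp add: blinfun.scaleR_left scaleR_scaleC scaleC_scaleC mult.commute)
  then show ?thesis by (simp add: nc_term_def op_word_scaleR scaleR_sum_right)
qed

lemma nc_term_coeff_scale: "nc_term (\<lambda>\<alpha>. of_real r ^ length \<alpha> * c \<alpha>) X k = r ^ k *\<^sub>R nc_term c X k"
  unfolding nc_term_def scaleR_sum_right
  by (rule sum.cong) (auto intro!: blinfun_eqI simp: blinfun.scaleR_left scaleR_scaleC scaleC_scaleC)

text \<open>The words of length \<open>k\<close> form a row that factors through \<open>X\<close>
  letter by letter, each letter costing a factor \<open>D\<close>.\<close>

lemma word_row_bound:
  assumes "row_norm X \<le> D"
  shows "(norm (\<Sum>\<alpha> | length \<alpha> = k. blinfun_apply (op_word X \<alpha>) (h \<alpha>)))\<^sup>2 \<le> (D\<^sup>2) ^ k * (\<Sum>\<alpha> | length \<alpha> = k. (norm (h \<alpha>))\<^sup>2)"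
proof (induction k arbitrary: h)
  case (Suc k)
  have "(\<Sum>\<alpha> | length \<alpha> = Suc k. blinfun_apply (op_word X \<alpha>) (h \<alpha>)) =
      (\<Sum>i\<in>UNIV. blinfun_apply (X i) (\<Sum>\<alpha> | length \<alpha> = k. blinfun_apply (op_word X \<alpha>) (h (i # \<alpha>))))"
    unfolding sum_words_Suc by (simp add: blinfun.sum_right)
  then have "(norm (\<Sum>\<alpha> | length \<alpha> = Suc k. blinfun_apply (op_word X \<alpha>) (h \<alpha>)))\<^sup>2 \<le>
      D\<^sup>2 * (\<Sum>i\<in>UNIV. (norm (\<Sum>\<alpha> | length \<alpha> = k. blinfun_apply (op_word X \<alpha>) (h (i # \<alpha>))))\<^sup>2)"
    using row_normD[OF assms] by simp
  also have "\<dots> \<le> D\<^sup>2 * (\<Sum>i\<in>UNIV. (D\<^sup>2) ^ k * (\<Sum>\<alpha> | length \<alpha> = k. (norm (h (i # \<alpha>)))\<^sup>2))"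
    by (intro mult_left_mono sum_mono Suc.IH) auto
  also have "\<dots> = (D\<^sup>2) ^ Suc k * (\<Sum>\<alpha> | length \<alpha> = Suc k. (norm (h \<alpha>))\<^sup>2)"
    unfolding sum_words_Suc by (simp add: sum_distrib_left mult.assoc)
  finally show ?case .
qed simp

text \<open>The sequence whose radius of convergence is \<open>nc_radius\<close>; together with
  \<open>word_row_bound\<close> it controls the homogeneous part of degree \<open>k\<close>.\<close>

definition degree_norm :: "'n::finite nc_series \<Rightarrow> nat \<Rightarrow> real" where
  "degree_norm c k = sqrt (\<Sum>\<alpha> | length \<alpha> = k. (cmod (c \<alpha>))\<^sup>2)"

lemma degree_norm_nonneg: "0 \<le> degree_norm c k"
  by (simp add: degree_norm_def sum_nonneg)

lemma degree_norm_sq: "(degree_norm c k)\<^sup>2 = (\<Sum>\<alpha> | length \<alpha> = k. (cmod (c \<alpha>))\<^sup>2)"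
  by (simp add: degree_norm_def sum_nonneg)

lemma nc_term_apply:
  assumes "\<And>i. X i \<in> bounded_clinear_ops"
  shows "blinfun_apply (nc_term c X k) h = (\<Sum>\<alpha> | length \<alpha> = k. blinfun_apply (op_word X \<alpha>) (c \<alpha> *\<^sub>C h))"
  by (simp add: nc_term_def blinfun.sum_left clinear_opD[OF op_word_clinear[OF assms]])

lemma norm_nc_term_le:
  assumes clin: "\<And>i. X i \<in> bounded_clinear_ops" and X: "row_norm X \<le> D"
  shows "norm (nc_term c X k) \<le> D ^ k * degree_norm c k"
proof (rule norm_blinfun_bound)
  have D: "0 \<le> D" using X row_norm_nonneg[of X] by simp
  then show nn: "0 \<le> D ^ k * degree_norm c k" by (simp add: degree_norm_nonneg)
  fix h
  have "(norm (blinfun_apply (nc_term c X k) h))\<^sup>2 \<le> (D\<^sup>2) ^ k * (\<Sum>\<alpha> | length \<alpha> = k. (norm (c \<alpha> *\<^sub>C h))\<^sup>2)"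
    unfolding nc_term_apply[OF clin] by (rule word_row_bound[OF X])
  also have "\<dots> = (D ^ k * degree_norm c k * norm h)\<^sup>2"
    by (simp add: norm_scaleC power_mult_distrib degree_norm_sq sum_distrib_right sum_distrib_left power_mult[symmetric] mult.commute mult.left_commute)
  finally show "norm (blinfun_apply (nc_term c X k) h) \<le> D ^ k * degree_norm c k * norm h"
    by (rule power2_le_imp_le) (use nn in simp)
qed

lemma degree_norm_ell2_le: "degree_norm (ell2_coeff u) k \<le> norm u"
  unfolding degree_norm_def using ell2_finite_sum_le[of "{\<alpha>. length \<alpha> = k}" u] by (simp add: real_le_lsqrt)

text \<open>Comparison with a geometric series of ratio \<open>row_norm Z\<close>. The explicit
  remainder is there for the locally uniform convergence in
  \<open>composition_vanishes\<close>.\<close>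

lemma nc_eval_summable:
  fixes Z :: "'n::finite \<Rightarrow> ('a::complex_hilbert_space \<Rightarrow>\<^sub>L 'a)"
  assumes clin: "\<And>i. Z i \<in> bounded_clinear_ops" and Z: "row_norm Z < 1"
    and c: "\<And>k. degree_norm c k \<le> B"
  shows "summable (nc_term c Z)" "norm (nc_eval c Z) \<le> B / (1 - row_norm Z)"
    "norm (nc_eval c Z - (\<Sum>k<N. nc_term c Z k)) \<le> B * row_norm Z ^ N / (1 - row_norm Z)"
proof -
  define r where "r = row_norm Z"
  have r: "0 \<le> r" "r < 1" using Z row_norm_nonneg[of Z] by (auto simp: r_def)
  have le: "norm (nc_term c Z k) \<le> r ^ k * B" for k
    using norm_nc_term_le[where X = Z and D = r and c = c and k = k, OF clin] mult_left_mono[OF c[of k], of "r ^ k"] r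
    by (simp add: r_def)
  have geo: "summable (\<lambda>k. r ^ k * B)" using r by (intro summable_mult2 summable_geometric) auto
  show s: "summable (nc_term c Z)" by (rule summable_comparison_test'[OF geo le])
  have tail: "norm (\<Sum>k. nc_term c Z (k + N)) \<le> r ^ N * (1 / (1 - r)) * B" for N
  proof -
    have g: "(\<lambda>k. r ^ k * (r ^ N * B)) sums ((1 / (1 - r)) * (r ^ N * B))"
      using r by (intro sums_mult2 geometric_sums) auto
    have le': "norm (nc_term c Z (k + N)) \<le> r ^ k * (r ^ N * B)" for k
      using le[of "k + N"] by (simp add: power_add mult.assoc)
    have "summable (\<lambda>k. norm (nc_term c Z (k + N)))"
      by (rule summable_comparison_test'[OF sums_summable[OF g], of 0]) (use le' in auto)
    then have "norm (\<Sum>k. nc_term c Z (k + N)) \<le> (\<Sum>k. norm (nc_term c Z (k + N)))" by (rule summable_norm)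
    also have "\<dots> \<le> (\<Sum>k. r ^ k * (r ^ N * B))"
      by (intro suminf_le le' sums_summable[OF g] \<open>summable (\<lambda>k. norm (nc_term c Z (k + N)))\<close>)
    also have "\<dots> = (1 / (1 - r)) * (r ^ N * B)" using g by (rule sums_unique[symmetric])
    finally show ?thesis by (simp add: mult.commute mult.left_commute)
  qed
  show "norm (nc_eval c Z) \<le> B / (1 - row_norm Z)"
    using tail[of 0] by (simp add: nc_eval_def r_def)
  show "norm (nc_eval c Z - (\<Sum>k<N. nc_term c Z k)) \<le> B * row_norm Z ^ N / (1 - row_norm Z)"
    using tail[of N] suminf_split_initial_segment[OF s, of N] by (simp add: nc_eval_def r_def mult.commute)
qed

section \<open>Evaluation of square-summable series at a strict row contraction\<close>

locale strict_row =
  fixes Z :: "'n::finite \<Rightarrow> ('a::complex_hilbert_space \<Rightarrow>\<^sub>L 'a)"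
  assumes Z_clinear: "\<And>i. Z i \<in> bounded_clinear_ops" and Z_strict: "row_norm Z < 1"
begin

definition ev :: "'n list ell2 \<Rightarrow> ('a \<Rightarrow>\<^sub>L 'a)" where
  "ev u = nc_eval (ell2_coeff u) Z"

lemma ev_summable: "summable (nc_term (ell2_coeff u) Z)"
  by (rule nc_eval_summable(1)[OF Z_clinear Z_strict degree_norm_ell2_le])

lemma norm_ev_le: "norm (ev u) \<le> norm u / (1 - row_norm Z)"
  unfolding ev_def by (rule nc_eval_summable(2)[OF Z_clinear Z_strict degree_norm_ell2_le])

lemma ev_clinear: "ev u \<in> bounded_clinear_ops"
  unfolding ev_def by (rule nc_eval_clinear[OF Z_clinear ev_summable])

lemma ev_add: "ev (u + v) = ev u + ev v"
proof -
  have "nc_term (ell2_coeff (u + v)) Z = (\<lambda>k. nc_term (ell2_coeff u) Z k + nc_term (ell2_coeff v) Z k)"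
    by (simp add: fun_eq_iff nc_term_def scaleC_op_add_left sum.distrib)
  then show ?thesis by (simp add: ev_def nc_eval_def suminf_add[OF ev_summable ev_summable])
qed

lemma ev_scale: "ev (c *\<^sub>C u) = scaleC_op c (ev u)"
proof (rule blinfun_eqI)
  fix h
  have "nc_term (ell2_coeff (c *\<^sub>C u)) Z k = scaleC_op c (nc_term (ell2_coeff u) Z k)" for k
    by (simp add: nc_term_def scaleC_op_sum_right)
  moreover have "(\<lambda>k. nc_term (ell2_coeff u) Z k) sums ev u"
    unfolding ev_def nc_eval_def by (rule summable_sums[OF ev_summable])
  then have "(\<lambda>k. c *\<^sub>C blinfun_apply (nc_term (ell2_coeff u) Z k) h) sums (c *\<^sub>C blinfun_apply (ev u) h)"
    by (intro bounded_linear.sums[OF bounded_linear_scaleC] bounded_linear.sums[OF blinfun.bounded_linear_left])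
  moreover have "(\<lambda>k. blinfun_apply (nc_term (ell2_coeff (c *\<^sub>C u)) Z k) h) sums blinfun_apply (ev (c *\<^sub>C u)) h"
    unfolding ev_def nc_eval_def
    by (intro bounded_linear.sums[OF blinfun.bounded_linear_left] summable_sums[OF ev_summable])
  ultimately show "blinfun_apply (ev (c *\<^sub>C u)) h = blinfun_apply (scaleC_op c (ev u)) h"
    by (simp add: sums_unique2)
qed

lemma ev_sum: "ev (sum f I) = (\<Sum>i\<in>I. ev (f i))"
proof (induction I rule: infinite_finite_induct)
  have "ev 0 = 0" using ev_add[of 0 0] by simp
  { case empty then show ?case using \<open>ev 0 = 0\<close> by simp }
  { case infinite then show ?case using \<open>ev 0 = 0\<close> by simp }
qed (auto simp: ev_add)

text \<open>At a fixed vector, evaluation is a bounded complex-linear map on the space of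
  square-summable series, so identities between evaluations can be checked on basis vectors.\<close>

definition ev_at :: "'a \<Rightarrow> ('n list ell2 \<Rightarrow>\<^sub>L 'a)" where
  "ev_at h = Blinfun (\<lambda>u. blinfun_apply (ev u) h)"

lemma ev_at_apply [simp]: "blinfun_apply (ev_at h) u = blinfun_apply (ev u) h"
proof -
  have "bounded_linear (\<lambda>u. blinfun_apply (ev u) h)"
  proof (rule bounded_linear_intro[where K = "norm h / (1 - row_norm Z)"])
    fix u v :: "'n list ell2" and r :: real
    show "blinfun_apply (ev (u + v)) h = blinfun_apply (ev u) h + blinfun_apply (ev v) h"
      by (simp add: ev_add blinfun.add_left)
    show "blinfun_apply (ev (r *\<^sub>R u)) h = r *\<^sub>R blinfun_apply (ev u) h"
      unfolding scaleR_scaleC ev_scale by simp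
    have "norm (blinfun_apply (ev u) h) \<le> norm (ev u) * norm h" by (rule norm_blinfun)
    also have "\<dots> \<le> (norm u / (1 - row_norm Z)) * norm h" by (intro mult_right_mono norm_ev_le) auto
    finally show "norm (blinfun_apply (ev u) h) \<le> norm u * (norm h / (1 - row_norm Z))" by simp
  qed
  then show ?thesis by (simp add: ev_at_def bounded_linear_Blinfun_apply)
qed

lemma ev_at_clinear: "ev_at h \<in> bounded_clinear_ops"
  by (rule clinear_opI) (simp add: ev_scale)

lemma nc_term_basis: "nc_term (ell2_coeff (ell2_basis \<beta>)) X k = (if k = length \<beta> then op_word X \<beta> else 0)"
proof -
  have "nc_term (ell2_coeff (ell2_basis \<beta>)) X k = (\<Sum>\<alpha> | length \<alpha> = k. if \<alpha> = \<beta> then op_word X \<beta> else 0)"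
    unfolding nc_term_def by (intro sum.cong) auto
  then show ?thesis by (simp add: sum.delta)
qed

lemma ev_basis: "ev (ell2_basis \<beta>) = op_word Z \<beta>"
proof -
  have "nc_term (ell2_coeff (ell2_basis \<beta>)) Z sums (\<Sum>k\<in>{length \<beta>}. nc_term (ell2_coeff (ell2_basis \<beta>)) Z k)"
    by (rule sums_finite) (auto simp: nc_term_basis)
  then have "nc_term (ell2_coeff (ell2_basis \<beta>)) Z sums op_word Z \<beta>" by (simp add: nc_term_basis)
  then show ?thesis unfolding ev_def nc_eval_def by (rule sums_unique[symmetric])
qed

text \<open>On basis vectors this is the concatenation rule \<open>op_word_append\<close>.\<close>

lemma ev_rshift: "ev (blinfun_apply (rshift \<beta>) u) = ev u o\<^sub>L op_word Z \<beta>"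
proof (rule blinfun_eqI)
  fix h
  have "ev_at h o\<^sub>L rshift \<beta> = ev_at (blinfun_apply (op_word Z \<beta>) h)"
    by (rule clinear_ell2_eqI) (auto simp: ev_at_clinear rshift_clinear rshift_basis ev_basis op_word_append)
  from arg_cong[OF this, of "\<lambda>T. blinfun_apply T u"]
  show "blinfun_apply (ev (blinfun_apply (rshift \<beta>) u)) h = blinfun_apply (ev u o\<^sub>L op_word Z \<beta>) h" by simp
qed

text \<open>Multiplicativity of the evaluation: \<open>T\<close> maps
  \<open>ell2_basis \<beta>\<close> to a right shift of its symbol, and right shifts evaluate to
  right factors by \<open>ev_rshift\<close>.\<close>

lemma ev_left_multiplication:
  assumes T: "left_multiplication T"
  shows "ev (blinfun_apply T u) = ev (blinfun_apply T (ell2_basis [])) o\<^sub>L ev u"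
proof (rule blinfun_eqI)
  fix h
  have "ev_at h o\<^sub>L T = ev (blinfun_apply T (ell2_basis [])) o\<^sub>L ev_at h"
  proof (rule clinear_ell2_eqI)
    fix \<beta>
    have eq: "blinfun_apply T (ell2_basis \<beta>) = blinfun_apply (rshift \<beta>) (blinfun_apply T (ell2_basis []))"
      by (rule left_multiplication_basis[OF T])
    show "blinfun_apply (ev_at h o\<^sub>L T) (ell2_basis \<beta>) = blinfun_apply (ev (blinfun_apply T (ell2_basis [])) o\<^sub>L ev_at h) (ell2_basis \<beta>)"
      by (simp add: ev_basis eq ev_rshift)
  qed (auto simp: ev_at_clinear ev_clinear left_multiplication_clinear[OF T])
  from arg_cong[OF this, of "\<lambda>T. blinfun_apply T u"]
  show "blinfun_apply (ev (blinfun_apply T u)) h = blinfun_apply (ev (blinfun_apply T (ell2_basis [])) o\<^sub>L ev u) h" by simp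
qed

end

section \<open>The algebra of polynomials and its evaluations\<close>

lemma nc_poly_eval_superset:
  "finite F \<Longrightarrow> {\<alpha>. p \<alpha> \<noteq> 0} \<subseteq> F \<Longrightarrow> nc_poly_eval p X = (\<Sum>\<alpha>\<in>F. scaleC_op (p \<alpha>) (op_word X \<alpha>))"
  unfolding nc_poly_eval_def by (rule sum.mono_neutral_left) auto

lemma nc_polynomial_add: "nc_polynomial p \<Longrightarrow> nc_polynomial q \<Longrightarrow> nc_polynomial (\<lambda>\<alpha>. p \<alpha> + q \<alpha>)"
  unfolding nc_polynomial_def by (rule finite_subset[of _ "{\<alpha>. p \<alpha> \<noteq> 0} \<union> {\<alpha>. q \<alpha> \<noteq> 0}"]) auto

lemma nc_poly_eval_add:
  assumes "nc_polynomial p" "nc_polynomial q"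
  shows "nc_poly_eval (\<lambda>\<alpha>. p \<alpha> + q \<alpha>) X = nc_poly_eval p X + nc_poly_eval q X"
proof -
  define F where "F = {\<alpha>. p \<alpha> \<noteq> 0} \<union> {\<alpha>. q \<alpha> \<noteq> 0}"
  have F: "finite F" "{\<alpha>. p \<alpha> \<noteq> 0} \<subseteq> F" "{\<alpha>. q \<alpha> \<noteq> 0} \<subseteq> F" "{\<alpha>. p \<alpha> + q \<alpha> \<noteq> 0} \<subseteq> F"
    using assms by (auto simp: F_def nc_polynomial_def)
  show ?thesis
    unfolding nc_poly_eval_superset[OF F(1,2)] nc_poly_eval_superset[OF F(1,3)] nc_poly_eval_superset[OF F(1,4)]
    by (simp add: scaleC_op_add_left sum.distrib)
qed

lemma nc_polynomial_scale: "nc_polynomial p \<Longrightarrow> nc_polynomial (\<lambda>\<alpha>. c * p \<alpha>)"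
  unfolding nc_polynomial_def by (rule rev_finite_subset) auto

lemma nc_poly_eval_scale: "nc_polynomial p \<Longrightarrow> nc_poly_eval (\<lambda>\<alpha>. c * p \<alpha>) X = scaleC_op c (nc_poly_eval p X)"
  using nc_poly_eval_superset[of "{\<alpha>. p \<alpha> \<noteq> 0}" "\<lambda>\<alpha>. c * p \<alpha>" X]
  by (auto simp: nc_polynomial_def nc_poly_eval_def scaleC_op_sum_right)

lemma nc_polynomial_one: "nc_polynomial nc_one"
  unfolding nc_polynomial_def nc_one_def by (rule finite_subset[of _ "{[]}"]) auto

lemma nc_poly_eval_one: "nc_poly_eval nc_one X = id_blinfun"
  using nc_poly_eval_superset[of "{[]}" nc_one X] by (auto simp: nc_one_def)

lemma nc_polynomial_var: "nc_polynomial (nc_var i)"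
  unfolding nc_polynomial_def nc_var_def by (rule finite_subset[of _ "{[i]}"]) auto

lemma nc_poly_eval_var: "nc_poly_eval (nc_var i) X = X i"
  using nc_poly_eval_superset[of "{[i]}" "nc_var i" X] by (auto simp: nc_var_def)

text \<open>The cut positions of \<gamma> correspond one to one to its factorizations into two
  words, so the convolution becomes a sum over pairs of words.\<close>

lemma nc_mult_eq_sum:
  assumes F: "finite F" "{\<alpha>. p \<alpha> \<noteq> 0} \<subseteq> F" and G: "finite G" "{\<alpha>. q \<alpha> \<noteq> 0} \<subseteq> G"
  shows "nc_mult p q \<gamma> = (\<Sum>(\<alpha>, \<beta>)\<in>F \<times> G. if \<alpha> @ \<beta> = \<gamma> then p \<alpha> * q \<beta> else 0)"
proof -
  define S where "S = {(\<alpha>, \<beta>). \<alpha> @ \<beta> = \<gamma>}"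
  have S: "S = (\<lambda>k. (take k \<gamma>, drop k \<gamma>)) ` {..length \<gamma>}"
  proof (intro equalityI subsetI)
    fix x assume "x \<in> S"
    then obtain \<alpha> \<beta> where "x = (\<alpha>, \<beta>)" "\<alpha> @ \<beta> = \<gamma>" by (auto simp: S_def)
    then show "x \<in> (\<lambda>k. (take k \<gamma>, drop k \<gamma>)) ` {..length \<gamma>}" by (auto intro!: image_eqI[of _ _ "length \<alpha>"])
  qed (auto simp: S_def)
  have inj: "inj_on (\<lambda>k. (take k \<gamma>, drop k \<gamma>)) {..length \<gamma>}"
    by (rule inj_onI) (metis Pair_inject atMost_iff length_take min.absorb2)
  have "nc_mult p q \<gamma> = (\<Sum>(\<alpha>, \<beta>)\<in>S. p \<alpha> * q \<beta>)"
    unfolding S nc_mult_def by (simp add: sum.reindex[OF inj])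
  also have "\<dots> = (\<Sum>(\<alpha>, \<beta>)\<in>S \<inter> F \<times> G. p \<alpha> * q \<beta>)"
    by (rule sum.mono_neutral_right) (use F G S in auto)
  also have "\<dots> = (\<Sum>(\<alpha>, \<beta>)\<in>F \<times> G. if \<alpha> @ \<beta> = \<gamma> then p \<alpha> * q \<beta> else 0)"
    by (rule sum.mono_neutral_cong_left) (use F G in \<open>auto simp: S_def split: if_splits\<close>)
  finally show ?thesis .
qed

lemma nc_mult_support:
  assumes "finite {\<alpha>. p \<alpha> \<noteq> 0}" "finite {\<alpha>. q \<alpha> \<noteq> 0}"
  shows "{\<gamma>. nc_mult p q \<gamma> \<noteq> 0} \<subseteq> (\<lambda>(\<alpha>, \<beta>). \<alpha> @ \<beta>) ` ({\<alpha>. p \<alpha> \<noteq> 0} \<times> {\<alpha>. q \<alpha> \<noteq> 0})"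
proof
  fix \<gamma> assume "\<gamma> \<in> {\<gamma>. nc_mult p q \<gamma> \<noteq> 0}"
  then have "(\<Sum>(\<alpha>, \<beta>)\<in>{\<alpha>. p \<alpha> \<noteq> 0} \<times> {\<alpha>. q \<alpha> \<noteq> 0}. if \<alpha> @ \<beta> = \<gamma> then p \<alpha> * q \<beta> else 0) \<noteq> 0"
    using nc_mult_eq_sum[OF assms(1) order_refl assms(2) order_refl] by simp
  then obtain x where "x \<in> {\<alpha>. p \<alpha> \<noteq> 0} \<times> {\<alpha>. q \<alpha> \<noteq> 0}" "(case x of (\<alpha>, \<beta>) \<Rightarrow> if \<alpha> @ \<beta> = \<gamma> then p \<alpha> * q \<beta> else 0) \<noteq> 0"
    by (rule sum.not_neutral_contains_not_neutral)
  then show "\<gamma> \<in> (\<lambda>(\<alpha>, \<beta>). \<alpha> @ \<beta>) ` ({\<alpha>. p \<alpha> \<noteq> 0} \<times> {\<alpha>. q \<alpha> \<noteq> 0})" by (auto split: if_splits)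
qed

lemma nc_polynomial_mult: "nc_polynomial p \<Longrightarrow> nc_polynomial q \<Longrightarrow> nc_polynomial (nc_mult p q)"
  unfolding nc_polynomial_def by (rule finite_subset[OF nc_mult_support]) auto

lemma nc_poly_eval_mult:
  assumes p: "nc_polynomial p" and q: "nc_polynomial q" and X: "\<And>i. X i \<in> bounded_clinear_ops"
  shows "nc_poly_eval (nc_mult p q) X = nc_poly_eval p X o\<^sub>L nc_poly_eval q X"
proof -
  define F where "F = {\<alpha>. p \<alpha> \<noteq> 0}"
  define G where "G = {\<alpha>. q \<alpha> \<noteq> 0}"
  define H where "H = (\<lambda>(\<alpha>, \<beta>). \<alpha> @ \<beta>) ` (F \<times> G)"
  have fin: "finite F" "finite G" using p q by (auto simp: F_def G_def nc_polynomial_def)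
  have H: "finite H" "{\<gamma>. nc_mult p q \<gamma> \<noteq> 0} \<subseteq> H"
    using nc_mult_support[of p q] fin by (auto simp: H_def F_def G_def)
  have "nc_poly_eval (nc_mult p q) X = (\<Sum>\<gamma>\<in>H. scaleC_op (nc_mult p q \<gamma>) (op_word X \<gamma>))"
    by (rule nc_poly_eval_superset[OF H])
  also have "\<dots> = (\<Sum>\<gamma>\<in>H. \<Sum>(\<alpha>, \<beta>)\<in>F \<times> G. if \<alpha> @ \<beta> = \<gamma> then scaleC_op (p \<alpha> * q \<beta>) (op_word X \<gamma>) else 0)"
  proof (rule sum.cong[OF refl])
    fix \<gamma>
    have "nc_mult p q \<gamma> = (\<Sum>(\<alpha>, \<beta>)\<in>F \<times> G. if \<alpha> @ \<beta> = \<gamma> then p \<alpha> * q \<beta> else 0)"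
      by (rule nc_mult_eq_sum) (use fin in \<open>auto simp: F_def G_def\<close>)
    then show "scaleC_op (nc_mult p q \<gamma>) (op_word X \<gamma>) =
        (\<Sum>(\<alpha>, \<beta>)\<in>F \<times> G. if \<alpha> @ \<beta> = \<gamma> then scaleC_op (p \<alpha> * q \<beta>) (op_word X \<gamma>) else 0)"
      by (auto simp: scaleC_op_sum_left intro!: sum.cong)
  qed
  also have "\<dots> = (\<Sum>(\<alpha>, \<beta>)\<in>F \<times> G. \<Sum>\<gamma>\<in>H. if \<alpha> @ \<beta> = \<gamma> then scaleC_op (p \<alpha> * q \<beta>) (op_word X \<gamma>) else 0)"
    by (subst sum.swap) (simp add: case_prod_unfold)
  also have "\<dots> = (\<Sum>(\<alpha>, \<beta>)\<in>F \<times> G. scaleC_op (p \<alpha> * q \<beta>) (op_word X (\<alpha> @ \<beta>)))"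
    using H(1) by (intro sum.cong) (auto simp: H_def)
  also have "\<dots> = nc_poly_eval p X o\<^sub>L nc_poly_eval q X"
  proof -
    have "nc_poly_eval p X o\<^sub>L nc_poly_eval q X =
        (\<Sum>\<alpha>\<in>F. \<Sum>\<beta>\<in>G. scaleC_op (p \<alpha>) (op_word X \<alpha>) o\<^sub>L scaleC_op (q \<beta>) (op_word X \<beta>))"
      unfolding nc_poly_eval_def F_def[symmetric] G_def[symmetric]
      by (subst blinfun_compose_sum_left) (simp only: blinfun_compose_sum_right)
    then show ?thesis
      by (simp add: sum.cartesian_product op_word_append scaleC_op_compose_left scaleC_op_compose_right op_word_clinear X)
  qed
  finally show ?thesis .
qed

lemma nc_term_polynomial:
  "nc_polynomial (\<lambda>\<alpha>. if length \<alpha> = k then c \<alpha> else 0)"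
  "nc_poly_eval (\<lambda>\<alpha>. if length \<alpha> = k then c \<alpha> else 0) X = nc_term c X k"
  for c :: "'n::finite nc_series"
proof -
  have sub: "{\<alpha>. (if length \<alpha> = k then c \<alpha> else 0) \<noteq> 0} \<subseteq> {\<alpha>. length \<alpha> = k}" by auto
  show "nc_polynomial (\<lambda>\<alpha>. if length \<alpha> = k then c \<alpha> else 0)"
    unfolding nc_polynomial_def by (rule finite_subset[OF sub]) simp
  show "nc_poly_eval (\<lambda>\<alpha>. if length \<alpha> = k then c \<alpha> else 0) X = nc_term c X k"
    unfolding nc_poly_eval_superset[OF finite_words sub] nc_term_def by simp
qed

lemma nc_term_sums_poly_eval:
  fixes p :: "'n::finite nc_series"
  assumes "nc_polynomial p"
  shows "nc_term p X sums nc_poly_eval p X" and "\<exists>N. \<forall>k\<ge>N. nc_term p X k = 0"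
    and "\<exists>N. \<forall>M\<ge>N. (\<Sum>k<M. nc_term p X k) = nc_poly_eval p X"
proof -
  have fin: "finite {\<alpha>. p \<alpha> \<noteq> 0}" using assms by (simp add: nc_polynomial_def)
  define N where "N = Suc (Max (insert 0 (length ` {\<alpha>. p \<alpha> \<noteq> 0})))"
  have N: "length \<alpha> < N" if "p \<alpha> \<noteq> 0" for \<alpha>
    unfolding N_def using that fin by (intro le_imp_less_Suc Max_ge) auto
  have z: "nc_term p X k = 0" if "k \<ge> N" for k
  proof -
    have "p \<alpha> = 0" if "length \<alpha> = k" for \<alpha> using N[of \<alpha>] that \<open>k \<ge> N\<close> by force
    then show ?thesis unfolding nc_term_def by (intro sum.neutral) auto
  qed
  then show "\<exists>N. \<forall>k\<ge>N. nc_term p X k = 0" by blast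
  have s: "(\<Sum>k<M. nc_term p X k) = nc_poly_eval p X" if "M \<ge> N" for M
  proof -
    have "(\<Sum>k<M. nc_term p X k) = (\<Sum>\<alpha>\<in>(\<Union>k<M. {\<alpha>. length \<alpha> = k}). scaleC_op (p \<alpha>) (op_word X \<alpha>))"
      unfolding nc_term_def by (rule sum.UNION_disjoint[symmetric]) auto
    also have "\<dots> = nc_poly_eval p X"
    proof (rule nc_poly_eval_superset[symmetric])
      show "{\<alpha>. p \<alpha> \<noteq> 0} \<subseteq> (\<Union>k<M. {\<alpha>. length \<alpha> = k})"
        using that by (auto dest!: N)
    qed auto
    finally show ?thesis .
  qed
  then show "\<exists>N. \<forall>M\<ge>N. (\<Sum>k<M. nc_term p X k) = nc_poly_eval p X" by blast
  have "nc_term p X sums (\<Sum>k\<in>{..<N}. nc_term p X k)" by (rule sums_finite) (use z in auto)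
  then show "nc_term p X sums nc_poly_eval p X" by (simp add: s)
qed

lemma left_multiplication_op_word: "(\<And>i. left_multiplication (W i)) \<Longrightarrow> left_multiplication (op_word W \<alpha>)"
  by (induction \<alpha>) (auto intro: left_multiplication_id left_multiplication_compose)

lemma left_multiplication_poly_eval:
  "(\<And>i. left_multiplication (W i)) \<Longrightarrow> left_multiplication (nc_poly_eval p W)"
  unfolding nc_poly_eval_def
  by (intro left_multiplication_sum left_multiplication_scale left_multiplication_op_word)

context strict_row
begin

lemma nc_poly_eval_ev:
  assumes W: "\<And>i. left_multiplication (W i)"
  shows "nc_poly_eval p (\<lambda>i. ev (blinfun_apply (W i) (ell2_basis []))) = ev (blinfun_apply (nc_poly_eval p W) (ell2_basis []))"
proof -
  have "op_word (\<lambda>i. ev (blinfun_apply (W i) (ell2_basis []))) \<alpha> = ev (blinfun_apply (op_word W \<alpha>) (ell2_basis []))" for \<alpha>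
    by (induction \<alpha>) (auto simp: ev_basis ev_left_multiplication[OF W, symmetric])
  then show ?thesis by (simp add: nc_poly_eval_def blinfun.sum_left ev_sum ev_scale)
qed

end

section \<open>The von Neumann inequality for strict row contractions\<close>

text \<open>Gram--Schmidt: a unit vector is adjoined only when the residual \<open>y\<close> is
  nonzero, and the old expansions persist because \<open>y\<close> is orthogonal to the old
  system.\<close>

lemma orthonormal_expansion:
  fixes S :: "'a::complex_hilbert_space set"
  assumes "finite S"
  shows "\<exists>(m::nat) e. (\<forall>l<m. \<forall>l'<m. cinner (e l) (e l') = (if l = l' then 1 else 0)) \<and>
    (\<forall>x\<in>S. x = (\<Sum>l<m. cinner x (e l) *\<^sub>C e l))"
  using assms
proof (induction S rule: finite_induct)
  case empty
  show ?case by (intro exI[of _ 0]) auto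
next
  case (insert x S)
  then obtain m :: nat and e :: "nat \<Rightarrow> 'a" where on: "\<And>l l'. l < m \<Longrightarrow> l' < m \<Longrightarrow> cinner (e l) (e l') = (if l = l' then 1 else 0)"
    and S: "\<And>z. z \<in> S \<Longrightarrow> z = (\<Sum>l<m. cinner z (e l) *\<^sub>C e l)" by blast
  define y where "y = x - (\<Sum>l<m. cinner x (e l) *\<^sub>C e l)"
  show ?case
  proof (cases "y = 0")
    case True
    then have "x = (\<Sum>l<m. cinner x (e l) *\<^sub>C e l)" by (simp add: y_def)
    with on S show ?thesis by (intro exI[of _ m] exI[of _ e]) auto
  next
    case False
    define e' where "e' = e(m := (1 / norm y) *\<^sub>R y)"
    have ye: "cinner y (e l) = 0" if l: "l < m" for l
    proof -
      have "cinner (\<Sum>k<m. cinner x (e k) *\<^sub>C e k) (e l) = (\<Sum>k<m. if k = l then cinner x (e l) else 0)"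
        unfolding cinner_sum_left using l by (intro sum.cong) (auto simp: cinner_scaleC_left on)
      also have "\<dots> = cinner x (e l)" using l by simp
      finally show ?thesis by (simp add: y_def cinner_diff_left)
    qed
    have ey: "cinner (e l) y = 0" if "l < m" for l
      using ye[OF that] cinner_commute[of "e l" y] by simp
    have xy: "cinner x y = of_real ((norm y)\<^sup>2)"
    proof -
      have "cinner (\<Sum>l<m. cinner x (e l) *\<^sub>C e l) y = 0"
        by (simp add: cinner_sum_left cinner_scaleC_left ey)
      then have "cinner x y = cinner y y" using cinner_diff_left[of x "\<Sum>l<m. cinner x (e l) *\<^sub>C e l" y] by (simp add: y_def)
      then show ?thesis by (simp only: cinner_self)
    qed
    have e'm: "e' m = of_real (1 / norm y) *\<^sub>C y" by (simp add: e'_def scaleR_scaleC del: of_real_divide)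
    have e'l: "l < m \<Longrightarrow> e' l = e l" for l by (simp add: e'_def)
    have on': "cinner (e' l) (e' l') = (if l = l' then 1 else 0)" if "l < Suc m" "l' < Suc m" for l l'
    proof -
      have mm: "cinner (e' m) (e' m) = 1"
      proof -
        have "norm (e' m) = 1" using False by (simp add: e'_def)
        then show ?thesis by (simp add: cinner_self)
      qed
      have "cinner (e' m) (e' k) = 0" "cinner (e' k) (e' m) = 0" if "k < m" for k
        using that unfolding e'm by (simp_all add: e'l cinner_scaleC_left cinner_scaleC_right ye ey)
      with mm that on show ?thesis by (cases "l = m"; cases "l' = m") (auto simp: e'l less_Suc_eq)
    qed
    have zm: "cinner z (e' m) = 0" if "z \<in> S" for z
    proof -
      have "cinner z (e' m) = (\<Sum>l<m. cinner z (e l) * cinner (e l) (e' m))"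
        by (subst S[OF that]) (simp add: cinner_sum_left cinner_scaleC_left)
      then show ?thesis by (simp add: e'm cinner_scaleC_right ey)
    qed
    have "z = (\<Sum>l<Suc m. cinner z (e' l) *\<^sub>C e' l)" if "z \<in> insert x S" for z
    proof (cases "z \<in> S")
      case True
      then show ?thesis using S[OF True] zm[OF True] by (simp add: e'l)
    next
      case z: False
      then have "z = x" using that by simp
      have "cinner x (e' m) *\<^sub>C e' m = y"
        unfolding e'm using False
        by (simp add: cinner_scaleC_right xy scaleC_scaleC power2_eq_square)
      then show ?thesis using \<open>z = x\<close> by (simp add: e'l y_def)
    qed
    with on' show ?thesis by (intro exI[of _ "Suc m"] exI[of _ e']) auto
  qed
qed

lemma norm_orthonormal_sum:
  assumes "\<And>l l'. l < m \<Longrightarrow> l' < m \<Longrightarrow> cinner (e l) (e l') = (if l = l' then 1 else 0)"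
  shows "(norm (\<Sum>l<m. c l *\<^sub>C (e l :: 'a::complex_hilbert_space)))\<^sup>2 = (\<Sum>l<(m::nat). (cmod (c l))\<^sup>2)"
proof -
  have "complex_of_real ((norm (\<Sum>l<m. c l *\<^sub>C e l))\<^sup>2) = (\<Sum>l<m. \<Sum>l'<m. c l * cnj (c l') * cinner (e l) (e l'))"
    by (simp only: cinner_self[symmetric])
      (simp add: cinner_sum_left cinner_scaleC_left,
       simp add: cinner_sum_right cinner_scaleC_right sum_distrib_left mult.assoc)
  also have "\<dots> = (\<Sum>l<m. \<Sum>l'<m. if l' = l then c l * cnj (c l) else 0)"
    by (intro sum.cong) (auto simp: assms)
  also have "\<dots> = (\<Sum>l<m. complex_of_real ((cmod (c l))\<^sup>2))"
    by (intro sum.cong) (auto simp: complex_norm_square simp del: of_real_power)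
  finally show ?thesis by (simp only: of_real_sum[symmetric] of_real_eq_iff)
qed

text \<open>In an orthonormal system whose span contains the finitely many \<open>x j\<close>, the
  matrix acts on each coordinate separately, and the scalar bounds add up.\<close>

lemma scalar_matrix_bound_vectors:
  fixes x :: "'j \<Rightarrow> 'a::complex_hilbert_space"
  assumes "finite J"
    and M: "\<And>z. (\<Sum>i\<in>I. (cmod (\<Sum>j\<in>J. M i j * z j))\<^sup>2) \<le> D * (\<Sum>j\<in>J. (cmod (z j))\<^sup>2)"
  shows "(\<Sum>i\<in>I. (norm (\<Sum>j\<in>J. M i j *\<^sub>C x j))\<^sup>2) \<le> D * (\<Sum>j\<in>J. (norm (x j))\<^sup>2)"
proof -
  obtain m :: nat and e :: "nat \<Rightarrow> 'a" where on: "\<And>l l'. l < m \<Longrightarrow> l' < m \<Longrightarrow> cinner (e l) (e l') = (if l = l' then 1 else 0)"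
    and x: "\<And>j. j \<in> J \<Longrightarrow> x j = (\<Sum>l<m. cinner (x j) (e l) *\<^sub>C e l)"
    using orthonormal_expansion[of "x ` J"] assms(1) by blast
  define c where "c j l = cinner (x j) (e l)" for j l
  have nx: "(norm (x j))\<^sup>2 = (\<Sum>l<m. (cmod (c j l))\<^sup>2)" if "j \<in> J" for j
    using norm_orthonormal_sum[where m = m and e = e and c = "c j", OF on] x[OF that] by (simp add: c_def)
  have "(\<Sum>j\<in>J. M i j *\<^sub>C x j) = (\<Sum>l<m. (\<Sum>j\<in>J. M i j * c j l) *\<^sub>C e l)" for i
  proof -
    have "(\<Sum>j\<in>J. M i j *\<^sub>C x j) = (\<Sum>j\<in>J. \<Sum>l<m. (M i j * c j l) *\<^sub>C e l)"
      by (rule sum.cong[OF refl], subst x) (auto simp: scaleC_sum_right scaleC_scaleC c_def)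
    then show ?thesis by (simp add: scaleC_sum_left sum.swap[of _ J])
  qed
  then have "(\<Sum>i\<in>I. (norm (\<Sum>j\<in>J. M i j *\<^sub>C x j))\<^sup>2) = (\<Sum>l<m. \<Sum>i\<in>I. (cmod (\<Sum>j\<in>J. M i j * c j l))\<^sup>2)"
    by (simp add: norm_orthonormal_sum[where m = m and e = e, OF on] sum.swap[of _ I])
  also have "\<dots> \<le> (\<Sum>l<m. D * (\<Sum>j\<in>J. (cmod (c j l))\<^sup>2))" by (intro sum_mono M)
  also have "\<dots> = D * (\<Sum>j\<in>J. (norm (x j))\<^sup>2)"
    by (simp add: nx sum_distrib_left sum.swap[of _ J])
  finally show ?thesis .
qed

lemma finite_words_below [simp]: "finite {\<alpha> :: 'n::finite list. length \<alpha> < N}"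
proof -
  have "{\<alpha> :: 'n list. length \<alpha> < N} = (\<Union>k<N. {\<alpha>. length \<alpha> = k})" by auto
  then show ?thesis by simp
qed

lemma sum_words_below:
  "(\<Sum>\<alpha> | length \<alpha> < N. g \<alpha>) = (\<Sum>k<N. \<Sum>\<alpha> | length \<alpha> = k. g \<alpha>)"
  for g :: "'n::finite list \<Rightarrow> 'b::comm_monoid_add"
proof -
  have "{\<alpha> :: 'n list. length \<alpha> < N} = (\<Union>k<N. {\<alpha>. length \<alpha> = k})" by auto
  moreover have "sum g (\<Union>k<N. {\<alpha>. length \<alpha> = k}) = (\<Sum>k<N. \<Sum>\<alpha> | length \<alpha> = k. g \<alpha>)"
    by (rule sum.UNION_disjoint) auto
  ultimately show ?thesis by simp
qed

lemma sum_words_below_Suc: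
  "(\<Sum>\<alpha> | length \<alpha> < Suc N. g \<alpha>) = g [] + (\<Sum>i\<in>UNIV. \<Sum>\<alpha> | length \<alpha> < N. g (i # \<alpha>))"
  for g :: "'n::finite list \<Rightarrow> 'b::comm_monoid_add"
  unfolding sum_words_below sum.lessThan_Suc_shift sum_words_Suc by (simp add: sum.swap[of _ "{..<N}"])

section \<open>The Poisson kernel of a strict row contraction\<close>

context strict_row
begin

text \<open>Pairing \<open>h\<close> with the row applied to the column of adjoints gives S^2 <=
  |h|^2 |Z|^2 S, and S cancels.\<close>

lemma adjoint_row: "(\<Sum>i\<in>UNIV. (norm (blinfun_apply (adj (Z i)) h))\<^sup>2) \<le> (row_norm Z)\<^sup>2 * (norm h)\<^sup>2"
proof -
  define S where "S = (\<Sum>i\<in>UNIV. (norm (blinfun_apply (adj (Z i)) h))\<^sup>2)"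
  have S0: "0 \<le> S" by (simp add: S_def sum_nonneg)
  have "S = inner h (\<Sum>i\<in>UNIV. blinfun_apply (Z i) (blinfun_apply (adj (Z i)) h))"
    unfolding S_def inner_sum_right by (simp add: adj_inner[symmetric] power2_norm_eq_inner)
  also have "\<dots> \<le> norm h * norm (\<Sum>i\<in>UNIV. blinfun_apply (Z i) (blinfun_apply (adj (Z i)) h))"
    by (rule norm_cauchy_schwarz)
  finally have "S \<le> norm h * norm (\<Sum>i\<in>UNIV. blinfun_apply (Z i) (blinfun_apply (adj (Z i)) h))" .
  from power_mono[OF this S0, of 2]
  have "S\<^sup>2 \<le> (norm h)\<^sup>2 * (norm (\<Sum>i\<in>UNIV. blinfun_apply (Z i) (blinfun_apply (adj (Z i)) h)))\<^sup>2"
    by (simp only: power_mult_distrib)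
  also have "\<dots> \<le> (norm h)\<^sup>2 * ((row_norm Z)\<^sup>2 * S)"
    unfolding S_def by (intro mult_left_mono row_normD) auto
  finally have le: "S * S \<le> ((row_norm Z)\<^sup>2 * (norm h)\<^sup>2) * S" by (simp add: power2_eq_square mult_ac)
  show ?thesis
  proof (cases "S = 0")
    case True
    then show ?thesis by (simp add: S_def[symmetric])
  next
    case False
    then have "S \<le> (row_norm Z)\<^sup>2 * (norm h)\<^sup>2" using le S0 by (intro mult_right_le_imp_le[OF le]) auto
    then show ?thesis by (simp add: S_def)
  qed
qed

text \<open>A square root of I minus the sum of the products of Z_i with its adjoint. Strictness
  keeps that sum below norm 1, as \<open>selfadjoint_sqrt\<close> requires.\<close>

definition "defect = (SOME \<Delta>. \<Delta> \<in> bounded_clinear_ops \<and>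
  (\<forall>x y. inner (blinfun_apply \<Delta> x) y = inner x (blinfun_apply \<Delta> y)) \<and>
  (\<forall>x. blinfun_apply \<Delta> (blinfun_apply \<Delta> x) = x - (\<Sum>i\<in>UNIV. blinfun_apply (Z i) (blinfun_apply (adj (Z i)) x))))"

lemma defect:
  "defect \<in> bounded_clinear_ops"
  "inner (blinfun_apply defect x) y = inner x (blinfun_apply defect y)"
  "blinfun_apply defect (blinfun_apply defect x) = x - (\<Sum>i\<in>UNIV. blinfun_apply (Z i) (blinfun_apply (adj (Z i)) x))"
proof -
  define P where "P = (\<Sum>i\<in>UNIV. Z i o\<^sub>L adj (Z i))"
  have P: "blinfun_apply P x = (\<Sum>i\<in>UNIV. blinfun_apply (Z i) (blinfun_apply (adj (Z i)) x))" for x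
    by (simp add: P_def blinfun.sum_left)
  have clin: "P \<in> bounded_clinear_ops" unfolding P_def by (intro clinear_sum clinear_compose Z_clinear adj_clinear)
  have "norm P \<le> (row_norm Z)\<^sup>2"
  proof (rule norm_blinfun_bound)
    fix h
    have "(norm (blinfun_apply P h))\<^sup>2 \<le> (row_norm Z)\<^sup>2 * (\<Sum>i\<in>UNIV. (norm (blinfun_apply (adj (Z i)) h))\<^sup>2)"
      unfolding P by (rule row_normD) simp
    also have "\<dots> \<le> (row_norm Z)\<^sup>2 * ((row_norm Z)\<^sup>2 * (norm h)\<^sup>2)" by (intro mult_left_mono adjoint_row) auto
    also have "\<dots> = ((row_norm Z)\<^sup>2 * norm h)\<^sup>2" by (simp add: power2_eq_square mult_ac)
    finally show "norm (blinfun_apply P h) \<le> (row_norm Z)\<^sup>2 * norm h" by (rule power2_le_imp_le) simp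
  qed simp
  moreover have "(row_norm Z)\<^sup>2 < 1" using Z_strict row_norm_nonneg[of Z] by (simp add: power_less_one_iff)
  ultimately have P1: "norm P < 1" by linarith
  have self: "inner (blinfun_apply P x) y = inner x (blinfun_apply P y)" for x y
    unfolding P inner_sum_left inner_sum_right by (rule sum.cong[OF refl]) (metis inner_adj adj_inner)
  obtain Y where Y: "Y \<in> bounded_clinear_ops"
    "\<And>x y. inner (blinfun_apply Y x) y = inner x (blinfun_apply Y y)"
    "(id_blinfun - Y) o\<^sub>L (id_blinfun - Y) = id_blinfun - P"
    using selfadjoint_sqrt[OF clin P1 self] by blast
  have sq: "blinfun_apply (id_blinfun - Y) (blinfun_apply (id_blinfun - Y) x) = x - blinfun_apply P x" for x
    using arg_cong[OF Y(3), of "\<lambda>T. blinfun_apply T x"] by (simp add: blinfun.diff_left)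
  have "\<exists>\<Delta>. \<Delta> \<in> bounded_clinear_ops \<and>
    (\<forall>x y. inner (blinfun_apply \<Delta> x) y = inner x (blinfun_apply \<Delta> y)) \<and>
    (\<forall>x. blinfun_apply \<Delta> (blinfun_apply \<Delta> x) = x - (\<Sum>i\<in>UNIV. blinfun_apply (Z i) (blinfun_apply (adj (Z i)) x)))"
  proof (intro exI[of _ "id_blinfun - Y"] conjI allI)
    show "id_blinfun - Y \<in> bounded_clinear_ops" using Y(1) by blast
    show "inner (blinfun_apply (id_blinfun - Y) x) y = inner x (blinfun_apply (id_blinfun - Y) y)" for x y
      by (simp add: blinfun.diff_left inner_diff_left inner_diff_right Y(2))
  qed (simp only: sq P)
  from someI_ex[OF this, folded defect_def]
  show "defect \<in> bounded_clinear_ops"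
    "inner (blinfun_apply defect x) y = inner x (blinfun_apply defect y)"
    "blinfun_apply defect (blinfun_apply defect x) = x - (\<Sum>i\<in>UNIV. blinfun_apply (Z i) (blinfun_apply (adj (Z i)) x))"
    by blast+
qed

lemma norm_defect: "(norm (blinfun_apply defect x))\<^sup>2 = (norm x)\<^sup>2 - (\<Sum>i\<in>UNIV. (norm (blinfun_apply (adj (Z i)) x))\<^sup>2)"
proof -
  have "(norm (blinfun_apply defect x))\<^sup>2 = inner x (blinfun_apply defect (blinfun_apply defect x))"
    by (simp add: power2_norm_eq_inner defect(2))
  also have "\<dots> = inner x x - (\<Sum>i\<in>UNIV. inner (blinfun_apply (adj (Z i)) x) (blinfun_apply (adj (Z i)) x))"
    unfolding defect(3) by (simp add: inner_diff_right inner_sum_right adj_inner)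
  finally show ?thesis by (simp add: power2_norm_eq_inner)
qed

text \<open>The adjoint of \<open>op_word Z \<alpha>\<close> at \<open>h\<close>. Adjoints reverse
  products, so the adjoint of the first letter acts first.\<close>

fun adj_word :: "'n list \<Rightarrow> 'a \<Rightarrow> 'a" where
  "adj_word [] h = h"
| "adj_word (i # \<alpha>) h = adj_word \<alpha> (blinfun_apply (adj (Z i)) h)"

lemma adj_word_inner: "inner (adj_word \<alpha> h) x = inner h (blinfun_apply (op_word Z \<alpha>) x)"
  by (induction \<alpha> arbitrary: h) (auto simp: adj_inner)

text \<open>The kernel sends \<open>h\<close> to the family of vectors \<open>defect\<close> applied
  to \<open>adj_word \<alpha> h\<close>. By \<open>norm_defect\<close> each level of words splits
  into a defect part and the next level, and the sum telescopes.\<close>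

lemma poisson_isometry:
  "(\<Sum>\<alpha> | length \<alpha> < N. (norm (blinfun_apply defect (adj_word \<alpha> h)))\<^sup>2) + (\<Sum>\<alpha> | length \<alpha> = N. (norm (adj_word \<alpha> h))\<^sup>2) = (norm h)\<^sup>2"
proof (induction N arbitrary: h)
  case (Suc N)
  have "(\<Sum>\<alpha> | length \<alpha> < Suc N. (norm (blinfun_apply defect (adj_word \<alpha> h)))\<^sup>2) + (\<Sum>\<alpha> | length \<alpha> = Suc N. (norm (adj_word \<alpha> h))\<^sup>2) =
    (norm (blinfun_apply defect h))\<^sup>2 +
    (\<Sum>i\<in>UNIV. (\<Sum>\<alpha> | length \<alpha> < N. (norm (blinfun_apply defect (adj_word \<alpha> (blinfun_apply (adj (Z i)) h))))\<^sup>2) +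
      (\<Sum>\<alpha> | length \<alpha> = N. (norm (adj_word \<alpha> (blinfun_apply (adj (Z i)) h)))\<^sup>2))"
    unfolding sum_words_below_Suc sum_words_Suc by (simp add: sum.distrib)
  also have "\<dots> = (norm (blinfun_apply defect h))\<^sup>2 + (\<Sum>i\<in>UNIV. (norm (blinfun_apply (adj (Z i)) h))\<^sup>2)"
    by (simp only: Suc.IH)
  also have "\<dots> = (norm h)\<^sup>2" by (simp add: norm_defect)
  finally show ?case .
qed simp

text \<open>The formula for the square of \<open>defect\<close> is substituted into itself
  \<open>N\<close> times: the adjoint of the kernel recovers \<open>h\<close> from its kernel, up to
  a remainder.\<close>

lemma poisson_reconstruction:
  "(\<Sum>\<alpha> | length \<alpha> < N. blinfun_apply (op_word Z \<alpha>) (blinfun_apply defect (blinfun_apply defect (adj_word \<alpha> h)))) +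
    (\<Sum>\<alpha> | length \<alpha> = N. blinfun_apply (op_word Z \<alpha>) (adj_word \<alpha> h)) = h"
proof (induction N arbitrary: h)
  case (Suc N)
  have "(\<Sum>\<alpha> | length \<alpha> < Suc N. blinfun_apply (op_word Z \<alpha>) (blinfun_apply defect (blinfun_apply defect (adj_word \<alpha> h)))) +
    (\<Sum>\<alpha> | length \<alpha> = Suc N. blinfun_apply (op_word Z \<alpha>) (adj_word \<alpha> h)) =
    blinfun_apply defect (blinfun_apply defect h) + (\<Sum>i\<in>UNIV. blinfun_apply (Z i)
      ((\<Sum>\<alpha> | length \<alpha> < N. blinfun_apply (op_word Z \<alpha>) (blinfun_apply defect (blinfun_apply defect (adj_word \<alpha> (blinfun_apply (adj (Z i)) h))))) +
       (\<Sum>\<alpha> | length \<alpha> = N. blinfun_apply (op_word Z \<alpha>) (adj_word \<alpha> (blinfun_apply (adj (Z i)) h)))))"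
    unfolding sum_words_below_Suc sum_words_Suc
    by (simp add: sum.distrib blinfun.sum_right blinfun.add_right)
  also have "\<dots> = blinfun_apply defect (blinfun_apply defect h) + (\<Sum>i\<in>UNIV. blinfun_apply (Z i) (blinfun_apply (adj (Z i)) h))"
    by (simp only: Suc.IH)
  also have "\<dots> = h" by (simp add: defect(3))
  finally show ?case .
qed simp

text \<open>The truncated kernel is a contraction by \<open>poisson_isometry\<close>, so its adjoint
  is one too: \<open>y\<close> is paired with itself and Cauchy--Schwarz applied.\<close>

lemma poisson_coisometry:
  "(norm (\<Sum>\<alpha> | length \<alpha> < N. blinfun_apply (op_word Z \<alpha>) (blinfun_apply defect (v \<alpha>))))\<^sup>2 \<le> (\<Sum>\<alpha> | length \<alpha> < N. (norm (v \<alpha>))\<^sup>2)"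
proof -
  define y where "y = (\<Sum>\<alpha> | length \<alpha> < N. blinfun_apply (op_word Z \<alpha>) (blinfun_apply defect (v \<alpha>)))"
  define S where "S = (\<Sum>\<alpha> | length \<alpha> < N. (norm (v \<alpha>))\<^sup>2)"
  have "(norm y)\<^sup>2 = (\<Sum>\<alpha> | length \<alpha> < N. inner (blinfun_apply defect (adj_word \<alpha> y)) (v \<alpha>))"
    unfolding power2_norm_eq_inner by (subst (2) y_def) (simp add: inner_sum_right adj_word_inner[symmetric] defect(2))
  also have "\<dots> \<le> (\<Sum>\<alpha> | length \<alpha> < N. norm (blinfun_apply defect (adj_word \<alpha> y)) * norm (v \<alpha>))"
    by (intro sum_mono norm_cauchy_schwarz)
  finally have "((norm y)\<^sup>2)\<^sup>2 \<le> (\<Sum>\<alpha> | length \<alpha> < N. norm (blinfun_apply defect (adj_word \<alpha> y)) * norm (v \<alpha>))\<^sup>2"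
    by (intro power_mono) auto
  also have "\<dots> \<le> (\<Sum>\<alpha> | length \<alpha> < N. (norm (blinfun_apply defect (adj_word \<alpha> y)))\<^sup>2) * S"
    unfolding S_def by (rule Cauchy_Schwarz_ineq_sum)
  also have "\<dots> \<le> (norm y)\<^sup>2 * S"
  proof (rule mult_right_mono)
    show "(\<Sum>\<alpha> | length \<alpha> < N. (norm (blinfun_apply defect (adj_word \<alpha> y)))\<^sup>2) \<le> (norm y)\<^sup>2"
      using poisson_isometry[where N = N and h = y] by (smt (verit) sum_nonneg zero_le_power2)
  qed (simp add: S_def sum_nonneg)
  finally have le: "(norm y)\<^sup>2 * (norm y)\<^sup>2 \<le> (norm y)\<^sup>2 * S" by (simp add: power2_eq_square)
  have "(norm y)\<^sup>2 \<le> S"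
  proof (cases "y = 0")
    case True
    then show ?thesis by (simp add: S_def sum_nonneg)
  next
    case False
    then show ?thesis using mult_left_le_imp_le[OF le] by simp
  qed
  then show ?thesis by (simp add: y_def S_def)
qed

text \<open>The row of words of length \<open>N\<close> has bound \<open>row_norm Z ^ N\<close> and
  the column of their adjoints bound 1; strictness of the row makes the product vanish in the
  limit.\<close>

lemma remainder_tendsto: "(\<lambda>N. \<Sum>\<alpha> | length \<alpha> = N. blinfun_apply (op_word Z \<alpha>) (adj_word \<alpha> h)) \<longlonglongrightarrow> 0"
proof (rule Lim_null_comparison)
  have "norm (\<Sum>\<alpha> | length \<alpha> = N. blinfun_apply (op_word Z \<alpha>) (adj_word \<alpha> h)) \<le> (row_norm Z) ^ N * norm h" for N
  proof -
    have "(norm (\<Sum>\<alpha> | length \<alpha> = N. blinfun_apply (op_word Z \<alpha>) (adj_word \<alpha> h)))\<^sup>2 \<le>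
        ((row_norm Z)\<^sup>2) ^ N * (\<Sum>\<alpha> | length \<alpha> = N. (norm (adj_word \<alpha> h))\<^sup>2)"
      by (rule word_row_bound) simp
    also have "\<dots> \<le> ((row_norm Z)\<^sup>2) ^ N * (norm h)\<^sup>2"
    proof (rule mult_left_mono)
      show "(\<Sum>\<alpha> | length \<alpha> = N. (norm (adj_word \<alpha> h))\<^sup>2) \<le> (norm h)\<^sup>2"
        using poisson_isometry[where N = N and h = h] by (smt (verit) sum_nonneg zero_le_power2)
    qed simp
    also have "\<dots> = ((row_norm Z) ^ N * norm h)\<^sup>2" by (simp add: power_mult_distrib power_mult[symmetric] mult.commute)
    finally show ?thesis by (rule power2_le_imp_le) (simp add: row_norm_nonneg)
  qed
  then show "\<forall>\<^sub>F N in sequentially. norm (\<Sum>\<alpha> | length \<alpha> = N. blinfun_apply (op_word Z \<alpha>) (adj_word \<alpha> h)) \<le> (row_norm Z) ^ N * norm h"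
    by simp
  show "(\<lambda>N. row_norm Z ^ N * norm h) \<longlonglongrightarrow> 0"
    using Z_strict row_norm_nonneg[of Z] by (intro tendsto_mult_left_zero LIMSEQ_power_zero) auto
qed

lemma ev_apply_tendsto:
  "(\<lambda>M. \<Sum>\<gamma> | length \<gamma> < M. ell2_coeff u \<gamma> *\<^sub>C blinfun_apply (op_word Z \<gamma>) h) \<longlonglongrightarrow> blinfun_apply (ev u) h"
proof -
  have "(\<lambda>k. blinfun_apply (nc_term (ell2_coeff u) Z k) h) sums blinfun_apply (ev u) h"
    unfolding ev_def nc_eval_def
    by (intro bounded_linear.sums[OF blinfun.bounded_linear_left] summable_sums[OF ev_summable])
  then show ?thesis by (simp add: sums_def sum_words_below nc_term_def blinfun.sum_left)
qed

text \<open>The operator matrix is compressed to finitely many words, acts there as a scalar matrix on the Poisson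
  kernel of \<open>h\<close>, and the truncations are removed afterwards.\<close>

lemma von_neumann:
  fixes I :: "'i set" and J :: "'j set"
  assumes I: "finite I" and J: "finite J" and T: "\<And>i j. i \<in> I \<Longrightarrow> j \<in> J \<Longrightarrow> left_multiplication (T i j)"
    and D: "op_bound I J T D"
  shows "op_bound I J (\<lambda>i j. ev (blinfun_apply (T i j) (ell2_basis []))) D"
  unfolding op_bound_def
proof
  fix h :: "'j \<Rightarrow> 'a"
  define rem where "rem N x = (\<Sum>\<alpha> | length \<alpha> = N. blinfun_apply (op_word Z \<alpha>) (adj_word \<alpha> x))" for N x
  define \<phi> where "\<phi> i j = ev (blinfun_apply (T i j) (ell2_basis []))" for i j
  define H where "H = (\<Sum>j\<in>J. (norm (h j))\<^sup>2)"
  \<comment> \<open>Kernels truncated to words shorter than \<open>N\<close> reproduce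
    \<open>h j - rem N (h j)\<close> instead of \<open>h j\<close>.\<close>
  have main: "(\<Sum>i\<in>I. (norm (\<Sum>j\<in>J. blinfun_apply (\<phi> i j) (h j - rem N (h j))))\<^sup>2) \<le> D\<^sup>2 * H" for N
  proof -
    define B where "B = {\<beta> :: 'n list. length \<beta> < N}"
    have B: "finite B" by (simp add: B_def)
    define u where "u j \<beta> = blinfun_apply defect (adj_word \<beta> (h j))" for j \<beta>
    \<comment> \<open>The matrix of \<open>T i j\<close> in the word basis. The vectors
      \<open>u j \<beta>\<close> form the truncated kernel of \<open>h j\<close>, on which this
      scalar matrix acts.\<close>
    define c where "c i j \<beta> \<gamma> = ell2_coeff (blinfun_apply (T i j) (ell2_basis \<beta>)) \<gamma>" for i j \<beta> \<gamma>
    define v where "v i \<gamma> = (\<Sum>(j, \<beta>)\<in>J \<times> B. c i j \<beta> \<gamma> *\<^sub>C u j \<beta>)" for i \<gamma>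
    have uH: "(\<Sum>(j, \<beta>)\<in>J \<times> B. (norm (u j \<beta>))\<^sup>2) \<le> H"
    proof -
      have "(\<Sum>(j, \<beta>)\<in>J \<times> B. (norm (u j \<beta>))\<^sup>2) = (\<Sum>j\<in>J. \<Sum>\<beta>\<in>B. (norm (u j \<beta>))\<^sup>2)"
        by (simp add: sum.cartesian_product)
      also have "\<dots> \<le> H"
        unfolding H_def u_def B_def
      proof (rule sum_mono)
        fix j
        show "(\<Sum>\<beta> | length \<beta> < N. (norm (blinfun_apply defect (adj_word \<beta> (h j))))\<^sup>2) \<le> (norm (h j))\<^sup>2"
          using poisson_isometry[where N = N and h = "h j"] by (smt (verit) sum_nonneg zero_le_power2)
      qed
      finally show ?thesis .
    qed
    have trunc: "(\<Sum>i\<in>I. (norm (\<Sum>\<gamma> | length \<gamma> < M. blinfun_apply (op_word Z \<gamma>) (blinfun_apply defect (v i \<gamma>))))\<^sup>2) \<le> D\<^sup>2 * H" for M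
    proof -
      define G where "G = {\<gamma> :: 'n list. length \<gamma> < M}"
      have G: "finite G" by (simp add: G_def)
      have "(\<Sum>(i, \<gamma>)\<in>I \<times> G. (norm (\<Sum>jb\<in>J \<times> B. c i (fst jb) (snd jb) \<gamma> *\<^sub>C u (fst jb) (snd jb)))\<^sup>2) \<le>
          D\<^sup>2 * (\<Sum>jb\<in>J \<times> B. (norm (u (fst jb) (snd jb)))\<^sup>2)"
        unfolding case_prod_unfold
      proof (rule scalar_matrix_bound_vectors)
        show "finite (J \<times> B)" using J B by simp
        fix z :: "'j \<times> 'n list \<Rightarrow> complex"
        define x where "x j = (\<Sum>\<beta>\<in>B. z (j, \<beta>) *\<^sub>C ell2_basis \<beta>)" for j
        have nx: "(norm (x j))\<^sup>2 = (\<Sum>\<beta>\<in>B. (cmod (z (j, \<beta>)))\<^sup>2)" for j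
        proof -
          have "ell2_coeff (x j) \<gamma> = (if \<gamma> \<in> B then z (j, \<gamma>) else 0)" for \<gamma>
            using B by (simp add: x_def if_distrib[of "(*) _"] cong: if_cong)
          then show ?thesis by (subst ell2_norm_sq_finite[OF B]) auto
        qed
        have co: "(\<Sum>jb\<in>J \<times> B. c i (fst jb) (snd jb) \<gamma> * z jb) = ell2_coeff (\<Sum>j\<in>J. blinfun_apply (T i j) (x j)) \<gamma>" if "i \<in> I" for i \<gamma>
        proof -
          have "ell2_coeff (\<Sum>j\<in>J. blinfun_apply (T i j) (x j)) \<gamma> = (\<Sum>j\<in>J. \<Sum>\<beta>\<in>B. z (j, \<beta>) * c i j \<beta> \<gamma>)"
            using T[OF that] by (auto intro!: sum.cong simp: x_def blinfun.sum_right clinear_opD[OF left_multiplication_clinear] c_def)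
          then show ?thesis by (simp add: sum.cartesian_product case_prod_unfold mult.commute)
        qed
        have "(\<Sum>ig\<in>I \<times> G. (cmod (\<Sum>jb\<in>J \<times> B. c (fst ig) (fst jb) (snd jb) (snd ig) * z jb))\<^sup>2) =
            (\<Sum>i\<in>I. \<Sum>\<gamma>\<in>G. (cmod (ell2_coeff (\<Sum>j\<in>J. blinfun_apply (T i j) (x j)) \<gamma>))\<^sup>2)"
          unfolding sum.cartesian_product by (intro sum.cong) (auto simp: co)
        also have "\<dots> \<le> (\<Sum>i\<in>I. (norm (\<Sum>j\<in>J. blinfun_apply (T i j) (x j)))\<^sup>2)"
          by (intro sum_mono ell2_finite_sum_le G)
        also have "\<dots> \<le> D\<^sup>2 * (\<Sum>j\<in>J. (norm (x j))\<^sup>2)" by (rule op_boundD[OF D])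
        also have "(\<Sum>j\<in>J. (norm (x j))\<^sup>2) = (\<Sum>jb\<in>J \<times> B. (cmod (z jb))\<^sup>2)"
          by (simp add: nx sum.cartesian_product)
        finally show "(\<Sum>ig\<in>I \<times> G. (cmod (\<Sum>jb\<in>J \<times> B. c (fst ig) (fst jb) (snd jb) (snd ig) * z jb))\<^sup>2) \<le>
            D\<^sup>2 * (\<Sum>jb\<in>J \<times> B. (cmod (z jb))\<^sup>2)" .
      qed
      then have vle: "(\<Sum>i\<in>I. \<Sum>\<gamma>\<in>G. (norm (v i \<gamma>))\<^sup>2) \<le> D\<^sup>2 * H"
        using mult_left_mono[OF uH, of "D\<^sup>2"] by (simp add: sum.cartesian_product v_def case_prod_unfold)
      have "(\<Sum>i\<in>I. (norm (\<Sum>\<gamma>\<in>G. blinfun_apply (op_word Z \<gamma>) (blinfun_apply defect (v i \<gamma>))))\<^sup>2) \<le> (\<Sum>i\<in>I. \<Sum>\<gamma>\<in>G. (norm (v i \<gamma>))\<^sup>2)"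
        unfolding G_def by (intro sum_mono poisson_coisometry)
      with vle show ?thesis by (simp add: G_def)
    qed
    \<comment> \<open>As \<open>M\<close> grows the compression of the range disappears. The image
      of \<open>ell2_basis \<beta>\<close> evaluates to \<open>\<phi> i j\<close> followed on the
      right by the word \<beta>, and the sum over \<beta> is the reconstruction formula.\<close>
    have lim: "(\<lambda>M. \<Sum>\<gamma> | length \<gamma> < M. blinfun_apply (op_word Z \<gamma>) (blinfun_apply defect (v i \<gamma>))) \<longlonglongrightarrow>
        (\<Sum>j\<in>J. blinfun_apply (\<phi> i j) (h j - rem N (h j)))" if i: "i \<in> I" for i
    proof -
      have "(\<Sum>\<gamma> | length \<gamma> < M. blinfun_apply (op_word Z \<gamma>) (blinfun_apply defect (v i \<gamma>))) =
          (\<Sum>(j, \<beta>)\<in>J \<times> B. \<Sum>\<gamma> | length \<gamma> < M. c i j \<beta> \<gamma> *\<^sub>C blinfun_apply (op_word Z \<gamma>) (blinfun_apply defect (u j \<beta>)))" for M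
        unfolding v_def case_prod_unfold
        by (simp add: blinfun.sum_right clinear_opD[OF defect(1)] clinear_opD[OF op_word_clinear[of Z, OF Z_clinear]] sum.swap[of _ "J \<times> B"])
      moreover have "(\<lambda>M. \<Sum>(j, \<beta>)\<in>J \<times> B. \<Sum>\<gamma> | length \<gamma> < M. c i j \<beta> \<gamma> *\<^sub>C blinfun_apply (op_word Z \<gamma>) (blinfun_apply defect (u j \<beta>))) \<longlonglongrightarrow>
          (\<Sum>(j, \<beta>)\<in>J \<times> B. blinfun_apply (ev (blinfun_apply (T i j) (ell2_basis \<beta>))) (blinfun_apply defect (u j \<beta>)))"
        unfolding c_def case_prod_unfold by (intro tendsto_sum ev_apply_tendsto)
      moreover have "(\<Sum>(j, \<beta>)\<in>J \<times> B. blinfun_apply (ev (blinfun_apply (T i j) (ell2_basis \<beta>))) (blinfun_apply defect (u j \<beta>))) =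
          (\<Sum>j\<in>J. blinfun_apply (\<phi> i j) (h j - rem N (h j)))"
      proof -
        have "(\<Sum>\<beta>\<in>B. blinfun_apply (ev (blinfun_apply (T i j) (ell2_basis \<beta>))) (blinfun_apply defect (u j \<beta>))) =
            blinfun_apply (\<phi> i j) (h j - rem N (h j))" if j: "j \<in> J" for j
        proof -
          have "ev (blinfun_apply (T i j) (ell2_basis \<beta>)) = \<phi> i j o\<^sub>L op_word Z \<beta>" for \<beta>
            using ev_left_multiplication[OF T[OF i j], of "ell2_basis \<beta>"] by (simp add: \<phi>_def ev_basis)
          then have "(\<Sum>\<beta>\<in>B. blinfun_apply (ev (blinfun_apply (T i j) (ell2_basis \<beta>))) (blinfun_apply defect (u j \<beta>))) =
              blinfun_apply (\<phi> i j) (\<Sum>\<beta>\<in>B. blinfun_apply (op_word Z \<beta>) (blinfun_apply defect (u j \<beta>)))"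
            by (simp add: blinfun.sum_right)
          also have "(\<Sum>\<beta>\<in>B. blinfun_apply (op_word Z \<beta>) (blinfun_apply defect (u j \<beta>))) = h j - rem N (h j)"
            using poisson_reconstruction[where N = N and h = "h j"] by (simp add: B_def u_def rem_def eq_diff_eq)
          finally show ?thesis .
        qed
        then show ?thesis by (simp add: sum.cartesian_product[symmetric])
      qed
      ultimately show ?thesis by simp
    qed
    have "(\<lambda>M. \<Sum>i\<in>I. (norm (\<Sum>\<gamma> | length \<gamma> < M. blinfun_apply (op_word Z \<gamma>) (blinfun_apply defect (v i \<gamma>))))\<^sup>2) \<longlonglongrightarrow>
        (\<Sum>i\<in>I. (norm (\<Sum>j\<in>J. blinfun_apply (\<phi> i j) (h j - rem N (h j))))\<^sup>2)"
      by (intro tendsto_sum tendsto_power tendsto_norm lim)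
    then show ?thesis by (rule tendsto_upperbound) (auto intro!: always_eventually trunc)
  qed
  have "(\<lambda>N. \<Sum>i\<in>I. (norm (\<Sum>j\<in>J. blinfun_apply (\<phi> i j) (h j - rem N (h j))))\<^sup>2) \<longlonglongrightarrow>
      (\<Sum>i\<in>I. (norm (\<Sum>j\<in>J. blinfun_apply (\<phi> i j) (h j - 0)))\<^sup>2)"
    unfolding rem_def by (intro tendsto_intros remainder_tendsto)
  then have "(\<Sum>i\<in>I. (norm (\<Sum>j\<in>J. blinfun_apply (\<phi> i j) (h j - 0)))\<^sup>2) \<le> D\<^sup>2 * H"
    by (rule tendsto_upperbound) (auto intro!: always_eventually main)
  then show "(\<Sum>i\<in>I. (norm (\<Sum>j\<in>J. blinfun_apply (ev (blinfun_apply (T i j) (ell2_basis []))) (h j)))\<^sup>2) \<le> D\<^sup>2 * (\<Sum>j\<in>J. (norm (h j))\<^sup>2)"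
    by (simp add: \<phi>_def H_def)
qed

end

section \<open>Radial limits and the domain\<close>

text \<open>Summation by parts turns the series into a mean of the partial sums, with weights (1 -
  r) r^k of total mass 1.\<close>

lemma abel_vector:
  fixes x :: "nat \<Rightarrow> 'a::banach"
  assumes x: "x sums s"
  shows "((\<lambda>r. \<Sum>k. r ^ k *\<^sub>R x k) \<longlongrightarrow> s) (at_left 1)"
proof -
  define S where "S n = (\<Sum>k<n. x k)" for n
  have S: "S \<longlonglongrightarrow> s" using x by (simp add: sums_def S_def[abs_def])
  obtain B where B: "\<And>n. norm (S n) \<le> B" using Bseq_bdd_above convergent_imp_Bseq[of S] S
    by (metis Bseq_def convergentI)
  have B0: "0 \<le> B" using order_trans[OF norm_ge_zero B[of 0]] .
  have part: "(\<Sum>k<N. r ^ k *\<^sub>R x k) = (\<Sum>k<N. ((1 - r) * r ^ k) *\<^sub>R S (Suc k)) + r ^ N *\<^sub>R S N" for r N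
    by (induction N) (auto simp: S_def algebra_simps)
  \<comment> \<open>The first \<open>M\<close> weights are at most 1 - r each, and their partial
    sums lie within \<open>B + norm s\<close> of \<open>s\<close>; the remaining partial sums lie
    within \<open>e\<close> of it.\<close>
  have key: "norm ((\<Sum>k. r ^ k *\<^sub>R x k) - s) \<le> (1 - r) * (real M * (B + norm s)) + e"
    if r: "0 < r" "r < 1" and M: "\<And>k. k \<ge> M \<Longrightarrow> norm (S (Suc k) - s) \<le> e" and e: "0 \<le> e" for r M e
  proof -
    have geo: "(\<lambda>k. (1 - r) * r ^ k) sums 1"
      using sums_mult[OF geometric_sums[of r], of "1 - r"] r by simp
    have sm: "summable (\<lambda>k. ((1 - r) * r ^ k) *\<^sub>R S (Suc k))"
    proof (rule summable_comparison_test'[where g = "\<lambda>k. ((1 - r) * r ^ k) * B"])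
      show "summable (\<lambda>k. ((1 - r) * r ^ k) * B)" by (intro summable_mult2 sums_summable[OF geo])
      show "norm (((1 - r) * r ^ k) *\<^sub>R S (Suc k)) \<le> ((1 - r) * r ^ k) * B" if "k \<ge> 0" for k
        using r B[of "Suc k"] by (simp add: mult_left_mono)
    qed
    have "(\<lambda>N. r ^ N *\<^sub>R S N) \<longlonglongrightarrow> 0 *\<^sub>R s" using r by (intro tendsto_scaleR S LIMSEQ_power_zero) auto
    then have "(\<lambda>N. (\<Sum>k<N. ((1 - r) * r ^ k) *\<^sub>R S (Suc k)) + r ^ N *\<^sub>R S N) \<longlonglongrightarrow> (\<Sum>k. ((1 - r) * r ^ k) *\<^sub>R S (Suc k)) + 0 *\<^sub>R s"
      by (intro tendsto_add summable_LIMSEQ[OF sm])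
    then have "(\<lambda>k. r ^ k *\<^sub>R x k) sums (\<Sum>k. ((1 - r) * r ^ k) *\<^sub>R S (Suc k))" by (simp add: sums_def part)
    then have eq: "(\<Sum>k. r ^ k *\<^sub>R x k) = (\<Sum>k. ((1 - r) * r ^ k) *\<^sub>R S (Suc k))" by (rule sums_unique[symmetric])
    have d: "(\<lambda>k. ((1 - r) * r ^ k) *\<^sub>R (S (Suc k) - s)) sums ((\<Sum>k. r ^ k *\<^sub>R x k) - 1 *\<^sub>R s)"
      unfolding eq scaleR_diff_right by (intro sums_diff summable_sums[OF sm] bounded_linear.sums[OF bounded_linear_scaleR_left geo])
    define g where "g k = (if k < M then (1 - r) * (B + norm s) else 0) + ((1 - r) * r ^ k) * e" for k
    have gs: "g sums ((\<Sum>k<M. (1 - r) * (B + norm s)) + 1 * e)"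
      unfolding g_def using sums_If_finite_set[of "{..<M}" "\<lambda>_. (1 - r) * (B + norm s)"]
      by (intro sums_add sums_mult2 geo) simp
    have le: "norm (((1 - r) * r ^ k) *\<^sub>R (S (Suc k) - s)) \<le> g k" for k
    proof (cases "k < M")
      case True
      have "norm (S (Suc k) - s) \<le> B + norm s" using norm_triangle_ineq4[of "S (Suc k)" s] B[of "Suc k"] by linarith
      moreover have "(1 - r) * r ^ k \<le> (1 - r) * 1" using r by (intro mult_left_mono power_le_one) auto
      ultimately have "((1 - r) * r ^ k) * norm (S (Suc k) - s) \<le> ((1 - r) * 1) * (B + norm s)"
        using r by (intro mult_mono) auto
      moreover have "0 \<le> ((1 - r) * r ^ k) * e" using r e by simp
      moreover have "norm (((1 - r) * r ^ k) *\<^sub>R (S (Suc k) - s)) = ((1 - r) * r ^ k) * norm (S (Suc k) - s)" using r by simp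
      moreover have "g k = (1 - r) * (B + norm s) + ((1 - r) * r ^ k) * e" using True by (simp add: g_def)
      ultimately show ?thesis by linarith
    next
      case False
      then show ?thesis using M[of k] r by (simp add: g_def mult_left_mono)
    qed
    have "norm ((\<Sum>k. r ^ k *\<^sub>R x k) - 1 *\<^sub>R s) \<le> (\<Sum>k<M. (1 - r) * (B + norm s)) + 1 * e"
      using norm_suminf_le[OF le sums_summable[OF gs]] sums_unique[OF d] sums_unique[OF gs] by simp
    then show ?thesis by (simp add: mult.commute mult.left_commute)
  qed
  show ?thesis
  proof (rule tendstoI)
    fix e :: real assume e: "0 < e"
    obtain M where M: "\<And>k. k \<ge> M \<Longrightarrow> norm (S k - s) < e / 2"
      using LIMSEQ_D[OF S, of "e / 2"] e by auto
    have "((\<lambda>r. (1 - r) * (real M * (B + norm s)) + e / 2) \<longlongrightarrow> (1 - 1) * (real M * (B + norm s)) + e / 2) (at_left (1::real))"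
      by (intro tendsto_intros)
    then have "\<forall>\<^sub>F r in at_left (1::real). (1 - r) * (real M * (B + norm s)) + e / 2 < e"
      by (rule order_tendstoD(2)) (use e in simp)
    moreover have "\<forall>\<^sub>F r in at_left (1::real). r \<in> {0<..<1}"
      by (rule eventually_at_leftI[of 0]) auto
    ultimately show "\<forall>\<^sub>F r in at_left 1. dist (\<Sum>k. r ^ k *\<^sub>R x k) s < e"
    proof eventually_elim
      case (elim r)
      have "norm (S (Suc k) - s) \<le> e / 2" if "k \<ge> M" for k using M[of "Suc k"] that by simp
      from key[of r M "e / 2", OF _ _ this] elim e show ?case by (simp add: dist_norm)
    qed
  qed
qed

text \<open>Brings the two notions of value to one form, the strong limit of Abel means, so that
  uniqueness and the estimates on the domain need not distinguish them.\<close>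

lemma has_value_radial:
  assumes "has_value f X Y"
  shows "((\<lambda>r. \<Sum>k. r ^ k *\<^sub>R blinfun_apply (nc_term (f j) X k) h) \<longlongrightarrow> blinfun_apply (Y j) h) (at_left 1)"
  using assms unfolding has_value_def
proof
  assume "sot_eval f X Y"
  then have "(\<lambda>k. blinfun_apply (nc_term (f j) X k) h) sums blinfun_apply (Y j) h"
    by (simp add: sot_eval_def limitin_strong_operator_topology blinfun.sum_left sums_def)
  then show ?thesis by (rule abel_vector)
next
  assume "rad_eval f X Y"
  then obtain \<delta> where \<delta>: "0 < \<delta>" "\<delta> < 1" "\<And>r. \<delta> < r \<Longrightarrow> r < 1 \<Longrightarrow> summable (nc_term (f j) (\<lambda>i. r *\<^sub>R X i))"
    and lim: "((\<lambda>r. blinfun_apply (nc_eval (f j) (\<lambda>i. r *\<^sub>R X i)) h) \<longlongrightarrow> blinfun_apply (Y j) h) (at_left 1)"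
    by (auto simp: rad_eval_def limitin_strong_operator_topology)
  have "\<forall>\<^sub>F r in at_left (1::real). r \<in> {\<delta><..<1}"
    by (rule eventually_at_leftI[of \<delta>]) (use \<delta> in auto)
  then have "\<forall>\<^sub>F r in at_left 1. blinfun_apply (nc_eval (f j) (\<lambda>i. r *\<^sub>R X i)) h = (\<Sum>k. r ^ k *\<^sub>R blinfun_apply (nc_term (f j) X k) h)"
  proof eventually_elim
    case (elim r)
    have "(\<lambda>k. blinfun_apply (nc_term (f j) (\<lambda>i. r *\<^sub>R X i) k) h) sums blinfun_apply (nc_eval (f j) (\<lambda>i. r *\<^sub>R X i)) h"
      unfolding nc_eval_def using \<delta>(3)[of r] elim
      by (intro bounded_linear.sums[OF blinfun.bounded_linear_left] summable_sums) auto
    then show ?case by (simp add: nc_term_scaleR blinfun.scaleR_left sums_unique)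
  qed
  from Lim_transform_eventually[OF lim this] show ?thesis .
qed

lemma has_value_unique:
  assumes "has_value f X Y" "has_value f X Y'"
  shows "Y = Y'"
proof (intro ext blinfun_eqI)
  fix j h
  show "blinfun_apply (Y j) h = blinfun_apply (Y' j) h"
    by (rule tendsto_unique[OF _ has_value_radial[OF assms(1)] has_value_radial[OF assms(2)]]) simp
qed

lemma clinear_sot_limit:
  assumes lim: "\<And>x. ((\<lambda>i. blinfun_apply (S i) x) \<longlongrightarrow> blinfun_apply T x) F" and "F \<noteq> bot"
    and ev: "\<forall>\<^sub>F i in F. S i \<in> bounded_clinear_ops"
  shows "T \<in> bounded_clinear_ops"
proof (rule clinear_opI)
  fix c x
  have "((\<lambda>i. c *\<^sub>C blinfun_apply (S i) x) \<longlongrightarrow> c *\<^sub>C blinfun_apply T x) F" by (intro tendsto_scaleC lim)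
  moreover have "\<forall>\<^sub>F i in F. c *\<^sub>C blinfun_apply (S i) x = blinfun_apply (S i) (c *\<^sub>C x)"
    using ev by eventually_elim (simp add: clinear_opD)
  ultimately have "((\<lambda>i. blinfun_apply (S i) (c *\<^sub>C x)) \<longlongrightarrow> c *\<^sub>C blinfun_apply T x) F"
    by (rule Lim_transform_eventually)
  from tendsto_unique[OF assms(2) lim this] show "blinfun_apply T (c *\<^sub>C x) = c *\<^sub>C blinfun_apply T x" .
qed

lemma has_value_clinear:
  assumes "has_value f X Y" and X: "\<And>i. X i \<in> bounded_clinear_ops"
  shows "Y j \<in> bounded_clinear_ops"
  using assms(1) unfolding has_value_def
proof
  assume "sot_eval f X Y"
  then have "((\<lambda>N. blinfun_apply (\<Sum>k<N. nc_term (f j) X k) x) \<longlongrightarrow> blinfun_apply (Y j) x) sequentially" for x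
    by (simp add: sot_eval_def limitin_strong_operator_topology)
  then show ?thesis by (rule clinear_sot_limit) (auto intro!: always_eventually nc_term_clinear X)
next
  assume "rad_eval f X Y"
  then obtain \<delta> where \<delta>: "0 < \<delta>" "\<delta> < 1" "\<And>r. \<delta> < r \<Longrightarrow> r < 1 \<Longrightarrow> summable (nc_term (f j) (\<lambda>i. r *\<^sub>R X i))"
    and lim: "\<And>x. ((\<lambda>r. blinfun_apply (nc_eval (f j) (\<lambda>i. r *\<^sub>R X i)) x) \<longlongrightarrow> blinfun_apply (Y j) x) (at_left 1)"
    by (auto simp: rad_eval_def limitin_strong_operator_topology)
  have "\<forall>\<^sub>F r in at_left (1::real). r \<in> {\<delta><..<1}"
    by (rule eventually_at_leftI[of \<delta>]) (use \<delta> in auto)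
  then have "\<forall>\<^sub>F r in at_left 1. nc_eval (f j) (\<lambda>i. r *\<^sub>R X i) \<in> bounded_clinear_ops"
    by eventually_elim (auto intro!: nc_eval_clinear \<delta> X)
  from clinear_sot_limit[OF lim _ this] show ?thesis by simp
qed

lemma row_norm_scaleR_less:
  assumes Y: "row_norm Y \<le> 1" and r: "0 < r" "r < 1"
  shows "row_norm (\<lambda>i. r *\<^sub>R Y i) < 1"
proof -
  have "row_norm (\<lambda>i. r *\<^sub>R Y i) \<le> r"
  proof (subst row_norm_le_iff)
    show "\<forall>h. (norm (\<Sum>i\<in>UNIV. blinfun_apply (r *\<^sub>R Y i) (h i)))\<^sup>2 \<le> r\<^sup>2 * (\<Sum>i\<in>UNIV. (norm (h i))\<^sup>2)"
    proof
      fix h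
      have "(norm (\<Sum>i\<in>UNIV. blinfun_apply (r *\<^sub>R Y i) (h i)))\<^sup>2 = r\<^sup>2 * (norm (\<Sum>i\<in>UNIV. blinfun_apply (Y i) (h i)))\<^sup>2"
        by (simp add: blinfun.scaleR_left scaleR_sum_right[symmetric] power_mult_distrib)
      also have "\<dots> \<le> r\<^sup>2 * (1\<^sup>2 * (\<Sum>i\<in>UNIV. (norm (h i))\<^sup>2))" by (intro mult_left_mono row_normD Y) auto
      finally show "(norm (\<Sum>i\<in>UNIV. blinfun_apply (r *\<^sub>R Y i) (h i)))\<^sup>2 \<le> r\<^sup>2 * (\<Sum>i\<in>UNIV. (norm (h i))\<^sup>2)" by simp
    qed
  qed (use r in simp)
  then show ?thesis using r by simp
qed

lemma domain_op_bound:
  fixes I :: "'i set" and J :: "'j set" and Y :: "'n::finite \<Rightarrow> ('a::complex_hilbert_space \<Rightarrow>\<^sub>L 'a)"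
  assumes W: "\<And>i. left_multiplication (W i)"
    and Y: "\<And>i. Y i \<in> bounded_clinear_ops" "row_norm Y \<le> 1"
    and T: "has_value (\<lambda>i. ell2_coeff (blinfun_apply (W i) (ell2_basis []))) Y T"
    and I: "finite I" and J: "finite J"
    and D: "op_bound I J (\<lambda>i j. nc_poly_eval (p i j) W) D"
  shows "op_bound I J (\<lambda>i j. nc_poly_eval (p i j) T) D"
proof -
  \<comment> \<open>\<open>V r\<close> is g(r Y): the coefficients of g_i are the symbol of
    \<open>W i\<close>.\<close>
  define V where "V r i = nc_eval (ell2_coeff (blinfun_apply (W i) (ell2_basis []))) (\<lambda>i. r *\<^sub>R Y i)" for r i
  have strict: "strict_row (\<lambda>i. r *\<^sub>R Y i)" if "0 < r" "r < 1" for r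
    by unfold_locales (use Y row_norm_scaleR_less[OF Y(2) that] in auto)
  have V_ev: "V r i = strict_row.ev (\<lambda>i. r *\<^sub>R Y i) (blinfun_apply (W i) (ell2_basis []))" if "0 < r" "r < 1" for r i
    by (simp add: V_def strict_row.ev_def[OF strict[OF that]])
  have ev01: "\<forall>\<^sub>F r in at_left (1::real). r \<in> {0<..<1}" by (rule eventually_at_leftI[of 0]) auto
  \<comment> \<open>The von Neumann inequality for one operator gives a bound uniform in
    \<open>r\<close>. In \<open>limw\<close> it controls the term where \<open>V r i\<close> meets
    the difference of the shorter words, so that strong convergence passes to products.\<close>
  have normV: "norm (V r i) \<le> norm (W i)" if r: "0 < r" "r < 1" for r i
  proof -
    have "op_bound {()} {()} (\<lambda>_ _. W i) (norm (W i))"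
      by (simp add: op_bound_def) (metis norm_blinfun power_mono power_mult_distrib norm_ge_zero)
    then have "op_bound {()} {()} (\<lambda>_ _. V r i) (norm (W i))"
      using strict_row.von_neumann[OF strict[OF r], of "{()}" "{()}" "\<lambda>_ _. W i" "norm (W i)"] W by (simp add: V_ev[OF r])
    from op_boundD[OF this, of "\<lambda>_. h" for h]
    have "(norm (blinfun_apply (V r i) h))\<^sup>2 \<le> (norm (W i) * norm h)\<^sup>2" for h
      by (simp add: power_mult_distrib)
    then have "norm (blinfun_apply (V r i) h) \<le> norm (W i) * norm h" for h
      by (rule power2_le_imp_le) simp
    then show ?thesis by (intro norm_blinfun_bound) auto
  qed
  have limV: "((\<lambda>r. blinfun_apply (V r i) h) \<longlongrightarrow> blinfun_apply (T i) h) (at_left 1)" for i h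
  proof -
    have "\<forall>\<^sub>F r in at_left 1. (\<Sum>k. r ^ k *\<^sub>R blinfun_apply (nc_term (ell2_coeff (blinfun_apply (W i) (ell2_basis []))) Y k) h) = blinfun_apply (V r i) h"
      using ev01
    proof eventually_elim
      case (elim r)
      interpret strict_row "\<lambda>i. r *\<^sub>R Y i" using strict elim by auto
      have "(\<lambda>k. blinfun_apply (nc_term (ell2_coeff (blinfun_apply (W i) (ell2_basis []))) (\<lambda>i. r *\<^sub>R Y i) k) h) sums blinfun_apply (V r i) h"
        unfolding nc_eval_def V_def
        by (intro bounded_linear.sums[OF blinfun.bounded_linear_left] summable_sums ev_summable)
      then show ?case by (simp add: nc_term_scaleR blinfun.scaleR_left sums_iff)
    qed
    from Lim_transform_eventually[OF has_value_radial[OF T] this] show ?thesis .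
  qed
  have limw: "((\<lambda>r. blinfun_apply (op_word (V r) \<alpha>) h) \<longlongrightarrow> blinfun_apply (op_word T \<alpha>) h) (at_left 1)" for \<alpha> h
  proof (induction \<alpha>)
    case (Cons i \<alpha>)
    define w where "w r = blinfun_apply (op_word (V r) \<alpha>) h" for r
    define w1 where "w1 = blinfun_apply (op_word T \<alpha>) h"
    have "((\<lambda>r. blinfun_apply (V r i) (w r - w1)) \<longlongrightarrow> 0) (at_left 1)"
    proof (rule Lim_null_comparison)
      show "\<forall>\<^sub>F r in at_left 1. norm (blinfun_apply (V r i) (w r - w1)) \<le> norm (W i) * norm (w r - w1)"
        using ev01
      proof eventually_elim
        case (elim r)
        have "norm (blinfun_apply (V r i) (w r - w1)) \<le> norm (V r i) * norm (w r - w1)" by (rule norm_blinfun)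
        also have "\<dots> \<le> norm (W i) * norm (w r - w1)" using elim by (intro mult_right_mono normV) auto
        finally show ?case .
      qed
      have "((\<lambda>r. norm (W i) * norm (w r - w1)) \<longlongrightarrow> norm (W i) * norm (w1 - w1)) (at_left 1)"
        using Cons by (intro tendsto_intros) (simp add: w_def w1_def)
      then show "((\<lambda>r. norm (W i) * norm (w r - w1)) \<longlongrightarrow> 0) (at_left 1)" by simp
    qed
    from tendsto_add[OF this limV[of i w1]]
    show ?case by (simp add: blinfun.diff_right w_def w1_def)
  qed simp
  have limp: "((\<lambda>r. blinfun_apply (nc_poly_eval q (V r)) h) \<longlongrightarrow> blinfun_apply (nc_poly_eval q T) h) (at_left 1)" for q h
    unfolding nc_poly_eval_def blinfun.sum_left scaleC_op_apply by (intro tendsto_sum tendsto_scaleC limw)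
  show ?thesis
    unfolding op_bound_def
  proof
    fix h
    have "((\<lambda>r. \<Sum>i\<in>I. (norm (\<Sum>j\<in>J. blinfun_apply (nc_poly_eval (p i j) (V r)) (h j)))\<^sup>2) \<longlongrightarrow>
        (\<Sum>i\<in>I. (norm (\<Sum>j\<in>J. blinfun_apply (nc_poly_eval (p i j) T) (h j)))\<^sup>2)) (at_left 1)"
      by (intro tendsto_intros limp)
    then show "(\<Sum>i\<in>I. (norm (\<Sum>j\<in>J. blinfun_apply (nc_poly_eval (p i j) T) (h j)))\<^sup>2) \<le> D\<^sup>2 * (\<Sum>j\<in>J. (norm (h j))\<^sup>2)"
    proof (rule tendsto_upperbound)
      show "\<forall>\<^sub>F r in at_left 1. (\<Sum>i\<in>I. (norm (\<Sum>j\<in>J. blinfun_apply (nc_poly_eval (p i j) (V r)) (h j)))\<^sup>2) \<le> D\<^sup>2 * (\<Sum>j\<in>J. (norm (h j))\<^sup>2)"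
        using ev01
      proof eventually_elim
        case (elim r)
        then have r: "0 < r" "r < 1" by auto
        have "nc_poly_eval (p i j) (V r) = strict_row.ev (\<lambda>i. r *\<^sub>R Y i) (blinfun_apply (nc_poly_eval (p i j) W) (ell2_basis []))" for i j
          using strict_row.nc_poly_eval_ev[OF strict[OF r], of W "p i j"] W by (simp add: V_ev[OF r, abs_def])
        moreover have "op_bound I J (\<lambda>i j. strict_row.ev (\<lambda>i. r *\<^sub>R Y i) (blinfun_apply (nc_poly_eval (p i j) W) (ell2_basis []))) D"
          by (intro strict_row.von_neumann[OF strict[OF r]] I J left_multiplication_poly_eval W D)
        ultimately show ?case using op_boundD by simp
      qed
    qed simp
  qed
qed

lemma nc_poly_eval_diff:
  assumes "nc_polynomial p" "nc_polynomial q"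
  shows "nc_poly_eval (\<lambda>\<alpha>. p \<alpha> + (-1) * q \<alpha>) X = nc_poly_eval p X - nc_poly_eval q X"
  unfolding nc_poly_eval_add[OF assms(1) nc_polynomial_scale[OF assms(2)]] nc_poly_eval_scale[OF assms(2)]
  by (rule blinfun_eqI) (simp add: blinfun.add_left blinfun.diff_left scaleC_minus_left)

text \<open>\<open>domain_op_bound\<close> with the bound 0, applied to the difference of the two
  polynomials.\<close>

lemma domain_poly_eval_cong:
  assumes W: "\<And>i. left_multiplication (W i)"
    and Y: "\<And>i. Y i \<in> bounded_clinear_ops" "row_norm Y \<le> 1"
    and T: "has_value (\<lambda>i. ell2_coeff (blinfun_apply (W i) (ell2_basis []))) Y T"
    and pq: "nc_polynomial p" "nc_polynomial q" "nc_poly_eval p W = nc_poly_eval q W"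
  shows "nc_poly_eval p T = nc_poly_eval q T"
proof -
  define d where "d = (\<lambda>\<alpha>. p \<alpha> + (-1) * q \<alpha>)"
  have "op_bound {()} {()} (\<lambda>_ _. nc_poly_eval d W) 0"
    using pq(3) nc_poly_eval_diff[OF pq(1,2), of W, folded d_def] by (simp add: op_bound_def)
  then have "op_bound {()} {()} (\<lambda>_ _. nc_poly_eval d T) 0"
    by (intro domain_op_bound[OF W Y T]) auto
  from op_boundD[OF this, of "\<lambda>_. x" for x] have "nc_poly_eval d T = 0" by (intro blinfun_eqI) simp
  then show ?thesis using nc_poly_eval_diff[OF pq(1,2), of T, folded d_def] by simp
qed

section \<open>Formal substitution\<close>

lemma nc_mult_Nil [simp]: "nc_mult c d [] = c [] * d []"
  by (simp add: nc_mult_def)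

text \<open>Separates the cut before the first letter from all others; associativity and the right
  unit law become inductions on the word.\<close>

lemma nc_mult_Cons: "nc_mult c d (i # \<gamma>) = c [] * d (i # \<gamma>) + nc_mult (\<lambda>\<alpha>. c (i # \<alpha>)) d \<gamma>"
  unfolding nc_mult_def by (simp add: sum.atMost_Suc_shift del: sum.atMost_Suc)

lemma nc_mult_linear_left:
  "nc_mult (\<lambda>\<alpha>. x * c \<alpha> + d \<alpha>) e \<gamma> = x * nc_mult c e \<gamma> + nc_mult d e \<gamma>"
  by (simp add: nc_mult_def distrib_right sum.distrib sum_distrib_left mult.assoc)

lemma nc_mult_assoc_apply: "nc_mult (nc_mult c d) e \<gamma> = nc_mult c (nc_mult d e) \<gamma>"
proof (induction \<gamma> arbitrary: c)
  case (Cons i \<gamma>)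
  show ?case
    unfolding nc_mult_Cons[of _ _ i] nc_mult_linear_left Cons.IH by (simp add: algebra_simps)
qed simp

lemma nc_mult_assoc: "nc_mult (nc_mult c d) e = nc_mult c (nc_mult d e)"
  by (rule ext) (rule nc_mult_assoc_apply)

lemma nc_mult_zero_left [simp]: "nc_mult (\<lambda>_. 0) d \<gamma> = 0"
  by (simp add: nc_mult_def)

lemma nc_mult_one_left [simp]: "nc_mult nc_one c = c"
proof
  show "nc_mult nc_one c \<gamma> = c \<gamma>" for \<gamma> by (cases \<gamma>) (auto simp: nc_mult_Cons nc_one_def)
qed

lemma nc_mult_one_right [simp]: "nc_mult c nc_one = c"
proof
  show "nc_mult c nc_one \<gamma> = c \<gamma>" for \<gamma>
    by (induction \<gamma> arbitrary: c) (auto simp: nc_mult_Cons nc_one_def)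
qed

lemma nc_mult_var: "nc_mult (nc_var i) d \<gamma> = (case \<gamma> of [] \<Rightarrow> 0 | j # \<beta> \<Rightarrow> if j = i then d \<beta> else 0)"
proof (cases \<gamma>)
  case (Cons j \<beta>)
  have "(\<lambda>\<alpha>. nc_var i (j # \<alpha>)) = (if j = i then nc_one else (\<lambda>_. 0))" by (auto simp: nc_var_def nc_one_def)
  then show ?thesis using Cons by (simp add: nc_mult_Cons nc_var_def)
qed (simp add: nc_var_def)

lemma nc_word_simps [simp]: "nc_word f [] = nc_one" "nc_word f (i # \<alpha>) = nc_mult (f i) (nc_word f \<alpha>)"
  by (simp_all add: nc_word_def)

lemma nc_word_append: "nc_word f (\<alpha> @ \<beta>) = nc_mult (nc_word f \<alpha>) (nc_word f \<beta>)"
  by (induction \<alpha>) (auto simp: nc_mult_assoc)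

text \<open>Sums over infinite index sets are 0 by convention, so \<open>nc_subst\<close> has its
  meaning only under this condition, which holds for polynomials and whenever f(0) = 0.\<close>

definition substitutable :: "'n nc_series \<Rightarrow> ('n \<Rightarrow> 'n nc_series) \<Rightarrow> bool" where
  "substitutable c f \<longleftrightarrow> (\<forall>\<beta>. finite {\<alpha>. c \<alpha> \<noteq> 0 \<and> nc_word f \<alpha> \<beta> \<noteq> 0})"

lemma substitutable_polynomial: "nc_polynomial c \<Longrightarrow> substitutable c f"
  unfolding nc_polynomial_def substitutable_def by (auto intro: rev_finite_subset)

text \<open>A factor without constant term uses up at least one letter.\<close>

lemma nc_word_low_degree:
  assumes "\<And>i. f i [] = 0"
  shows "length \<beta> < length \<alpha> \<Longrightarrow> nc_word f \<alpha> \<beta> = 0"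
proof (induction \<alpha> arbitrary: \<beta>)
  case (Cons i \<alpha>)
  have "f i (take k \<beta>) * nc_word f \<alpha> (drop k \<beta>) = 0" if "k \<le> length \<beta>" for k
  proof (cases "k = 0")
    case False
    then have "length (drop k \<beta>) < length \<alpha>" using Cons.prems that by auto
    then show ?thesis using Cons.IH by simp
  qed (simp add: assms)
  then show ?case unfolding nc_word_simps nc_mult_def by (intro sum.neutral) auto
qed simp

lemma substitutable_vanishing:
  fixes f :: "'n::finite \<Rightarrow> 'n nc_series"
  assumes "\<And>i. f i [] = 0"
  shows "substitutable c f"
  unfolding substitutable_def
proof
  fix \<beta> :: "'n list"
  have "{\<alpha>. c \<alpha> \<noteq> 0 \<and> nc_word f \<alpha> \<beta> \<noteq> 0} \<subseteq> {\<alpha>. length \<alpha> < Suc (length \<beta>)}"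
    using nc_word_low_degree[of f \<beta>, OF assms] by (auto simp: less_Suc_eq_le not_less[symmetric])
  then show "finite {\<alpha>. c \<alpha> \<noteq> 0 \<and> nc_word f \<alpha> \<beta> \<noteq> 0}" by (rule finite_subset) (rule finite_words_below)
qed

lemma nc_subst_superset:
  "finite F \<Longrightarrow> {\<alpha>. c \<alpha> \<noteq> 0 \<and> nc_word f \<alpha> \<beta> \<noteq> 0} \<subseteq> F \<Longrightarrow> nc_subst c f \<beta> = (\<Sum>\<alpha>\<in>F. c \<alpha> * nc_word f \<alpha> \<beta>)"
  unfolding nc_subst_def by (rule sum.mono_neutral_left) auto

lemma nc_subst_linear:
  assumes "substitutable c f" "substitutable d f"
  shows "nc_subst (\<lambda>\<alpha>. c \<alpha> + x * d \<alpha>) f \<beta> = nc_subst c f \<beta> + x * nc_subst d f \<beta>"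
proof -
  define F where "F = {\<alpha>. c \<alpha> \<noteq> 0 \<and> nc_word f \<alpha> \<beta> \<noteq> 0} \<union> {\<alpha>. d \<alpha> \<noteq> 0 \<and> nc_word f \<alpha> \<beta> \<noteq> 0}"
  have F: "finite F" "{\<alpha>. c \<alpha> \<noteq> 0 \<and> nc_word f \<alpha> \<beta> \<noteq> 0} \<subseteq> F" "{\<alpha>. d \<alpha> \<noteq> 0 \<and> nc_word f \<alpha> \<beta> \<noteq> 0} \<subseteq> F"
    "{\<alpha>. c \<alpha> + x * d \<alpha> \<noteq> 0 \<and> nc_word f \<alpha> \<beta> \<noteq> 0} \<subseteq> F"
    using assms by (auto simp: F_def substitutable_def)
  show ?thesis
    unfolding nc_subst_superset[OF F(1,2)] nc_subst_superset[OF F(1,3)] nc_subst_superset[of F "\<lambda>\<alpha>. c \<alpha> + x * d \<alpha>", OF F(1,4)]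
    by (simp add: sum.distrib sum_distrib_left algebra_simps)
qed

lemma nc_subst_basis: "nc_subst (ell2_coeff (ell2_basis \<alpha>)) f = nc_word f \<alpha>"
  by (rule ext, subst nc_subst_superset[of "{\<alpha>}"]) (auto split: if_splits)

lemma nc_subst_rshift:
  assumes "substitutable (ell2_coeff u) f"
  shows "nc_subst (ell2_coeff (blinfun_apply (rshift \<delta>) u)) f = nc_mult (nc_subst (ell2_coeff u) f) (nc_word f \<delta>)"
proof
  fix \<beta>
  define v where "v = ell2_coeff (blinfun_apply (rshift \<delta>) u)"
  \<comment> \<open>The product at \<beta> involves the substituted series at all prefixes of
    \<beta>; \<open>F\<close> collects every word that contributes to one of them.\<close>
  define F where "F = (\<Union>k\<le>length \<beta>. {\<alpha>. ell2_coeff u \<alpha> \<noteq> 0 \<and> nc_word f \<alpha> (take k \<beta>) \<noteq> 0})"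
  have F: "finite F" using assms by (auto simp: F_def substitutable_def)
  have v: "v (\<alpha> @ \<delta>) = ell2_coeff u \<alpha>" for \<alpha> by (simp add: v_def rshift_coeff_append)
  have "{\<gamma>. v \<gamma> \<noteq> 0 \<and> nc_word f \<gamma> \<beta> \<noteq> 0} \<subseteq> (\<lambda>\<alpha>. \<alpha> @ \<delta>) ` F"
  proof safe
    fix \<gamma> assume g: "v \<gamma> \<noteq> 0" "nc_word f \<gamma> \<beta> \<noteq> 0"
    then obtain \<alpha> where \<gamma>: "\<gamma> = \<alpha> @ \<delta>" using rshift_coeff_other[of \<gamma> \<delta> u] v_def by blast
    then have "ell2_coeff u \<alpha> \<noteq> 0" using g(1) v by simp
    moreover have "(\<Sum>k\<le>length \<beta>. nc_word f \<alpha> (take k \<beta>) * nc_word f \<delta> (drop k \<beta>)) \<noteq> 0"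
      using g(2) by (simp add: \<gamma> nc_word_append nc_mult_def)
    then obtain k where "k \<le> length \<beta>" "nc_word f \<alpha> (take k \<beta>) \<noteq> 0"
      by (metis (no_types, lifting) sum.not_neutral_contains_not_neutral atMost_iff mult_eq_0_iff)
    ultimately show "\<gamma> \<in> (\<lambda>\<alpha>. \<alpha> @ \<delta>) ` F" by (auto simp: F_def \<gamma>)
  qed
  then have "nc_subst v f \<beta> = (\<Sum>\<gamma>\<in>(\<lambda>\<alpha>. \<alpha> @ \<delta>) ` F. v \<gamma> * nc_word f \<gamma> \<beta>)"
    by (intro nc_subst_superset) (use F in auto)
  also have "\<dots> = (\<Sum>\<alpha>\<in>F. ell2_coeff u \<alpha> * nc_mult (nc_word f \<alpha>) (nc_word f \<delta>) \<beta>)"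
    by (subst sum.reindex) (auto simp: inj_on_def v nc_word_append)
  also have "\<dots> = (\<Sum>k\<le>length \<beta>. (\<Sum>\<alpha>\<in>F. ell2_coeff u \<alpha> * nc_word f \<alpha> (take k \<beta>)) * nc_word f \<delta> (drop k \<beta>))"
    unfolding nc_mult_def sum_distrib_left sum_distrib_right by (subst sum.swap) (simp add: mult.assoc)
  also have "\<dots> = (\<Sum>k\<le>length \<beta>. nc_subst (ell2_coeff u) f (take k \<beta>) * nc_word f \<delta> (drop k \<beta>))"
    by (intro sum.cong refl arg_cong2[where f = "(*)"] nc_subst_superset[OF F, symmetric]) (auto simp: F_def)
  finally show "nc_subst v f \<beta> = nc_mult (nc_subst (ell2_coeff u) f) (nc_word f \<delta>) \<beta>"
    by (simp add: nc_mult_def)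
qed

section \<open>Injectivity of formal substitution\<close>

lemma nc_mult_lowest:
  assumes "\<And>\<beta>'. length \<beta>' < length \<beta> \<Longrightarrow> w \<beta>' = 0"
  shows "nc_mult c w \<beta> = c [] * w \<beta>"
proof -
  have "nc_mult c w \<beta> = (\<Sum>k\<in>{0}. c (take k \<beta>) * w (drop k \<beta>))"
    unfolding nc_mult_def by (rule sum.mono_neutral_right) (auto intro!: assms)
  then show ?thesis by simp
qed

text \<open>In lowest degree the coefficients of the products f_\<alpha> form a tensor power of the
  Jacobian J_f(0), one factor for each letter.\<close>

lemma nc_word_diagonal:
  assumes "\<And>i. f i [] = 0" "length \<alpha> = length \<beta>"
  shows "nc_word f (i # \<alpha>) (j # \<beta>) = f i [j] * nc_word f \<alpha> \<beta>"
  using nc_mult_lowest[of \<beta> "nc_word f \<alpha>" "\<lambda>\<alpha>. f i (j # \<alpha>)"] nc_word_low_degree[of f _ \<alpha>, OF assms(1)] assms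
  by (simp add: nc_mult_Cons)

lemma left_kernel_trivial:
  fixes J :: "complex^'n^'n"
  assumes "det J \<noteq> 0" "\<And>j. (\<Sum>i\<in>UNIV. d i * J $ i $ j) = 0"
  shows "d i = 0"
proof -
  have "invertible (transpose J)" using assms(1) by (simp add: invertible_det_nz det_transpose)
  then obtain B where B: "B ** transpose J = mat 1" by (auto simp: invertible_def)
  define x where "x = (\<chi> i. d i)"
  have "transpose J *v x = 0"
    using assms(2) by (simp add: vec_eq_iff matrix_vector_mult_def transpose_def x_def mult.commute)
  then have "x = 0" using B by (metis matrix_vector_mul_assoc matrix_vector_mul_lid matrix_vector_mult_0_right)
  then show ?thesis by (simp add: x_def vec_eq_iff)
qed

text \<open>Tensor powers of an invertible matrix are injective; the induction strips one tensor
  factor at a time with \<open>left_kernel_trivial\<close>.\<close>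

lemma diagonal_injective:
  fixes f :: "'n::finite \<Rightarrow> 'n nc_series"
  assumes f0: "\<And>i. f i [] = 0" and det: "det ((\<chi> i j. f i [j]) :: complex^'n^'n) \<noteq> 0"
  shows "(\<And>\<beta>. length \<beta> = m \<Longrightarrow> (\<Sum>\<alpha> | length \<alpha> = m. c \<alpha> * nc_word f \<alpha> \<beta>) = 0) \<Longrightarrow> length \<alpha> = m \<Longrightarrow> c \<alpha> = 0"
proof (induction m arbitrary: c \<alpha>)
  case 0
  from 0(1)[of "[]"] 0(2) show ?case by (simp add: nc_one_def)
next
  case (Suc m)
  obtain i \<alpha>' where \<alpha>: "\<alpha> = i # \<alpha>'" "length \<alpha>' = m" using Suc.prems(2) by (cases \<alpha>) auto
  have "(\<Sum>\<alpha> | length \<alpha> = m. c (i # \<alpha>) * nc_word f \<alpha> \<beta>) = 0" if \<beta>: "length \<beta> = m" for \<beta> i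
  proof (rule left_kernel_trivial[OF det])
    fix j
    have "0 = (\<Sum>i\<in>UNIV. \<Sum>\<alpha> | length \<alpha> = m. c (i # \<alpha>) * nc_word f (i # \<alpha>) (j # \<beta>))"
      using Suc.prems(1)[of "j # \<beta>"] \<beta> unfolding sum_words_Suc by simp
    also have "\<dots> = (\<Sum>i\<in>UNIV. (\<Sum>\<alpha> | length \<alpha> = m. c (i # \<alpha>) * nc_word f \<alpha> \<beta>) * f i [j])"
      unfolding sum_distrib_right
      by (intro sum.cong refl) (use nc_word_diagonal[of f _ \<beta>, OF f0] \<beta> in auto)
    finally show "(\<Sum>i\<in>UNIV. (\<Sum>\<alpha> | length \<alpha> = m. c (i # \<alpha>) * nc_word f \<alpha> \<beta>) * (\<chi> i j. f i [j]) $ i $ j) = 0" by simp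
  qed
  from Suc.IH[of "\<lambda>\<alpha>. c (i # \<alpha>)", OF this \<alpha>(2)] show ?case by (simp add: \<alpha>(1))
qed

text \<open>In degree m, words shorter than m drop out by induction and longer ones by
  \<open>nc_word_low_degree\<close>, so only the diagonal block of length m remains.\<close>

lemma formal_substitution_injective:
  fixes f :: "'n::finite \<Rightarrow> 'n nc_series"
  assumes f0: "\<And>i. f i [] = 0" and det: "det ((\<chi> i j. f i [j]) :: complex^'n^'n) \<noteq> 0"
    and eq: "nc_subst c f = nc_subst d f"
  shows "c = d"
proof -
  define e where "e \<alpha> = c \<alpha> + (-1) * d \<alpha>" for \<alpha>
  have e0: "nc_subst e f \<beta> = 0" for \<beta>
    unfolding e_def nc_subst_linear[OF substitutable_vanishing[where f = f, OF f0] substitutable_vanishing[where f = f, OF f0]] eq by simp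
  have "e \<alpha> = 0" if "length \<alpha> = m" for m \<alpha>
    using that
  proof (induction m arbitrary: \<alpha> rule: less_induct)
    case (less m)
    have "(\<Sum>\<alpha> | length \<alpha> = m. e \<alpha> * nc_word f \<alpha> \<beta>) = 0" if \<beta>: "length \<beta> = m" for \<beta>
    proof -
      have "0 = (\<Sum>\<alpha> | length \<alpha> = m. e \<alpha> * nc_word f \<alpha> \<beta>)"
        unfolding e0[of \<beta>, symmetric]
      proof (rule nc_subst_superset[OF finite_words])
        have "e \<alpha> = 0" if "length \<alpha> < m" for \<alpha> using less.IH[OF that] by simp
        then show "{\<alpha>. e \<alpha> \<noteq> 0 \<and> nc_word f \<alpha> \<beta> \<noteq> 0} \<subseteq> {\<alpha>. length \<alpha> = m}"
          using nc_word_low_degree[of f \<beta>, OF f0] \<beta> by (auto intro: linorder_neqE_nat)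
      qed
      then show ?thesis by simp
    qed
    from diagonal_injective[where f = f, OF f0 det this less.prems] show ?case .
  qed
  then have "e \<alpha> = 0" for \<alpha> by blast
  then show ?thesis by (auto simp: e_def fun_eq_iff)
qed

lemma nc_polynomial_sum:
  "(\<And>\<alpha>. \<alpha> \<in> F \<Longrightarrow> nc_polynomial (q \<alpha>)) \<Longrightarrow> nc_polynomial (\<lambda>\<beta>. \<Sum>\<alpha>\<in>F. c \<alpha> * q \<alpha> \<beta>)"
proof (induction F rule: infinite_finite_induct)
  case (insert x F)
  then show ?case by (auto intro!: nc_polynomial_add nc_polynomial_scale)
qed (auto simp: nc_polynomial_def)

lemma nc_poly_eval_sum:
  "(\<And>\<alpha>. \<alpha> \<in> F \<Longrightarrow> nc_polynomial (q \<alpha>)) \<Longrightarrow>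
    nc_poly_eval (\<lambda>\<beta>. \<Sum>\<alpha>\<in>F. c \<alpha> * q \<alpha> \<beta>) X = (\<Sum>\<alpha>\<in>F. scaleC_op (c \<alpha>) (nc_poly_eval (q \<alpha>) X))"
proof (induction F rule: infinite_finite_induct)
  case (insert x F)
  then show ?case by (simp add: nc_poly_eval_add nc_poly_eval_scale nc_polynomial_scale nc_polynomial_sum)
qed (simp_all add: nc_poly_eval_def)

lemma nc_word_polynomial: "(\<And>i. nc_polynomial (f i)) \<Longrightarrow> nc_polynomial (nc_word f \<alpha>)"
  by (induction \<alpha>) (auto intro: nc_polynomial_one nc_polynomial_mult)

lemma nc_poly_eval_word:
  assumes "\<And>i. nc_polynomial (f i)" "\<And>i. X i \<in> bounded_clinear_ops"
  shows "nc_poly_eval (nc_word f \<alpha>) X = op_word (\<lambda>j. nc_poly_eval (f j) X) \<alpha>"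
  by (induction \<alpha>) (auto simp: nc_poly_eval_one nc_poly_eval_mult nc_word_polynomial assms)

lemma nc_poly_eval_subst:
  assumes c: "nc_polynomial c" and f: "\<And>i. nc_polynomial (f i)" and X: "\<And>i. X i \<in> bounded_clinear_ops"
  shows "nc_poly_eval (nc_subst c f) X = nc_poly_eval c (\<lambda>j. nc_poly_eval (f j) X)"
proof -
  have "nc_subst c f = (\<lambda>\<beta>. \<Sum>\<alpha> | c \<alpha> \<noteq> 0. c \<alpha> * nc_word f \<alpha> \<beta>)"
    by (rule ext, rule nc_subst_superset) (use c in \<open>auto simp: nc_polynomial_def\<close>)
  then have "nc_poly_eval (nc_subst c f) X = (\<Sum>\<alpha> | c \<alpha> \<noteq> 0. scaleC_op (c \<alpha>) (nc_poly_eval (nc_word f \<alpha>) X))"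
    by (simp add: nc_poly_eval_sum nc_word_polynomial f)
  then show ?thesis by (simp add: nc_poly_eval_word f X) (simp add: nc_poly_eval_def)
qed

lemma op_word_lshift: "blinfun_apply (op_word lshift \<alpha>) (ell2_basis \<beta>) = ell2_basis (\<alpha> @ \<beta>)"
  by (induction \<alpha>) (auto simp: lshift_basis)

lemma nc_poly_eval_lshift:
  assumes "nc_polynomial p"
  shows "ell2_coeff (blinfun_apply (nc_poly_eval p lshift) (ell2_basis [])) \<beta> = p \<beta>"
proof -
  have "ell2_coeff (blinfun_apply (nc_poly_eval p lshift) (ell2_basis [])) \<beta> = (\<Sum>\<alpha> | p \<alpha> \<noteq> 0. if \<alpha> = \<beta> then p \<beta> else 0)"
    unfolding nc_poly_eval_def blinfun.sum_left ell2_coeff_sum by (intro sum.cong) (auto simp: op_word_lshift)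
  then show ?thesis using assms by (simp add: nc_polynomial_def)
qed

text \<open>If \<open>c \<circ> f = d \<circ> f\<close>, evaluate at \<open>g(S)\<close> for the tuple \<open>S\<close> of left shifts: \<open>f(g(S)) = S\<close>, and \<open>S\<close>
  satisfies no polynomial identity.\<close>

lemma polynomial_substitution_injective:
  fixes f :: "'n \<Rightarrow> 'n nc_series"
  assumes f: "\<And>i. nc_polynomial (f i)" and g: "\<And>i. nc_polynomial (g i)" and fg: "\<And>i. nc_subst (f i) g = nc_var i"
    and c: "nc_polynomial c" and d: "nc_polynomial d" and eq: "nc_subst c f = nc_subst d f"
  shows "c = d"
proof -
  define X where "X j = nc_poly_eval (g j) lshift" for j
  have X: "X j \<in> bounded_clinear_ops" for j unfolding X_def by (intro nc_poly_eval_clinear lshift_clinear)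
  have fX: "nc_poly_eval (f j) X = lshift j" for j
    using nc_poly_eval_subst[of "f j" g lshift, OF f g lshift_clinear] by (simp add: fg nc_poly_eval_var X_def[abs_def])
  have "nc_poly_eval c lshift = nc_poly_eval d lshift"
    using nc_poly_eval_subst[of c f X, OF c f X] nc_poly_eval_subst[of d f X, OF d f X] by (simp add: fX eq)
  then show ?thesis using nc_poly_eval_lshift[OF c] nc_poly_eval_lshift[OF d] by (metis ext)
qed

section \<open>The universal model\<close>

text \<open>Makes square-summable series, whose degree norms are bounded, admissible in the
  faithfulness condition of case (F).\<close>

lemma degree_norm_bounded_radius:
  fixes c :: "'n::finite nc_series"
  assumes "\<And>k. degree_norm c k \<le> B"
  shows "nc_radius c \<ge> 1"
  unfolding nc_radius_def degree_norm_def[symmetric]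
proof (rule conv_radius_geI_ex)
  fix r :: real assume r: "0 < r" "ereal r < 1"
  have "summable (\<lambda>k. degree_norm c k * r ^ k)"
  proof (rule summable_comparison_test')
    show "summable (\<lambda>k. B * r ^ k)" using r by (intro summable_mult summable_geometric) auto
    show "norm (degree_norm c k * r ^ k) \<le> B * r ^ k" if "k \<ge> 0" for k
      using r assms[of k] degree_norm_nonneg[of c k] by (simp add: abs_mult mult_right_mono)
  qed
  then show "\<exists>z. norm z = r \<and> summable (\<lambda>k. degree_norm c k * z ^ k)"
    using r by (intro exI[of _ r]) auto
qed

lemma nc_eval_var: "nc_eval (nc_var i) X = X i"
  unfolding nc_eval_def using sums_unique[OF nc_term_sums_poly_eval(1)[OF nc_polynomial_var, of i X]]
  by (simp add: nc_poly_eval_var)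

lemma polynomial_has_value:
  fixes f :: "'n::finite \<Rightarrow> 'n nc_series"
  assumes "\<And>j. nc_polynomial (f j)"
  shows "has_value f X (\<lambda>j. nc_poly_eval (f j) X)"
  unfolding has_value_def sot_eval_def limitin_strong_operator_topology
proof (intro disjI1 allI)
  fix j x
  have "(\<lambda>N. \<Sum>k<N. nc_term (f j) X k) \<longlonglongrightarrow> nc_poly_eval (f j) X"
    using nc_term_sums_poly_eval(1)[OF assms] by (simp add: sums_def)
  then show "(\<lambda>N. blinfun_apply (\<Sum>k<N. nc_term (f j) X k) x) \<longlonglongrightarrow> blinfun_apply (nc_poly_eval (f j) X) x"
    by (rule bounded_linear.tendsto[OF blinfun.bounded_linear_left])
qed

lemma ell2_basis_polynomial: "nc_polynomial (ell2_coeff (ell2_basis \<beta>))"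
  unfolding nc_polynomial_def by (rule finite_subset[of _ "{\<beta>}"]) auto

lemma rshift_polynomial:
  assumes "nc_polynomial (ell2_coeff u)"
  shows "nc_polynomial (ell2_coeff (blinfun_apply (rshift \<beta>) u))"
proof -
  have "{\<gamma>. ell2_coeff (blinfun_apply (rshift \<beta>) u) \<gamma> \<noteq> 0} \<subseteq> (\<lambda>\<alpha>. \<alpha> @ \<beta>) ` {\<alpha>. ell2_coeff u \<alpha> \<noteq> 0}"
  proof
    fix \<gamma> assume g: "\<gamma> \<in> {\<gamma>. ell2_coeff (blinfun_apply (rshift \<beta>) u) \<gamma> \<noteq> 0}"
    then obtain \<alpha> where "\<gamma> = \<alpha> @ \<beta>" using rshift_coeff_other[of \<gamma> \<beta> u] by blast
    then show "\<gamma> \<in> (\<lambda>\<alpha>. \<alpha> @ \<beta>) ` {\<alpha>. ell2_coeff u \<alpha> \<noteq> 0}" using g by (auto simp: rshift_coeff_append)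
  qed
  then show ?thesis using assms unfolding nc_polynomial_def by (meson finite_imageI finite_subset)
qed

text \<open>The common form in which the three alternatives of the model property deliver the
  operators \<open>W i\<close>.\<close>

lemma left_multiplication_rshift_basis:
  assumes "T \<in> bounded_clinear_ops" "\<And>\<beta>. blinfun_apply T (ell2_basis \<beta>) = blinfun_apply (rshift \<beta>) a"
  shows "left_multiplication T" "blinfun_apply T (ell2_basis []) = a"
proof -
  have r: "blinfun_apply (rshift []) a = a"
    by (rule ell2_eqI) (use rshift_coeff_append[of "[]" a] in simp)
  show "blinfun_apply T (ell2_basis []) = a" using assms(2)[of "[]"] r by simp
  then show "left_multiplication T" by (intro left_multiplicationI assms(1)) (simp add: assms(2))
qed

text \<open>In case (A) the relation f(W) = \<open>lshift\<close> has to be derived. For a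
  polynomial p the symbol of p(W), substituted in f, returns p (\<open>poly\<close>); for p = f_j
  the symbol \<open>ell2_basis [j]\<close> does the same, so injectivity of substitution identifies
  the two.\<close>

lemma model_A_universal:
  fixes f :: "'n::finite \<Rightarrow> 'n nc_series"
  assumes "model_A f a W"
  shows "left_multiplication (W i)" "blinfun_apply (W i) (ell2_basis []) = a i" "has_value f W lshift"
proof -
  obtain g where f: "\<And>i. nc_polynomial (f i)" and g: "\<And>i. nc_polynomial (g i)"
    and fg: "\<And>i. nc_subst (f i) g = nc_var i"
    and a: "\<And>i. nc_polynomial (ell2_coeff (a i))" "\<And>i. nc_subst (ell2_coeff (a i)) f = nc_var i"
    and W: "\<And>i. W i \<in> bounded_clinear_ops"
      "\<And>i u. nc_polynomial (ell2_coeff u) \<Longrightarrow> nc_polynomial (ell2_coeff (blinfun_apply (W i) u))"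
      "\<And>i u. nc_polynomial (ell2_coeff u) \<Longrightarrow> nc_subst (ell2_coeff (blinfun_apply (W i) u)) f = nc_mult (nc_var i) (nc_subst (ell2_coeff u) f)"
    using assms unfolding model_A_def by blast
  have inj: "u = v" if "nc_polynomial (ell2_coeff u)" "nc_polynomial (ell2_coeff v)"
    "nc_subst (ell2_coeff u) f = nc_subst (ell2_coeff v) f" for u v
    using polynomial_substitution_injective[OF f g fg that] by (simp add: ell2_coeff_inject)
  have basis: "blinfun_apply (W i) (ell2_basis \<beta>) = blinfun_apply (rshift \<beta>) (a i)" for i \<beta>
    by (rule inj) (simp_all add: W ell2_basis_polynomial rshift_polynomial a nc_subst_basis
        nc_subst_rshift[OF substitutable_polynomial[OF a(1)]])
  note lm = left_multiplication_rshift_basis[OF W(1) basis]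
  show "left_multiplication (W i)" "blinfun_apply (W i) (ell2_basis []) = a i" for i by (rule lm)+
  have word: "nc_polynomial (ell2_coeff (blinfun_apply (op_word W \<alpha>) (ell2_basis []))) \<and>
      nc_subst (ell2_coeff (blinfun_apply (op_word W \<alpha>) (ell2_basis []))) f = ell2_coeff (ell2_basis \<alpha>)" for \<alpha>
  proof (induction \<alpha>)
    case Nil
    show ?case
      unfolding op_word_simps blinfun_id_apply nc_subst_basis nc_word_simps
      by (intro conjI ell2_basis_polynomial ext) (simp add: nc_one_def)
  next
    case (Cons i \<alpha>)
    have "nc_mult (nc_var i) (ell2_coeff (ell2_basis \<alpha>)) = ell2_coeff (ell2_basis (i # \<alpha>))"
      by (auto simp: fun_eq_iff nc_mult_var split: list.split)
    with Cons show ?case by (simp only: op_word_simps blinfun_apply_blinfun_compose W(2,3) simp_thms)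
  qed
  have poly: "nc_polynomial (ell2_coeff (blinfun_apply (nc_poly_eval p W) (ell2_basis []))) \<and>
      nc_subst (ell2_coeff (blinfun_apply (nc_poly_eval p W) (ell2_basis []))) f = p" if p: "nc_polynomial p" for p
  proof -
    define w where "w \<alpha> = ell2_coeff (blinfun_apply (op_word W \<alpha>) (ell2_basis []))" for \<alpha>
    have w: "nc_polynomial (w \<alpha>)" "nc_subst (w \<alpha>) f = ell2_coeff (ell2_basis \<alpha>)" for \<alpha>
      using word by (auto simp: w_def)
    have eq: "ell2_coeff (blinfun_apply (nc_poly_eval p W) (ell2_basis [])) = (\<lambda>\<beta>. \<Sum>\<alpha> | p \<alpha> \<noteq> 0. p \<alpha> * w \<alpha> \<beta>)"
      by (simp add: fun_eq_iff nc_poly_eval_def blinfun.sum_left w_def)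
    have P: "nc_polynomial (\<lambda>\<beta>. \<Sum>\<alpha>\<in>F. p \<alpha> * w \<alpha> \<beta>)" for F by (rule nc_polynomial_sum) (rule w)
    have "nc_subst (\<lambda>\<beta>. \<Sum>\<alpha>\<in>F. p \<alpha> * w \<alpha> \<beta>) f = (\<lambda>\<beta>. \<Sum>\<alpha>\<in>F. p \<alpha> * ell2_coeff (ell2_basis \<alpha>) \<beta>)" if "finite F" for F
      using that
    proof (induction F)
      case (insert x F)
      have "nc_subst (\<lambda>\<beta>. (\<Sum>\<alpha>\<in>F. p \<alpha> * w \<alpha> \<beta>) + p x * w x \<beta>) f \<beta> =
          nc_subst (\<lambda>\<beta>. \<Sum>\<alpha>\<in>F. p \<alpha> * w \<alpha> \<beta>) f \<beta> + p x * nc_subst (w x) f \<beta>" for \<beta>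
        by (rule nc_subst_linear) (intro substitutable_polynomial P w)+
      then show ?case using insert by (simp add: fun_eq_iff w add.commute)
    qed (simp add: nc_subst_def fun_eq_iff)
    from this[of "{\<alpha>. p \<alpha> \<noteq> 0}"] have "nc_subst (\<lambda>\<beta>. \<Sum>\<alpha> | p \<alpha> \<noteq> 0. p \<alpha> * w \<alpha> \<beta>) f = p"
      using p by (auto simp: fun_eq_iff nc_polynomial_def if_distrib[of "(*) _"] cong: if_cong)
    then show ?thesis unfolding eq using P by blast
  qed
  have "nc_poly_eval (f j) W = lshift j" for j
  proof (rule left_multiplication_eqI)
    show "blinfun_apply (nc_poly_eval (f j) W) (ell2_basis []) = blinfun_apply (lshift j) (ell2_basis [])"
      unfolding lshift_basis by (rule inj) (use poly[OF f[of j]] in \<open>auto simp: ell2_basis_polynomial nc_subst_basis\<close>)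
  qed (auto intro: left_multiplication_poly_eval lm left_multiplication_lshift)
  then show "has_value f W lshift" using polynomial_has_value[of f W, OF f] by (metis (no_types) ext)
qed

text \<open>Injectivity of formal substitution recovers the images of basis vectors under
  \<open>W i\<close> and \<open>Y j\<close> from the series they stand for.\<close>

lemma model_S_universal:
  fixes f :: "'n::finite \<Rightarrow> 'n nc_series"
  assumes "model_S f a W"
  shows "left_multiplication (W i)" "blinfun_apply (W i) (ell2_basis []) = a i" "has_value f W lshift"
proof -
  have f0: "\<And>i. f i [] = 0" and det: "det ((\<chi> i j. f i [j]) :: complex^'n^'n) \<noteq> 0"
    and a: "\<And>i. nc_subst (ell2_coeff (a i)) f = nc_var i"
    and W: "\<And>i. W i \<in> bounded_clinear_ops"
      "\<And>i u. nc_subst (ell2_coeff (blinfun_apply (W i) u)) f = nc_mult (nc_var i) (nc_subst (ell2_coeff u) f)"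
    using assms unfolding model_S_def formal_multiplication_def by auto
  obtain Y where Y: "has_value f W Y" "\<And>j. Y j \<in> bounded_clinear_ops"
      "\<And>j u. nc_subst (ell2_coeff (blinfun_apply (Y j) u)) f = nc_mult (f j) (nc_subst (ell2_coeff u) f)"
    using assms unfolding model_S_def formal_multiplication_def by blast
  have inj: "u = v" if "nc_subst (ell2_coeff u) f = nc_subst (ell2_coeff v) f" for u v
    using formal_substitution_injective[where f = f, OF f0 det that] by (simp add: ell2_coeff_inject)
  have basis: "blinfun_apply (W i) (ell2_basis \<beta>) = blinfun_apply (rshift \<beta>) (a i)" for i \<beta>
    by (rule inj) (simp add: W nc_subst_basis nc_subst_rshift[OF substitutable_vanishing[where f = f, OF f0]] a)
  show "left_multiplication (W i)" "blinfun_apply (W i) (ell2_basis []) = a i" for i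
    by (rule left_multiplication_rshift_basis[OF W(1) basis])+
  have "Y j = lshift j" for j
    by (rule clinear_ell2_eqI[OF Y(2) lshift_clinear], rule inj) (simp add: Y(3) nc_subst_basis lshift_basis)
  then show "has_value f W lshift" using Y(1) by (metis (no_types) ext)
qed

lemma op_ball_strict_row: "Z \<in> op_ball 1 \<Longrightarrow> strict_row Z"
  by unfold_locales (auto simp: op_ball_def)

lemma model_FE:
  fixes f :: "'n::finite \<Rightarrow> 'n nc_series"
  assumes "model_F f a W"
  obtains \<gamma> Y where "0 < \<gamma>" "\<And>j. nc_radius (f j) \<ge> ereal \<gamma>"
    "\<And>X. X \<in> op_ball \<gamma> \<Longrightarrow> (\<lambda>j. nc_eval (f j) X) \<in> op_ball 1"
    "\<And>G. nc_radius G \<ge> 1 \<Longrightarrow> G \<noteq> (\<lambda>_. 0) \<Longrightarrow> \<exists>X\<in>op_ball \<gamma>. nc_eval G (\<lambda>j. nc_eval (f j) X) \<noteq> 0"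
    "\<And>i X. X \<in> op_ball \<gamma> \<Longrightarrow> nc_eval (ell2_coeff (a i)) (\<lambda>j. nc_eval (f j) X) = X i"
    "\<And>i. holomorphic_multiplication \<gamma> f (nc_var i) (W i)"
    "has_value f W Y" "\<And>j. holomorphic_multiplication \<gamma> f (f j) (Y j)"
proof -
  obtain \<gamma> Y where F: "0 < \<gamma>" "\<forall>j. nc_radius (f j) \<ge> ereal \<gamma>"
    "\<forall>X\<in>op_ball \<gamma>. (\<lambda>j. nc_eval (f j) X) \<in> op_ball 1"
    "\<forall>G. nc_radius G \<ge> 1 \<and> G \<noteq> (\<lambda>_. 0) \<longrightarrow> (\<exists>X\<in>op_ball \<gamma>. nc_eval G (\<lambda>j. nc_eval (f j) X) \<noteq> 0)"
    "\<forall>i. \<forall>X\<in>op_ball \<gamma>. nc_eval (ell2_coeff (a i)) (\<lambda>j. nc_eval (f j) X) = X i"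
    "\<forall>i. holomorphic_multiplication \<gamma> f (nc_var i) (W i)"
    "has_value f W Y" "\<forall>j. holomorphic_multiplication \<gamma> f (f j) (Y j)"
    using assms unfolding model_F_def by (elim exE conjE)
  show thesis by (rule that[of \<gamma> Y]) (use F in blast)+
qed

text \<open>Faithfulness, applied to the difference of two square-summable series, takes the place
  of formal injectivity (\<open>inj\<close>). Identities are tested at the tuples f(X), which are
  strict rows, so the calculus of \<open>ev\<close> is available.\<close>

lemma model_F_universal:
  fixes f :: "'n::finite \<Rightarrow> 'n nc_series"
  assumes "model_F f a W"
  shows "left_multiplication (W i)" "blinfun_apply (W i) (ell2_basis []) = a i" "has_value f W lshift"
proof -
  obtain \<gamma> Y where "0 < \<gamma>" "\<And>j. nc_radius (f j) \<ge> ereal \<gamma>"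
    and range: "\<And>X. X \<in> op_ball \<gamma> \<Longrightarrow> (\<lambda>j. nc_eval (f j) X) \<in> op_ball 1"
    and faithful: "\<And>G. nc_radius G \<ge> 1 \<Longrightarrow> G \<noteq> (\<lambda>_. 0) \<Longrightarrow> \<exists>X\<in>op_ball \<gamma>. nc_eval G (\<lambda>j. nc_eval (f j) X) \<noteq> 0"
    and a: "\<And>i X. X \<in> op_ball \<gamma> \<Longrightarrow> nc_eval (ell2_coeff (a i)) (\<lambda>j. nc_eval (f j) X) = X i"
    and W: "\<And>i. holomorphic_multiplication \<gamma> f (nc_var i) (W i)"
    and Y: "has_value f W Y" "\<And>j. holomorphic_multiplication \<gamma> f (f j) (Y j)"
    by (rule model_FE[OF assms]; rule that; assumption)
  have inj: "u = v" if eq: "\<And>X. X \<in> op_ball \<gamma> \<Longrightarrow> nc_eval (ell2_coeff u) (\<lambda>j. nc_eval (f j) X) = nc_eval (ell2_coeff v) (\<lambda>j. nc_eval (f j) X)" for u v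
  proof (rule ccontr)
    assume "u \<noteq> v"
    have "ell2_coeff (u - v) \<noteq> (\<lambda>_. 0)"
    proof
      assume "ell2_coeff (u - v) = (\<lambda>_. 0)"
      from fun_cong[OF this] have "ell2_coeff u i = ell2_coeff v i" for i by simp
      then show False using \<open>u \<noteq> v\<close> ell2_eqI by blast
    qed
    moreover have "nc_radius (ell2_coeff (u - v)) \<ge> 1" by (rule degree_norm_bounded_radius[OF degree_norm_ell2_le])
    ultimately obtain X where X: "X \<in> op_ball \<gamma>" "nc_eval (ell2_coeff (u - v)) (\<lambda>j. nc_eval (f j) X) \<noteq> 0"
      using faithful by blast
    interpret strict_row "\<lambda>j. nc_eval (f j) X" by (rule op_ball_strict_row[OF range[OF X(1)]])
    have "ev u = ev ((u - v) + v)" by simp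
    also have "\<dots> = ev (u - v) + ev v" by (rule ev_add)
    finally show False using X eq[OF X(1)] by (simp add: ev_def)
  qed
  have basis: "blinfun_apply (W i) (ell2_basis \<beta>) = blinfun_apply (rshift \<beta>) (a i)" for i \<beta>
  proof (rule inj)
    fix X :: "'n \<Rightarrow> (nat ell2 \<Rightarrow>\<^sub>L nat ell2)" assume X: "X \<in> op_ball \<gamma>"
    interpret strict_row "\<lambda>j. nc_eval (f j) X" by (rule op_ball_strict_row[OF range[OF X]])
    show "nc_eval (ell2_coeff (blinfun_apply (W i) (ell2_basis \<beta>))) (\<lambda>j. nc_eval (f j) X) =
        nc_eval (ell2_coeff (blinfun_apply (rshift \<beta>) (a i))) (\<lambda>j. nc_eval (f j) X)"
      using W[of i] X ev_rshift[of \<beta> "a i"] ev_basis[of \<beta>] a[OF X, of i]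
      by (simp add: holomorphic_multiplication_def ev_def nc_eval_var)
  qed
  have Wc: "W i \<in> bounded_clinear_ops" and Yc: "Y j \<in> bounded_clinear_ops" for i j
    using W Y(2) by (auto simp: holomorphic_multiplication_def)
  show "left_multiplication (W i)" "blinfun_apply (W i) (ell2_basis []) = a i" for i
    by (rule left_multiplication_rshift_basis[OF Wc basis])+
  have "Y j = lshift j" for j
  proof (rule clinear_ell2_eqI[OF Yc lshift_clinear], rule inj)
    fix \<beta> and X :: "'n \<Rightarrow> (nat ell2 \<Rightarrow>\<^sub>L nat ell2)" assume X: "X \<in> op_ball \<gamma>"
    interpret strict_row "\<lambda>j. nc_eval (f j) X" by (rule op_ball_strict_row[OF range[OF X]])
    show "nc_eval (ell2_coeff (blinfun_apply (Y j) (ell2_basis \<beta>))) (\<lambda>j. nc_eval (f j) X) =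
        nc_eval (ell2_coeff (blinfun_apply (lshift j) (ell2_basis \<beta>))) (\<lambda>j. nc_eval (f j) X)"
      using Y(2)[of j] X ev_basis[of \<beta>] ev_basis[of "j # \<beta>"]
      by (simp add: holomorphic_multiplication_def ev_def lshift_basis)
  qed
  then show "has_value f W lshift" using Y(1) by (metis (no_types) ext)
qed

lemma is_model_universal:
  fixes f :: "'n::finite \<Rightarrow> 'n nc_series"
  assumes "is_model f a W"
  shows "left_multiplication (W i)" "blinfun_apply (W i) (ell2_basis []) = a i" "has_value f W lshift"
proof -
  consider "model_A f a W" | "model_S f a W" | "model_F f a W" using assms by (auto simp: is_model_def)
  then have "left_multiplication (W i) \<and> blinfun_apply (W i) (ell2_basis []) = a i \<and> has_value f W lshift"
  proof cases
    case 1
    show ?thesis by (intro conjI model_A_universal[OF 1])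
  next
    case 2
    show ?thesis by (intro conjI model_S_universal[OF 2])
  next
    case 3
    show ?thesis by (intro conjI model_F_universal[OF 3])
  qed
  then show "left_multiplication (W i)" "blinfun_apply (W i) (ell2_basis []) = a i" "has_value f W lshift" by auto
qed

section \<open>Identification of the inverse series\<close>

text \<open>The factor \<open>s\<close> leaves room beyond the tuple itself:
  \<open>composition_vanishes\<close> needs absolute convergence at multiples of \<open>X\<close> by
  numbers of modulus larger than 1.\<close>

lemma nc_term_summable_radius:
  fixes X :: "'n::finite \<Rightarrow> ('a::complex_hilbert_space \<Rightarrow>\<^sub>L 'a)"
  assumes clin: "\<And>i. X i \<in> bounded_clinear_ops" and X: "row_norm X \<le> D" "0 \<le> s" "ereal (s * D) < nc_radius c"
  shows "summable (\<lambda>k. s ^ k * norm (nc_term c X k))"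
proof (rule summable_comparison_test')
  have D: "0 \<le> D" using X(1) row_norm_nonneg[of X] by simp
  have "summable (\<lambda>k. norm (degree_norm c k * (s * D) ^ k))"
    using X(2,3) D unfolding nc_radius_def degree_norm_def[symmetric] by (intro abs_summable_in_conv_radius) simp
  then show "summable (\<lambda>k. degree_norm c k * (s * D) ^ k)" by (rule summable_norm_cancel)
  show "norm (s ^ k * norm (nc_term c X k)) \<le> degree_norm c k * (s * D) ^ k" if "k \<ge> 0" for k
    using mult_left_mono[OF norm_nc_term_le[where k = k and c = c, OF clin X(1)], of "s ^ k"] X(2)
    by (simp add: power_mult_distrib mult_ac)
qed

lemma op_ball_summable:
  fixes X :: "'n::finite \<Rightarrow> (nat ell2 \<Rightarrow>\<^sub>L nat ell2)"
  assumes "X \<in> op_ball \<gamma>" "nc_radius c \<ge> ereal \<gamma>"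
  shows "summable (nc_term c X)"
proof -
  have "row_norm X < \<gamma>" using assms(1) by (simp add: op_ball_def)
  then have "ereal (1 * row_norm X) < ereal \<gamma>" by simp
  then have "ereal (1 * row_norm X) < nc_radius c" using assms(2) by (rule less_le_trans)
  then have "summable (\<lambda>k. 1 ^ k * norm (nc_term c X k))"
    using assms by (intro nc_term_summable_radius[of X "row_norm X"]) (auto simp: op_ball_def)
  then show ?thesis by (simp add: summable_norm_cancel)
qed

lemma row_norm_scaleC_le:
  "row_norm (\<lambda>i. scaleC_op t (X i)) \<le> cmod t * row_norm X"
proof (subst row_norm_le_iff)
  show "\<forall>h. (norm (\<Sum>i\<in>UNIV. blinfun_apply (scaleC_op t (X i)) (h i)))\<^sup>2 \<le> (cmod t * row_norm X)\<^sup>2 * (\<Sum>i\<in>UNIV. (norm (h i))\<^sup>2)"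
  proof
    fix h
    have "(norm (\<Sum>i\<in>UNIV. blinfun_apply (scaleC_op t (X i)) (h i)))\<^sup>2 = (cmod t)\<^sup>2 * (norm (\<Sum>i\<in>UNIV. blinfun_apply (X i) (h i)))\<^sup>2"
      by (simp add: scaleC_sum_right[symmetric] norm_scaleC power_mult_distrib)
    also have "\<dots> \<le> (cmod t)\<^sup>2 * ((row_norm X)\<^sup>2 * (\<Sum>i\<in>UNIV. (norm (h i))\<^sup>2))"
      by (intro mult_left_mono row_normD) auto
    finally show "(norm (\<Sum>i\<in>UNIV. blinfun_apply (scaleC_op t (X i)) (h i)))\<^sup>2 \<le> (cmod t * row_norm X)\<^sup>2 * (\<Sum>i\<in>UNIV. (norm (h i))\<^sup>2)"
      by (simp add: power_mult_distrib mult.assoc)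
  qed
qed (simp add: row_norm_nonneg)

text \<open>The left shifts, transported to \<open>\<ell>\<^sup>2(\<nat>)\<close> by an enumeration of the words; scaled by \<open>\<epsilon>\<close> they lie in every
  ball, and a formal identity can be read off from the evaluation there.\<close>

definition word_shift :: "'n::finite \<Rightarrow> (nat ell2 \<Rightarrow>\<^sub>L nat ell2)" where
  "word_shift j = pull_op (\<lambda>m. case from_nat m of [] \<Rightarrow> None
     | k # \<alpha> \<Rightarrow> if k = j \<and> m = to_nat (k # \<alpha>) then Some (to_nat (\<alpha> :: 'n list)) else None)"

lemma word_shift:
  fixes j :: "'n::finite" and \<beta> :: "'n list"
  shows "ell2_coeff (blinfun_apply (word_shift j) v) (to_nat \<beta>) = (case \<beta> of [] \<Rightarrow> 0 | k # \<alpha> \<Rightarrow> if k = j then ell2_coeff v (to_nat \<alpha>) else 0)"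
  "word_shift j \<in> bounded_clinear_ops"
proof -
  have inj: "injective_partial (\<lambda>m. case from_nat m of [] \<Rightarrow> None
     | k # \<alpha> \<Rightarrow> if k = j \<and> m = to_nat (k # \<alpha>) then Some (to_nat (\<alpha> :: 'n list)) else None)"
    by (auto simp: injective_partial_def split: list.splits if_splits)
  show "ell2_coeff (blinfun_apply (word_shift j) v) (to_nat \<beta>) = (case \<beta> of [] \<Rightarrow> 0 | k # \<alpha> \<Rightarrow> if k = j then ell2_coeff v (to_nat \<alpha>) else 0)"
    unfolding word_shift_def pull_op(1)[OF inj] by (auto split: list.splits)
  show "word_shift j \<in> bounded_clinear_ops" unfolding word_shift_def by (rule pull_op(3)[OF inj])
qed

lemma ell2_coeff_bounded_linear: "bounded_linear (\<lambda>u. ell2_coeff u i)"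
  by (rule bounded_linear_intro[where K = 1]) (auto simp: ell2_coeff_norm_le scaleR_conv_of_real)

context
  fixes \<epsilon> :: real
  assumes \<epsilon>: "\<epsilon> > 0"
begin

definition scaled_shift :: "'n::finite \<Rightarrow> (nat ell2 \<Rightarrow>\<^sub>L nat ell2)" where
  "scaled_shift j = scaleC_op (of_real \<epsilon>) (word_shift j)"

text \<open>Dividing by the power of \<epsilon> undoes the scaling, so that on these coefficients
  \<open>scaled_shift j\<close> acts as left multiplication by Z_j.\<close>

definition word_coeffs :: "nat ell2 \<Rightarrow> 'n::finite nc_series" where
  "word_coeffs v \<beta> = ell2_coeff v (to_nat \<beta>) / of_real \<epsilon> ^ length \<beta>"

lemma scaled_shift_clinear: "scaled_shift j \<in> bounded_clinear_ops"
  unfolding scaled_shift_def by (intro clinear_scaleC_op word_shift)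

lemma word_coeffs_shift:
  "word_coeffs (blinfun_apply (scaled_shift j) v) \<beta> = (case \<beta> of [] \<Rightarrow> 0 | k # \<alpha> \<Rightarrow> if k = j then word_coeffs v \<alpha> else 0)"
  using \<epsilon> by (auto simp: word_coeffs_def scaled_shift_def word_shift split: list.split)

lemma word_coeffs_bounded_linear: "bounded_linear (\<lambda>v. word_coeffs v \<beta>)"
  unfolding word_coeffs_def by (rule bounded_linear_compose[OF bounded_linear_divide ell2_coeff_bounded_linear])

lemma word_coeffs_word:
  "word_coeffs (blinfun_apply (op_word scaled_shift \<alpha>) v) \<beta> =
    (if take (length \<alpha>) \<beta> = \<alpha> then word_coeffs v (drop (length \<alpha>) \<beta>) else 0)"
proof (induction \<alpha> arbitrary: \<beta>)
  case (Cons i \<alpha>)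
  then show ?case by (cases \<beta>) (auto simp: word_coeffs_shift)
qed simp

lemma word_coeffs_scaleC: "word_coeffs (c *\<^sub>C v) \<beta> = c * word_coeffs v \<beta>"
  by (simp add: word_coeffs_def)

lemma word_coeffs_sum: "word_coeffs (sum v A) \<beta> = (\<Sum>a\<in>A. word_coeffs (v a) \<beta>)"
  by (simp add: word_coeffs_def sum_divide_distrib)

lemma word_coeffs_term:
  fixes c :: "'n::finite nc_series"
  shows "word_coeffs (blinfun_apply (nc_term c scaled_shift k) v) \<beta> =
    (if k \<le> length \<beta> then c (take k \<beta>) * word_coeffs v (drop k \<beta>) else 0)"
proof -
  have "word_coeffs (blinfun_apply (nc_term c scaled_shift k) v) \<beta> =
      (\<Sum>\<alpha> | length \<alpha> = k. if \<alpha> = take k \<beta> then c \<alpha> * word_coeffs v (drop k \<beta>) else 0)"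
    unfolding nc_term_def blinfun.sum_left word_coeffs_sum
  proof (intro sum.cong refl)
    fix \<alpha> assume "\<alpha> \<in> {\<alpha> :: 'n list. length \<alpha> = k}"
    then have l: "length \<alpha> = k" by simp
    show "word_coeffs (blinfun_apply (scaleC_op (c \<alpha>) (op_word scaled_shift \<alpha>)) v) \<beta> =
        (if \<alpha> = take k \<beta> then c \<alpha> * word_coeffs v (drop k \<beta>) else 0)"
      unfolding scaleC_op_apply word_coeffs_scaleC word_coeffs_word l by auto
  qed
  then show ?thesis by (auto simp: sum.delta)
qed

lemma word_coeffs_eval:
  fixes c :: "'n::finite nc_series"
  assumes "summable (nc_term c scaled_shift)"
  shows "word_coeffs (blinfun_apply (nc_eval c scaled_shift) v) = nc_mult c (word_coeffs v)"
proof
  fix \<beta> :: "'n list"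
  have "(\<lambda>k. word_coeffs (blinfun_apply (nc_term c scaled_shift k) v) \<beta>) sums word_coeffs (blinfun_apply (nc_eval c scaled_shift) v) \<beta>"
    unfolding nc_eval_def
    by (intro bounded_linear.sums[OF word_coeffs_bounded_linear] bounded_linear.sums[OF blinfun.bounded_linear_left] summable_sums assms)
  moreover have "(\<lambda>k. word_coeffs (blinfun_apply (nc_term c scaled_shift k) v) \<beta>) sums
      (\<Sum>k\<in>{..length \<beta>}. word_coeffs (blinfun_apply (nc_term c scaled_shift k) v) \<beta>)"
    by (rule sums_finite) (simp_all add: word_coeffs_term)
  ultimately have "word_coeffs (blinfun_apply (nc_eval c scaled_shift) v) \<beta> =
      (\<Sum>k\<le>length \<beta>. word_coeffs (blinfun_apply (nc_term c scaled_shift k) v) \<beta>)" by (rule sums_unique2)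
  then show "word_coeffs (blinfun_apply (nc_eval c scaled_shift) v) \<beta> = nc_mult c (word_coeffs v) \<beta>"
    by (simp add: word_coeffs_term nc_mult_def)
qed

text \<open>On the vector with coefficients \<open>nc_one\<close> the word \<alpha> in the evaluated
  f gives \<open>nc_word f \<alpha>\<close>. Since f(0) = 0, the coefficient at \<beta> receives
  only degrees up to its length, and the norm limit becomes a finite formal sum.\<close>

lemma word_coeffs_composition:
  fixes f :: "'n::finite \<Rightarrow> 'n nc_series"
  assumes f0: "\<And>j. f j [] = 0" and sm: "\<And>j. summable (nc_term (f j) scaled_shift)"
    and c: "summable (nc_term c (\<lambda>j. nc_eval (f j) scaled_shift))"
  shows "word_coeffs (blinfun_apply (nc_eval c (\<lambda>j. nc_eval (f j) scaled_shift)) (ell2_basis (to_nat ([] :: 'n list)))) = nc_subst c f"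
proof
  fix \<beta> :: "'n list"
  define v where "v = ell2_basis (to_nat ([] :: 'n list))"
  have v: "word_coeffs v = (nc_one :: 'n nc_series)"
    by (auto simp: fun_eq_iff word_coeffs_def v_def nc_one_def)
  have word: "word_coeffs (blinfun_apply (op_word (\<lambda>j. nc_eval (f j) scaled_shift) \<alpha>) v) = nc_word f \<alpha>" for \<alpha>
    by (induction \<alpha>) (simp_all add: v word_coeffs_eval[OF sm])
  have tm: "word_coeffs (blinfun_apply (nc_term c (\<lambda>j. nc_eval (f j) scaled_shift) k) v) \<beta> = (\<Sum>\<alpha> | length \<alpha> = k. c \<alpha> * nc_word f \<alpha> \<beta>)" for k
    by (simp add: nc_term_def blinfun.sum_left word_coeffs_sum word_coeffs_scaleC word)
  have "(\<lambda>k. word_coeffs (blinfun_apply (nc_term c (\<lambda>j. nc_eval (f j) scaled_shift) k) v) \<beta>) sums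
      word_coeffs (blinfun_apply (nc_eval c (\<lambda>j. nc_eval (f j) scaled_shift)) v) \<beta>"
    unfolding nc_eval_def[of c]
    by (intro bounded_linear.sums[OF word_coeffs_bounded_linear] bounded_linear.sums[OF blinfun.bounded_linear_left] summable_sums c)
  moreover have "(\<lambda>k. word_coeffs (blinfun_apply (nc_term c (\<lambda>j. nc_eval (f j) scaled_shift) k) v) \<beta>) sums
      (\<Sum>k\<in>{..<Suc (length \<beta>)}. word_coeffs (blinfun_apply (nc_term c (\<lambda>j. nc_eval (f j) scaled_shift) k) v) \<beta>)"
    by (rule sums_finite) (auto simp: tm nc_word_low_degree[where f = f, OF f0] intro!: sum.neutral)
  ultimately have "word_coeffs (blinfun_apply (nc_eval c (\<lambda>j. nc_eval (f j) scaled_shift)) v) \<beta> =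
      (\<Sum>k<Suc (length \<beta>). \<Sum>\<alpha> | length \<alpha> = k. c \<alpha> * nc_word f \<alpha> \<beta>)"
    unfolding tm by (rule sums_unique2)
  also have "\<dots> = (\<Sum>\<alpha> | length \<alpha> < Suc (length \<beta>). c \<alpha> * nc_word f \<alpha> \<beta>)" by (rule sum_words_below[symmetric])
  also have "\<dots> = nc_subst c f \<beta>"
    by (rule nc_subst_superset[symmetric, OF finite_words_below])
      (use nc_word_low_degree[of f \<beta>, OF f0] in \<open>auto simp: less_Suc_eq_le not_less[symmetric]\<close>)
  finally show "word_coeffs (blinfun_apply (nc_eval c (\<lambda>j. nc_eval (f j) scaled_shift)) (ell2_basis (to_nat ([] :: 'n list)))) \<beta> = nc_subst c f \<beta>"
    by (simp add: v_def)
qed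

lemma word_coeffs_shift_basis:
  "word_coeffs (blinfun_apply (scaled_shift i) (ell2_basis (to_nat ([] :: 'n list)))) = (nc_var i :: 'n::finite nc_series)"
proof
  fix \<beta> :: "'n list"
  have v: "word_coeffs (ell2_basis (to_nat ([] :: 'n list))) \<alpha> = (nc_one :: 'n nc_series) \<alpha>" for \<alpha>
    by (auto simp: word_coeffs_def nc_one_def)
  show "word_coeffs (blinfun_apply (scaled_shift i) (ell2_basis (to_nat ([] :: 'n list)))) \<beta> = nc_var i \<beta>"
    unfolding word_coeffs_shift v by (auto simp: nc_one_def nc_var_def split: list.split)
qed

end

text \<open>Extracts from case (F) the same formal inverse relation that cases (A) and (S) contain,
  so that models of different kinds become comparable.\<close>

lemma composition_identity_formal:
  fixes f :: "'n::finite \<Rightarrow> 'n nc_series"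
  assumes \<gamma>: "\<gamma> > 0" and f0: "\<And>j. f j [] = 0" and rad: "\<And>j. nc_radius (f j) \<ge> ereal \<gamma>"
    and range: "\<And>X. X \<in> op_ball \<gamma> \<Longrightarrow> (\<lambda>j. nc_eval (f j) X) \<in> op_ball 1"
    and id: "\<And>X. X \<in> op_ball \<gamma> \<Longrightarrow> nc_eval (ell2_coeff u) (\<lambda>j. nc_eval (f j) X) = X i"
  shows "nc_subst (ell2_coeff u) f = nc_var i"
proof -
  define M where "M = row_norm (word_shift :: 'n \<Rightarrow> _)"
  \<comment> \<open>The denominator \<open>M + 1\<close> keeps \<open>\<epsilon> * M\<close> below
    \<gamma> and is positive even if \<open>M = 0\<close>.\<close>
  define \<epsilon> where "\<epsilon> = \<gamma> / (M + 1)"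
  have M: "0 \<le> M" by (simp add: M_def row_norm_nonneg)
  have \<epsilon>: "\<epsilon> > 0" using \<gamma> M by (simp add: \<epsilon>_def)
  define X :: "'n \<Rightarrow> _" where "X = scaled_shift \<epsilon>"
  have "row_norm X \<le> cmod (of_real \<epsilon>) * M"
    unfolding X_def M_def scaled_shift_def[OF \<epsilon>, abs_def] by (rule row_norm_scaleC_le)
  also have "\<dots> = \<epsilon> * M" using \<epsilon> by simp
  also have "\<dots> < \<gamma>" using \<gamma> M by (simp add: \<epsilon>_def field_simps)
  finally have X: "X \<in> op_ball \<gamma>" by (auto simp: op_ball_def X_def scaled_shift_clinear[OF \<epsilon>])
  interpret strict_row "\<lambda>j. nc_eval (f j) X" by (rule op_ball_strict_row[OF range[OF X]])
  have "nc_subst (ell2_coeff u) f = word_coeffs \<epsilon> (blinfun_apply (nc_eval (ell2_coeff u) (\<lambda>j. nc_eval (f j) X)) (ell2_basis (to_nat ([] :: 'n list))))"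
    using ev_summable[of u] op_ball_summable[OF X rad] unfolding X_def
    by (intro word_coeffs_composition[where f = f, OF \<epsilon> f0, symmetric])
  also have "\<dots> = word_coeffs \<epsilon> (blinfun_apply (scaled_shift \<epsilon> i) (ell2_basis (to_nat ([] :: 'n list))))"
    by (simp only: id[OF X]) (simp only: X_def)
  also have "\<dots> = nc_var i" by (rule word_coeffs_shift_basis[OF \<epsilon>])
  finally show ?thesis .
qed

section \<open>Uniqueness on small balls\<close>

text \<open>Vector-valued holomorphy, tested weakly; continuity makes it stable under composition with series.\<close>

definition weakly_holomorphic :: "complex set \<Rightarrow> (complex \<Rightarrow> 'a::complex_hilbert_space) \<Rightarrow> bool" where
  "weakly_holomorphic S \<phi> \<longleftrightarrow> continuous_on S \<phi> \<and> (\<forall>k. (\<lambda>t. cinner (\<phi> t) k) holomorphic_on S)"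

lemma weakly_holomorphic_const: "weakly_holomorphic S (\<lambda>_. h)"
  by (simp add: weakly_holomorphic_def)

lemma weakly_holomorphic_sum:
  "(\<And>i. i \<in> I \<Longrightarrow> weakly_holomorphic S (\<phi> i)) \<Longrightarrow> weakly_holomorphic S (\<lambda>t. \<Sum>i\<in>I. \<phi> i t)"
  unfolding weakly_holomorphic_def cinner_sum_left by (auto intro!: continuous_on_sum holomorphic_on_sum)

lemma continuous_on_scaleC:
  assumes "continuous_on S g" "continuous_on S \<phi>"
  shows "continuous_on S (\<lambda>t. g t *\<^sub>C (\<phi> t :: 'a::complex_hilbert_space))"
  unfolding scaleC_decompose[of "g _"]
  by (intro continuous_intros assms bounded_linear.continuous_on[OF bounded_linear_scaleC])

lemma weakly_holomorphic_scaleC: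
  "g holomorphic_on S \<Longrightarrow> weakly_holomorphic S \<phi> \<Longrightarrow> weakly_holomorphic S (\<lambda>t. g t *\<^sub>C \<phi> t)"
  unfolding weakly_holomorphic_def cinner_scaleC_left
  by (auto intro!: continuous_on_scaleC holomorphic_on_mult holomorphic_on_imp_continuous_on)

lemma cinner_adj:
  assumes "B \<in> bounded_clinear_ops"
  shows "cinner (blinfun_apply B x) k = cinner x (blinfun_apply (adj B) k)"
  using clinear_opD[OF adj_clinear[OF assms], of \<i> k] by (simp add: cinner_eq_inner inner_adj[symmetric])

lemma weakly_holomorphic_op:
  assumes B: "B \<in> bounded_clinear_ops" and \<phi>: "weakly_holomorphic S \<phi>"
  shows "weakly_holomorphic S (\<lambda>t. blinfun_apply B (\<phi> t))"
  using \<phi> unfolding weakly_holomorphic_def cinner_adj[OF B]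
  by (auto intro!: bounded_linear.continuous_on[OF blinfun.bounded_linear_right])

text \<open>Uniform limits on small discs keep continuity, and the pairings with a fixed vector
  converge uniformly along with them, so Weierstrass' theorem applies to each pairing.\<close>

lemma weakly_holomorphic_limit:
  assumes S: "open S" and \<phi>: "\<And>n. weakly_holomorphic S (\<phi> n)"
    and lim: "\<And>t. t \<in> S \<Longrightarrow> \<exists>d>0. cball t d \<subseteq> S \<and> uniform_limit (cball t d) \<phi> \<psi> sequentially"
  shows "weakly_holomorphic S \<psi>"
  unfolding weakly_holomorphic_def
proof (intro conjI allI)
  show "continuous_on S \<psi>"
  proof (rule continuous_at_imp_continuous_on, intro ballI)
    fix t assume "t \<in> S"
    then obtain d where d: "d > 0" "cball t d \<subseteq> S" "uniform_limit (cball t d) \<phi> \<psi> sequentially" using lim by blast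
    have "continuous_on (cball t d) \<psi>"
      by (rule uniform_limit_theorem[OF _ d(3)])
        (use \<phi> d(2) in \<open>auto simp: weakly_holomorphic_def intro!: always_eventually intro: continuous_on_subset\<close>)
    moreover have "t \<in> interior (cball t d)" using d(1) by simp
    ultimately show "isCont \<psi> t" by (rule continuous_on_interior)
  qed
  fix k
  show "(\<lambda>t. cinner (\<psi> t) k) holomorphic_on S"
  proof (rule holomorphic_uniform_sequence[OF S])
    show "(\<lambda>t. cinner (\<phi> n t) k) holomorphic_on S" for n using \<phi> by (simp add: weakly_holomorphic_def)
    fix t assume "t \<in> S"
    then obtain d where d: "d > 0" "cball t d \<subseteq> S" "uniform_limit (cball t d) \<phi> \<psi> sequentially" using lim by blast
    have "bounded_linear (\<lambda>x. cinner x k)"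
      by (rule bounded_linear_intro[where K = "norm k"])
        (auto simp: cinner_add_left scaleR_scaleC cinner_scaleC_left scaleR_conv_of_real cmod_cinner_le)
    then have "uniform_limit (cball t d) (\<lambda>n t. cinner (\<phi> n t) k) (\<lambda>t. cinner (\<psi> t) k) sequentially"
      by (rule bounded_linear.uniform_limit[OF _ d(3)])
    then show "\<exists>d>0. cball t d \<subseteq> S \<and> uniform_limit (cball t d) (\<lambda>n t. cinner (\<phi> n t) k) (\<lambda>t. cinner (\<psi> t) k) sequentially"
      using d by blast
  qed
qed

lemma nc_term_scaleC:
  assumes "\<And>i. X i \<in> bounded_clinear_ops"
  shows "nc_term c (\<lambda>i. scaleC_op t (X i)) k = scaleC_op (t ^ k) (nc_term c X k)"
proof -
  have "op_word (\<lambda>i. scaleC_op t (X i)) \<alpha> = scaleC_op (t ^ length \<alpha>) (op_word X \<alpha>)" for \<alpha>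
    by (induction \<alpha>) (auto simp: scaleC_op_compose_left scaleC_op_compose_right assms)
  then show ?thesis by (simp add: nc_term_def scaleC_op_sum_right mult.commute)
qed

text \<open>A crude Lipschitz estimate in the entries. It serves to keep row norms below 1 near a
  point and to approximate a row by polynomial rows in \<open>graph_row_norm\<close>.\<close>

lemma row_norm_perturb: "row_norm X \<le> row_norm Y + (\<Sum>i\<in>UNIV. norm (X i - Y i))"
  for X :: "'n::finite \<Rightarrow> ('a::complex_hilbert_space \<Rightarrow>\<^sub>L 'a)"
proof (subst row_norm_le_iff)
  define e where "e = (\<Sum>i\<in>UNIV. norm (X i - Y i))"
  have e: "0 \<le> e" by (simp add: e_def sum_nonneg)
  show "0 \<le> row_norm Y + (\<Sum>i\<in>UNIV. norm (X i - Y i))" using row_norm_nonneg[of Y] e by (simp add: e_def)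
  show "\<forall>h. (norm (\<Sum>i\<in>UNIV. blinfun_apply (X i) (h i)))\<^sup>2 \<le> (row_norm Y + (\<Sum>i\<in>UNIV. norm (X i - Y i)))\<^sup>2 * (\<Sum>i\<in>UNIV. (norm (h i))\<^sup>2)"
  proof
    fix h :: "'n \<Rightarrow> 'a"
    define s where "s = sqrt (\<Sum>i\<in>UNIV. (norm (h i))\<^sup>2)"
    have s: "0 \<le> s" "s\<^sup>2 = (\<Sum>i\<in>UNIV. (norm (h i))\<^sup>2)" by (auto simp: s_def sum_nonneg)
    have hs: "norm (h i) \<le> s" for i
      unfolding s_def by (rule real_le_rsqrt) (rule member_le_sum, auto)
    have "(norm (\<Sum>i\<in>UNIV. blinfun_apply (Y i) (h i)))\<^sup>2 \<le> (row_norm Y * s)\<^sup>2"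
      using row_normD[of Y "row_norm Y" h] by (simp add: power_mult_distrib s(2))
    then have Y: "norm (\<Sum>i\<in>UNIV. blinfun_apply (Y i) (h i)) \<le> row_norm Y * s"
      by (rule power2_le_imp_le) (simp add: s row_norm_nonneg)
    have "norm (\<Sum>i\<in>UNIV. blinfun_apply (X i - Y i) (h i)) \<le> (\<Sum>i\<in>UNIV. norm (X i - Y i) * s)"
      by (rule order_trans[OF norm_sum]) (intro sum_mono order_trans[OF norm_blinfun] mult_left_mono hs, simp)
    then have "norm (\<Sum>i\<in>UNIV. blinfun_apply (X i - Y i) (h i)) \<le> e * s" by (simp add: e_def sum_distrib_right)
    moreover have "(\<Sum>i\<in>UNIV. blinfun_apply (X i) (h i)) = (\<Sum>i\<in>UNIV. blinfun_apply (Y i) (h i)) + (\<Sum>i\<in>UNIV. blinfun_apply (X i - Y i) (h i))"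
      by (simp add: sum.distrib[symmetric] blinfun.diff_left)
    ultimately have "norm (\<Sum>i\<in>UNIV. blinfun_apply (X i) (h i)) \<le> (row_norm Y + e) * s"
      using Y norm_triangle_ineq[of "\<Sum>i\<in>UNIV. blinfun_apply (Y i) (h i)" "\<Sum>i\<in>UNIV. blinfun_apply (X i - Y i) (h i)"]
      by (simp add: distrib_right)
    then have "(norm (\<Sum>i\<in>UNIV. blinfun_apply (X i) (h i)))\<^sup>2 \<le> ((row_norm Y + e) * s)\<^sup>2"
      by (intro power_mono) auto
    then show "(norm (\<Sum>i\<in>UNIV. blinfun_apply (X i) (h i)))\<^sup>2 \<le> (row_norm Y + (\<Sum>i\<in>UNIV. norm (X i - Y i)))\<^sup>2 * (\<Sum>i\<in>UNIV. (norm (h i))\<^sup>2)"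
      by (simp add: power_mult_distrib s(2) e_def)
  qed
qed

text \<open>For fixed \<open>X\<close> the function t -> G(f(t X)) is weakly holomorphic on a disc
  of radius larger than 1 and vanishes near 0, hence at t = 1. This bridges two models of kind (F)
  whose balls have different radii.\<close>

lemma composition_vanishes:
  fixes f :: "'n::finite \<Rightarrow> 'n nc_series"
  assumes rad: "\<And>j. nc_radius (f j) \<ge> ereal \<gamma>"
    and range: "\<And>X. X \<in> op_ball \<gamma> \<Longrightarrow> (\<lambda>j. nc_eval (f j) X) \<in> op_ball 1"
    and G: "\<And>k. degree_norm G k \<le> B"
    and \<gamma>': "0 < \<gamma>'" and vanish: "\<And>X. X \<in> op_ball \<gamma> \<Longrightarrow> X \<in> op_ball \<gamma>' \<Longrightarrow> nc_eval G (\<lambda>j. nc_eval (f j) X) = 0"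
    and X: "X \<in> op_ball \<gamma>"
  shows "nc_eval G (\<lambda>j. nc_eval (f j) X) = 0"
proof -
  define R where "R = row_norm X"
  have clin: "X i \<in> bounded_clinear_ops" for i using X by (simp add: op_ball_def)
  have R: "0 \<le> R" "R < \<gamma>" using X by (auto simp: R_def row_norm_nonneg op_ball_def)
  \<comment> \<open>This is 2 \<gamma>/(R + \<gamma>), which exceeds 1 and satisfies \<rho> R <
    \<gamma>, also for R = 0.\<close>
  define \<rho> where "\<rho> = \<gamma> / ((R + \<gamma>) / 2)"
  have \<rho>: "1 < \<rho>" using R by (simp add: \<rho>_def)
  have \<rho>R: "\<tau> * R < \<gamma>" if "0 \<le> \<tau>" "\<tau> < \<rho>" for \<tau>
  proof -
    have "\<tau> * R \<le> \<rho> * R" using that R by (intro mult_right_mono) auto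
    also have "\<dots> < \<gamma>" using R by (simp add: \<rho>_def field_simps)
    finally show ?thesis .
  qed
  define S where "S = ball (0::complex) \<rho>"
  have S: "open S" "connected S" "1 \<in> S" using \<rho> by (auto simp: S_def)
  define tX where "tX t i = scaleC_op t (X i)" for t i
  have tX: "tX t \<in> op_ball \<gamma>" if "t \<in> S" for t
  proof -
    have "row_norm (tX t) \<le> cmod t * R" unfolding tX_def[abs_def] R_def by (rule row_norm_scaleC_le)
    also have "\<dots> < \<gamma>" using that by (intro \<rho>R) (auto simp: S_def)
    finally show ?thesis using clin by (auto simp: op_ball_def tX_def)
  qed
  define Bm where "Bm j m = nc_term (f j) X m" for j m
  have Bm: "Bm j m \<in> bounded_clinear_ops" for j m unfolding Bm_def by (rule nc_term_clinear[OF clin])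
  define F where "F t j = nc_eval (f j) (tX t)" for t j
  have Fball: "F t \<in> op_ball 1" if "t \<in> S" for t using range[OF tX[OF that]] by (simp add: F_def[abs_def])
  have Fsums: "(\<lambda>m. scaleC_op (t ^ m) (Bm j m)) sums F t j" if "t \<in> S" for t j
  proof -
    have "nc_term (f j) (tX t) = (\<lambda>m. scaleC_op (t ^ m) (Bm j m))"
      unfolding tX_def[abs_def] Bm_def by (rule ext) (rule nc_term_scaleC[OF clin])
    then show ?thesis using summable_sums[OF op_ball_summable[OF tX[OF that] rad], of j] by (simp add: F_def nc_eval_def)
  qed
  have dom: "summable (\<lambda>m. \<tau> ^ m * norm (Bm j m))" if "0 \<le> \<tau>" "\<tau> < \<rho>" for \<tau> j
    unfolding Bm_def
  proof (rule nc_term_summable_radius[OF clin])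
    show "row_norm X \<le> R" by (simp add: R_def)
    show "ereal (\<tau> * R) < nc_radius (f j)" using \<rho>R[OF that] rad[of j] by (meson ereal_less_eq less_le_trans less_ereal.simps(1))
  qed fact
  have inside: "\<exists>d>0. cball t d \<subseteq> S \<and> (\<forall>s\<in>cball t d. cmod s \<le> (cmod t + \<rho>) / 2)" if "t \<in> S" for t
  proof (intro exI conjI ballI)
    define d where "d = (\<rho> - cmod t) / 2"
    show "(\<rho> - cmod t) / 2 > 0" using that by (simp add: S_def)
    have le: "cmod s \<le> (cmod t + \<rho>) / 2" if "s \<in> cball t ((\<rho> - cmod t) / 2)" for s
    proof -
      have "cmod s \<le> cmod t + cmod (s - t)" using norm_triangle_ineq[of t "s - t"] by simp
      also have "cmod (s - t) \<le> (\<rho> - cmod t) / 2" using that by (simp add: dist_norm norm_minus_commute)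
      finally show ?thesis by (simp add: field_simps)
    qed
    then show "cmod s \<le> (cmod t + \<rho>) / 2" if "s \<in> cball t ((\<rho> - cmod t) / 2)" for s using that by blast
    show "cball t ((\<rho> - cmod t) / 2) \<subseteq> S"
      using le that by (force simp: S_def)
  qed
  have unif: "uniform_limit K (\<lambda>N s. \<Sum>m<N. scaleC_op (s ^ m) (Bm j m)) (\<lambda>s. F s j) sequentially"
    if K: "K \<subseteq> S" "\<And>s. s \<in> K \<Longrightarrow> cmod s \<le> \<tau>" "0 \<le> \<tau>" "\<tau> < \<rho>" for K \<tau> j
  proof -
    have "uniform_limit K (\<lambda>N s. \<Sum>m<N. scaleC_op (s ^ m) (Bm j m)) (\<lambda>s. \<Sum>m. scaleC_op (s ^ m) (Bm j m)) sequentially"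
    proof (rule Weierstrass_m_test[OF _ dom[OF K(3,4)]])
      fix m s assume "s \<in> K"
      then show "norm (scaleC_op (s ^ m) (Bm j m)) \<le> \<tau> ^ m * norm (Bm j m)"
        using K(2) by (simp add: norm_scaleC_op norm_power mult_right_mono power_mono)
    qed
    moreover have "(\<Sum>m. scaleC_op (s ^ m) (Bm j m)) = F s j" if "s \<in> K" for s
      using sums_unique[OF Fsums[of s j]] that K(1) by auto
    ultimately show ?thesis by (simp cong: uniform_limit_cong')
  qed
  have contF: "isCont (\<lambda>t. F t j) t" if t: "t \<in> S" for t j
  proof -
    obtain d where d: "d > 0" "cball t d \<subseteq> S" "\<forall>s\<in>cball t d. cmod s \<le> (cmod t + \<rho>) / 2" using inside[OF t] by blast
    have "continuous_on (cball t d) (\<lambda>s. F s j)"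
    proof (rule uniform_limit_theorem)
      show "uniform_limit (cball t d) (\<lambda>N s. \<Sum>m<N. scaleC_op (s ^ m) (Bm j m)) (\<lambda>s. F s j) sequentially"
      proof (rule unif[OF d(2)])
        show "cmod s \<le> (cmod t + \<rho>) / 2" if "s \<in> cball t d" for s using d(3) that by blast
        have "cmod t < \<rho>" using t by (simp add: S_def)
        then show "0 \<le> (cmod t + \<rho>) / 2" "(cmod t + \<rho>) / 2 < \<rho>" using \<rho> by auto
      qed
      have sc: "continuous_on A (\<lambda>s. scaleC_op (g s) T)" if "continuous_on A g" for A and g :: "complex \<Rightarrow> complex" and T :: "nat ell2 \<Rightarrow>\<^sub>L nat ell2"
      proof -
        have "bounded_linear (\<lambda>c. scaleC_op c T)"
          by (rule bounded_linear_intro[where K = "norm T"])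
            (auto simp: scaleC_op_add_left norm_scaleC_op scaleR_conv_of_real scaleC_op_of_real[symmetric])
        then show ?thesis using that by (rule bounded_linear.continuous_on)
      qed
      show "\<forall>\<^sub>F N in sequentially. continuous_on (cball t d) (\<lambda>s. \<Sum>m<N. scaleC_op (s ^ m) (Bm j m))"
        by (intro always_eventually allI continuous_on_sum sc continuous_intros)
    qed simp
    moreover have "t \<in> interior (cball t d)" using d(1) by simp
    ultimately show ?thesis by (rule continuous_on_interior)
  qed
  \<comment> \<open>Stated for a weakly holomorphic argument \<phi>, so that induction over letters
    reaches all words. Compactness of the closed disc bounds \<phi> and provides a summable
    majorant.\<close>
  have holF: "weakly_holomorphic S (\<lambda>t. blinfun_apply (F t j) (\<phi> t))" if \<phi>: "weakly_holomorphic S \<phi>" for j and \<phi> :: "complex \<Rightarrow> nat ell2"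
  proof (rule weakly_holomorphic_limit[OF S(1)])
    show "weakly_holomorphic S (\<lambda>t. \<Sum>m<N. t ^ m *\<^sub>C blinfun_apply (Bm j m) (\<phi> t))" for N
      by (intro weakly_holomorphic_sum weakly_holomorphic_scaleC weakly_holomorphic_op Bm \<phi> holomorphic_intros)
    fix t assume t: "t \<in> S"
    then obtain d where d: "d > 0" "cball t d \<subseteq> S" "\<forall>s\<in>cball t d. cmod s \<le> (cmod t + \<rho>) / 2" using inside by blast
    have "continuous_on (cball t d) \<phi>" using \<phi> d(2) continuous_on_subset by (auto simp: weakly_holomorphic_def)
    then have "bounded (\<phi> ` cball t d)" by (intro compact_imp_bounded compact_continuous_image) auto
    then obtain M where M: "\<And>s. s \<in> cball t d \<Longrightarrow> norm (\<phi> s) \<le> M" unfolding bounded_iff by blast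
    define \<tau> where "\<tau> = (cmod t + \<rho>) / 2"
    have \<tau>: "0 \<le> \<tau>" "\<tau> < \<rho>" using t \<rho> by (auto simp: \<tau>_def S_def)
    have U: "uniform_limit (cball t d) (\<lambda>N s. \<Sum>m<N. s ^ m *\<^sub>C blinfun_apply (Bm j m) (\<phi> s)) (\<lambda>s. \<Sum>m. s ^ m *\<^sub>C blinfun_apply (Bm j m) (\<phi> s)) sequentially"
    proof (rule Weierstrass_m_test)
      show "summable (\<lambda>m. (\<tau> ^ m * norm (Bm j m)) * M)" by (intro summable_mult2 dom \<tau>)
      fix m s assume s: "s \<in> cball t d"
      have "norm (s ^ m *\<^sub>C blinfun_apply (Bm j m) (\<phi> s)) \<le> cmod s ^ m * (norm (Bm j m) * norm (\<phi> s))"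
        by (simp add: norm_scaleC norm_power mult_left_mono norm_blinfun)
      also have "\<dots> \<le> \<tau> ^ m * (norm (Bm j m) * M)"
        using d(3) s M[OF s] \<tau> by (intro mult_mono power_mono mult_left_mono) (auto simp: \<tau>_def)
      finally show "norm (s ^ m *\<^sub>C blinfun_apply (Bm j m) (\<phi> s)) \<le> (\<tau> ^ m * norm (Bm j m)) * M" by (simp add: mult.assoc)
    qed
    have E: "(\<Sum>m. s ^ m *\<^sub>C blinfun_apply (Bm j m) (\<phi> s)) = blinfun_apply (F s j) (\<phi> s)" if "s \<in> cball t d" for s
    proof -
      have "(\<lambda>m. blinfun_apply (scaleC_op (s ^ m) (Bm j m)) (\<phi> s)) sums blinfun_apply (F s j) (\<phi> s)"
        using Fsums[of s j] that d(2) by (intro bounded_linear.sums[OF blinfun.bounded_linear_left]) auto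
      then show ?thesis by (simp add: sums_iff)
    qed
    have "uniform_limit (cball t d) (\<lambda>N s. \<Sum>m<N. s ^ m *\<^sub>C blinfun_apply (Bm j m) (\<phi> s)) (\<lambda>s. blinfun_apply (F s j) (\<phi> s)) sequentially"
      by (rule iffD1[OF uniform_limit_cong'[OF refl E] U])
    then show "\<exists>d>0. cball t d \<subseteq> S \<and> uniform_limit (cball t d) (\<lambda>N s. \<Sum>m<N. s ^ m *\<^sub>C blinfun_apply (Bm j m) (\<phi> s)) (\<lambda>s. blinfun_apply (F s j) (\<phi> s)) sequentially"
      using d by blast
  qed
  have holG: "weakly_holomorphic S (\<lambda>t. blinfun_apply (nc_eval G (F t)) h)" for h
  proof (rule weakly_holomorphic_limit[OF S(1)])
    have word: "weakly_holomorphic S (\<lambda>t. blinfun_apply (op_word (F t) \<alpha>) h)" for \<alpha>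
      by (induction \<alpha>) (auto intro: weakly_holomorphic_const holF)
    show "weakly_holomorphic S (\<lambda>t. blinfun_apply (\<Sum>k<N. nc_term G (F t) k) h)" for N
      unfolding blinfun.sum_left nc_term_def scaleC_op_apply
      by (intro weakly_holomorphic_sum weakly_holomorphic_scaleC word holomorphic_on_const)
    fix t assume t: "t \<in> S"
    obtain d where d: "d > 0" "cball t d \<subseteq> S" using inside[OF t] by blast
    \<comment> \<open>By continuity of \<open>F\<close> the row norm stays at most q < 1 on a small
      disc around \<open>t\<close>, so the outer series converges uniformly there.\<close>
    define q where "q = (row_norm (F t) + 1) / 2"
    have q: "row_norm (F t) < q" "0 \<le> q" "q < 1" using Fball[OF t] row_norm_nonneg[of "F t"] by (auto simp: q_def op_ball_def)
    have "((\<lambda>s. row_norm (F t) + (\<Sum>j\<in>UNIV. norm (F s j - F t j))) \<longlongrightarrow> row_norm (F t) + (\<Sum>j\<in>UNIV. norm (F t j - F t j))) (at t)"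
      using contF[OF t] unfolding isCont_def by (intro tendsto_intros)
    then have "\<forall>\<^sub>F s in at t. row_norm (F t) + (\<Sum>j\<in>UNIV. norm (F s j - F t j)) < q"
      by (rule order_tendstoD(2)) (use q in simp)
    then obtain d' where d': "d' > 0" "\<And>s. s \<noteq> t \<Longrightarrow> dist s t < d' \<Longrightarrow> row_norm (F t) + (\<Sum>j\<in>UNIV. norm (F s j - F t j)) < q"
      unfolding eventually_at by blast
    have qle: "row_norm (F s) \<le> q" if "dist s t < d'" for s
      using d'(2)[of s] that q row_norm_perturb[of "F s" "F t"] by (cases "s = t") auto
    define e where "e = min d (d' / 2)"
    have e: "e > 0" "cball t e \<subseteq> S" using d d' by (auto simp: e_def)
    have "uniform_limit (cball t e) (\<lambda>N s. blinfun_apply (\<Sum>k<N. nc_term G (F s) k) h) (\<lambda>s. blinfun_apply (nc_eval G (F s)) h) sequentially"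
    proof (rule uniform_limitI)
      fix \<epsilon> :: real assume \<epsilon>: "\<epsilon> > 0"
      have "(\<lambda>N. B * q ^ N / (1 - q) * norm h) \<longlonglongrightarrow> B * 0 / (1 - q) * norm h"
        using q by (intro tendsto_intros LIMSEQ_power_zero) auto
      then have "\<forall>\<^sub>F N in sequentially. B * q ^ N / (1 - q) * norm h < \<epsilon>"
        by (rule order_tendstoD(2)) (use \<epsilon> in simp)
      then show "\<forall>\<^sub>F N in sequentially. \<forall>s\<in>cball t e. dist (blinfun_apply (\<Sum>k<N. nc_term G (F s) k) h) (blinfun_apply (nc_eval G (F s)) h) < \<epsilon>"
      proof eventually_elim
        case (elim N)
        show ?case
        proof
          fix s assume s: "s \<in> cball t e"
          have sq: "row_norm (F s) \<le> q" using s d' by (intro qle) (auto simp: e_def dist_commute)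
          have B: "0 \<le> B" using G[of 0] degree_norm_nonneg[of G 0] by linarith
          have "norm (nc_eval G (F s) - (\<Sum>k<N. nc_term G (F s) k)) \<le> B * row_norm (F s) ^ N / (1 - row_norm (F s))"
            by (rule nc_eval_summable(3)[OF _ _ G]) (use Fball[of s] s e in \<open>auto simp: op_ball_def\<close>)
          also have "\<dots> \<le> B * q ^ N / (1 - q)"
            using sq q B row_norm_nonneg[of "F s"] by (intro frac_le mult_left_mono power_mono mult_nonneg_nonneg) auto
          finally have le: "norm (nc_eval G (F s) - (\<Sum>k<N. nc_term G (F s) k)) \<le> B * q ^ N / (1 - q)" .
          have "norm (blinfun_apply (nc_eval G (F s) - (\<Sum>k<N. nc_term G (F s) k)) h) \<le> B * q ^ N / (1 - q) * norm h"
            by (rule order_trans[OF norm_blinfun mult_right_mono[OF le]]) simp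
          then show "dist (blinfun_apply (\<Sum>k<N. nc_term G (F s) k) h) (blinfun_apply (nc_eval G (F s)) h) < \<epsilon>"
            using elim by (simp add: dist_norm norm_minus_commute blinfun.diff_left)
        qed
      qed
    qed
    with e show "\<exists>d>0. cball t d \<subseteq> S \<and> uniform_limit (cball t d) (\<lambda>N s. blinfun_apply (\<Sum>k<N. nc_term G (F s) k) h) (\<lambda>s. blinfun_apply (nc_eval G (F s)) h) sequentially"
      by blast
  qed
  \<comment> \<open>For t of modulus below \<sigma> the multiple t X lies in both balls, where the
    vanishing is assumed.\<close>
  define \<sigma> where "\<sigma> = min \<rho> (\<gamma>' / (R + 1))"
  have \<sigma>: "0 < \<sigma>" using \<rho> \<gamma>' R by (simp add: \<sigma>_def)
  have zero: "nc_eval G (F t) = 0" if "t \<in> ball 0 \<sigma>" for t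
  proof -
    have tS: "t \<in> S" using that by (auto simp: S_def \<sigma>_def)
    have "row_norm (tX t) \<le> cmod t * R" unfolding tX_def[abs_def] R_def by (rule row_norm_scaleC_le)
    also have "\<dots> \<le> cmod t * (R + 1)" by (intro mult_left_mono) auto
    also have "\<dots> < \<gamma>'" using that R by (simp add: \<sigma>_def field_simps)
    finally have "tX t \<in> op_ball \<gamma>'" using clin by (auto simp: op_ball_def tX_def)
    then show ?thesis using vanish[OF tX[OF tS]] by (simp add: F_def[abs_def])
  qed
  have "cinner (blinfun_apply (nc_eval G (F 1)) h) k = 0" for h k
  proof (rule analytic_continuation[where f = "\<lambda>t. cinner (blinfun_apply (nc_eval G (F t)) h) k" and S = S
        and U = "ball 0 \<sigma>" and \<xi> = 0 and w = 1])
    show "(\<lambda>t. cinner (blinfun_apply (nc_eval G (F t)) h) k) holomorphic_on S"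
      using holG by (simp add: weakly_holomorphic_def)
    show "0 islimpt ball (0::complex) \<sigma>" using \<sigma> by (simp add: islimpt_ball)
    show "ball 0 \<sigma> \<subseteq> S" by (auto simp: S_def \<sigma>_def)
    show "0 \<in> S" using \<rho> by (simp add: S_def)
  qed (use zero S in auto)
  then have "nc_eval G (F 1) = 0"
    by (intro blinfun_eqI) (metis blinfun.zero_left cinner_self norm_eq_zero of_real_eq_0_iff power_eq_0_iff)
  then show ?thesis by (simp add: F_def[abs_def] tX_def[abs_def])
qed

section \<open>Comparison of the models of f and of r f\<close>

lemma nc_mult_scale: "nc_mult (\<lambda>\<alpha>. x * c \<alpha>) (\<lambda>\<alpha>. y * d \<alpha>) \<gamma> = x * y * nc_mult c d \<gamma>"
  by (simp add: nc_mult_def sum_distrib_left mult_ac)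

lemma nc_word_scaled: "nc_word (\<lambda>i \<alpha>. x * f i \<alpha>) \<alpha> = (\<lambda>\<beta>. x ^ length \<alpha> * nc_word f \<alpha> \<beta>)"
proof (induction \<alpha>)
  case (Cons i \<alpha>)
  show ?case by (rule ext) (simp add: Cons.IH nc_mult_scale)
qed simp

lemma nc_subst_scaled:
  assumes "r \<noteq> 0"
  shows "nc_subst b (\<lambda>i \<alpha>. r * f i \<alpha>) = nc_subst (\<lambda>\<alpha>. r ^ length \<alpha> * b \<alpha>) f"
  unfolding nc_subst_def nc_word_scaled by (rule ext, rule sum.cong) (use assms in auto)

lemma degree_norm_scaled:
  assumes "0 \<le> r"
  shows "degree_norm (\<lambda>\<alpha>. of_real r ^ length \<alpha> * b \<alpha>) k = r ^ k * degree_norm b k"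
proof -
  have "(\<Sum>\<alpha> | length \<alpha> = k. (cmod (of_real r ^ length \<alpha> * b \<alpha>))\<^sup>2) = (r ^ k)\<^sup>2 * (\<Sum>\<alpha> | length \<alpha> = k. (cmod (b \<alpha>))\<^sup>2)"
    using assms by (simp add: norm_mult norm_power power_mult_distrib sum_distrib_left)
  then show ?thesis using assms by (simp add: degree_norm_def real_sqrt_mult)
qed

lemma degree_norm_scaled_le:
  assumes "0 \<le> r" "r \<le> 1"
  shows "degree_norm (\<lambda>\<alpha>. of_real r ^ length \<alpha> * ell2_coeff u \<alpha>) k \<le> norm u"
proof -
  have "r ^ k * degree_norm (ell2_coeff u) k \<le> 1 * norm u"
    using assms degree_norm_nonneg by (intro mult_mono power_le_one degree_norm_ell2_le) auto
  then show ?thesis unfolding degree_norm_scaled[OF assms(1)] by simp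
qed

lemma degree_norm_diff_le:
  "degree_norm (\<lambda>\<alpha>. c \<alpha> - d \<alpha>) k \<le> degree_norm c k + degree_norm d k"
proof -
  have "L2_set (\<lambda>\<alpha>. cmod (c \<alpha> - d \<alpha>)) {\<alpha>. length \<alpha> = k} \<le> L2_set (\<lambda>\<alpha>. cmod (c \<alpha>) + cmod (d \<alpha>)) {\<alpha>. length \<alpha> = k}"
    by (rule L2_set_mono) (auto simp: norm_triangle_ineq4)
  also have "\<dots> \<le> L2_set (\<lambda>\<alpha>. cmod (c \<alpha>)) {\<alpha>. length \<alpha> = k} + L2_set (\<lambda>\<alpha>. cmod (d \<alpha>)) {\<alpha>. length \<alpha> = k}"
    by (rule L2_set_triangle_ineq)
  finally show ?thesis by (simp add: degree_norm_def L2_set_def)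
qed

lemma nc_eval_diff:
  assumes "summable (nc_term c X)" "summable (nc_term d X)"
  shows "nc_eval (\<lambda>\<alpha>. c \<alpha> - d \<alpha>) X = nc_eval c X - nc_eval d X"
proof -
  have "nc_term (\<lambda>\<alpha>. c \<alpha> - d \<alpha>) X k = nc_term c X k - nc_term d X k" for k
    by (simp add: nc_term_def scaleC_op_diff_left sum_subtractf)
  then show ?thesis using suminf_diff[OF assms] by (simp add: nc_eval_def)
qed

lemma polynomial_degree_norm_summable:
  fixes p :: "'n::finite nc_series"
  assumes "nc_polynomial p"
  shows "summable (degree_norm p)"
proof (rule summable_finite)
  have fin: "finite {\<alpha>. p \<alpha> \<noteq> 0}" using assms by (simp add: nc_polynomial_def)
  then show "finite (length ` {\<alpha>. p \<alpha> \<noteq> 0})" by simp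
  fix k assume "k \<notin> length ` {\<alpha>. p \<alpha> \<noteq> 0}"
  then have "p \<alpha> = 0" if "length \<alpha> = k" for \<alpha> using that by blast
  then show "degree_norm p k = 0" by (simp add: degree_norm_def)
qed

text \<open>Stated for bounded degree norms instead of elements of \<open>ell2\<close>, so that the
  rescaled coefficients of a model of r f fit directly.\<close>

lemma model_F_unique:
  fixes f :: "'n::finite \<Rightarrow> 'n nc_series"
  assumes range: "\<And>X. X \<in> op_ball \<gamma> \<Longrightarrow> (\<lambda>j. nc_eval (f j) X) \<in> op_ball 1"
    and faithful: "\<And>G. nc_radius G \<ge> 1 \<Longrightarrow> G \<noteq> (\<lambda>_. 0) \<Longrightarrow> \<exists>X\<in>op_ball \<gamma>. nc_eval G (\<lambda>j. nc_eval (f j) X) \<noteq> 0"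
    and c: "\<And>k. degree_norm c k \<le> B" and d: "\<And>k. degree_norm d k \<le> B'"
    and eq: "\<And>X. X \<in> op_ball \<gamma> \<Longrightarrow> nc_eval (\<lambda>\<alpha>. c \<alpha> - d \<alpha>) (\<lambda>j. nc_eval (f j) X) = 0"
  shows "c = d"
proof (rule ccontr)
  assume "c \<noteq> d"
  then have "(\<lambda>\<alpha>. c \<alpha> - d \<alpha>) \<noteq> (\<lambda>_. 0)" by (auto simp: fun_eq_iff)
  moreover have "degree_norm (\<lambda>\<alpha>. c \<alpha> - d \<alpha>) k \<le> B + B'" for k
    using degree_norm_diff_le[of c d k] c[of k] d[of k] by linarith
  then have "nc_radius (\<lambda>\<alpha>. c \<alpha> - d \<alpha>) \<ge> 1" by (rule degree_norm_bounded_radius)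
  ultimately show False using faithful eq by blast
qed

text \<open>A model of \<open>f\<close> and a model of \<open>r f\<close> have inverse series \<open>a\<close>, \<open>b\<close> with \<open>a\<^sub>\<alpha> = r\<^sup>|\<^sup>\<alpha>\<^sup>| b\<^sub>\<alpha>\<close>, whichever of the
  alternatives of the model property the two of them satisfy.\<close>

lemma inverse_series_scaled:
  fixes f :: "'n::finite \<Rightarrow> 'n nc_series"
  assumes f: "is_model f a W" and b: "is_model (\<lambda>i \<alpha>. of_real r * f i \<alpha>) b W'" and r: "0 < r" "r < 1"
    and nA: "\<not> model_A f a W"
  shows "ell2_coeff (a i) = (\<lambda>\<alpha>. of_real r ^ length \<alpha> * ell2_coeff (b i) \<alpha>)"
proof -
  define d where "d i = (\<lambda>\<alpha>. of_real r ^ length \<alpha> * ell2_coeff (b i) \<alpha>)" for i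
  define g where "g = (\<lambda>i \<alpha>. complex_of_real r * f i \<alpha>)"
  have rne: "complex_of_real r \<noteq> 0" using r by simp
  have subst_d: "nc_subst (ell2_coeff (b i)) g = nc_subst (d i) f" for i
    unfolding g_def d_def by (rule nc_subst_scaled[OF rne])
  have d_le: "degree_norm (d i) k \<le> norm (b i)" for i k
    unfolding d_def using r by (intro degree_norm_scaled_le) auto
  have g0: "g j [] = 0 \<longleftrightarrow> f j [] = 0" for j using rne by (simp add: g_def)
  \<comment> \<open>If f(0) = 0, case (F) for r f yields the formal identity that (A) and (S) for r
    f contain outright.\<close>
  have gF: "nc_subst (d i) f = nc_var i" if "model_F g b W'" "\<And>j. f j [] = 0" for i
    unfolding subst_d[symmetric]
  proof (rule model_FE[OF that(1)])
    fix \<gamma> assume F: "0 < \<gamma>" "\<And>j. nc_radius (g j) \<ge> ereal \<gamma>"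
      "\<And>X. X \<in> op_ball \<gamma> \<Longrightarrow> (\<lambda>j. nc_eval (g j) X) \<in> op_ball 1"
      "\<And>i X. X \<in> op_ball \<gamma> \<Longrightarrow> nc_eval (ell2_coeff (b i)) (\<lambda>j. nc_eval (g j) X) = X i"
    show "nc_subst (ell2_coeff (b i)) g = nc_var i"
      by (rule composition_identity_formal[OF F(1) _ F(2,3,4)]) (use that(2) g0 in auto)
  qed
  \<comment> \<open>Alternative (A) for f is set aside by \<open>nA\<close>: there the inverse
    series is a polynomial, which \<open>inverse_series_summable\<close> treats directly.\<close>
  consider "model_S f a W" | "model_F f a W" using f nA by (auto simp: is_model_def)
  then have "ell2_coeff (a i) = d i"
  proof cases
    case 1
    then have f0: "\<And>i. f i [] = 0" and det: "det ((\<chi> i j. f i [j]) :: complex^'n^'n) \<noteq> 0"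
      and a: "nc_subst (ell2_coeff (a i)) f = nc_var i" by (auto simp: model_S_def)
    have "nc_subst (d i) f = nc_var i"
      using b[folded g_def] gF[OF _ f0] unfolding is_model_def model_A_def model_S_def subst_d[symmetric] by blast
    then show ?thesis using formal_substitution_injective[where f = f, OF f0 det] a by metis
  next
    case 2
    obtain \<gamma> where \<gamma>: "0 < \<gamma>" and rad: "\<And>j. nc_radius (f j) \<ge> ereal \<gamma>"
      and range: "\<And>X. X \<in> op_ball \<gamma> \<Longrightarrow> (\<lambda>j. nc_eval (f j) X) \<in> op_ball 1"
      and faithful: "\<And>G. nc_radius G \<ge> 1 \<Longrightarrow> G \<noteq> (\<lambda>_. 0) \<Longrightarrow> \<exists>X\<in>op_ball \<gamma>. nc_eval G (\<lambda>j. nc_eval (f j) X) \<noteq> 0"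
      and a: "\<And>i X. X \<in> op_ball \<gamma> \<Longrightarrow> nc_eval (ell2_coeff (a i)) (\<lambda>j. nc_eval (f j) X) = X i"
      by (rule model_FE[OF 2]; rule that; assumption)
    have diff: "nc_eval (\<lambda>\<alpha>. ell2_coeff (a i) \<alpha> - d i \<alpha>) (\<lambda>j. nc_eval (f j) X) = X i - nc_eval (d i) (\<lambda>j. nc_eval (f j) X)"
      if X: "X \<in> op_ball \<gamma>" for X
    proof -
      interpret strict_row "\<lambda>j. nc_eval (f j) X" by (rule op_ball_strict_row[OF range[OF X]])
      show ?thesis
        using nc_eval_diff[OF ev_summable nc_eval_summable(1)[OF Z_clinear Z_strict d_le], of "a i" i] a[OF X, of i] by simp
    qed
    consider "model_A g b W'" | "model_S g b W'" | "model_F g b W'" using b by (auto simp: is_model_def g_def)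
    then show ?thesis
    proof cases
      case 1
      \<comment> \<open>The polynomial identity for r f, rewritten for f, is evaluated at the tuples
        of the ball, where faithfulness for f decides.\<close>
      have gp: "nc_polynomial (g j)" for j using 1 by (simp add: model_A_def)
      have fp: "nc_polynomial (f j)" for j using gp[of j] rne by (simp add: g_def nc_polynomial_def)
      have dp: "nc_polynomial (d i)" using 1 rne by (auto simp: model_A_def d_def nc_polynomial_def)
      have sd: "nc_subst (d i) f = nc_var i" using 1 by (simp add: model_A_def subst_d)
      have "nc_eval (\<lambda>\<alpha>. ell2_coeff (a i) \<alpha> - d i \<alpha>) (\<lambda>j. nc_eval (f j) X) = 0" if X: "X \<in> op_ball \<gamma>" for X
      proof -
        have ev: "nc_eval p Y = nc_poly_eval p Y" if "nc_polynomial p" for p :: "'n nc_series" and Y :: "'n \<Rightarrow> (nat ell2 \<Rightarrow>\<^sub>L nat ell2)"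
          unfolding nc_eval_def by (rule sums_unique[OF nc_term_sums_poly_eval(1)[OF that], symmetric])
        have "X i = nc_poly_eval (nc_subst (d i) f) X" by (simp add: sd nc_poly_eval_var)
        also have "\<dots> = nc_poly_eval (d i) (\<lambda>j. nc_poly_eval (f j) X)"
          using X by (intro nc_poly_eval_subst dp fp) (auto simp: op_ball_def)
        finally show ?thesis using diff[OF X] by (simp add: ev[OF fp] ev[OF dp])
      qed
      from model_F_unique[OF range faithful degree_norm_ell2_le d_le this] show ?thesis .
    next
      case 2
      then have g0': "\<And>j. g j [] = 0" and det: "det ((\<chi> i j. g i [j]) :: complex^'n^'n) \<noteq> 0"
        and bg: "nc_subst (ell2_coeff (b i)) g = nc_var i" by (auto simp: model_S_def)
      have f0: "\<And>j. f j [] = 0" using g0 g0' by blast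
      \<comment> \<open>The inverse series of f, rescaled the other way, is compared with
        \<open>b\<close> purely formally, by injectivity of substitution in r f.\<close>
      define a' where "a' \<alpha> = ell2_coeff (a i) \<alpha> / of_real r ^ length \<alpha>" for \<alpha>
      have aa: "(\<lambda>\<alpha>. of_real r ^ length \<alpha> * a' \<alpha>) = ell2_coeff (a i)" using rne by (simp add: a'_def fun_eq_iff)
      have "nc_subst a' g = nc_subst (ell2_coeff (a i)) f"
        unfolding g_def nc_subst_scaled[OF rne] aa ..
      also have "\<dots> = nc_var i" by (rule composition_identity_formal[OF \<gamma> f0 rad range a])
      finally have "nc_subst a' g = nc_subst (ell2_coeff (b i)) g" by (simp only: bg)
      then have "a' = ell2_coeff (b i)" by (rule formal_substitution_injective[where f = g, OF g0' det])
      then show ?thesis using aa by (simp add: d_def)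
    next
      case 3
      \<comment> \<open>The model of r f has a ball of its own, so the identity is first known only
        at tuples that lie in both balls.\<close>
      obtain \<gamma>' where \<gamma>': "0 < \<gamma>'"
        and b: "\<And>i X. X \<in> op_ball \<gamma>' \<Longrightarrow> nc_eval (ell2_coeff (b i)) (\<lambda>j. nc_eval (g j) X) = X i"
        by (rule model_FE[OF 3]; rule that; assumption)
      have le: "degree_norm (\<lambda>\<alpha>. ell2_coeff (a i) \<alpha> - d i \<alpha>) k \<le> norm (a i) + norm (b i)" for k
        using degree_norm_diff_le[of "ell2_coeff (a i)" "d i" k] degree_norm_ell2_le[of "a i" k] d_le[of i k] by linarith
      have "nc_eval (\<lambda>\<alpha>. ell2_coeff (a i) \<alpha> - d i \<alpha>) (\<lambda>j. nc_eval (f j) X) = 0" if X: "X \<in> op_ball \<gamma>" for X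
      proof (rule composition_vanishes[OF rad range le \<gamma>' _ X])
        fix X :: "'n \<Rightarrow> (nat ell2 \<Rightarrow>\<^sub>L nat ell2)" assume X: "X \<in> op_ball \<gamma>" "X \<in> op_ball \<gamma>'"
        have "nc_eval (g j) X = r *\<^sub>R nc_eval (f j) X" for j
        proof -
          have "nc_term (g j) X k = r *\<^sub>R nc_term (f j) X k" for k
            unfolding scaleC_op_of_real[symmetric] g_def nc_term_def scaleC_op_sum_right by simp
          then show ?thesis using suminf_scaleR_right[OF op_ball_summable[OF X(1) rad], of r j] by (simp add: nc_eval_def)
        qed
        moreover have "nc_eval (ell2_coeff (b i)) (\<lambda>j. r *\<^sub>R nc_eval (f j) X) = nc_eval (d i) (\<lambda>j. nc_eval (f j) X)"
          by (simp add: nc_eval_def d_def nc_term_scaleR[abs_def] nc_term_coeff_scale[abs_def])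
        ultimately have "nc_eval (d i) (\<lambda>j. nc_eval (f j) X) = X i" using b[OF X(2), of i] by simp
        then show "nc_eval (\<lambda>\<alpha>. ell2_coeff (a i) \<alpha> - d i \<alpha>) (\<lambda>j. nc_eval (f j) X) = 0" using diff[OF X(1)] by simp
      qed
      from model_F_unique[OF range faithful degree_norm_ell2_le d_le this] show ?thesis .
    qed
  qed
  then show ?thesis by (simp add: d_def)
qed

lemma inverse_series_summable:
  fixes f :: "'n::finite \<Rightarrow> 'n nc_series"
  assumes "f \<in> M_rad" and f: "is_model f a W"
  shows "summable (degree_norm (ell2_coeff (a i)))"
proof (cases "model_A f a W")
  case True
  then show ?thesis by (intro polynomial_degree_norm_summable) (simp add: model_A_def)
next
  case False
  obtain \<delta> where \<delta>: "0 < \<delta>" "\<delta> < 1" "\<forall>r\<in>{\<delta><..1}. model_property (\<lambda>i \<alpha>. complex_of_real r * f i \<alpha>)"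
    using assms(1) by (auto simp: M_rad_def)
  \<comment> \<open>Any number strictly between \<delta> and 1 provides a model of r f; the degree
    norms of \<open>a i\<close> are then at most r^k times the norm of \<open>b i\<close>.\<close>
  define r where "r = (\<delta> + 1) / 2"
  have r: "0 < r" "r < 1" "\<delta> < r" using \<delta> by (auto simp: r_def)
  then obtain b W' where b: "is_model (\<lambda>i \<alpha>. of_real r * f i \<alpha>) b W'"
    using \<delta>(3) by (fastforce simp: model_property_def)
  have "degree_norm (ell2_coeff (a i)) = (\<lambda>k. r ^ k * degree_norm (ell2_coeff (b i)) k)"
    unfolding inverse_series_scaled[OF f b r(1,2) False] using r by (intro ext degree_norm_scaled) simp
  moreover have "summable (\<lambda>k. r ^ k * degree_norm (ell2_coeff (b i)) k)"
  proof (rule summable_comparison_test')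
    show "summable (\<lambda>k. r ^ k * norm (b i))" using r by (intro summable_mult2 summable_geometric) auto
    show "norm (r ^ k * degree_norm (ell2_coeff (b i)) k) \<le> r ^ k * norm (b i)" if "k \<ge> 0" for k
      using r degree_norm_ell2_le[of "b i" k] degree_norm_nonneg[of "ell2_coeff (b i)" k] by (simp add: mult_left_mono)
  qed
  ultimately show ?thesis by simp
qed

section \<open>Similarity to a tuple in the domain\<close>

lemma op_bound_cong:
  "(\<And>i j. i \<in> I \<Longrightarrow> j \<in> J \<Longrightarrow> T i j = T' i j) \<Longrightarrow> op_bound I J T D \<longleftrightarrow> op_bound I J T' D"
  unfolding op_bound_def by (simp cong: sum.cong)

lemma nc_poly_eval_similar:
  assumes XX: "X o\<^sub>L X' = id_blinfun" "X' o\<^sub>L X = id_blinfun" and X: "X \<in> bounded_clinear_ops"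
    and A: "\<And>i. T i = X o\<^sub>L A i o\<^sub>L X'"
  shows "nc_poly_eval p T = X o\<^sub>L nc_poly_eval p A o\<^sub>L X'"
proof -
  have "op_word T \<alpha> = X o\<^sub>L op_word A \<alpha> o\<^sub>L X'" for \<alpha>
  proof (induction \<alpha>)
    case (Cons i \<alpha>)
    have "T i o\<^sub>L (X o\<^sub>L op_word A \<alpha> o\<^sub>L X') = X o\<^sub>L (A i o\<^sub>L ((X' o\<^sub>L X) o\<^sub>L (op_word A \<alpha> o\<^sub>L X')))"
      unfolding A by (simp only: blinfun_compose_assoc)
    then show ?case by (simp only: op_word_simps Cons.IH XX blinfun_compose_id blinfun_compose_assoc)
  qed (simp add: XX)
  then show ?thesis
    by (simp add: nc_poly_eval_def blinfun_compose_sum_left blinfun_compose_sum_right scaleC_op_compose_left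
        scaleC_op_compose_right X)
qed

lemma similar_domain_polynomially_bounded:
  fixes W :: "'n::finite \<Rightarrow> ('n list ell2 \<Rightarrow>\<^sub>L 'n list ell2)" and T A :: "'n \<Rightarrow> ('h::complex_hilbert_space \<Rightarrow>\<^sub>L 'h)"
  assumes W: "\<And>i. left_multiplication (W i)"
    and Y: "\<And>i. Y i \<in> bounded_clinear_ops" "row_norm Y \<le> 1"
    and T: "has_value (\<lambda>i. ell2_coeff (blinfun_apply (W i) (ell2_basis []))) Y T"
    and X: "X \<in> bounded_clinear_ops" "X' \<in> bounded_clinear_ops" "X' o\<^sub>L X = id_blinfun" "X o\<^sub>L X' = id_blinfun"
    and A: "\<And>i. A i = X' o\<^sub>L T i o\<^sub>L X"
  shows "\<exists>\<Phi>. (\<forall>p. nc_polynomial p \<longrightarrow> \<Phi> (nc_poly_eval p W) = nc_poly_eval p A) \<and> completely_bounded_on (poly_algebra W) \<Phi>"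
proof -
  have pA: "nc_poly_eval p A = X' o\<^sub>L nc_poly_eval p T o\<^sub>L X" for p
    by (rule nc_poly_eval_similar[OF X(3,4,2) A])
  \<comment> \<open>Any polynomial that represents \<open>B\<close> may be chosen, because
    \<open>domain_poly_eval_cong\<close> makes the value independent of the choice.\<close>
  define \<Phi> where "\<Phi> B = nc_poly_eval (SOME p. nc_polynomial p \<and> nc_poly_eval p W = B) A" for B
  have \<Phi>: "\<Phi> (nc_poly_eval p W) = nc_poly_eval p A" if p: "nc_polynomial p" for p
  proof -
    define q where "q = (SOME q. nc_polynomial q \<and> nc_poly_eval q W = nc_poly_eval p W)"
    have q: "nc_polynomial q" "nc_poly_eval q W = nc_poly_eval p W"
      using someI[of "\<lambda>q. nc_polynomial q \<and> nc_poly_eval q W = nc_poly_eval p W" p] p by (auto simp: q_def)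
    from domain_poly_eval_cong[OF W Y T q(1) p q(2)] show ?thesis unfolding \<Phi>_def q_def[symmetric] pA by simp
  qed
  have "completely_bounded_on (poly_algebra W) \<Phi>"
    unfolding completely_bounded_on_def
  \<comment> \<open>The similarity costs its condition number; the inequality for \<open>T\<close>
    itself has constant 1.\<close>
  proof (intro exI[of _ "norm X' * norm X"] allI impI)
    fix k :: nat and B :: "nat \<Rightarrow> nat \<Rightarrow> ('n list ell2 \<Rightarrow>\<^sub>L 'n list ell2)"
    assume "\<forall>i<k. \<forall>j<k. B i j \<in> poly_algebra W"
    then have "\<forall>i j. \<exists>p. i < k \<and> j < k \<longrightarrow> nc_polynomial p \<and> B i j = nc_poly_eval p W"
      by (auto simp: poly_algebra_def)
    then obtain p where p: "\<And>i j. i < k \<Longrightarrow> j < k \<Longrightarrow> nc_polynomial (p i j)"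
      "\<And>i j. i < k \<Longrightarrow> j < k \<Longrightarrow> B i j = nc_poly_eval (p i j) W" by metis
    define D where "D = opmat_norm {..<k} {..<k} B"
    have D: "0 \<le> D" by (simp add: D_def opmat_norm_nonneg)
    have "op_bound {..<k} {..<k} B D" unfolding D_def by (rule opmat_norm_op_bound) auto
    then have "op_bound {..<k} {..<k} (\<lambda>i j. nc_poly_eval (p i j) W) D"
      by (subst op_bound_cong[where T' = B]) (auto simp: p)
    then have TD: "op_bound {..<k} {..<k} (\<lambda>i j. nc_poly_eval (p i j) T) D"
      by (intro domain_op_bound[OF W Y T]) auto
    have "op_bound {..<k} {..<k} (\<lambda>i j. nc_poly_eval (p i j) A) (norm X' * norm X * D)"
      unfolding op_bound_def
    proof
      fix h
      have "(\<Sum>i<k. (norm (\<Sum>j<k. blinfun_apply (nc_poly_eval (p i j) A) (h j)))\<^sup>2) =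
          (\<Sum>i<k. (norm (blinfun_apply X' (\<Sum>j<k. blinfun_apply (nc_poly_eval (p i j) T) (blinfun_apply X (h j)))))\<^sup>2)"
        by (simp add: pA blinfun.sum_right)
      also have "\<dots> \<le> (\<Sum>i<k. (norm X' * norm (\<Sum>j<k. blinfun_apply (nc_poly_eval (p i j) T) (blinfun_apply X (h j))))\<^sup>2)"
        by (intro sum_mono power_mono norm_blinfun) auto
      also have "\<dots> = (norm X')\<^sup>2 * (\<Sum>i<k. (norm (\<Sum>j<k. blinfun_apply (nc_poly_eval (p i j) T) (blinfun_apply X (h j))))\<^sup>2)"
        by (simp add: power_mult_distrib sum_distrib_left)
      also have "\<dots> \<le> (norm X')\<^sup>2 * (D\<^sup>2 * (\<Sum>j<k. (norm (blinfun_apply X (h j)))\<^sup>2))"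
        by (intro mult_left_mono op_boundD[OF TD]) auto
      also have "\<dots> \<le> (norm X')\<^sup>2 * (D\<^sup>2 * (\<Sum>j<k. (norm X * norm (h j))\<^sup>2))"
        by (intro mult_left_mono sum_mono power_mono norm_blinfun) auto
      also have "\<dots> = (norm X' * norm X * D)\<^sup>2 * (\<Sum>j<k. (norm (h j))\<^sup>2)"
        by (simp add: power_mult_distrib sum_distrib_left[symmetric] mult_ac)
      finally show "(\<Sum>i<k. (norm (\<Sum>j<k. blinfun_apply (nc_poly_eval (p i j) A) (h j)))\<^sup>2) \<le>
          (norm X' * norm X * D)\<^sup>2 * (\<Sum>j<k. (norm (h j))\<^sup>2)" .
    qed
    then have "op_bound {..<k} {..<k} (\<lambda>i j. \<Phi> (B i j)) (norm X' * norm X * D)"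
      by (subst op_bound_cong[where T' = "\<lambda>i j. nc_poly_eval (p i j) A"]) (auto simp: p \<Phi>)
    then show "opmat_norm {..<k} {..<k} (\<lambda>i j. \<Phi> (B i j)) \<le> norm X' * norm X * opmat_norm {..<k} {..<k} B"
      unfolding D_def[symmetric] using D by (intro opmat_norm_le) auto
  qed
  with \<Phi> show ?thesis by blast
qed

section \<open>From complete polynomial boundedness towards the domain\<close>

lemma poly_algebra_cb_homomorphism:
  fixes W :: "'n::finite \<Rightarrow> ('k::complex_hilbert_space \<Rightarrow>\<^sub>L 'k)" and A :: "'n \<Rightarrow> ('h::complex_hilbert_space \<Rightarrow>\<^sub>L 'h)"
  assumes W: "\<And>i. W i \<in> bounded_clinear_ops" and A: "\<And>i. A i \<in> bounded_clinear_ops"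
    and \<Phi>: "\<And>p. nc_polynomial p \<Longrightarrow> \<Phi> (nc_poly_eval p W) = nc_poly_eval p A"
    and cb: "completely_bounded_on (poly_algebra W) \<Phi>"
  shows "\<exists>C. cb_homomorphism (poly_algebra W) \<Phi> C"
proof -
  obtain C where C: "\<And>(k::nat) T. (\<forall>i<k. \<forall>j<k. T i j \<in> poly_algebra W) \<Longrightarrow>
        opmat_norm {..<k} {..<k} (\<lambda>i j. \<Phi> (T i j)) \<le> C * opmat_norm {..<k} {..<k} T"
    using cb unfolding completely_bounded_on_def by blast
  have mem: "nc_polynomial p \<Longrightarrow> nc_poly_eval p W \<in> poly_algebra W" for p by (auto simp: poly_algebra_def)
  have P: "b \<in> poly_algebra W \<Longrightarrow> \<exists>p. nc_polynomial p \<and> b = nc_poly_eval p W" for b by (auto simp: poly_algebra_def)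
  \<comment> \<open>The constant in \<open>completely_bounded_on\<close> may be negative, while the
    locale demands a nonnegative one.\<close>
  have "cb_homomorphism (poly_algebra W) \<Phi> (max C 0)"
  proof
    fix b b' c
    show "id_blinfun \<in> poly_algebra W" using mem[OF nc_polynomial_one] by (simp add: nc_poly_eval_one)
    show "\<Phi> id_blinfun = id_blinfun" using \<Phi>[OF nc_polynomial_one] by (simp add: nc_poly_eval_one)
    assume "b \<in> poly_algebra W"
    then obtain p where p: "nc_polynomial p" "b = nc_poly_eval p W" using P by blast
    show "b \<in> bounded_clinear_ops" using nc_poly_eval_clinear[OF W] p by simp
    show "\<Phi> b \<in> bounded_clinear_ops" using nc_poly_eval_clinear[OF A] p by (simp add: \<Phi>)
    show "scaleC_op c b \<in> poly_algebra W" "\<Phi> (scaleC_op c b) = scaleC_op c (\<Phi> b)"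
      using mem[OF nc_polynomial_scale[OF p(1)], of c] \<Phi>[OF nc_polynomial_scale[OF p(1)], of c] p
      by (simp_all add: nc_poly_eval_scale \<Phi>)
    assume "b' \<in> poly_algebra W"
    then obtain q where q: "nc_polynomial q" "b' = nc_poly_eval q W" using P by blast
    show "b + b' \<in> poly_algebra W" "\<Phi> (b + b') = \<Phi> b + \<Phi> b'"
      using mem[OF nc_polynomial_add[OF p(1) q(1)]] \<Phi>[OF nc_polynomial_add[OF p(1) q(1)]] p q
      by (simp_all add: nc_poly_eval_add \<Phi>)
    show "b o\<^sub>L b' \<in> poly_algebra W" "\<Phi> (b o\<^sub>L b') = \<Phi> b o\<^sub>L \<Phi> b'"
      using mem[OF nc_polynomial_mult[OF p(1) q(1)]] \<Phi>[OF nc_polynomial_mult[OF p(1) q(1)]] p q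
      by (simp_all add: nc_poly_eval_mult W A \<Phi>)
  next
    fix k :: nat and T :: "nat \<Rightarrow> nat \<Rightarrow> 'k \<Rightarrow>\<^sub>L 'k" and D :: real
    assume T: "\<And>i j. i < k \<Longrightarrow> j < k \<Longrightarrow> T i j \<in> poly_algebra W" and D: "0 \<le> D" "op_bound {..<k} {..<k} T D"
    have "opmat_norm {..<k} {..<k} (\<lambda>i j. \<Phi> (T i j)) \<le> C * opmat_norm {..<k} {..<k} T" by (rule C) (use T in auto)
    also have "\<dots> \<le> max C 0 * opmat_norm {..<k} {..<k} T" by (intro mult_right_mono opmat_norm_nonneg) auto
    also have "\<dots> \<le> max C 0 * D" by (intro mult_left_mono opmat_norm_le D) auto
    finally show "op_bound {..<k} {..<k} (\<lambda>i j. \<Phi> (T i j)) (max C 0 * D)"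
      by (rule op_bound_mono[OF opmat_norm_op_bound opmat_norm_nonneg, rotated -1]) auto
  qed auto
  then show ?thesis by blast
qed

text \<open>Isolates what the renorming provides, for the passage from f(W) = S and g(S) = W to f(T)
  = Y and g(Y) = T.\<close>

locale row_contractive_pair =
  fixes W :: "'n::finite \<Rightarrow> ('k::complex_hilbert_space \<Rightarrow>\<^sub>L 'k)" and T :: "'n \<Rightarrow> ('h::complex_hilbert_space \<Rightarrow>\<^sub>L 'h)"
  assumes W_clinear: "\<And>i. W i \<in> bounded_clinear_ops" and T_clinear: "\<And>i. T i \<in> bounded_clinear_ops"
    and row: "\<And>p :: 'n \<Rightarrow> 'n nc_series. (\<And>j. nc_polynomial (p j)) \<Longrightarrow>
      row_norm (\<lambda>j. nc_poly_eval (p j) T) \<le> row_norm (\<lambda>j. nc_poly_eval (p j) W)"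
begin

text \<open>A single polynomial becomes a row by zero entries at all generators but one.\<close>

lemma poly_contractive:
  assumes p: "nc_polynomial p"
  shows "norm (nc_poly_eval p T) \<le> norm (nc_poly_eval p W)"
proof (rule norm_blinfun_bound)
  fix h
  obtain j0 :: 'n where "j0 \<in> UNIV" by blast
  define q where "q j = (if j = j0 then p else (\<lambda>_. 0))" for j
  have q: "nc_polynomial (q j)" for j using p by (simp add: q_def nc_polynomial_def)
  have z: "nc_poly_eval (\<lambda>_. 0) X = 0" for X :: "'n \<Rightarrow> ('z::complex_hilbert_space \<Rightarrow>\<^sub>L 'z)" by (simp add: nc_poly_eval_def)
  have red: "(\<Sum>j\<in>UNIV. blinfun_apply (nc_poly_eval (q j) X) (h j)) = blinfun_apply (nc_poly_eval p X) (h j0)"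
    for X :: "'n \<Rightarrow> ('z::complex_hilbert_space \<Rightarrow>\<^sub>L 'z)" and h
  proof -
    have "(\<Sum>j\<in>UNIV. blinfun_apply (nc_poly_eval (q j) X) (h j)) = (\<Sum>j\<in>UNIV. if j = j0 then blinfun_apply (nc_poly_eval p X) (h j0) else 0)"
      by (intro sum.cong) (auto simp: q_def nc_poly_eval_def)
    then show ?thesis by simp
  qed
  have "row_norm (\<lambda>j. nc_poly_eval (q j) W) \<le> norm (nc_poly_eval p W)"
  proof (subst row_norm_le_iff)
    show "\<forall>h. (norm (\<Sum>i\<in>UNIV. blinfun_apply (nc_poly_eval (q i) W) (h i)))\<^sup>2 \<le> (norm (nc_poly_eval p W))\<^sup>2 * (\<Sum>i\<in>UNIV. (norm (h i))\<^sup>2)"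
    proof
      fix h :: "'n \<Rightarrow> 'k"
      have "(norm (blinfun_apply (nc_poly_eval p W) (h j0)))\<^sup>2 \<le> (norm (nc_poly_eval p W) * norm (h j0))\<^sup>2"
        by (intro power_mono norm_blinfun) auto
      also have "\<dots> \<le> (norm (nc_poly_eval p W))\<^sup>2 * (\<Sum>i\<in>UNIV. (norm (h i))\<^sup>2)"
        unfolding power_mult_distrib by (intro mult_left_mono member_le_sum) auto
      finally show "(norm (\<Sum>i\<in>UNIV. blinfun_apply (nc_poly_eval (q i) W) (h i)))\<^sup>2 \<le> (norm (nc_poly_eval p W))\<^sup>2 * (\<Sum>i\<in>UNIV. (norm (h i))\<^sup>2)"
        by (simp add: red)
    qed
  qed simp
  then have le: "row_norm (\<lambda>j. nc_poly_eval (q j) T) \<le> norm (nc_poly_eval p W)"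
    by (rule order_trans[OF row[of q, OF q]])
  have "(norm (blinfun_apply (nc_poly_eval p T) h))\<^sup>2 \<le> (norm (nc_poly_eval p W))\<^sup>2 * (norm h)\<^sup>2"
    using row_normD[OF le, of "\<lambda>j. if j = j0 then h else 0"] by (simp add: red if_distrib[of norm] if_distrib[of "\<lambda>x. x\<^sup>2"] cong: if_cong)
  then show "norm (blinfun_apply (nc_poly_eval p T) h) \<le> norm (nc_poly_eval p W) * norm h"
    by (intro power2_le_imp_le[where x = "norm (blinfun_apply (nc_poly_eval p T) h)"]) (simp_all add: power_mult_distrib)
qed simp

text \<open>Stands for the extension of p(W) -> p(T) to norm limits: by
  \<open>graph_contractive\<close> and \<open>graph_unique\<close> it is the graph of a contractive
  homomorphism, handled as a closed set of pairs.\<close>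

definition graph :: "(('k \<Rightarrow>\<^sub>L 'k) \<times> ('h \<Rightarrow>\<^sub>L 'h)) set" where
  "graph = closure {(nc_poly_eval p W, nc_poly_eval p T) | p. nc_polynomial p}"

lemma graph_poly: "nc_polynomial p \<Longrightarrow> (nc_poly_eval p W, nc_poly_eval p T) \<in> graph"
  unfolding graph_def by (rule subsetD[OF closure_subset]) blast

lemma graph_seq:
  "(B, D) \<in> graph \<longleftrightarrow> (\<exists>p. (\<forall>m. nc_polynomial (p m)) \<and> (\<lambda>m. nc_poly_eval (p m) W) \<longlonglongrightarrow> B \<and> (\<lambda>m. nc_poly_eval (p m) T) \<longlonglongrightarrow> D)"
proof
  assume "(B, D) \<in> graph"
  then obtain x where x: "\<And>m. x m \<in> {(nc_poly_eval p W, nc_poly_eval p T) | p. nc_polynomial p}" "x \<longlonglongrightarrow> (B, D)"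
    unfolding graph_def closure_sequential by blast
  have "\<forall>m. \<exists>p. nc_polynomial p \<and> x m = (nc_poly_eval p W, nc_poly_eval p T)" using x(1) by blast
  then obtain p where p: "\<And>m. nc_polynomial (p m)" "\<And>m. x m = (nc_poly_eval (p m) W, nc_poly_eval (p m) T)" by metis
  from tendsto_fst[OF x(2)] tendsto_snd[OF x(2)] p
  show "\<exists>p. (\<forall>m. nc_polynomial (p m)) \<and> (\<lambda>m. nc_poly_eval (p m) W) \<longlonglongrightarrow> B \<and> (\<lambda>m. nc_poly_eval (p m) T) \<longlonglongrightarrow> D" by auto
next
  assume "\<exists>p. (\<forall>m. nc_polynomial (p m)) \<and> (\<lambda>m. nc_poly_eval (p m) W) \<longlonglongrightarrow> B \<and> (\<lambda>m. nc_poly_eval (p m) T) \<longlonglongrightarrow> D"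
  then obtain p where p: "\<forall>m. nc_polynomial (p m)" "(\<lambda>m. nc_poly_eval (p m) W) \<longlonglongrightarrow> B" "(\<lambda>m. nc_poly_eval (p m) T) \<longlonglongrightarrow> D" by blast
  then show "(B, D) \<in> graph" unfolding graph_def closure_sequential
    by (intro exI[of _ "\<lambda>m. (nc_poly_eval (p m) W, nc_poly_eval (p m) T)"]) (auto intro!: tendsto_Pair)
qed

lemma graph_contractive: "(B, D) \<in> graph \<Longrightarrow> norm D \<le> norm B"
proof -
  assume "(B, D) \<in> graph"
  then obtain p where p: "\<And>m. nc_polynomial (p m)" "(\<lambda>m. nc_poly_eval (p m) W) \<longlonglongrightarrow> B" "(\<lambda>m. nc_poly_eval (p m) T) \<longlonglongrightarrow> D"
    unfolding graph_seq by blast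
  show ?thesis by (rule LIMSEQ_le[OF tendsto_norm[OF p(3)] tendsto_norm[OF p(2)]]) (use poly_contractive[OF p(1)] in blast)
qed

lemma graph_add: "(B, D) \<in> graph \<Longrightarrow> (B', D') \<in> graph \<Longrightarrow> (B + B', D + D') \<in> graph"
proof -
  assume "(B, D) \<in> graph" "(B', D') \<in> graph"
  then obtain p q where p: "\<And>m. nc_polynomial (p m)" "(\<lambda>m. nc_poly_eval (p m) W) \<longlonglongrightarrow> B" "(\<lambda>m. nc_poly_eval (p m) T) \<longlonglongrightarrow> D"
    and q: "\<And>m. nc_polynomial (q m)" "(\<lambda>m. nc_poly_eval (q m) W) \<longlonglongrightarrow> B'" "(\<lambda>m. nc_poly_eval (q m) T) \<longlonglongrightarrow> D'"
    unfolding graph_seq by metis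
  show ?thesis unfolding graph_seq
    using tendsto_add[OF p(2) q(2)] tendsto_add[OF p(3) q(3)]
    by (intro exI[of _ "\<lambda>m \<alpha>. p m \<alpha> + q m \<alpha>"]) (simp add: nc_polynomial_add p(1) q(1) nc_poly_eval_add)
qed

lemma graph_scale: "(B, D) \<in> graph \<Longrightarrow> (scaleC_op c B, scaleC_op c D) \<in> graph"
proof -
  assume "(B, D) \<in> graph"
  then obtain p where p: "\<And>m. nc_polynomial (p m)" "(\<lambda>m. nc_poly_eval (p m) W) \<longlonglongrightarrow> B" "(\<lambda>m. nc_poly_eval (p m) T) \<longlonglongrightarrow> D"
    unfolding graph_seq by blast
  have lim: "(\<lambda>m. scaleC_op c (x m)) \<longlonglongrightarrow> scaleC_op c y" if "x \<longlonglongrightarrow> y"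
    for x and y :: "'z::complex_hilbert_space \<Rightarrow>\<^sub>L 'z"
  proof -
    have "bounded_linear (scaleC_op c :: ('z \<Rightarrow>\<^sub>L 'z) \<Rightarrow> _)"
      by (rule bounded_linear_intro[where K = "cmod c"])
        (auto intro!: blinfun_eqI simp: norm_scaleC_op blinfun.add_left blinfun.scaleR_left scaleC_add_right scaleR_scaleC scaleC_scaleC mult.commute)
    then show ?thesis using that by (rule bounded_linear.tendsto)
  qed
  show ?thesis unfolding graph_seq
    using lim[OF p(2)] lim[OF p(3)]
    by (intro exI[of _ "\<lambda>m \<alpha>. c * p m \<alpha>"]) (simp add: nc_polynomial_scale p(1) nc_poly_eval_scale)
qed

lemma graph_diff: "(B, D) \<in> graph \<Longrightarrow> (B', D') \<in> graph \<Longrightarrow> (B - B', D - D') \<in> graph"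
proof -
  have m: "scaleC_op (-1) S = - S" for S :: "'z::complex_hilbert_space \<Rightarrow>\<^sub>L 'z"
    by (rule blinfun_eqI) (simp add: scaleC_minus_left blinfun.minus_left)
  show "(B, D) \<in> graph \<Longrightarrow> (B', D') \<in> graph \<Longrightarrow> (B - B', D - D') \<in> graph"
    using graph_add[OF _ graph_scale[of B' D' "-1"], of B D] by (simp add: m)
qed

lemma graph_compose: "(B, D) \<in> graph \<Longrightarrow> (B', D') \<in> graph \<Longrightarrow> (B o\<^sub>L B', D o\<^sub>L D') \<in> graph"
proof -
  assume "(B, D) \<in> graph" "(B', D') \<in> graph"
  then obtain p q where p: "\<And>m. nc_polynomial (p m)" "(\<lambda>m. nc_poly_eval (p m) W) \<longlonglongrightarrow> B" "(\<lambda>m. nc_poly_eval (p m) T) \<longlonglongrightarrow> D"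
    and q: "\<And>m. nc_polynomial (q m)" "(\<lambda>m. nc_poly_eval (q m) W) \<longlonglongrightarrow> B'" "(\<lambda>m. nc_poly_eval (q m) T) \<longlonglongrightarrow> D'"
    unfolding graph_seq by metis
  show ?thesis unfolding graph_seq
    using tendsto_blinfun_compose[OF p(2) q(2)] tendsto_blinfun_compose[OF p(3) q(3)]
    by (intro exI[of _ "\<lambda>m. nc_mult (p m) (q m)"])
      (simp add: nc_polynomial_mult p(1) q(1) nc_poly_eval_mult W_clinear T_clinear)
qed

lemma graph_sum: "(\<And>i. i \<in> I \<Longrightarrow> (B i, D i) \<in> graph) \<Longrightarrow> (sum B I, sum D I) \<in> graph"
proof (induction I rule: infinite_finite_induct)
  have "nc_polynomial (\<lambda>_. 0)" by (simp add: nc_polynomial_def)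
  from graph_poly[OF this] have z: "(0, 0) \<in> graph" by (simp add: nc_poly_eval_def)
  { case empty show ?case using z by simp }
  { case infinite show ?case using infinite z by simp }
qed (auto intro: graph_add)

text \<open>Contractivity applied to differences makes the second components Cauchy, and closedness
  puts the limit pair into \<open>graph\<close>.\<close>

lemma graph_limit:
  fixes B :: "nat \<Rightarrow> _"
  assumes g: "\<And>m. (B m, D m) \<in> graph" and B: "B \<longlonglongrightarrow> B0"
  shows "\<exists>D0. D \<longlonglongrightarrow> D0 \<and> (B0, D0) \<in> graph"
proof -
  have "Cauchy D"
  proof (rule CauchyI)
    fix e :: real assume "0 < e"
    then obtain M where "\<forall>m\<ge>M. \<forall>n\<ge>M. norm (B m - B n) < e" using CauchyD[OF LIMSEQ_imp_Cauchy[OF B]] by blast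
    then show "\<exists>M. \<forall>m\<ge>M. \<forall>n\<ge>M. norm (D m - D n) < e"
      using graph_contractive[OF graph_diff[OF g g]] by (meson le_less_trans)
  qed
  then obtain D0 where D0: "D \<longlonglongrightarrow> D0" using Cauchy_convergent convergent_def by blast
  have "(\<lambda>m. (B m, D m)) \<longlonglongrightarrow> (B0, D0)" by (rule tendsto_Pair[OF B D0])
  then have "(B0, D0) \<in> graph"
    using closed_sequentially[of graph "\<lambda>m. (B m, D m)"] g by (auto simp: graph_def)
  with D0 show ?thesis by blast
qed

lemma graph_suminf:
  assumes g: "\<And>k. (B k, D k) \<in> graph" and B: "summable B"
  shows "summable D" "(suminf B, suminf D) \<in> graph"
proof -
  obtain D0 where D0: "(\<lambda>N. \<Sum>k<N. D k) \<longlonglongrightarrow> D0" "(suminf B, D0) \<in> graph"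
    using graph_limit[OF graph_sum[OF g] summable_LIMSEQ[OF B]] by blast
  then have "D sums D0" by (simp add: sums_def)
  then show "summable D" "(suminf B, suminf D) \<in> graph" using D0(2) by (auto simp: sums_iff)
qed

lemma graph_unique: "(B, D) \<in> graph \<Longrightarrow> (B, D') \<in> graph \<Longrightarrow> D = D'"
  using graph_contractive[OF graph_diff[of B D B D']] by simp

lemma graph_term: "(nc_term c W k, nc_term c T k) \<in> graph"
  using graph_poly[OF nc_term_polynomial(1)[of k c]] by (simp add: nc_term_polynomial(2))

lemma graph_id: "(id_blinfun, id_blinfun) \<in> graph"
  using graph_poly[OF nc_polynomial_one] by (simp add: nc_poly_eval_one)

lemma graph_nc_term:
  assumes "\<And>j. (S j, Y j) \<in> graph"
  shows "(nc_term c S k, nc_term c Y k) \<in> graph"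
proof -
  have "(op_word S \<alpha>, op_word Y \<alpha>) \<in> graph" for \<alpha>
    by (induction \<alpha>) (auto intro: graph_id graph_compose assms)
  then show ?thesis unfolding nc_term_def by (intro graph_sum graph_scale)
qed

text \<open>The row inequality is available for polynomials, so the pairs are approximated by
  polynomial ones; the row of \<open>Y\<close> is compared with its approximation in
  \<open>T\<close>, that with the one in \<open>W\<close>, and that with \<open>S\<close>.\<close>

lemma graph_row_norm:
  fixes S :: "'n \<Rightarrow> ('k \<Rightarrow>\<^sub>L 'k)"
  assumes g: "\<And>j. (S j, Y j) \<in> graph" and S: "row_norm S \<le> 1"
  shows "row_norm Y \<le> 1"
proof (rule field_le_epsilon)
  fix e :: real assume e: "0 < e"
  define n where "n = real (CARD('n))"
  have n: "n > 0" by (simp add: n_def)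
  \<comment> \<open>Two perturbations, each with \<open>n\<close> entries, then cost
    \<open>e\<close> in total.\<close>
  define d where "d = e / (2 * n)"
  have d: "d > 0" using e n by (simp add: d_def)
  have "\<forall>j. \<exists>p. nc_polynomial p \<and> norm (nc_poly_eval p W - S j) < d \<and> norm (Y j - nc_poly_eval p T) < d"
  proof
    fix j
    obtain p where p: "\<forall>m. nc_polynomial (p m)" "(\<lambda>m. nc_poly_eval (p m) W) \<longlonglongrightarrow> S j" "(\<lambda>m. nc_poly_eval (p m) T) \<longlonglongrightarrow> Y j"
      using g[of j] unfolding graph_seq by blast
    have "\<forall>\<^sub>F m in sequentially. norm (nc_poly_eval (p m) W - S j) < d \<and> norm (Y j - nc_poly_eval (p m) T) < d"
      using tendstoD[OF p(2) d] tendstoD[OF p(3) d] by eventually_elim (auto simp: dist_norm norm_minus_commute)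
    then obtain m where "norm (nc_poly_eval (p m) W - S j) < d \<and> norm (Y j - nc_poly_eval (p m) T) < d"
      using eventually_happens trivial_limit_sequentially by blast
    then show "\<exists>p. nc_polynomial p \<and> norm (nc_poly_eval p W - S j) < d \<and> norm (Y j - nc_poly_eval p T) < d" using p(1) by blast
  qed
  then obtain p where p: "\<And>j. nc_polynomial (p j)" "\<And>j. norm (nc_poly_eval (p j) W - S j) < d" "\<And>j. norm (Y j - nc_poly_eval (p j) T) < d"
    by metis
  have "row_norm Y \<le> row_norm (\<lambda>j. nc_poly_eval (p j) T) + (\<Sum>j\<in>UNIV. norm (Y j - nc_poly_eval (p j) T))"
    by (rule row_norm_perturb)
  also have "\<dots> \<le> row_norm (\<lambda>j. nc_poly_eval (p j) W) + (\<Sum>j\<in>(UNIV::'n set). d)"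
    by (intro add_mono row p sum_mono less_imp_le)
  also have "row_norm (\<lambda>j. nc_poly_eval (p j) W) \<le> row_norm S + (\<Sum>j\<in>UNIV. norm (nc_poly_eval (p j) W - S j))"
    by (rule row_norm_perturb)
  also have "\<dots> \<le> 1 + (\<Sum>j\<in>(UNIV::'n set). d)"
    by (intro add_mono S p sum_mono less_imp_le)
  finally show "row_norm Y \<le> 1 + e" using n by (simp add: n_def[symmetric] d_def)
qed

end

text \<open>The left shifts are isometries with mutually orthogonal ranges: nonempty words are
  sorted by their first letter.\<close>

lemma row_norm_lshift: "row_norm (lshift :: 'n::finite \<Rightarrow> _) \<le> 1"
proof (subst row_norm_le_iff)
  show "\<forall>h. (norm (\<Sum>i\<in>UNIV. blinfun_apply (lshift i) (h i)))\<^sup>2 \<le> 1\<^sup>2 * (\<Sum>i\<in>UNIV. (norm (h (i::'n)))\<^sup>2)"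
  proof
    fix h :: "'n \<Rightarrow> 'n list ell2"
    define u where "u = (\<Sum>i\<in>UNIV. blinfun_apply (lshift i) (h i))"
    have u: "ell2_coeff u [] = 0" "ell2_coeff u (i # \<alpha>) = ell2_coeff (h i) \<alpha>" for i \<alpha>
      by (simp_all add: u_def lshift_coeff)
    have "(norm u)\<^sup>2 \<le> (\<Sum>i\<in>UNIV. (norm (h i))\<^sup>2)"
      unfolding ell2_norm_sq[of u]
    proof (rule infsum_le_finite_sums[OF ell2_summable])
      fix F :: "'n list set" assume F: "finite F"
      define G where "G i = {\<alpha>. i # \<alpha> \<in> F}" for i
      have G: "finite (G i)" for i
        unfolding G_def by (rule finite_vimageI[OF F, of "\<lambda>\<alpha>. i # \<alpha>", unfolded vimage_def]) (simp add: inj_on_def)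
      have img: "F - {[]} = (\<lambda>(i, \<alpha>). i # \<alpha>) ` (SIGMA i:UNIV. G i)"
      proof (intro equalityI subsetI)
        fix \<gamma> assume "\<gamma> \<in> F - {[]}"
        then show "\<gamma> \<in> (\<lambda>(i, \<alpha>). i # \<alpha>) ` (SIGMA i:UNIV. G i)"
          by (cases \<gamma>) (auto simp: G_def intro!: image_eqI[of _ _ "(hd \<gamma>, tl \<gamma>)"])
      qed (auto simp: G_def)
      have inj: "inj_on (\<lambda>(i, \<alpha>). i # \<alpha>) (SIGMA i:UNIV. G i)" by (auto simp: inj_on_def)
      have "(\<Sum>\<gamma>\<in>F. (cmod (ell2_coeff u \<gamma>))\<^sup>2) = (\<Sum>\<gamma>\<in>F - {[]}. (cmod (ell2_coeff u \<gamma>))\<^sup>2)"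
        by (rule sum.mono_neutral_right) (use F u(1) in auto)
      also have "\<dots> = (\<Sum>(i, \<alpha>)\<in>(SIGMA i:UNIV. G i). (cmod (ell2_coeff (h i) \<alpha>))\<^sup>2)"
        unfolding img by (subst sum.reindex[OF inj]) (auto simp: u(2) intro!: sum.cong)
      also have "\<dots> = (\<Sum>i\<in>UNIV. \<Sum>\<alpha>\<in>G i. (cmod (ell2_coeff (h i) \<alpha>))\<^sup>2)"
        by (rule sum.Sigma[symmetric]) (auto simp: G)
      also have "\<dots> \<le> (\<Sum>i\<in>UNIV. (norm (h i))\<^sup>2)" by (intro sum_mono ell2_finite_sum_le G)
      finally show "(\<Sum>\<gamma>\<in>F. (cmod (ell2_coeff u \<gamma>))\<^sup>2) \<le> (\<Sum>i\<in>UNIV. (norm (h i))\<^sup>2)" .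
    qed
    then show "(norm (\<Sum>i\<in>UNIV. blinfun_apply (lshift i) (h i)))\<^sup>2 \<le> 1\<^sup>2 * (\<Sum>i\<in>UNIV. (norm (h i))\<^sup>2)"
      by (simp add: u_def)
  qed
qed simp

text \<open>As \<open>lshift\<close> is a row contraction, summable degree norms force norm
  convergence. The sum commutes with right shifts and has the same symbol as \<open>W\<close>, so it
  is \<open>W\<close>.\<close>

lemma series_of_lshift:
  fixes W :: "'n::finite list ell2 \<Rightarrow>\<^sub>L 'n list ell2"
  assumes W: "left_multiplication W" and sm: "summable (degree_norm (ell2_coeff (blinfun_apply W (ell2_basis []))))"
  shows "nc_term (ell2_coeff (blinfun_apply W (ell2_basis []))) lshift sums W"
proof -
  define a where "a = blinfun_apply W (ell2_basis [])"
  have summ: "summable (nc_term (ell2_coeff a) lshift)"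
  proof (rule summable_comparison_test'[OF sm])
    show "norm (nc_term (ell2_coeff a) lshift k) \<le> degree_norm (ell2_coeff (blinfun_apply W (ell2_basis []))) k" if "k \<ge> 0" for k
      using norm_nc_term_le[where k = k and c = "ell2_coeff a", OF lshift_clinear row_norm_lshift] by (simp add: a_def)
  qed
  define V where "V = suminf (nc_term (ell2_coeff a) lshift)"
  have lim: "(\<lambda>N. \<Sum>k<N. nc_term (ell2_coeff a) lshift k) \<longlonglongrightarrow> V" unfolding V_def by (rule summable_LIMSEQ[OF summ])
  have lm: "left_multiplication (\<Sum>k<N. nc_term (ell2_coeff a) lshift k)" for N
    unfolding nc_term_def
    by (intro left_multiplication_sum left_multiplication_scale left_multiplication_op_word left_multiplication_lshift)
  have "V o\<^sub>L rshift \<beta> = rshift \<beta> o\<^sub>L V" for \<beta>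
  proof (rule LIMSEQ_unique)
    show "(\<lambda>N. (\<Sum>k<N. nc_term (ell2_coeff a) lshift k) o\<^sub>L rshift \<beta>) \<longlonglongrightarrow> (V o\<^sub>L rshift \<beta>)"
      by (intro tendsto_blinfun_compose lim tendsto_const)
    have "(\<lambda>N. rshift \<beta> o\<^sub>L (\<Sum>k<N. nc_term (ell2_coeff a) lshift k)) \<longlonglongrightarrow> (rshift \<beta> o\<^sub>L V)"
      by (intro tendsto_blinfun_compose lim tendsto_const)
    then show "(\<lambda>N. (\<Sum>k<N. nc_term (ell2_coeff a) lshift k) o\<^sub>L rshift \<beta>) \<longlonglongrightarrow> (rshift \<beta> o\<^sub>L V)"
      using lm by (simp add: left_multiplication_def)
  qed
  moreover have "V \<in> bounded_clinear_ops"
    using clinear_limit[OF lim] left_multiplication_clinear[OF lm] by simp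
  ultimately have Vlm: "left_multiplication V" by (simp add: left_multiplication_def)
  have "blinfun_apply V (ell2_basis []) = a"
  proof (rule ell2_eqI)
    fix \<gamma>
    have "(\<lambda>N. ell2_coeff (blinfun_apply (\<Sum>k<N. nc_term (ell2_coeff a) lshift k) (ell2_basis [])) \<gamma>) \<longlonglongrightarrow> ell2_coeff (blinfun_apply V (ell2_basis [])) \<gamma>"
      by (intro bounded_linear.tendsto[OF ell2_coeff_bounded_linear] bounded_linear.tendsto[OF blinfun.bounded_linear_left] lim)
    moreover have "ell2_coeff (blinfun_apply (\<Sum>k<N. nc_term (ell2_coeff a) lshift k) (ell2_basis [])) \<gamma> = ell2_coeff a \<gamma>" if "N > length \<gamma>" for N
    proof -
      have "ell2_coeff (blinfun_apply (nc_term (ell2_coeff a) lshift k) (ell2_basis [])) \<gamma> = (if k = length \<gamma> then ell2_coeff a \<gamma> else 0)" for k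
      proof -
        have "ell2_coeff (blinfun_apply (nc_term (ell2_coeff a) lshift k) (ell2_basis [])) \<gamma> = (\<Sum>\<alpha> | length \<alpha> = k. if \<alpha> = \<gamma> then ell2_coeff a \<gamma> else 0)"
          unfolding nc_term_def blinfun.sum_left ell2_coeff_sum by (intro sum.cong) (auto simp: op_word_lshift)
        then show ?thesis by (auto simp: sum.delta)
      qed
      then show ?thesis using that by (simp add: blinfun.sum_left)
    qed
    then have "\<forall>\<^sub>F N in sequentially. ell2_coeff (blinfun_apply (\<Sum>k<N. nc_term (ell2_coeff a) lshift k) (ell2_basis [])) \<gamma> = ell2_coeff a \<gamma>"
      using eventually_gt_at_top[of "length \<gamma>"] by (rule eventually_mono[rotated]) blast
    ultimately show "ell2_coeff (blinfun_apply V (ell2_basis [])) \<gamma> = ell2_coeff a \<gamma>"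
      using tendsto_unique[OF _ _ tendsto_eventually] trivial_limit_sequentially by blast
  qed
  then have "V = W" using left_multiplication_eqI[OF Vlm W] by (simp add: a_def)
  then show ?thesis using summable_sums[OF summ] by (simp add: V_def a_def)
qed

lemma norm_sums_sot_eval: "(\<And>j. nc_term (f j) X sums Y j) \<Longrightarrow> sot_eval f X Y"
  unfolding sot_eval_def limitin_strong_operator_topology sums_def
  by (intro allI bounded_linear.tendsto[OF blinfun.bounded_linear_left])

context row_contractive_pair
begin

lemma has_value_transfer:
  fixes f :: "'n \<Rightarrow> 'n nc_series"
  assumes S: "has_value f W S" and conv: "norm_convergent_at f W \<or> radially_norm_convergent_at f W"
  shows "\<exists>Y. has_value f T Y \<and> (\<forall>j. (S j, Y j) \<in> graph)"
  using conv
proof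
  assume "norm_convergent_at f W"
  then have sm: "summable (nc_term (f j) W)" for j by (simp add: norm_convergent_at_def)
  have "sot_eval f W (\<lambda>j. suminf (nc_term (f j) W))"
    by (rule norm_sums_sot_eval) (rule summable_sums[OF sm])
  then have S': "S = (\<lambda>j. suminf (nc_term (f j) W))"
    by (intro has_value_unique[OF S]) (simp add: has_value_def)
  note g = graph_suminf[OF graph_term sm]
  have "sot_eval f T (\<lambda>j. suminf (nc_term (f j) T))"
    by (rule norm_sums_sot_eval) (rule summable_sums[OF g(1)])
  then show ?thesis using g(2) unfolding S' has_value_def by blast
next
  assume "radially_norm_convergent_at f W"
  then obtain \<delta> S' where \<delta>: "0 < \<delta>" "\<delta> < 1" and sm: "\<And>r j. \<delta> < r \<Longrightarrow> r < 1 \<Longrightarrow> summable (nc_term (f j) (\<lambda>i. r *\<^sub>R W i))"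
    and S': "has_value f W S'" "\<And>j. ((\<lambda>r. nc_eval (f j) (\<lambda>i. r *\<^sub>R W i)) \<longlongrightarrow> S' j) (at_left (1::real))"
    unfolding radially_norm_convergent_at_def by auto
  have lim: "((\<lambda>r. nc_eval (f j) (\<lambda>i. r *\<^sub>R W i)) \<longlongrightarrow> S j) (at_left (1::real))" for j
    using S'(2) has_value_unique[OF S S'(1)] by simp
  have tm: "(nc_term (f j) (\<lambda>i. r *\<^sub>R W i) k, nc_term (f j) (\<lambda>i. r *\<^sub>R T i) k) \<in> graph" for r j k
    unfolding nc_term_scaleR using graph_scale[OF graph_term[of "f j" k], of "of_real (r ^ k)"]
    by (simp only: scaleC_op_of_real)
  have g: "summable (nc_term (f j) (\<lambda>i. r *\<^sub>R T i))"
    "(nc_eval (f j) (\<lambda>i. r *\<^sub>R W i), nc_eval (f j) (\<lambda>i. r *\<^sub>R T i)) \<in> graph" if "\<delta> < r" "r < 1" for r j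
    using graph_suminf[OF tm sm[OF that]] by (auto simp: nc_eval_def)
  \<comment> \<open>A sequence in the interval from \<delta> to 1 that tends to 1, since
    \<open>graph_limit\<close> works with sequences.\<close>
  define \<rho> where "\<rho> m = 1 - (1 - \<delta>) / (real m + 2)" for m
  have \<rho>: "\<delta> < \<rho> m" "\<rho> m < 1" for m
  proof -
    have "(1 - \<delta>) / (real m + 2) < (1 - \<delta>) / 1" using \<delta> by (intro divide_strict_left_mono) auto
    then show "\<delta> < \<rho> m" by (simp add: \<rho>_def)
    show "\<rho> m < 1" using \<delta> by (simp add: \<rho>_def)
  qed
  have "\<rho> \<longlonglongrightarrow> 1"
  proof -
    have "(\<lambda>m. 1 - (1 - \<delta>) * inverse (real (m + 2))) \<longlonglongrightarrow> 1 - (1 - \<delta>) * 0"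
      by (intro tendsto_diff tendsto_mult tendsto_const LIMSEQ_ignore_initial_segment[OF lim_inverse_n])
    then show ?thesis by (simp add: \<rho>_def[abs_def] divide_inverse add.commute)
  qed
  then have \<rho>lim: "filterlim \<rho> (at_left 1) sequentially"
    unfolding filterlim_at using \<rho>(2) by (auto intro!: always_eventually simp: less_imp_neq)
  have "\<exists>Y. (S j, Y) \<in> graph" for j
    using graph_limit[of "\<lambda>m. nc_eval (f j) (\<lambda>i. \<rho> m *\<^sub>R W i)" "\<lambda>m. nc_eval (f j) (\<lambda>i. \<rho> m *\<^sub>R T i)", OF g(2)[OF \<rho>]
        filterlim_compose[OF lim \<rho>lim]] by blast
  then obtain Y where Y: "\<And>j. (S j, Y j) \<in> graph" by metis
  have ev: "\<forall>\<^sub>F r in at_left (1::real). r \<in> {\<delta><..<1}"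
    by (rule eventually_at_leftI[of \<delta>]) (use \<delta> in auto)
  \<comment> \<open>Contractivity on differences gives back the full limit in \<open>r\<close>,
    beyond the chosen sequence.\<close>
  have limT: "((\<lambda>r. nc_eval (f j) (\<lambda>i. r *\<^sub>R T i)) \<longlongrightarrow> Y j) (at_left (1::real))" for j
  proof (rule Lim_transform2[OF tendsto_const], rule Lim_null_comparison)
    show "\<forall>\<^sub>F r in at_left 1. norm (Y j - nc_eval (f j) (\<lambda>i. r *\<^sub>R T i)) \<le> norm (S j - nc_eval (f j) (\<lambda>i. r *\<^sub>R W i))"
      using ev by eventually_elim (auto intro!: graph_contractive graph_diff Y g)
    have "((\<lambda>r. norm (S j - nc_eval (f j) (\<lambda>i. r *\<^sub>R W i))) \<longlongrightarrow> norm (S j - S j)) (at_left 1)"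
      by (intro tendsto_intros lim)
    then show "((\<lambda>r. norm (S j - nc_eval (f j) (\<lambda>i. r *\<^sub>R W i))) \<longlongrightarrow> 0) (at_left 1)" by simp
  qed
  have "rad_eval f T Y"
    unfolding rad_eval_def limitin_strong_operator_topology
  proof (intro conjI allI)
    show "\<exists>\<delta>\<in>{0<..<1}. \<forall>r\<in>{\<delta><..<1}. \<forall>j. summable (nc_term (f j) (\<lambda>i. r *\<^sub>R T i))"
      using \<delta> g(1) by (intro bexI[of _ \<delta>]) auto
    show "((\<lambda>r. blinfun_apply (nc_eval (f j) (\<lambda>i. r *\<^sub>R T i)) x) \<longlongrightarrow> blinfun_apply (Y j) x) (at_left 1)" for j x
      by (rule bounded_linear.tendsto[OF blinfun.bounded_linear_left limT])
  qed
  then show ?thesis using Y unfolding has_value_def by blast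
qed

end

theorem theorem4p9:
  fixes f :: "'n::finite \<Rightarrow> 'n nc_series"
    and A :: "'n \<Rightarrow> ('h::complex_hilbert_space \<Rightarrow>\<^sub>L 'h)"
  assumes "f \<in> M_rad \<inter> M_norm"
    and "\<forall>i. A i \<in> bounded_clinear_ops"
  shows "(\<exists>(T :: 'n \<Rightarrow> ('h \<Rightarrow>\<^sub>L 'h)) (X :: 'h \<Rightarrow>\<^sub>L 'h) (X' :: 'h \<Rightarrow>\<^sub>L 'h).
            T \<in> nc_domain f \<and>
            X \<in> bounded_clinear_ops \<and> X' \<in> bounded_clinear_ops \<and>
            X' o\<^sub>L X = id_blinfun \<and> X o\<^sub>L X' = id_blinfun \<and>
            (\<forall>i. A i = X' o\<^sub>L T i o\<^sub>L X))
         \<longleftrightarrow> completely_polynomially_bounded f A"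
proof -
  \<comment> \<open>\<open>model_data\<close> selects some model; what follows uses only the
    properties that \<open>is_model_universal\<close> gives to every model.\<close>
  obtain a W where aW: "model_data f = (a, W)" by fastforce
  have "\<exists>x. case x of (a, W) \<Rightarrow> is_model f a W"
    using assms(1) by (auto simp: M_rad_def model_property_def)
  then have model: "is_model f a W"
    using someI_ex[of "\<lambda>(a, W). is_model f a W"] aW by (simp add: model_data_def)
  note universal = is_model_universal[OF model]
  have W: "universal_model f = W" by (simp add: universal_model_def aW)
  have inv: "inverse_series f = (\<lambda>i. ell2_coeff (blinfun_apply (W i) (ell2_basis [])))"
    by (simp add: inverse_series_def[abs_def] aW universal(2))
  have A: "A i \<in> bounded_clinear_ops" for i using assms(2) by blast
  show ?thesis
  proof
    assume "\<exists>(T :: 'n \<Rightarrow> ('h \<Rightarrow>\<^sub>L 'h)) (X :: 'h \<Rightarrow>\<^sub>L 'h) (X' :: 'h \<Rightarrow>\<^sub>L 'h).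
            T \<in> nc_domain f \<and>
            X \<in> bounded_clinear_ops \<and> X' \<in> bounded_clinear_ops \<and>
            X' o\<^sub>L X = id_blinfun \<and> X o\<^sub>L X' = id_blinfun \<and>
            (\<forall>i. A i = X' o\<^sub>L T i o\<^sub>L X)"
    then obtain T :: "'n \<Rightarrow> ('h \<Rightarrow>\<^sub>L 'h)" and X X' :: "'h \<Rightarrow>\<^sub>L 'h" where T: "T \<in> nc_domain f"
      and X: "X \<in> bounded_clinear_ops" "X' \<in> bounded_clinear_ops" "X' o\<^sub>L X = id_blinfun" "X o\<^sub>L X' = id_blinfun"
        "\<And>i. A i = X' o\<^sub>L T i o\<^sub>L X" by blast
    from T obtain Y where Tc: "\<And>i. T i \<in> bounded_clinear_ops" and Y: "has_value f T Y"
      "has_value (inverse_series f) Y T" "row_norm Y \<le> 1" by (auto simp: nc_domain_def)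
    from similar_domain_polynomially_bounded[OF universal(1) has_value_clinear[OF Y(1) Tc] Y(3) Y(2)[unfolded inv] X]
    show "completely_polynomially_bounded f A" unfolding completely_polynomially_bounded_def W .
  next
    assume "completely_polynomially_bounded f A"
    then obtain \<Phi> where \<Phi>: "\<And>p. nc_polynomial p \<Longrightarrow> \<Phi> (nc_poly_eval p W) = nc_poly_eval p A"
      and cb: "completely_bounded_on (poly_algebra W) \<Phi>"
      unfolding completely_polynomially_bounded_def W by blast
    have Wc: "W i \<in> bounded_clinear_ops" for i by (rule left_multiplication_clinear[OF universal(1)])
    obtain C where "cb_homomorphism (poly_algebra W) \<Phi> C"
      using poly_algebra_cb_homomorphism[OF Wc A \<Phi> cb] by blast
    then interpret cb_homomorphism "poly_algebra W" \<Phi> C .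
    obtain X X' :: "'h \<Rightarrow>\<^sub>L 'h" where X: "X \<in> bounded_clinear_ops" "X' \<in> bounded_clinear_ops"
      "X' o\<^sub>L X = id_blinfun" "X o\<^sub>L X' = id_blinfun"
      and contr: "\<forall>b D h. (\<forall>j\<in>(UNIV :: 'n set). b j \<in> poly_algebra W) \<longrightarrow>
        (\<forall>\<xi> :: 'n \<Rightarrow> 'n list ell2. (norm (\<Sum>j\<in>UNIV. blinfun_apply (b j) (\<xi> j)))\<^sup>2 \<le> D\<^sup>2 * (\<Sum>j\<in>UNIV. (norm (\<xi> j))\<^sup>2)) \<longrightarrow>
        (norm (\<Sum>j\<in>UNIV. blinfun_apply (X o\<^sub>L \<Phi> (b j) o\<^sub>L X') (h j)))\<^sup>2 \<le> D\<^sup>2 * (\<Sum>j\<in>UNIV. (norm (h j))\<^sup>2)"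
      using similar_to_row_contractive[of "UNIV :: 'n set", OF finite] by (elim bexE conjE)
    \<comment> \<open>Conjugation by \<open>X\<close> moves the estimates that \<open>A\<close>
      satisfies in the new norm back to the original norm.\<close>
    define T where "T i = X o\<^sub>L A i o\<^sub>L X'" for i
    have Tc: "T i \<in> bounded_clinear_ops" for i unfolding T_def by (intro clinear_compose X A)
    have pT: "nc_poly_eval p T = X o\<^sub>L nc_poly_eval p A o\<^sub>L X'" for p
      by (rule nc_poly_eval_similar[OF X(4,3,1) T_def])
    have row: "row_norm (\<lambda>j. nc_poly_eval (p j) T) \<le> row_norm (\<lambda>j. nc_poly_eval (p j) W)"
      if p: "\<And>j. nc_polynomial (p j)" for p :: "'n \<Rightarrow> 'n nc_series"
    proof (subst row_norm_le_iff[OF row_norm_nonneg], rule allI)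
      fix h :: "'n \<Rightarrow> 'h"
      have "(norm (\<Sum>j\<in>UNIV. blinfun_apply (X o\<^sub>L \<Phi> (nc_poly_eval (p j) W) o\<^sub>L X') (h j)))\<^sup>2 \<le>
          (row_norm (\<lambda>j. nc_poly_eval (p j) W))\<^sup>2 * (\<Sum>j\<in>UNIV. (norm (h j))\<^sup>2)"
        by (rule contr[rule_format]) (use p row_normD[OF order_refl] in \<open>auto simp: poly_algebra_def\<close>)
      then show "(norm (\<Sum>j\<in>UNIV. blinfun_apply (nc_poly_eval (p j) T) (h j)))\<^sup>2 \<le>
          (row_norm (\<lambda>j. nc_poly_eval (p j) W))\<^sup>2 * (\<Sum>j\<in>UNIV. (norm (h j))\<^sup>2)"
        by (simp add: pT \<Phi>[OF p])
    qed
    interpret pair: row_contractive_pair W T by unfold_locales (fact Wc Tc row)+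
    have conv: "norm_convergent_at f W \<or> radially_norm_convergent_at f W"
      using assms(1) by (simp add: M_norm_def W)
    obtain Y where Y: "has_value f T Y" "\<And>j. (lshift j, Y j) \<in> pair.graph"
      using pair.has_value_transfer[OF universal(3) conv] by blast
    have rowY: "row_norm Y \<le> 1" by (rule pair.graph_row_norm[OF Y(2) row_norm_lshift])
    \<comment> \<open>The series g_i converges in norm at \<open>lshift\<close> to W_i, hence also
      at Y. The pairs of W_i with g_i(Y) and with T_i both lie in the graph, whose first entry
      determines the second.\<close>
    have "nc_term (inverse_series f i) Y sums T i" for i
    proof -
      have "summable (degree_norm (ell2_coeff (blinfun_apply (W i) (ell2_basis []))))"
        unfolding universal(2) using assms(1) by (intro inverse_series_summable[OF _ model]) auto
      from series_of_lshift[OF universal(1) this]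
      have sums: "nc_term (inverse_series f i) lshift sums W i" by (simp add: inv)
      note g = pair.graph_suminf[OF pair.graph_nc_term[OF Y(2)] sums_summable[OF sums]]
      have "(W i, suminf (nc_term (inverse_series f i) Y)) \<in> pair.graph" using g(2) sums by (simp add: sums_iff)
      moreover have "(W i, T i) \<in> pair.graph" using pair.graph_poly[OF nc_polynomial_var[of i]] by (simp add: nc_poly_eval_var)
      ultimately have "suminf (nc_term (inverse_series f i) Y) = T i" by (rule pair.graph_unique)
      then show ?thesis using summable_sums[OF g(1)] by simp
    qed
    then have "has_value (inverse_series f) Y T" unfolding has_value_def by (intro disjI1 norm_sums_sot_eval)
    then have "T \<in> nc_domain f" using Tc Y(1) rowY by (auto simp: nc_domain_def)
    moreover have "A i = X' o\<^sub>L T i o\<^sub>L X" for i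
    proof -
      have "X' o\<^sub>L T i o\<^sub>L X = (X' o\<^sub>L X) o\<^sub>L A i o\<^sub>L (X' o\<^sub>L X)" by (simp only: T_def blinfun_compose_assoc)
      then show ?thesis by (simp add: X(3))
    qed
    ultimately show "\<exists>(T :: 'n \<Rightarrow> ('h \<Rightarrow>\<^sub>L 'h)) (X :: 'h \<Rightarrow>\<^sub>L 'h) (X' :: 'h \<Rightarrow>\<^sub>L 'h).
            T \<in> nc_domain f \<and>
            X \<in> bounded_clinear_ops \<and> X' \<in> bounded_clinear_ops \<and>
            X' o\<^sub>L X = id_blinfun \<and> X o\<^sub>L X' = id_blinfun \<and>
            (\<forall>i. A i = X' o\<^sub>L T i o\<^sub>L X)"
      using X by blast
  qed
qed

end
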